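(* Let $X\subseteq\mathbb{R}^d$ be a fat closed subanalytic set. Let $f\in\mathcal{C}^\infty(X)$ be such that $f\circ c$ is real analytic for every real analytic curve $c:\mathbb{R}\to\mathbb{R}^d$ with $c(\mathbb{R})\subseteq X$. Then $f$ extends to a holomorphic function defined on an open neighborhood of $X$ in $\mathbb{C}^d$.
   Context: $\mathcal{C}^\infty(X)$ is the set of $f:X\to\mathbb{R}$ such that every $x\in X$ has an open neighborhood $U$ in $\mathbb{R}^d$ and a smooth $F:U\to\mathbb{R}$ with $F=f$ on $U\cap X$. A nonempty closed set $X$ is fat if $X=\overline{\mathrm{int}(X)}$. Subanalytic is meant in the sense of real analytic geometry. *)

theory Defs
  imports "HOL-Analysis.Analysis"
begin

primrec Ck_on :: "nat \<Rightarrow> 'a::euclidean_space set \<Rightarrow> ('a \<Rightarrow> real) \<Rightarrow> bool" where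
  "Ck_on 0 U F = continuous_on U F"
| "Ck_on (Suc k) U F =
     (F differentiable_on U \<and>
      (\<forall>b\<in>Basis. Ck_on k U (\<lambda>x. frechet_derivative F (at x) b)))"

definition smooth_on_open :: "'a::euclidean_space set \<Rightarrow> ('a \<Rightarrow> real) \<Rightarrow> bool" where
  "smooth_on_open U F \<longleftrightarrow> open U \<and> (\<forall>k. Ck_on k U F)"

definition Cinf_on :: "'a::euclidean_space set \<Rightarrow> ('a \<Rightarrow> real) \<Rightarrow> bool" where
  "Cinf_on X f \<longleftrightarrow>
     (\<forall>x\<in>X. \<exists>U F. open U \<and> x \<in> U \<and> smooth_on_open U F \<and> (\<forall>y\<in>U \<inter> X. F y = f y))"

definition fat :: "'a::topological_space set \<Rightarrow> bool" where
  "fat X \<longleftrightarrow> X \<noteq> {} \<and> closed X \<and> X = closure (interior X)"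

definition real_analytic_fun :: "(real \<Rightarrow> real) \<Rightarrow> bool" where
  "real_analytic_fun g \<longleftrightarrow>
     (\<forall>t. \<exists>r>0. \<exists>a::nat \<Rightarrow> real. \<forall>s. \<bar>s - t\<bar> < r \<longrightarrow> (\<lambda>n. a n * (s - t) ^ n) sums g s)"

definition real_analytic_curve :: "(real \<Rightarrow> real^'n) \<Rightarrow> bool" where
  "real_analytic_curve c \<longleftrightarrow> (\<forall>i. real_analytic_fun (\<lambda>t. c t $ i))"

definition holomorphic_multi_on :: "(complex^'n) set \<Rightarrow> (complex^'n \<Rightarrow> complex) \<Rightarrow> bool" where
  "holomorphic_multi_on W F \<longleftrightarrow>
     (\<forall>z\<in>W. \<exists>L. (F has_derivative L) (at z) \<and> (\<forall>c v. L (c *s v) = c * L v))"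

definition cemb :: "real^'n \<Rightarrow> complex^'n" where
  "cemb x = (\<chi> i. complex_of_real (x $ i))"

text \<open>R^N is modelled as the functions nat => real vanishing at coordinates >= N.\<close>
definition inR :: "nat \<Rightarrow> (nat \<Rightarrow> real) \<Rightarrow> bool" where
  "inR N x \<longleftrightarrow> (\<forall>i\<ge>N. x i = 0)"

definition nball :: "nat \<Rightarrow> (nat \<Rightarrow> real) \<Rightarrow> real \<Rightarrow> (nat \<Rightarrow> real) set" where
  "nball N a r = {y. inR N y \<and> (\<Sum>i<N. (y i - a i)^2) < r^2}"

definition analytic_near :: "nat \<Rightarrow> ((nat \<Rightarrow> real) \<Rightarrow> real) \<Rightarrow> (nat \<Rightarrow> real) \<Rightarrow> real \<Rightarrow> bool" where
  "analytic_near N g a r \<longleftrightarrow>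
     (\<exists>c :: (nat \<Rightarrow> nat) \<Rightarrow> real. \<forall>y\<in>nball N a r.
        ((\<lambda>\<alpha>. c \<alpha> * (\<Prod>i<N. (y i - a i) ^ \<alpha> i)) has_sum g y) {\<alpha>. \<forall>i\<ge>N. \<alpha> i = 0})"

definition analytic_onN :: "nat \<Rightarrow> (nat \<Rightarrow> real) set \<Rightarrow> ((nat \<Rightarrow> real) \<Rightarrow> real) \<Rightarrow> bool" where
  "analytic_onN N V g \<longleftrightarrow> (\<forall>a\<in>V. \<exists>r>0. nball N a r \<subseteq> V \<and> analytic_near N g a r)"

definition semianalytic :: "nat \<Rightarrow> (nat \<Rightarrow> real) set \<Rightarrow> bool" where
  "semianalytic N A \<longleftrightarrow> (\<forall>x\<in>A. inR N x) \<and>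
     (\<forall>a. inR N a \<longrightarrow> (\<exists>r>0. \<exists>(M::nat) (p::nat \<Rightarrow> nat) (q::nat \<Rightarrow> nat)
        (g::nat \<Rightarrow> nat \<Rightarrow> (nat \<Rightarrow> real) \<Rightarrow> real) (h::nat \<Rightarrow> nat \<Rightarrow> (nat \<Rightarrow> real) \<Rightarrow> real).
        (\<forall>k<M. \<forall>j<p k. analytic_onN N (nball N a r) (g k j)) \<and>
        (\<forall>k<M. \<forall>j<q k. analytic_onN N (nball N a r) (h k j)) \<and>
        A \<inter> nball N a r =
          (\<Union>k<M. {x \<in> nball N a r. (\<forall>j<p k. g k j x = 0) \<and> (\<forall>j<q k. h k j x > 0)})))"

definition boundedN :: "nat \<Rightarrow> (nat \<Rightarrow> real) set \<Rightarrow> bool" where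
  "boundedN N A \<longleftrightarrow> (\<exists>B. \<forall>x\<in>A. (\<Sum>i<N. (x i)^2) \<le> B)"

definition projN :: "nat \<Rightarrow> (nat \<Rightarrow> real) \<Rightarrow> (nat \<Rightarrow> real)" where
  "projN N x = (\<lambda>i. if i < N then x i else 0)"

definition subanalytic :: "nat \<Rightarrow> (nat \<Rightarrow> real) set \<Rightarrow> bool" where
  "subanalytic N X \<longleftrightarrow> (\<forall>x\<in>X. inR N x) \<and>
     (\<forall>a. inR N a \<longrightarrow> (\<exists>r>0. \<exists>m A. semianalytic (N + m) A \<and> boundedN (N + m) A \<and>
        X \<inter> nball N a r = projN N ` A))"

definition subanalytic_set :: "(real^'n) set \<Rightarrow> bool" where
  "subanalytic_set X \<longleftrightarrow> (\<exists>e. bij_betw e {..<CARD('n)} (UNIV :: 'n set) \<and>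
     subanalytic CARD('n) ((\<lambda>x i. if i < CARD('n) then x $ e i else 0) ` X))"

end

theory Submission
  imports Defs "HOL-Complex_Analysis.Complex_Analysis"
begin

text \<open>Near a point a of X, resolution of singularities (monomialization by blow-ups of
codimension two) covers X by finitely many analytic images of unit cubes. Since X is fat, some cube
phi with a in its image fills an open set, so by an analytic version of Sard's theorem phi has full rank
somewhere; as its Jacobian vanishes to finite order only, X contains a horn: balls of
radius eps t^q around c t for an analytic curve c with c 0 = a.

The horn is swept out by a full-dimensional family of analytic curves through a. Baire's theorem makes the
Cauchy estimates for f along these curves uniform on an open set of parameters, and finite differences
in the parameters turn them into Cauchy estimates for all partial derivatives of f at a. So the Taylor
series of f at a converges to a holomorphic function. Along analytic curves in the cubes the
difference of f and this function is analytic and flat at a, hence zero, so the Taylor series represents f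
on X near a. As X is fat, the local extensions agree on overlaps of suitably small balls.\<close>

section \<open>Holomorphic functions of finitely many variables\<close>

text \<open>Germs live on \<open>nat => real\<close> with a finite set S of active coordinates,
  since the inductions on the number of variables (monomialization, Sard) must drop a coordinate,
  which the types real^'n do not allow. A real analytic germ is one with a holomorphic extension to
  a polydisc, so that composition, division by a coordinate, implicit functions and the identity
  principle all come from one complex variable.

  Monomialization carries an inner induction on the order d in one variable. The Tschirnhaus shift
  that removes the coefficient of degree d-1 is what makes it work: without it, the polynomial met
  on the exceptional fibre of a blow-up could be the d-th power of a linear form, and d would not
  drop.

  The hypothesis on f speaks of curves defined on the whole line, while the arcs that occur are
  parametrized by [0,1] and cannot be prolonged inside X. They are run through by t = (sin s)^2,
  which is analytic on the line and never leaves [0,1]. The double zero at s = 0 only doubles the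
  exponents.\<close>

lemma open_fun_box:
  fixes a :: "nat => 'b::metric_space"
  assumes "open V" "a : V" "finite S"
  obtains r where "r > 0" "\<And>x. (ALL i:S. dist (x i) (a i) < r) ==> (ALL i. i \<notin> S --> x i = a i) ==> x : V"
proof -
  obtain X where X: "a : (\<Pi>\<^sub>E i\<in>UNIV. X i)" "\<And>i. open (X i)" "(\<Pi>\<^sub>E i\<in>UNIV. X i) \<subseteq> V"
  proof -
    have "openin (product_topology (%i. euclidean) UNIV) V" using assms(1) unfolding open_fun_def .
    from product_topology_open_contains_basis[OF this assms(2)] that show thesis
      unfolding open_openin[symmetric] by blast
  qed
  have aX: "a i : X i" for i using X(1) by (auto simp: PiE_iff)
  have "EX r>0. ALL y. dist y (a i) < r --> y : X i" for i
    using X(2)[of i] aX[of i] unfolding open_dist by auto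
  then obtain r where r: "\<And>i. r i > 0" "\<And>i y. dist y (a i) < r i ==> y : X i"
    by metis
  define R where "R = Min (insert 1 (r ` S))"
  have R: "R > 0" "\<And>i. i:S ==> R <= r i"
    unfolding R_def using assms(3) r(1) by (auto simp: Min_le_iff)
  show ?thesis
  proof (rule that[OF R(1)])
    fix x assume x: "ALL i:S. dist (x i) (a i) < R" "ALL i. i \<notin> S --> x i = a i"
    have "x i : X i" for i
      using x R(2)[of i] r(2)[of "x i" i] aX[of i] by (cases "i:S") force+
    then show "x : V" using X(3) by (auto simp: PiE_iff)
  qed
qed

lemma open_polybox:
  fixes a :: "nat => 'b::metric_space"
  assumes "finite S"
  shows "open {z. ALL i:S. dist (z i) (a i) < r}"
proof -
  have "{z. ALL i:S. dist (z i) (a i) < r} = (\<Inter>i\<in>S. (%z. z i) -` ball (a i) r)"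
    by (auto simp: dist_commute)
  moreover have "open ((%z. z i) -` ball (a i) r)" for i
    by (rule open_vimage) auto
  ultimately show ?thesis using assms by (auto intro!: open_INT)
qed

text \<open>Only the coordinates in S are restricted. For finite S the set is therefore open in the
  product topology, and it contains the whole fibre of the other coordinates.\<close>

definition poly_disc :: "nat set => (nat => complex) => real => (nat => complex) set" where
  "poly_disc S a r = {z. ALL i:S. dist (z i) (a i) < r}"

lemma open_poly_disc [simp]: "finite S ==> open (poly_disc S a r)"
  unfolding poly_disc_def by (rule open_polybox)

text \<open>Holomorphy is tested along analytic discs, so that it is stable under composition for free.\<close>

definition hol :: "(nat => complex) set => ((nat => complex) => complex) => bool" where
  "hol U F \<longleftrightarrow> open U & continuous_on U F &
     (ALL D gamma. open D --> (ALL i. (%t. gamma t i) holomorphic_on D) --> gamma ` D \<subseteq> U --> (%t. F (gamma t)) holomorphic_on D)"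

lemma holD:
  assumes "hol U F"
  shows "open U" "continuous_on U F"
    "\<And>D gamma. open D ==> (\<And>i. (%t. gamma t i) holomorphic_on D) ==> gamma ` D \<subseteq> U ==> (%t. F (gamma t)) holomorphic_on D"
  using assms unfolding hol_def by auto

lemma holI:
  assumes "open U" "continuous_on U F"
    "\<And>D gamma. open D ==> (\<And>i. (%t. gamma t i) holomorphic_on D) ==> gamma ` D \<subseteq> U ==> (%t. F (gamma t)) holomorphic_on D"
  shows "hol U F"
  using assms unfolding hol_def by auto

lemma hol_const [simp]: "open U ==> hol U (%z. c)"
  unfolding hol_def by auto

lemma hol_proj [simp]: "open U ==> hol U (%z. z i)"
  unfolding hol_def using continuous_on_subset[OF continuous_on_product_coordinates] by auto

lemma hol_add: "hol U F ==> hol U G ==> hol U (%z. F z + G z)"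
  by (rule holI) (auto simp: holD intro!: continuous_on_add holomorphic_on_add)

lemma hol_diff: "hol U F ==> hol U G ==> hol U (%z. F z - G z)"
  by (rule holI) (auto simp: holD intro!: continuous_on_diff holomorphic_on_diff)

lemma hol_mult: "hol U F ==> hol U G ==> hol U (%z. F z * G z)"
  by (rule holI) (auto simp: holD intro!: continuous_on_mult holomorphic_on_mult)

lemma hol_inverse: "hol U F ==> (\<And>z. z : U ==> F z ~= 0) ==> hol U (%z. inverse (F z))"
  by (rule holI) (auto simp: holD intro!: continuous_on_inverse holomorphic_on_inverse)

lemma hol_subset: "hol U F ==> open V ==> V \<subseteq> U ==> hol V F"
  unfolding hol_def using continuous_on_subset by blast

lemma hol_compose:
  assumes F: "hol V F" and U: "open U" and P: "\<And>i. hol U (%z. Phi z i)" and sub: "Phi ` U \<subseteq> V"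
  shows "hol U (%z. F (Phi z))"
  unfolding hol_def
proof (intro conjI allI impI)
  show "open U" by fact
  have "continuous_on U Phi"
    using P holD(2) by (auto intro!: continuous_on_coordinatewise_then_product)
  then show "continuous_on U (%z. F (Phi z))"
    using continuous_on_compose2[OF holD(2)[OF F] _ sub] by auto
  fix D and gamma :: "complex => nat => complex"
  assume "open D" and g: "ALL i. (%t. gamma t i) holomorphic_on D" "gamma ` D \<subseteq> U"
  then have "(%t. Phi (gamma t) i) holomorphic_on D" for i
    using holD(3)[OF P] by auto
  moreover have "(%t. Phi (gamma t)) ` D \<subseteq> V" using g sub by blast
  ultimately show "(%t. F (Phi (gamma t))) holomorphic_on D"
    using holD(3)[OF F \<open>open D\<close>, of "%t. Phi (gamma t)"] by auto
qed

text \<open>Along every test disc this is the one-variable theorem of Weierstrass. It serves for the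
  Newton iterates of the implicit function theorem and for power series.\<close>

lemma hol_uniform_limit:
  assumes f: "\<And>n. hol U (f n)" and ul: "uniform_limit U f F G" and G: "G ~= bot"
  shows "hol U F"
proof (rule holI)
  show oU: "open U" using f holD by blast
  show "continuous_on U F"
    by (rule uniform_limit_theorem[OF _ ul]) (use f holD G in auto)
  fix D and gamma :: "complex => nat => complex"
  assume D: "open D" and g: "\<And>i. (%t. gamma t i) holomorphic_on D" "gamma ` D \<subseteq> U"
  have fh: "(%t. f n (gamma t)) holomorphic_on D" for n
    by (rule holD(3)[OF f D g])
  have "(%t. F (gamma t)) analytic_on D"
    unfolding analytic_on_def
  proof
    fix x assume "x : D"
    then obtain d where d: "d > 0" "cball x d \<subseteq> D"
      using D open_contains_cball by blast
    have "uniform_limit (cball x d) (%n t. f n (gamma t)) (%t. F (gamma t)) G"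
      unfolding uniform_limit_iff
    proof (intro allI impI)
      fix e :: real assume "e > 0"
      then have "\<forall>\<^sub>F n in G. ALL x:U. dist (f n x) (F x) < e"
        using ul by (auto simp: uniform_limit_iff)
      then show "\<forall>\<^sub>F n in G. ALL t:cball x d. dist (f n (gamma t)) (F (gamma t)) < e"
        by (rule eventually_mono) (use d g in blast)
    qed
    moreover have "\<forall>\<^sub>F n in G. continuous_on (cball x d) (%t. f n (gamma t)) & (%t. f n (gamma t)) holomorphic_on ball x d"
      using fh d by (intro always_eventually allI conjI holomorphic_on_imp_continuous_on)
        (meson holomorphic_on_subset ball_subset_cball subset_trans)+
    ultimately have "(%t. F (gamma t)) holomorphic_on ball x d"
      using holomorphic_uniform_limit[of x d "%n t. f n (gamma t)" G "%t. F (gamma t)"] G by blast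
    then show "EX e>0. (%t. F (gamma t)) holomorphic_on ball x e" using d by blast
  qed
  then show "(%t. F (gamma t)) holomorphic_on D" by (rule analytic_imp_holomorphic)
qed

text \<open>Leibniz's rule asks for a jointly continuous t-derivative, while only g itself is known
  to be jointly continuous. Cauchy's formula on the circle of radius r (\<open>fx\<close>) expresses
  this derivative as an integral of g and so transfers the continuity.\<close>

lemma holomorphic_integral_param:
  fixes g :: "complex => real => complex"
  assumes r: "r > 0" and cont: "continuous_on (cball t0 r \<times> {0..1}) (%(t,s). g t s)"
    and hol: "\<And>s. s : {0..1} ==> (%t. g t s) holomorphic_on ball t0 r"
  shows "(%t. integral {0..1} (g t)) holomorphic_on ball t0 r"
proof -
  define fx where "fx t s = 1 / (2 * of_real pi * \<i>) * contour_integral (circlepath t0 r) (%u. g u s / (u - t)^2)" for t s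
  have 1: "((%t. g t s) has_field_derivative fx t s) (at t within ball t0 r)"
    if "t : ball t0 r" "s : cbox 0 1" for t s
  proof -
    have "continuous_on (cball t0 r) (%t. g t s)"
      by (rule continuous_on_compose2[OF cont, of _ "%t. (t,s)", simplified])
        (use that in \<open>auto intro!: continuous_intros\<close>)
    from Cauchy_derivative_integral_circlepath(2)[OF this hol that(1)] that(2)
    show ?thesis unfolding fx_def by (auto intro: has_field_derivative_at_within)
  qed
  have 2: "g t integrable_on cbox 0 1" if "t : ball t0 r" for t
  proof -
    have "continuous_on {0..1} (g t)"
      by (rule continuous_on_compose2[OF cont, of _ "%s. (t,s)", simplified])
        (use that in \<open>auto intro!: continuous_intros\<close>)
    then show ?thesis by (simp add: integrable_continuous_interval)
  qed
  have 3: "continuous_on (ball t0 r \<times> cbox 0 1) (%(t,s). fx t s)"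
  proof -
    have fxe: "fx t s = 1 / (2 * of_real pi * \<i>) *
       integral (cbox 0 1) (%x. g (circlepath t0 r x) s / (circlepath t0 r x - t)^2 * (2 * pi * \<i> * r * exp (2 * of_real pi * \<i> * x)))" for t s
      unfolding fx_def by (simp add: contour_integral_integral vector_derivative_circlepath)
    have c: "continuous_on ((ball t0 r \<times> {0..1}) \<times> cbox (0::real) 1)
       (%(p,x). g (circlepath t0 r x) (snd p) / (circlepath t0 r x - fst p)^2 * (2 * pi * \<i> * r * exp (2 * of_real pi * \<i> * x)))"
    proof -
      have cc: "continuous_on UNIV (%x. circlepath t0 r x)"
        unfolding circlepath_def part_circlepath_def linepath_def by (intro continuous_intros)
      have cg: "continuous_on ((ball t0 r \<times> {0..1}) \<times> cbox (0::real) 1) (%q. g (circlepath t0 r (snd q)) (snd (fst q)))"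
        apply (rule continuous_on_compose2[OF cont, of _ "%q. (circlepath t0 r (snd q), snd (fst q))", simplified])
         apply (intro continuous_intros continuous_on_compose2[OF cc]; simp)
        using r by (auto simp: circlepath_def part_circlepath_def dist_norm norm_mult)
      have ne: "circlepath t0 r x ~= t" if "t : ball t0 r" for x t
        using that r by (auto simp: circlepath_def part_circlepath_def dist_norm norm_mult)
      show ?thesis
      proof -
        let ?A = "(ball t0 r \<times> {0..1::real}) \<times> cbox (0::real) 1"
        have 1: "continuous_on ?A (%q. circlepath t0 r (snd q))"
          by (rule continuous_on_compose2[OF cc continuous_on_snd[OF continuous_on_id]]) auto
        have 2: "continuous_on ?A (%q. fst (fst q))"
          by (intro continuous_on_fst continuous_on_id)
        have 3: "continuous_on ?A (%q. 2 * pi * \<i> * r * exp (2 * of_real pi * \<i> * snd q))"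
          by (intro continuous_intros)
        show ?thesis unfolding split_beta
          by (rule continuous_on_mult[OF continuous_on_divide[OF cg continuous_on_power[OF continuous_on_diff[OF 1 2]]] 3])
            (use ne in auto)
      qed
    qed
    have "continuous_on (ball t0 r \<times> {0..1}) (%p. integral (cbox 0 1) (%x. g (circlepath t0 r x) (snd p) / (circlepath t0 r x - fst p)^2 * (2 * pi * \<i> * r * exp (2 * of_real pi * \<i> * x))))"
      by (rule integral_continuous_on_param) (rule c)
    from continuous_on_mult_left[OF this, of "1 / (2 * of_real pi * \<i>)"]
    show ?thesis unfolding split_beta fxe by simp
  qed
  show ?thesis
  proof -
    have "(%x. integral (cbox 0 1) (g x)) holomorphic_on ball t0 r"
      by (rule leibniz_rule_holomorphic[OF 1 2 3 convex_ball])
    then show ?thesis by simp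
  qed
qed

lemma partial_fraction:
  fixes u :: "'a::field"
  assumes "u ~= a" "u ~= b" "a ~= b"
  shows "(f / (u - a) - f / (u - b)) / (a - b) = f / ((u - b) * (u - a))"
proof -
  have ne: "u - a ~= 0" "u - b ~= 0" "a - b ~= 0" using assms by auto
  have "f / (u - a) - f / (u - b) = (f * (u - b) - f * (u - a)) / ((u - a) * (u - b))"
    by (rule diff_frac_eq[OF ne(1,2)])
  also have "f * (u - b) - f * (u - a) = f * (a - b)" by (simp add: algebra_simps)
  also have "(u - a) * (u - b) = (u - b) * (u - a)" by (rule mult.commute)
  finally show ?thesis using ne(3) by (metis nonzero_mult_div_cancel_right times_divide_eq_left)
qed

lemma hol_integral:
  fixes K :: "(nat => complex) => real => complex"
  assumes U: "open U" and h: "\<And>s. s : {0..1} ==> hol U (%z. K z s)"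
    and cont: "continuous_on (U \<times> {0..1}) (%(z,s). K z s)"
  shows "hol U (%z. integral {0..1} (K z))"
  unfolding hol_def
proof (intro conjI allI impI)
  show "open U" by fact
  show "continuous_on U (%z. integral {0..1} (K z))"
    using integral_continuous_on_param[of U 0 1 K] cont by simp
  fix D and gamma :: "complex => nat => complex"
  assume D: "open D" and g: "ALL i. (%t. gamma t i) holomorphic_on D" "gamma ` D \<subseteq> U"
  have cg: "continuous_on D gamma"
    using g(1) holomorphic_on_imp_continuous_on by (auto intro!: continuous_on_coordinatewise_then_product)
  have "(%t. integral {0..1} (K (gamma t))) analytic_on D"
    unfolding analytic_on_def
  proof
    fix x assume "x : D"
    then obtain d where d: "d > 0" "cball x d \<subseteq> D"
      using D open_contains_cball by blast
    have "(%t. integral {0..1} (K (gamma t))) holomorphic_on ball x d"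
    proof (rule holomorphic_integral_param[OF d(1)])
      show "continuous_on (cball x d \<times> {0..1}) (%(t,s). K (gamma t) s)"
        unfolding split_beta
      proof (rule continuous_on_compose2[OF cont, of _ "%p. (gamma (fst p), snd p)", simplified])
        have "continuous_on (cball x d \<times> {0..1::real}) (%p. gamma (fst p))"
          by (rule continuous_on_compose2[OF cg]) (use d in \<open>auto intro!: continuous_on_fst continuous_on_id\<close>)
        then show "continuous_on (cball x d \<times> {0..1::real}) (%p. (gamma (fst p), snd p))"
          by (auto intro!: continuous_on_Pair continuous_on_snd continuous_on_id)
        show "(%p. (gamma (fst p), snd p)) ` (cball x d \<times> {0..1::real}) \<subseteq> U \<times> {0..1}"
        proof
          fix p assume "p : (%p. (gamma (fst p), snd p)) ` (cball x d \<times> {0..1::real})"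
          then obtain t s where "p = (gamma t, s)" "t : cball x d" "s : {0..1}" by auto
          moreover from this have "gamma t : U" using d(2) g(2) by blast
          ultimately show "p : U \<times> {0..1}" by blast
        qed
      qed
      show "(%t. K (gamma t) s) holomorphic_on ball x d" if "s : {0..1}" for s
      proof -
        have "(%t. K (gamma t) s) holomorphic_on D"
          using holD(3)[OF h[OF that] D] g by blast
        then show ?thesis
          by (rule holomorphic_on_subset) (use d ball_subset_cball in blast)
      qed
    qed
    then show "EX e>0. (%t. integral {0..1} (K (gamma t))) holomorphic_on ball x e" using d by blast
  qed
  then show "(%t. integral {0..1} (K (gamma t))) holomorphic_on D"
    by (rule analytic_imp_holomorphic)
qed

text \<open>The divided difference of F in the i-th variable at the nodes z i and w z;
  the Cauchy kernel makes it visibly holomorphic also where the nodes coincide.\<close>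

lemma hol_divided_difference:
  assumes F: "hol (poly_disc S a r) F" and S: "finite S" "i : S" and r: "r > 0"
    and w: "hol (poly_disc S a r) w" "\<And>z. z : poly_disc S a (r/2) ==> dist (w z) (a i) < r/2"
  obtains Q where "hol (poly_disc S a (r/2)) Q"
    "\<And>z. z : poly_disc S a (r/2) ==> Q z = (if z i = w z then deriv (%t. F (z(i:=t))) (z i)
         else (F z - F (z(i := w z))) / (z i - w z))"
proof -
  let ?U = "poly_disc S a (r/2)" and ?V = "poly_disc S a r"
  define c where "c s = circlepath (a i) (r/2) s" for s
  have c_cont: "continuous_on UNIV c"
    unfolding c_def circlepath_def part_circlepath_def linepath_def by (intro continuous_intros)
  have c_dist: "dist (c s) (a i) = r/2" for s
    using r by (simp add: c_def circlepath_def part_circlepath_def dist_norm norm_mult)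
  \<comment> \<open>The last factor is c'(s) / (2 pi i). Hence the integral of K over [0,1] is the
    Cauchy integral of f(u) / ((u - w z)(u - z i)) over the circle of radius r/2, which separates
    both nodes from the boundary of the domain of F.\<close>
  define K where "K z s = F (z(i := c s)) * inverse ((c s - w z) * (c s - z i)) * (r/2 * exp (2 * of_real pi * \<i> * s))" for z s
  have oU: "open ?U" and oV: "open ?V" using S by auto
  have UV: "?U \<subseteq> ?V" using r by (force simp: poly_disc_def)
  have ne: "c s ~= w z" "c s ~= z i" if "z : ?U" for z s
    using w(2)[OF that] c_dist[of s] that S by (auto simp: poly_disc_def)
  have up: "z(i := t) : ?V" if "z : ?U" "dist t (a i) <= r/2" for z t
    using that r by (force simp: poly_disc_def)
  have upc: "z(i := c s) : ?V" if "z : ?U" for z s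
    using up[OF that] c_dist by simp
  have hw: "hol ?U w" using hol_subset[OF w(1) oU UV] .
  have hK: "hol ?U (%z. K z s)" for s
  proof -
    have "hol ?U (%z. F (z(i := c s)))"
    proof (rule hol_compose[OF F oU])
      show "hol ?U (%z. (z(i := c s)) j)" for j using oU by (cases "j = i") auto
      show "(%z. z(i := c s)) ` ?U \<subseteq> ?V" using upc by auto
    qed
    then show ?thesis unfolding K_def
      by (intro hol_mult hol_inverse hol_diff hol_const[OF oU] hol_proj[OF oU] hw) (use ne in auto)
  qed
  have cK: "continuous_on (?U \<times> {0..1}) (%(z,s). K z s)"
  proof -
    have cs: "continuous_on (?U \<times> {0..1::real}) (%p. c (snd p))"
      by (rule continuous_on_compose2[OF c_cont continuous_on_snd[OF continuous_on_id]]) auto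
    have cf: "continuous_on (?U \<times> {0..1::real}) (%p. fst p j)" for j
      by (rule continuous_on_product_then_coordinatewise[OF continuous_on_fst[OF continuous_on_id]])
    have "continuous_on (?U \<times> {0..1}) (%p. F ((fst p)(i := c (snd p))))"
    proof (rule continuous_on_compose2[OF holD(2)[OF F]])
      show "continuous_on (?U \<times> {0..1}) (%p. (fst p)(i := c (snd p)))"
      proof (rule continuous_on_coordinatewise_then_product)
        fix j show "continuous_on (?U \<times> {0..1}) (%p. ((fst p)(i := c (snd p))) j)"
          using cs cf by (cases "j = i") auto
      qed
    qed (use upc in auto)
    moreover have "continuous_on (?U \<times> {0..1}) (%p. w (fst p))"
      by (rule continuous_on_compose2[OF holD(2)[OF hw] continuous_on_fst[OF continuous_on_id]]) auto
    ultimately show ?thesis unfolding K_def split_beta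
      by (intro continuous_on_mult continuous_on_inverse continuous_on_diff cs cf continuous_intros) (use ne in auto)
  qed
  have hQ: "hol ?U (%z. integral {0..1} (K z))"
    by (rule hol_integral[OF oU hK cK])
  show ?thesis
  proof (rule that[OF hQ])
    fix z assume z: "z : ?U"
    define f where "f t = F (z(i := t))" for t
    have hf: "f holomorphic_on ball (a i) r"
      unfolding f_def
    proof (rule holD(3)[OF F])
      show "(%t. (z(i := t)) j) holomorphic_on ball (a i) r" for j by (cases "j = i") auto
      show "(%t. z(i := t)) ` ball (a i) r \<subseteq> ?V"
        using z r by (force simp: poly_disc_def dist_commute)
    qed auto
    have cf: "continuous_on (cball (a i) (r/2)) f" "f holomorphic_on ball (a i) (r/2)"
    proof -
      have "cball (a i) (r/2) \<subseteq> ball (a i) r" using r by auto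
      then show "continuous_on (cball (a i) (r/2)) f"
        using continuous_on_subset[OF holomorphic_on_imp_continuous_on[OF hf]] by blast
      have "ball (a i) (r/2) \<subseteq> ball (a i) r" using r by auto
      then show "f holomorphic_on ball (a i) (r/2)"
        by (rule holomorphic_on_subset[OF hf])
    qed
    have zi: "z i : ball (a i) (r/2)" and wi: "w z : ball (a i) (r/2)"
      using z S w(2)[OF z] by (auto simp: poly_disc_def dist_commute)
    have int: "integral {0..1} (K z) =
        contour_integral (circlepath (a i) (r/2)) (%u. f u / ((u - w z) * (u - z i))) / (2 * of_real pi * \<i>)"
    proof -
      have "contour_integral (circlepath (a i) (r/2)) (%u. f u / ((u - w z) * (u - z i))) =
         integral {0..1} (%s. (2 * of_real pi * \<i>) * K z s)"
        unfolding contour_integral_integral vector_derivative_circlepath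
      proof (rule integral_cong)
        have aux: "x / y * (p * q * e) = p * (x * inverse y * (q * e))" for x y p q e :: complex
          by (simp add: divide_inverse mult_ac)
        show "f (circlepath (a i) (r/2) s) / ((circlepath (a i) (r/2) s - w z) * (circlepath (a i) (r/2) s - z i)) *
            (complex_of_real (2 * pi) * \<i> * complex_of_real (r/2) * exp (2 * complex_of_real pi * \<i> * complex_of_real s)) =
            2 * complex_of_real pi * \<i> * K z s" for s
          unfolding aux K_def f_def c_def by simp
      qed
      also have "\<dots> = (2 * of_real pi * \<i>) * integral {0..1} (K z)" by (rule integral_mult_right)
      finally have "contour_integral (circlepath (a i) (r/2)) (%u. f u / ((u - w z) * (u - z i))) / (2 * of_real pi * \<i>) = (2 * of_real pi * \<i>) * integral {0..1} (K z) / (2 * of_real pi * \<i>)"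
        by (rule arg_cong)
      also have "\<dots> = integral {0..1} (K z)" by (rule nonzero_mult_div_cancel_left) simp
      finally show ?thesis by (rule sym)
    qed
    have C1: "((%u. f u / (u - x)) has_contour_integral 2 * of_real pi * \<i> * f x) (circlepath (a i) (r/2))"
      if "x : ball (a i) (r/2)" for x
      using Cauchy_integral_circlepath[OF cf] that by (simp add: dist_norm norm_minus_commute)
    show "integral {0..1} (K z) = (if z i = w z then deriv (%t. F (z(i:=t))) (z i)
         else (F z - F (z(i := w z))) / (z i - w z))"
    proof (cases "z i = w z")
      case True
      have "(f has_field_derivative (1 / (2 * of_real pi * \<i>) * contour_integral(circlepath (a i) (r/2)) (%u. f u / (u - z i)^2))) (at (z i))"
        by (rule Cauchy_derivative_integral_circlepath[OF cf zi])
      then have "deriv f (z i) = 1 / (2 * of_real pi * \<i>) * contour_integral(circlepath (a i) (r/2)) (%u. f u / (u - z i)^2)"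
        by (rule DERIV_imp_deriv)
      moreover have "deriv f (z i) = deriv (%t. F (z(i:=t))) (z i)" by (simp add: f_def[abs_def])
      ultimately show ?thesis using True int by (simp add: power2_eq_square)
    next
      case False
      have "((%u. (f u / (u - z i) - f u / (u - w z)) / (z i - w z)) has_contour_integral
          (2 * of_real pi * \<i> * f (z i) - 2 * of_real pi * \<i> * f (w z)) / (z i - w z)) (circlepath (a i) (r/2))"
        by (intro has_contour_integral_div has_contour_integral_diff C1 zi wi)
      then have "((%u. f u / ((u - w z) * (u - z i))) has_contour_integral
          (2 * of_real pi * \<i> * f (z i) - 2 * of_real pi * \<i> * f (w z)) / (z i - w z)) (circlepath (a i) (r/2))"
      proof (rule has_contour_integral_eq)
        fix u assume "u : path_image (circlepath (a i) (r/2))"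
        then have "u ~= z i" "u ~= w z" using zi wi r by auto
        then show "(f u / (u - z i) - f u / (u - w z)) / (z i - w z) = f u / ((u - w z) * (u - z i))"
          using False by (intro partial_fraction)
      qed
      then have "integral {0..1} (K z) = (2 * of_real pi * \<i> * f (z i) - 2 * of_real pi * \<i> * f (w z)) / (z i - w z) / (2 * of_real pi * \<i>)"
        unfolding int by (simp add: contour_integral_unique)
      also have "\<dots> = (2 * of_real pi * \<i>) * (f (z i) - f (w z)) / (z i - w z) / (2 * of_real pi * \<i>)"
        by (simp only: right_diff_distrib)
      also have "\<dots> = (f (z i) - f (w z)) / (z i - w z)" by simp
      finally show ?thesis using False by (simp add: f_def)
    qed
  qed
qed

section \<open>Real analytic germs\<close>

definition emb :: "(nat => real) => nat => complex" where
  "emb x = (%i. complex_of_real (x i))"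

definition dep :: "nat set => ((nat => real) => 'b) => bool" where
  "dep S f \<longleftrightarrow> (ALL x y. (ALL i:S. x i = y i) --> f x = f y)"

lemma depD: "dep S f ==> (\<And>i. i : S ==> x i = y i) ==> f x = f y"
  unfolding dep_def by blast

lemma depI: "(\<And>x y. (\<And>i. i : S ==> x i = y i) ==> f x = f y) ==> dep S f"
  unfolding dep_def by blast

text \<open>f is a total function: \<open>dep\<close> restricts it everywhere, the holomorphic
  extension only near a. The extension F itself is not asked to depend on S alone; agreement at the
  points \<open>emb x\<close> is enough.\<close>

definition ra :: "nat set => ((nat => real) => real) => (nat => real) => bool" where
  "ra S f a \<longleftrightarrow> finite S & dep S f & (EX r>0. EX F. hol (poly_disc S (emb a) r) F &
     (ALL x. emb x : poly_disc S (emb a) r --> F (emb x) = of_real (f x)))"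

lemma raD: "ra S f a ==> finite S" "ra S f a ==> dep S f"
  unfolding ra_def by auto

lemma raE:
  assumes "ra S f a"
  obtains r F where "r > 0" "hol (poly_disc S (emb a) r) F"
    "\<And>x. emb x : poly_disc S (emb a) r ==> F (emb x) = of_real (f x)"
  using assms unfolding ra_def by blast

lemma emb_poly_disc: "emb x : poly_disc S (emb a) r \<longleftrightarrow> (ALL i:S. dist (x i) (a i) < r)"
  unfolding poly_disc_def emb_def by (simp add: dist_norm flip: of_real_diff)

lemma poly_disc_mono: "s <= r ==> S \<subseteq> T ==> poly_disc T a s \<subseteq> poly_disc S a r"
  unfolding poly_disc_def by force

lemma center_poly_disc [simp]: "r > 0 ==> a : poly_disc S a r"
  unfolding poly_disc_def by simp

lemma continuous_emb: "continuous_on A emb"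
  unfolding emb_def
  by (intro continuous_on_coordinatewise_then_product continuous_on_of_real
    continuous_on_product_then_coordinatewise[OF continuous_on_id])

text \<open>Any open set around \<open>emb a\<close> will do: freezing the coordinates outside S at
  a (the map T) turns a basic neighbourhood of the product topology into a polydisc in S.\<close>

lemma raI:
  assumes S: "finite S" and d: "dep S f" and F: "hol U F" and a: "emb a : U"
    and ag: "\<And>x. emb x : U ==> F (emb x) = of_real (f x)"
  shows "ra S f a"
proof -
  define T where "T z = (%i. if i : S then z i else emb a i)" for z
  obtain r where r: "r > 0" "\<And>x. (ALL i:S. dist (x i) (emb a i) < r) ==> (ALL i. i \<notin> S --> x i = emb a i) ==> x : U"
    using open_fun_box[OF holD(1)[OF F] a S] by blast
  let ?P = "poly_disc S (emb a) r"
  have TU: "T z : U" if "z : ?P" for z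
    by (rule r(2)) (use that in \<open>auto simp: T_def poly_disc_def\<close>)
  have "hol ?P (%z. F (T z))"
  proof (rule hol_compose[OF F])
    show "hol ?P (%z. T z i)" for i using S by (cases "i : S") (auto simp: T_def)
  qed (use S TU in auto)
  moreover have "F (T (emb x)) = of_real (f x)" if "emb x : ?P" for x
  proof -
    define y where "y = (%i. if i : S then x i else a i)"
    have "T (emb x) = emb y" by (auto simp: T_def emb_def y_def fun_eq_iff)
    moreover have "f y = f x" by (rule depD[OF d]) (auto simp: y_def)
    ultimately show ?thesis using TU[OF that] ag by metis
  qed
  ultimately show ?thesis unfolding ra_def using S d r(1) by blast
qed

lemma ra_const [simp]: "finite S ==> ra S (%x. c) a"
  by (rule raI[where U = UNIV and F = "%z. of_real c"]) (auto simp: dep_def)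

lemma ra_proj [simp]: "finite S ==> i : S ==> ra S (%x. x i) a"
  by (rule raI[where U = UNIV and F = "%z. z i"]) (auto simp: dep_def emb_def)

lemma ra_mono:
  assumes f: "ra S f a" and T: "S \<subseteq> T" "finite T"
  shows "ra T f a"
proof -
  obtain r F where r: "r > 0" "hol (poly_disc S (emb a) r) F"
    "\<And>x. emb x : poly_disc S (emb a) r ==> F (emb x) = of_real (f x)"
    using raE[OF f] by blast
  show ?thesis
  proof (rule raI[OF T(2) _ r(2)])
    show "dep T f" by (rule depI, rule depD[OF raD(2)[OF f]]) (use T in blast)
  qed (use r in auto)
qed

lemma ra_binop:
  assumes "ra S f a" "ra S g a"
    and h: "\<And>U F G. hol U F ==> hol U G ==> hol U (%z. Op (F z) (G z))"
    and op: "\<And>x y. Op (of_real x) (of_real y) = of_real (op x y)"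
  shows "ra S (%x. op (f x) (g x)) a"
proof -
  obtain r F where r: "r > 0" "hol (poly_disc S (emb a) r) F"
    "\<And>x. emb x : poly_disc S (emb a) r ==> F (emb x) = of_real (f x)"
    using raE[OF assms(1)] by blast
  obtain s G where s: "s > 0" "hol (poly_disc S (emb a) s) G"
    "\<And>x. emb x : poly_disc S (emb a) s ==> G (emb x) = of_real (g x)"
    using raE[OF assms(2)] by blast
  let ?P = "poly_disc S (emb a) (min r s)"
  have fin: "finite S" using assms raD by blast
  have sub: "?P \<subseteq> poly_disc S (emb a) r" "?P \<subseteq> poly_disc S (emb a) s"
    using poly_disc_mono[of "min r s" _ S S] by auto
  have "hol ?P F" "hol ?P G" using hol_subset[OF r(2) _ sub(1)] hol_subset[OF s(2) _ sub(2)] fin by auto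
  then show ?thesis
  proof (intro raI[where U = ?P and F = "%z. Op (F z) (G z)"])
    show "dep S (%x. op (f x) (g x))" using raD(2)[OF assms(1)] raD(2)[OF assms(2)]
      unfolding dep_def by metis
    show "emb a : ?P" using r s by auto
    show "Op (F (emb x)) (G (emb x)) = of_real (op (f x) (g x))" if "emb x : ?P" for x
    proof -
      have "F (emb x) = of_real (f x)" "G (emb x) = of_real (g x)"
        using that sub r(3)[of x] s(3)[of x] by blast+
      then show ?thesis by (simp add: op)
    qed
  qed (use fin h in auto)
qed

lemma ra_add: "ra S f a ==> ra S g a ==> ra S (%x. f x + g x) a"
  by (rule ra_binop[where Op = "(+)"]) (auto intro: hol_add)

lemma ra_diff: "ra S f a ==> ra S g a ==> ra S (%x. f x - g x) a"
  by (rule ra_binop[where Op = "(-)"]) (auto intro: hol_diff)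

lemma ra_mult: "ra S f a ==> ra S g a ==> ra S (%x. f x * g x) a"
  by (rule ra_binop[where Op = "(*)"]) (auto intro: hol_mult)

lemma ra_power: "ra S f a ==> ra S (%x. f x ^ n) a"
  by (induction n) (auto intro: ra_mult dest: raD)

lemma ra_sum: "finite S ==> (\<And>j. j : J ==> ra S (f j) a) ==> ra S (%x. \<Sum>j\<in>J. f j x) a"
  by (induction J rule: infinite_finite_induct) (auto intro: ra_add)

lemma ra_prod: "finite S ==> (\<And>j. j : J ==> ra S (f j) a) ==> ra S (%x. \<Prod>j\<in>J. f j x) a"
  by (induction J rule: infinite_finite_induct) (auto intro: ra_mult)

lemma isCont_ra:
  assumes "ra S f a" shows "isCont f a"
proof -
  obtain r F where r: "r > 0" "hol (poly_disc S (emb a) r) F"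
    "\<And>x. emb x : poly_disc S (emb a) r ==> F (emb x) = of_real (f x)"
    using raE[OF assms] by blast
  let ?V = "{x. ALL i:S. dist (x i) (a i) < r}"
  have op: "open ?V" using open_polybox raD(1)[OF assms] by blast
  have "continuous_on ?V (%x. Re (F (emb x)))"
    by (intro continuous_on_Re continuous_on_compose2[OF holD(2)[OF r(2)] continuous_emb])
      (auto simp: emb_poly_disc)
  then have "continuous_on ?V f"
    by (rule continuous_on_eq) (use r(3) in \<open>auto simp: emb_poly_disc\<close>)
  moreover have "a : ?V" using r(1) by auto
  ultimately show ?thesis using continuous_on_eq_continuous_at[OF op] by blast
qed

lemma ra_eventually:
  assumes "ra S f a" shows "\<forall>\<^sub>F x in nhds a. ra S f x"
proof -
  obtain r F where r: "r > 0" "hol (poly_disc S (emb a) r) F"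
    "\<And>x. emb x : poly_disc S (emb a) r ==> F (emb x) = of_real (f x)"
    using raE[OF assms] by blast
  let ?V = "{x. ALL i:S. dist (x i) (a i) < r}"
  have "open ?V" "a : ?V" using open_polybox raD(1)[OF assms] r by auto
  moreover have "ra S f x" if "x : ?V" for x
    by (rule raI[OF _ _ r(2)]) (use raD[OF assms] that r in \<open>auto simp: emb_poly_disc\<close>)
  ultimately show ?thesis unfolding eventually_nhds by blast
qed

lemma ra_compose:
  assumes f: "ra S f (Phi a)" and T: "finite T" and P: "\<And>i. i : S ==> ra T (%x. Phi x i) a"
  shows "ra T (%x. f (Phi x)) a"
proof -
  obtain r F where r: "r > 0" "hol (poly_disc S (emb (Phi a)) r) F"
    "\<And>x. emb x : poly_disc S (emb (Phi a)) r ==> F (emb x) = of_real (f x)"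
    using raE[OF f] by blast
  have fS: "finite S" using raD(1)[OF f] .
  have "ALL i:S. EX s G. s > 0 & hol (poly_disc T (emb a) s) G &
    (ALL x. emb x : poly_disc T (emb a) s --> G (emb x) = of_real (Phi x i))"
    using raE[OF P] by metis
  then obtain s G where s: "\<And>i. i:S ==> s i > 0" "\<And>i. i:S ==> hol (poly_disc T (emb a) (s i)) (G i)"
    "\<And>i x. i:S ==> emb x : poly_disc T (emb a) (s i) ==> G i (emb x) = of_real (Phi x i)"
    by metis
  define R where "R = Min (insert 1 (s ` S))"
  have R: "R > 0" "\<And>i. i:S ==> R <= s i"
    unfolding R_def using fS s(1) by (auto simp: Min_le_iff)
  let ?P = "poly_disc T (emb a) R"
  \<comment> \<open>Coordinates outside S are frozen, because Phi is known to be analytic only in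
    those of S, and f does not see the others.\<close>
  define Psi where "Psi z = (%i. if i : S then G i z else emb (Phi a) i)" for z
  have sub: "i : S ==> ?P \<subseteq> poly_disc T (emb a) (s i)" for i using R(2) by (intro poly_disc_mono) auto
  have hPsi: "hol ?P (%z. Psi z i)" for i
    using hol_subset[OF s(2) _ sub] T unfolding Psi_def by (cases "i : S") auto
  have cPsi: "continuous_on ?P Psi"
    using hPsi holD(2) by (auto intro!: continuous_on_coordinatewise_then_product)
  define U where "U = {z : ?P. Psi z : poly_disc S (emb (Phi a)) r}"
  have oU: "open U" unfolding U_def
  proof -
    have "open (?P \<inter> Psi -` poly_disc S (emb (Phi a)) r)"
      by (rule continuous_open_preimage[OF cPsi]) (use T fS in auto)
    moreover have "?P \<inter> Psi -` poly_disc S (emb (Phi a)) r = {z : ?P. Psi z : poly_disc S (emb (Phi a)) r}" by blast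
    ultimately show "open {z : ?P. Psi z : poly_disc S (emb (Phi a)) r}" by simp
  qed
  have hU: "hol U (%z. F (Psi z))"
  proof (rule hol_compose[OF r(2) oU])
    show "hol U (%z. Psi z i)" for i using hol_subset[OF hPsi oU] by (auto simp: U_def)
  qed (auto simp: U_def)
  have emPsi: "Psi (emb x) = emb (%i. if i : S then Phi x i else Phi a i)" if "emb x : ?P" for x
    using s(3) sub that by (auto simp: Psi_def emb_def fun_eq_iff)
  show ?thesis
  proof (rule raI[OF T _ hU])
    show "dep T (%x. f (Phi x))"
    proof (rule depI)
      fix x y :: "nat => real" assume xy: "\<And>i. i : T ==> x i = y i"
      show "f (Phi x) = f (Phi y)"
        by (rule depD[OF raD(2)[OF f]]) (use depD[OF raD(2)[OF P]] xy in blast)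
    qed
    show "emb a : U" unfolding U_def using R(1) r(1) emPsi[of a] by (auto simp: emb_poly_disc)
    fix x assume x: "emb x : U"
    then have "F (Psi (emb x)) = of_real (f (%i. if i : S then Phi x i else Phi a i))"
      using emPsi[of x] r(3) by (auto simp: U_def)
    also have "f (%i. if i : S then Phi x i else Phi a i) = f (Phi x)"
      by (rule depD[OF raD(2)[OF f]]) auto
    finally show "F (Psi (emb x)) = of_real (f (Phi x))" .
  qed
qed

lemma has_vector_derivative_transform_within_open_ev:
  assumes "(f has_vector_derivative D) (at c)" "\<forall>\<^sub>F t in nhds c. f t = g t"
  shows "(g has_vector_derivative D) (at c)"
proof -
  obtain V where "open V" "c : V" "\<And>t. t : V ==> f t = g t"
    using assms(2) unfolding eventually_nhds by blast
  then show ?thesis using has_vector_derivative_transform_within_open[OF assms(1)] by blast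
qed

lemma real_deriv_of_holomorphic:
  fixes g :: "real => real"
  assumes G: "(G has_field_derivative D) (at (of_real c))"
    and ev: "\<forall>\<^sub>F t in nhds c. G (of_real t) = of_real (g t)"
  shows "(g has_real_derivative Re D) (at c)" "D = of_real (deriv g c)"
proof -
  have "((%x. G (of_real x)) has_vector_derivative D) (at c)"
    by (rule has_vector_derivative_real_field[OF G])
  then have v: "((%x. complex_of_real (g x)) has_vector_derivative D) (at c)"
    by (rule has_vector_derivative_transform_within_open_ev[OF _ ev])
  have "((%x. Re (complex_of_real (g x))) has_vector_derivative Re D) (at c)"
    using bounded_linear.has_vector_derivative[OF bounded_linear_Re v] .
  then show 1: "(g has_real_derivative Re D) (at c)"
    by (simp add: has_real_derivative_iff_has_vector_derivative)
  have "((%x. Im (complex_of_real (g x))) has_vector_derivative Im D) (at c)"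
    using bounded_linear.has_vector_derivative[OF bounded_linear_Im v] .
  then have "((%x::real. 0::real) has_vector_derivative Im D) (at c)" by simp
  then have "Im D = 0" using vector_derivative_unique_at has_vector_derivative_const by blast
  then show "D = of_real (deriv g c)" using DERIV_imp_deriv[OF 1] by (simp add: complex_eq_iff)
qed

section \<open>Partial derivatives and divided differences of germs\<close>

definition pd :: "nat => ((nat => real) => real) => (nat => real) => real" where
  "pd i f x = deriv (%t. f (x(i := t))) (x i)"

text \<open>Subtracting the slice at x i = c and dividing by x i - c stays within analytic germs.
  The iterates at c = a i are the Taylor coefficients in the i-th variable, and orders of vanishing
  are measured by them throughout.\<close>

definition dd :: "nat => real => ((nat => real) => real) => (nat => real) => real" where
  "dd i c f x = (if x i = c then pd i f x else (f x - f (x(i := c))) / (x i - c))"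

lemma dd_expand: "f x = f (x(i := c)) + (x i - c) * dd i c f x"
  by (auto simp: dd_def fun_upd_idem)

lemma dep_pd: "dep S f ==> i : S ==> dep S (pd i f)"
  unfolding pd_def
proof (rule depI)
  fix x y :: "nat => real" assume d: "dep S f" "i : S" and xy: "\<And>i. i : S ==> x i = y i"
  have "(%t. f (x(i := t))) = (%t. f (y(i := t)))"
    by (rule ext, rule depD[OF d(1)]) (use xy in auto)
  then show "deriv (%t. f (x(i := t))) (x i) = deriv (%t. f (y(i := t))) (y i)"
    using xy[OF d(2)] by simp
qed

lemma dep_dd:
  assumes "dep S f" "i : S" shows "dep S (dd i c f)"
proof (rule depI)
  fix x y :: "nat => real" assume xy: "\<And>i. i : S ==> x i = y i"
  have "f x = f y" "f (x(i:=c)) = f (y(i:=c))" by (auto intro!: depD[OF assms(1)] simp: xy)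
  moreover have "pd i f x = pd i f y" by (rule depD[OF dep_pd[OF assms]]) (rule xy)
  ultimately show "dd i c f x = dd i c f y" using xy[OF assms(2)] by (simp add: dd_def)
qed

lemma emb_upd: "emb (x(i := t)) = (emb x)(i := of_real t)"
  by (auto simp: emb_def)

lemma hol_slice:
  assumes F: "hol (poly_disc S a r) F" and z: "z : poly_disc S a r" and i: "i : S"
  shows "(%t. F (z(i := t))) holomorphic_on ball (a i) r"
proof (rule holD(3)[OF F])
  show "(%t. (z(i := t)) j) holomorphic_on ball (a i) r" for j by (cases "j = i") auto
  show "(%t. z(i := t)) ` ball (a i) r \<subseteq> poly_disc S a r"
    using z i by (auto simp: poly_disc_def dist_commute)
qed auto

lemma ra_slice_deriv:
  assumes F: "hol (poly_disc S (emb a) r) F"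
    and ag: "\<And>x. emb x : poly_disc S (emb a) r ==> F (emb x) = of_real (f x)"
    and x: "emb x : poly_disc S (emb a) r" and i: "i : S"
  shows "((%t. f (x(i := t))) has_real_derivative pd i f x) (at (x i))"
    "deriv (%t. F ((emb x)(i := t))) (emb x i) = of_real (pd i f x)"
proof -
  let ?G = "%t. F ((emb x)(i := t))"
  have h: "?G holomorphic_on ball (emb a i) r" by (rule hol_slice[OF F x i])
  have xi: "emb x i : ball (emb a i) r" using x i by (auto simp: poly_disc_def dist_commute)
  have "(?G has_field_derivative deriv ?G (emb x i)) (at (emb x i))"
    using holomorphic_derivI[OF h _ xi] by auto
  then have G: "(?G has_field_derivative deriv ?G (emb x i)) (at (of_real (x i)))"
    by (simp add: emb_def)
  have ev: "\<forall>\<^sub>F t in nhds (x i). ?G (of_real t) = of_real (f (x(i := t)))"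
  proof -
    have "\<forall>\<^sub>F t in nhds (x i). t : ball (a i) r"
      by (rule eventually_nhds_in_open) (use x i in \<open>auto simp: emb_poly_disc dist_commute\<close>)
    then show ?thesis
    proof (rule eventually_mono)
      fix t assume "t : ball (a i) r"
      then have "emb (x(i := t)) : poly_disc S (emb a) r"
        using x by (auto simp: emb_poly_disc dist_commute)
      from ag[OF this] show "?G (of_real t) = of_real (f (x(i := t)))" by (simp add: emb_upd)
    qed
  qed
  from real_deriv_of_holomorphic[OF G ev] DERIV_imp_deriv
  show "((%t. f (x(i := t))) has_real_derivative pd i f x) (at (x i))"
    "deriv (%t. F ((emb x)(i := t))) (emb x i) = of_real (pd i f x)"
    unfolding pd_def by auto
qed

lemma has_real_derivative_pd:
  assumes "ra S f a" "i : S"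
  shows "((%t. f (a(i := t))) has_real_derivative pd i f a) (at (a i))"
proof -
  obtain r F where r: "r > 0" "hol (poly_disc S (emb a) r) F"
    "\<And>x. emb x : poly_disc S (emb a) r ==> F (emb x) = of_real (f x)"
    using raE[OF assms(1)] by blast
  show ?thesis by (rule ra_slice_deriv[OF r(2,3) _ assms(2)]) (use r in auto)
qed

text \<open>Both nodes of the divided difference are put at z i, so that it becomes the partial
  derivative, already holomorphic in all variables together.\<close>

lemma ra_pd:
  assumes f: "ra S f a" and i: "i : S"
  shows "ra S (pd i f) a"
proof -
  obtain r F where r: "r > 0" "hol (poly_disc S (emb a) r) F"
    "\<And>x. emb x : poly_disc S (emb a) r ==> F (emb x) = of_real (f x)"
    using raE[OF f] by blast
  have fS: "finite S" using raD(1)[OF f] .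
  obtain Q where Q: "hol (poly_disc S (emb a) (r/2)) Q"
    "\<And>z. z : poly_disc S (emb a) (r/2) ==> Q z = (if z i = z i then deriv (%t. F (z(i:=t))) (z i)
         else (F z - F (z(i := z i))) / (z i - z i))"
  proof (rule hol_divided_difference[OF r(2) fS i r(1), of "%z. z i"])
    show "hol (poly_disc S (emb a) r) (%z. z i)" using fS by auto
    show "dist (z i) (emb a i) < r/2" if "z : poly_disc S (emb a) (r/2)" for z
      using that i unfolding poly_disc_def by blast
  qed (use that in blast)
  have sub: "poly_disc S (emb a) (r/2) \<subseteq> poly_disc S (emb a) r" using r by (intro poly_disc_mono) auto
  show ?thesis
  proof (rule raI[OF fS dep_pd[OF raD(2)[OF f] i] Q(1)])
    show "emb a : poly_disc S (emb a) (r/2)" using r by auto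
    fix x assume x: "emb x : poly_disc S (emb a) (r/2)"
    show "Q (emb x) = of_real (pd i f x)"
      using Q(2)[OF x] ra_slice_deriv(2)[OF r(2,3) subsetD[OF sub x] i] by simp
  qed
qed

lemma ra_dd:
  assumes f: "ra S f a" and i: "i : S"
  shows "ra S (dd i (a i) f) a"
proof -
  obtain r F where r: "r > 0" "hol (poly_disc S (emb a) r) F"
    "\<And>x. emb x : poly_disc S (emb a) r ==> F (emb x) = of_real (f x)"
    using raE[OF f] by blast
  have fS: "finite S" using raD(1)[OF f] .
  obtain Q where Q: "hol (poly_disc S (emb a) (r/2)) Q"
    "\<And>z. z : poly_disc S (emb a) (r/2) ==> Q z = (if z i = emb a i then deriv (%t. F (z(i:=t))) (z i)
         else (F z - F (z(i := emb a i))) / (z i - emb a i))"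
    using hol_divided_difference[OF r(2) fS i r(1), of "%z. emb a i"] fS r(1) by auto
  have sub: "poly_disc S (emb a) (r/2) \<subseteq> poly_disc S (emb a) r" using r by (intro poly_disc_mono) auto
  show ?thesis
  proof (rule raI[OF fS dep_dd[OF raD(2)[OF f] i] Q(1)])
    show "emb a : poly_disc S (emb a) (r/2)" using r by auto
    fix x assume x: "emb x : poly_disc S (emb a) (r/2)"
    then have x': "emb x : poly_disc S (emb a) r" using sub by auto
    have u: "emb (x(i := a i)) : poly_disc S (emb a) r"
      using x' r by (auto simp: emb_poly_disc)
    show "Q (emb x) = of_real (dd i (a i) f x)"
    proof (cases "x i = a i")
      case True
      then have "emb x i = emb a i" by (simp add: emb_def)
      then have "Q (emb x) = deriv (%t. F ((emb x)(i := t))) (emb x i)" using Q(2)[OF x] by simp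
      also have "\<dots> = of_real (pd i f x)" by (rule ra_slice_deriv(2)[OF r(2,3) x' i])
      finally show ?thesis using True by (simp add: dd_def)
    next
      case False
      then have "emb x i ~= emb a i" by (simp add: emb_def)
      then have "Q (emb x) = (F (emb x) - F (emb (x(i := a i)))) / (emb x i - emb a i)"
        using Q(2)[OF x] by (simp add: emb_upd) (simp add: emb_def)
      then show ?thesis using r(3)[OF x'] r(3)[OF u] False by (simp add: dd_def emb_def)
    qed
  qed
qed

text \<open>Complexifies the segment from p to q. The complex parameters whose point stays in the
  polydisc form a convex, hence connected, neighbourhood of [0,1], and there the one-variable
  identity theorem can be used.\<close>

lemma hol_segment:
  assumes F: "hol (poly_disc S (emb a) r) F"
    and p: "\<And>i. i : S ==> dist (p i) (a i) < r" and q: "\<And>i. i : S ==> dist (q i) (a i) < r"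
    and S: "finite S"
  obtains D where "open D" "convex D" "of_real ` {0..1} \<subseteq> D"
    "(%t. F (%i. of_real (p i) + t * of_real (q i - p i))) holomorphic_on D"
    "\<And>t. t : D ==> (%i. of_real (p i) + t * of_real (q i - p i)) : poly_disc S (emb a) r"
proof -
  let ?gamma = "%t i. complex_of_real (p i) + t * of_real (q i - p i)"
  define D where "D = {t. ?gamma t : poly_disc S (emb a) r}"
  have Deq: "D = (\<Inter>i\<in>S. (%t. ?gamma t i) -` ball (emb a i) r)"
    by (auto simp: D_def poly_disc_def dist_commute)
  have oD: "open D" unfolding Deq
    by (intro open_INT S ballI open_vimage) (auto intro!: continuous_intros)
  have cD: "convex D" unfolding Deq
  proof (intro convex_INT)
    fix i assume "i : S"
    have "(%t. ?gamma t i) -` ball (emb a i) r = {t. norm (t * of_real (q i - p i) - (emb a i - of_real (p i))) < r}"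
      by (auto simp: dist_norm norm_minus_commute algebra_simps)
    also have "convex \<dots>"
    proof (rule convexI)
      fix x y :: complex and u v :: real
      assume x: "x : {t. norm (t * of_real (q i - p i) - (emb a i - of_real (p i))) < r}"
        and y: "y : {t. norm (t * of_real (q i - p i) - (emb a i - of_real (p i))) < r}"
        and uv: "0 <= u" "0 <= v" "u + v = 1"
      define w c where "w = complex_of_real (q i - p i)" and "c = emb a i - of_real (p i)"
      have "u *\<^sub>R (x * w - c) + v *\<^sub>R (y * w - c) = (u *\<^sub>R x + v *\<^sub>R y) * w - (u + v) *\<^sub>R c"
        by (simp add: scaleR_right_diff_distrib scaleR_left_distrib ring_distribs)
      then have "(u *\<^sub>R x + v *\<^sub>R y) * w - c = u *\<^sub>R (x * w - c) + v *\<^sub>R (y * w - c)"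
        using uv(3) by simp
      moreover have "u *\<^sub>R (x * w - c) + v *\<^sub>R (y * w - c) : ball 0 r"
        using convexD[OF convex_ball[of 0 r], of "x * w - c" "y * w - c" u v] x y uv by (auto simp: w_def c_def)
      ultimately show "u *\<^sub>R x + v *\<^sub>R y : {t. norm (t * of_real (q i - p i) - (emb a i - of_real (p i))) < r}"
        by (simp add: w_def c_def)
    qed
    finally show "convex ((%t. ?gamma t i) -` ball (emb a i) r)" .
  qed
  have "dist (p i + t * (q i - p i)) (a i) < r" if "i : S" "0 <= t" "t <= 1" for i t
  proof -
    have "(1 - t) *\<^sub>R p i + t *\<^sub>R q i : ball (a i) r"
      by (rule convexD[OF convex_ball]) (use that p q in \<open>auto simp: dist_commute\<close>)
    then show ?thesis by (simp add: dist_commute algebra_simps)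
  qed
  moreover have "?gamma (of_real t) = emb (%i. p i + t * (q i - p i))" for t
    by (auto simp: emb_def)
  ultimately have seg: "of_real ` {0..1} \<subseteq> D" by (auto simp: D_def emb_poly_disc)
  have h: "(%t. F (?gamma t)) holomorphic_on D"
  proof (rule holD(3)[OF F oD])
    show "(%t. ?gamma t i) holomorphic_on D" for i by (intro holomorphic_intros)
  qed (auto simp: D_def)
  show ?thesis by (rule that[OF oD cD seg h]) (auto simp: D_def)
qed

lemma not_eventually_box:
  fixes a :: "nat => real"
  assumes "\<not> (\<forall>\<^sub>F x in nhds a. P x)" "finite S" "r > 0"
  obtains p where "\<And>i. i : S ==> dist (p i) (a i) < r" "\<not> P p"
proof -
  have "EX x:{x. ALL i:S. dist (x i) (a i) < r}. \<not> P x"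
  proof (rule ccontr)
    assume "\<not> ?thesis"
    then have "\<forall>\<^sub>F x in nhds a. P x"
      using open_polybox[OF assms(2), of a r] assms(3) unfolding eventually_nhds by (intro exI[of _ "{x. ALL i:S. dist (x i) (a i) < r}"]) auto
    with assms(1) show False by blast
  qed
  with that show thesis by blast
qed

text \<open>Germs form an integral domain. If f p and g q are nonzero at points near a, join p to q:
  along the complexified segment the product of the extensions vanishes on [0,1] and hence on all of
  D. The first factor is nonzero near the parameter 0, so the second one vanishes there, and by
  continuation at q.\<close>

lemma ra_mult_zero:
  assumes f: "ra S f a" and g: "ra S g a" and z: "\<forall>\<^sub>F x in nhds a. f x * g x = 0"
  shows "(\<forall>\<^sub>F x in nhds a. f x = 0) \<or> (\<forall>\<^sub>F x in nhds a. g x = 0)"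
proof (rule ccontr)
  assume neg: "\<not> ?thesis"
  have fS: "finite S" using raD f by blast
  obtain r1 F where F: "r1 > 0" "hol (poly_disc S (emb a) r1) F"
    "\<And>x. emb x : poly_disc S (emb a) r1 ==> F (emb x) = of_real (f x)" using raE[OF f] by blast
  obtain r2 G where G: "r2 > 0" "hol (poly_disc S (emb a) r2) G"
    "\<And>x. emb x : poly_disc S (emb a) r2 ==> G (emb x) = of_real (g x)" using raE[OF g] by blast
  obtain V where V: "open V" "a : V" "\<And>x. x : V ==> f x * g x = 0"
    using z unfolding eventually_nhds by blast
  obtain r3 where r3: "r3 > 0" "\<And>x. (ALL i:S. dist (x i) (a i) < r3) ==> (ALL i. i \<notin> S --> x i = a i) ==> x : V"
    using open_fun_box[OF V(1,2) fS] by blast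
  define r where "r = min r1 (min r2 r3)"
  have r: "r > 0" "r <= r1" "r <= r2" "r <= r3" using F G r3 by (auto simp: r_def)
  let ?P = "poly_disc S (emb a) r"
  have P: "?P \<subseteq> poly_disc S (emb a) r1" "?P \<subseteq> poly_disc S (emb a) r2"
    using r poly_disc_mono by auto
  have hF: "hol ?P F" and hG: "hol ?P G"
    using hol_subset[OF F(2) _ P(1)] hol_subset[OF G(2) _ P(2)] fS by auto
  have Fe: "F (emb x) = of_real (f x)" and Ge: "G (emb x) = of_real (g x)" if "emb x : ?P" for x
    using that P F(3) G(3) by blast+
  have fg0: "f x * g x = 0" if x: "emb x : ?P" for x
  proof -
    define y where "y = (%i. if i : S then x i else a i)"
    have "y : V" by (rule r3(2)) (use x r in \<open>force simp: emb_poly_disc y_def\<close>)+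
    moreover have "f y = f x" by (rule depD[OF raD(2)[OF f]]) (auto simp: y_def)
    moreover have "g y = g x" by (rule depD[OF raD(2)[OF g]]) (auto simp: y_def)
    ultimately show ?thesis using V(3) by metis
  qed

  obtain p where p: "\<And>i. i : S ==> dist (p i) (a i) < r" "f p ~= 0"
    using not_eventually_box[OF _ fS r(1)] neg by blast
  obtain q where q: "\<And>i. i : S ==> dist (q i) (a i) < r" "g q ~= 0"
    using not_eventually_box[OF _ fS r(1)] neg by blast
  let ?gamma = "%t i. complex_of_real (p i) + t * of_real (q i - p i)"
  obtain D where D: "open D" "convex D" "of_real ` {0..1} \<subseteq> D" "(%t. F (?gamma t)) holomorphic_on D"
    "\<And>t. t : D ==> ?gamma t : ?P"
    using hol_segment[OF hF p(1) q(1) fS] by blast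
  have hG': "(%t. G (?gamma t)) holomorphic_on D"
    by (rule holD(3)[OF hG D(1)]) (use D(5) in \<open>auto intro!: holomorphic_intros\<close>)
  have lim: "(0::complex) islimpt of_real ` {0..1::real}"
  proof (rule islimptI)
    fix T :: "complex set" assume "0 : T" "open T"
    then obtain e where e: "e > 0" "ball 0 e \<subseteq> T" using open_contains_ball by blast
    show "EX y:of_real ` {0..1}. y : T & y ~= 0"
      by (rule bexI[of _ "of_real (min 1 (e/2))"]) (use e in \<open>auto intro!: subsetD[OF e(2)]\<close>)
  qed
  have "complex_of_real 0 : D" "complex_of_real 1 : D" using D(3) by fastforce+
  then have sub0: "0 : D" "1 : D" by auto
  have prod0: "F (?gamma t) * G (?gamma t) = 0" if "t : D" for t
  proof (rule analytic_continuation[of "%t. F (?gamma t) * G (?gamma t)" D "of_real ` {0..1}" 0 t])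
    show "(%t. F (?gamma t) * G (?gamma t)) holomorphic_on D" by (intro holomorphic_intros D hG')
    fix s :: complex assume s: "s : of_real ` {0..1::real}"
    then obtain t where t: "s = of_real t" by blast
    have e: "?gamma (of_real t) = emb (%i. p i + t * (q i - p i))" by (auto simp: emb_def)
    have "?gamma s : ?P" using D s by blast
    then show "F (?gamma s) * G (?gamma s) = 0"
      using Fe Ge fg0 unfolding t e by (metis of_real_0 of_real_mult)
  qed (use D lim that sub0 in \<open>auto intro: convex_connected\<close>)
  have F0: "F (?gamma 0) ~= 0"
  proof -
    have "?gamma 0 = emb p" by (auto simp: emb_def)
    then show ?thesis using Fe[of p] p D(5)[OF sub0(1)] by simp
  qed
  define N where "N = D \<inter> (%t. F (?gamma t)) -` (-{0})"
  have N: "open N" "0 : N" "\<And>t. t : N ==> F (?gamma t) ~= 0"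
  proof -
    show "open N" unfolding N_def
      by (rule continuous_open_preimage[OF holomorphic_on_imp_continuous_on[OF D(4)] D(1)]) auto
    show "0 : N" using sub0 F0 by (simp add: N_def)
  qed (auto simp: N_def)
  have "G (?gamma 1) = 0"
  proof (rule analytic_continuation_open[of "N \<inter> D" D "%t. G (?gamma t)" "%_. 0"])
    show "N \<inter> D ~= {}" using N sub0 by auto
    show "G (?gamma t) = 0" if "t : N \<inter> D" for t using that N(3) prod0[of t] by auto
  qed (use N D hG' sub0 in \<open>auto intro: convex_connected\<close>)
  moreover have "?gamma 1 = emb q" by (auto simp: emb_def)
  ultimately show False using Ge[of q] q D(5)[OF sub0(2)] by auto
qed

text \<open>Newton's iteration with the fixed slope L, the derivative at a. Close to a the map
  \<open>N z\<close> contracts a disc about a i with factor 1/2. Its iterates are holomorphic in z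
  and converge uniformly, so the fixed point H is holomorphic; it is real at real points because L
  and the iterates are. Uniqueness of the fixed point gives the last conclusion.\<close>

lemma ra_implicit:
  assumes g: "ra (insert i S) g a" and i: "i \<notin> S" and g0: "g a = 0" and nz: "pd i g a ~= 0"
  obtains eta where "ra S eta a" "eta a = a i" "\<forall>\<^sub>F x in nhds a. g (x(i := eta x)) = 0"
    "\<forall>\<^sub>F x in nhds a. g x = 0 --> x i = eta x"
proof -
  let ?T = "insert i S"
  have fT: "finite ?T" and fS: "finite S" using raD(1)[OF g] by auto
  obtain R G where R: "R > 0" "hol (poly_disc ?T (emb a) R) G"
    "\<And>x. emb x : poly_disc ?T (emb a) R ==> G (emb x) = of_real (g x)" using raE[OF g] by blast
  define L where "L = complex_of_real (pd i g a)"
  have L0: "L ~= 0" using nz by (simp add: L_def)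
  obtain Q where Q: "hol (poly_disc ?T (emb a) (R/2)) Q"
    "\<And>z. z : poly_disc ?T (emb a) (R/2) ==> Q z = (if z i = z i then deriv (%t. G (z(i:=t))) (z i)
         else (G z - G (z(i := z i))) / (z i - z i))"
  proof (rule hol_divided_difference[OF R(2) fT _ R(1), of i "%z. z i"])
    show "hol (poly_disc ?T (emb a) R) (%z. z i)" using fT by auto
    show "dist (z i) (emb a i) < R/2" if "z : poly_disc ?T (emb a) (R/2)" for z
      using that unfolding poly_disc_def by blast
  qed (use that in auto)
  have aR: "emb a : poly_disc ?T (emb a) (R/2)" "emb a : poly_disc ?T (emb a) R" using R by auto
  have subR: "poly_disc ?T (emb a) (R/2) \<subseteq> poly_disc ?T (emb a) R" using R by (intro poly_disc_mono) auto
  have Qa: "Q (emb a) = L"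
    using Q(2)[OF aR(1)] ra_slice_deriv(2)[OF R(2,3) aR(2), of i] by (simp add: L_def)
  have opQ: "open (poly_disc ?T (emb a) (R/2) \<inter> Q -` ball L (norm L / 2))"
    by (rule continuous_open_preimage[OF holD(2)[OF Q(1)]]) (use fT in auto)
  have meQ: "emb a : poly_disc ?T (emb a) (R/2) \<inter> Q -` ball L (norm L / 2)"
    using aR Qa L0 by auto
  obtain rho' where rho': "rho' > 0" "\<And>x. (ALL i:?T. dist (x i) (emb a i) < rho') ==> (ALL i. i \<notin> ?T --> x i = emb a i) ==>
      x : poly_disc ?T (emb a) (R/2) \<inter> Q -` ball L (norm L / 2)"
    using open_fun_box[OF opQ meQ fT] by blast
  define rho where "rho = rho'/2"
  have rho: "rho > 0" "rho < rho'" using rho' by (auto simp: rho_def)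
  define A where "A = emb a i"
  define tr where "tr z = (%j. if j : S then z j else emb a j)" for z :: "nat => complex"
  have trU: "(tr z)(i := t) : poly_disc ?T (emb a) (R/2) \<inter> Q -` ball L (norm L / 2)"
    if "z : poly_disc S (emb a) rho'" "dist t A < rho'" for z t
    by (rule rho'(2)) (use that i in \<open>auto simp: tr_def poly_disc_def A_def\<close>)
  define g1 where "g1 z t = G ((tr z)(i := t))" for z t
  have dg1: "(g1 z has_field_derivative Q ((tr z)(i := t))) (at t)"
    if "z : poly_disc S (emb a) rho'" "dist t A < rho'" for z t
  proof -
    let ?z = "(tr z)(i := t)"
    have z1: "?z : poly_disc ?T (emb a) (R/2)" using trU[OF that] by blast
    have "(%s. G (?z(i := s))) holomorphic_on ball (emb a i) R"
      by (rule hol_slice[OF R(2)]) (use z1 subR in auto)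
    moreover have "t : ball (emb a i) R" using z1 R by (auto simp: poly_disc_def dist_commute)
    ultimately have "((%s. G (?z(i := s))) has_field_derivative deriv (%s. G (?z(i := s))) t) (at t)"
      using holomorphic_derivI by blast
    moreover have "Q ?z = deriv (%s. G (?z(i := s))) t" using Q(2)[OF z1] by simp
    ultimately show ?thesis by (simp add: g1_def[abs_def])
  qed
  define N where "N z t = t - g1 z t / L" for z t
  have dN: "(N z has_field_derivative 1 - Q ((tr z)(i := t)) / L) (at t)"
    if "z : poly_disc S (emb a) rho'" "dist t A < rho'" for z t
    unfolding N_def[abs_def] by (auto intro!: derivative_eq_intros dg1[OF that] simp: L0)
  have contr: "norm (N z s - N z t) <= 1/2 * norm (s - t)"
    if z: "z : poly_disc S (emb a) rho'" and "s : cball A rho" "t : cball A rho" for z s t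
  proof (rule field_differentiable_bound[OF convex_cball _ _ that(2,3)])
    fix t assume "t : cball A rho"
    then have t: "dist t A < rho'" using rho by (auto simp: dist_commute)
    show "(N z has_field_derivative 1 - Q ((tr z)(i := t)) / L) (at t within cball A rho)"
      using dN[OF z t] by (rule has_field_derivative_at_within)
    have "norm (L - Q ((tr z)(i := t))) < norm L / 2" using trU[OF z t] by (auto simp: dist_norm)
    moreover have "1 - Q ((tr z)(i := t)) / L = (L - Q ((tr z)(i := t))) / L" using L0 by (simp add: field_simps)
    ultimately show "norm (1 - Q ((tr z)(i := t)) / L) <= 1/2" using L0 by (simp add: norm_divide field_simps)
  qed
  have hg1A: "hol (poly_disc S (emb a) rho') (%z. g1 z A)"
    unfolding g1_def
  proof (rule hol_compose[OF R(2)])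
    show "hol (poly_disc S (emb a) rho') (%z. ((tr z)(i := A)) j)" for j
      using fS by (cases "j = i"; cases "j : S") (auto simp: tr_def)
    show "(%z. (tr z)(i := A)) ` poly_disc S (emb a) rho' \<subseteq> poly_disc ?T (emb a) R"
      using trU rho'(1) subR by (auto simp: A_def)
  qed (use fS in auto)
  have g1a: "g1 (emb a) A = 0"
  proof -
    have "(tr (emb a))(i := A) = emb a" by (auto simp: tr_def A_def)
    then show ?thesis using R(3)[OF aR(2)] g0 by (simp add: g1_def)
  qed
  \<comment> \<open>The bound norm L * rho / 4 makes the first Newton step at most rho / 4. With the
    contraction factor 1/2 the disc of radius rho is then mapped into itself: rho/2 + rho/4 <=
    rho.\<close>
  have opg: "open (poly_disc S (emb a) rho' \<inter> (%z. g1 z A) -` ball 0 (norm L * rho / 4))"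
    by (rule continuous_open_preimage[OF holD(2)[OF hg1A]]) (use fS in auto)
  have meg: "emb a : poly_disc S (emb a) rho' \<inter> (%z. g1 z A) -` ball 0 (norm L * rho / 4)"
    using g1a rho'(1) rho(1) L0 by simp
  obtain delta where delta: "delta > 0" "\<And>x. (ALL i:S. dist (x i) (emb a i) < delta) ==> (ALL i. i \<notin> S --> x i = emb a i) ==>
     x : poly_disc S (emb a) rho' \<inter> (%z. g1 z A) -` ball 0 (norm L * rho / 4)"
    using open_fun_box[OF opg meg fS] by blast
  let ?P = "poly_disc S (emb a) delta"
  have Prho: "z : poly_disc S (emb a) rho'" and PA: "norm (g1 z A) < norm L * rho / 4" if "z : ?P" for z
  proof -
    have "tr z : poly_disc S (emb a) rho' \<inter> (%z. g1 z A) -` ball 0 (norm L * rho / 4)"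
      by (rule delta(2)) (use that in \<open>auto simp: tr_def poly_disc_def\<close>)
    moreover have "tr (tr z) = tr z" by (auto simp: tr_def)
    ultimately show "z : poly_disc S (emb a) rho'" "norm (g1 z A) < norm L * rho / 4"
      by (auto simp: g1_def poly_disc_def tr_def)
  qed
  have NA: "norm (N z A - A) <= rho / 4" if "z : ?P" for z
    using PA[OF that] L0 by (simp add: N_def norm_divide field_simps)
  have Nin: "N z t : cball A rho" if z: "z : ?P" and t: "t : cball A rho" for z t
  proof -
    have "norm (N z t - A) <= norm (N z t - N z A) + norm (N z A - A)"
      using norm_triangle_ineq[of "N z t - N z A" "N z A - A"] by simp
    also have "\<dots> <= 1/2 * norm (t - A) + rho/4"
      using contr[OF Prho[OF z] t] NA[OF z] rho(1) by (intro add_mono) auto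
    also have "\<dots> <= rho" using t rho by (auto simp: dist_norm norm_minus_commute)
    finally show ?thesis by (simp add: dist_norm norm_minus_commute)
  qed
  define h where "h k z = (N z ^^ k) A" for k z
  have hSuc: "h (Suc k) z = N z (h k z)" and h0: "h 0 z = A" for k z by (auto simp: h_def)
  have hin: "h k z : cball A rho" if "z : ?P" for k z
    by (induction k) (use rho Nin[OF that] in \<open>auto simp: hSuc h0\<close>)
  have hhol: "hol ?P (h k)" for k
  proof (induction k)
    case 0 then show ?case using fS by (simp add: h0[abs_def])
  next
    case (Suc k)
    have "hol ?P (%z. G ((tr z)(i := h k z)))"
    proof (rule hol_compose[OF R(2)])
      show "hol ?P (%z. ((tr z)(i := h k z)) j)" for j
        using fS Suc by (cases "j = i"; cases "j : S") (auto simp: tr_def)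
      show "(%z. (tr z)(i := h k z)) ` ?P \<subseteq> poly_disc ?T (emb a) R"
      proof (rule image_subsetI)
        fix z assume z: "z : ?P"
        have "dist (h k z) A < rho'" using hin[OF z, of k] rho by (auto simp: dist_commute)
        from trU[OF Prho[OF z] this] show "(tr z)(i := h k z) : poly_disc ?T (emb a) R" using subR by blast
      qed
    qed (use fS in auto)
    then have "hol ?P (%z. h k z - G ((tr z)(i := h k z)) * inverse L)"
      by (intro hol_diff Suc hol_mult hol_const) (use fS in auto)
    then show ?case by (simp add: hSuc[abs_def] N_def g1_def divide_inverse)
  qed
  have step: "norm (h (Suc k) z - h k z) <= rho/4 * (1/2)^k" if z: "z : ?P" for k z
  proof (induction k)
    case 0 show ?case using NA[OF z] by (simp add: hSuc h0)
  next
    case (Suc k)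
    have "norm (h (Suc (Suc k)) z - h (Suc k) z) <= 1/2 * norm (h (Suc k) z - h k z)"
      unfolding hSuc[of "Suc k"] using contr[OF Prho[OF z] hin[OF z] hin[OF z], of "Suc k" k] by (simp add: hSuc)
    then show ?case using Suc by simp
  qed
  define H where "H z = A + (\<Sum>k. h (Suc k) z - h k z)" for z
  have ul: "uniform_limit ?P h H sequentially"
  proof -
    have "uniform_limit ?P (%n z. \<Sum>k<n. h (Suc k) z - h k z) (%z. \<Sum>k. h (Suc k) z - h k z) sequentially"
      by (rule Weierstrass_m_test[where M = "%k. rho/4 * (1/2)^k"]) (use step in \<open>auto intro!: summable_mult\<close>)
    then have "uniform_limit ?P (%n z. A + (\<Sum>k<n. h (Suc k) z - h k z)) H sequentially"
      unfolding H_def[abs_def] by (intro uniform_limit_add uniform_limit_const)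
    moreover have "A + (\<Sum>k<n. h (Suc k) z - h k z) = h n z" for n z
      using sum_lessThan_telescope[of "%k. h k z" n] by (simp add: h0)
    ultimately show ?thesis by simp
  qed
  have hH: "hol ?P H" by (rule hol_uniform_limit[OF hhol ul]) simp
  have lim: "(%k. h k z) \<longlonglongrightarrow> H z" if "z : ?P" for z
    using tendsto_uniform_limitI[OF ul that] .
  have Hin: "H z : cball A rho" if "z : ?P" for z
    by (rule closed_sequentially[OF closed_cball _ lim[OF that]]) (use hin that in auto)
  have fixH: "N z (H z) = H z" if z: "z : ?P" for z
  proof -
    have "isCont (N z) (H z)"
    proof (rule DERIV_isCont[OF dN[OF Prho[OF z]]])
      show "dist (H z) A < rho'" using Hin[OF z] rho by (auto simp: dist_commute)
    qed
    then have "(%k. N z (h k z)) \<longlonglongrightarrow> N z (H z)" using isCont_tendsto_compose lim[OF z] by blast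
    moreover have "(%k. N z (h k z)) \<longlonglongrightarrow> H z" using LIMSEQ_Suc[OF lim[OF z]] by (simp add: hSuc)
    ultimately show ?thesis using LIMSEQ_unique by blast
  qed
  have G0: "g1 z (H z) = 0" if "z : ?P" for z using fixH[OF that] L0 by (simp add: N_def)
  have uniq: "t = H z" if z: "z : ?P" and t: "t : cball A rho" "g1 z t = 0" for z t
  proof -
    have "norm (N z t - N z (H z)) <= 1/2 * norm (t - H z)" by (rule contr[OF Prho[OF z] t(1) Hin[OF z]])
    moreover have "N z t = t" using t(2) by (simp add: N_def)
    ultimately show ?thesis using fixH[OF z] by simp
  qed
  have real_h: "h k z : \<real>" if z: "z : ?P" "z = emb x" for k z x
  proof (induction k)
    case 0 then show ?case by (simp add: h0 A_def emb_def)
  next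
    case (Suc k)
    then obtain t where t: "h k z = of_real t" by (auto elim: Reals_cases)
    let ?y = "(%j. if j : S then x j else a j)(i := t)"
    have e: "(tr z)(i := h k z) = emb ?y" by (subst t) (simp add: z(2) tr_def emb_def fun_eq_iff)
    have "dist (h k z) A < rho'" using hin[OF z(1), of k] rho by (auto simp: dist_commute)
    from trU[OF Prho[OF z(1)] this] have "emb ?y : poly_disc ?T (emb a) R" unfolding e using subR by blast
    from R(3)[OF this] have "g1 z (h k z) : \<real>" unfolding g1_def e by simp
    then show ?case using Suc by (simp add: hSuc N_def L_def)
  qed
  have real_H: "H z : \<real>" if z: "z : ?P" "z = emb x" for z x
    by (rule closed_sequentially[OF closed_complex_Reals _ lim[OF z(1)]]) (use real_h[OF z] in auto)
  define eta where "eta x = Re (H (tr (emb x)))" for x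
  have deta: "dep S eta"
    by (rule depI) (simp add: eta_def tr_def emb_def cong: if_cong)
  have trP: "tr z : ?P \<longleftrightarrow> z : ?P" for z by (auto simp: tr_def poly_disc_def)
  have treal: "tr (emb x) = emb (%j. if j : S then x j else a j)" for x by (auto simp: tr_def emb_def)
  have Heta: "H (tr (emb x)) = of_real (eta x)" if "emb x : ?P" for x
    using real_H[OF _ treal] that trP by (simp add: eta_def)
  have raeta: "ra S eta a"
  proof (rule raI[OF fS deta, of ?P "%z. H (tr z)"])
    show "hol ?P (%z. H (tr z))"
    proof (rule hol_compose[OF hH])
      show "hol ?P (%z. tr z j)" for j using fS by (cases "j : S") (auto simp: tr_def)
    qed (use fS trP in auto)
  qed (use delta Heta in auto)
  have g1g: "g1 (tr (emb x)) (of_real t) = of_real (g (x(i := t)))" if x: "emb x : ?P" "dist t (a i) < rho'" for x t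
  proof -
    let ?y = "(%j. if j : S then x j else a j)(i := t)"
    have e: "(tr (tr (emb x)))(i := of_real t) = emb ?y" by (auto simp: tr_def emb_def)
    have "dist (complex_of_real t) A < rho'" using x(2) by (simp add: A_def emb_def dist_norm flip: of_real_diff)
    from trU[OF Prho this, of "tr (emb x)"] have "emb ?y : poly_disc ?T (emb a) R" unfolding e using subR x trP by blast
    from R(3)[OF this] have "g1 (tr (emb x)) (of_real t) = of_real (g ?y)" unfolding g1_def e by simp
    also have "g ?y = g (x(i := t))" by (rule depD[OF raD(2)[OF g]]) auto
    finally show ?thesis .
  qed
  have evP: "\<forall>\<^sub>F x in nhds a. emb x : ?P"
    unfolding emb_poly_disc
    using eventually_nhds_in_open[OF open_polybox[OF fS, of a delta], of a] delta(1) by simp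
  show ?thesis
  proof (rule that[OF raeta])
    have etaball: "dist (eta x) (a i) <= rho" if "emb x : ?P" for x
      using Hin[of "tr (emb x)"] trP that Heta[OF that] by (simp add: A_def emb_def dist_norm norm_minus_commute flip: of_real_diff)
    have Pa: "emb a : ?P" using delta by simp
    have "of_real (a i) = H (tr (emb a))"
    proof (rule uniq)
      show "tr (emb a) : ?P" using Pa trP by blast
      show "complex_of_real (a i) : cball A rho" using rho by (simp add: A_def emb_def)
      show "g1 (tr (emb a)) (of_real (a i)) = 0" using g1g[OF Pa, of "a i"] rho' g0 by simp
    qed
    then show "eta a = a i" using Heta[OF Pa] by simp
    show "\<forall>\<^sub>F x in nhds a. g (x(i := eta x)) = 0"
      using evP
    proof (rule eventually_mono)
      fix x assume x: "emb x : ?P"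
      have "g1 (tr (emb x)) (of_real (eta x)) = 0" using G0[of "tr (emb x)"] Heta[OF x] trP x by simp
      then show "g (x(i := eta x)) = 0" using g1g[OF x, of "eta x"] etaball[OF x] rho by simp
    qed
    have "open {x::nat=>real. ALL j:{i}. dist (x j) (a j) < rho}" by (rule open_polybox) simp
    then have "\<forall>\<^sub>F x in nhds a. x : {x. ALL j:{i}. dist (x j) (a j) < rho}"
      by (rule eventually_nhds_in_open) (use rho in auto)
    with evP show "\<forall>\<^sub>F x in nhds a. g x = 0 --> x i = eta x"
    proof (rule eventually_elim2, intro impI)
      fix x assume x: "emb x : ?P" "x : {x. ALL j:{i}. dist (x j) (a j) < rho}" and gx: "g x = 0"
      have "of_real (x i) = H (tr (emb x))"
      proof (rule uniq)
        show "tr (emb x) : ?P" using x trP by blast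
        show "complex_of_real (x i) : cball A rho" using x(2) by (simp add: A_def emb_def dist_norm norm_minus_commute flip: of_real_diff)
        show "g1 (tr (emb x)) (of_real (x i)) = 0" using g1g[OF x(1), of "x i"] x(2) rho gx by simp
      qed
      then show "x i = eta x" using Heta[OF x(1)] by simp
    qed
  qed
qed

lemma ra_dd_iter: "ra S f a ==> n : S ==> ra S ((dd n (a n) ^^ k) f) a"
  by (induction k) (auto intro: ra_dd)

lemma ra_pd_iter: "ra S f a ==> n : S ==> ra S ((pd n ^^ k) f) a"
  by (induction k) (auto intro: ra_pd)

lemma dd_taylor:
  "e x = (\<Sum>i<j. (x n - c) ^ i * ((dd n c ^^ i) e) (x(n := c))) + (x n - c) ^ j * ((dd n c ^^ j) e) x"
proof (induction j)
  case (Suc j)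
  have "((dd n c ^^ j) e) x = ((dd n c ^^ j) e) (x(n := c)) + (x n - c) * ((dd n c ^^ Suc j) e) x"
    using dd_expand[of "(dd n c ^^ j) e" x n c] by simp
  with Suc show ?case by (simp add: algebra_simps del: fun_upd_apply)
qed simp

lemma isCont_nhds: "isCont f a ==> filterlim f (nhds (f a)) (nhds a)"
  by (simp add: isCont_def tendsto_at_iff_tendsto_nhds)

lemma isCont_upd: "isCont (%t. (a::nat => real)(i := t)) s"
proof -
  have "continuous_on UNIV (%t. a(i := t))"
    by (rule continuous_on_coordinatewise_then_product, rename_tac j, case_tac "j = i") auto
  then show ?thesis by (simp add: continuous_on_eq_continuous_at)
qed

text \<open>If all Taylor coefficients up to j vanished, e would be (t - a n)^(j+1) times a
  continuous function on the line, and the quotient by (t - a n)^j would tend to 0 instead of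
  L.\<close>

lemma order_dd:
  assumes e: "ra S e a" "n : S" and L: "L ~= 0" "((%t. e (a(n := t)) / (t - a n) ^ j) \<longlongrightarrow> L) (at (a n))"
  shows "EX i<=j. (dd n (a n) ^^ i) e a ~= 0"
proof (rule ccontr)
  assume "\<not> ?thesis"
  then have z: "(dd n (a n) ^^ i) e a = 0" if "i <= j" for i using that by blast
  let ?k = "(dd n (a n) ^^ Suc j) e"
  have ex: "e (a(n := t)) = (t - a n) ^ Suc j * ?k (a(n := t))" for t
    using dd_taylor[of e "a(n := t)" n "a n" "Suc j"] z by simp
  have "isCont ?k a" using isCont_ra[OF ra_dd_iter[OF e]] .
  then have "isCont (%t. ?k (a(n := t))) (a n)"
    by (intro isCont_o2[OF isCont_upd]) simp
  then have "((%t. (t - a n) * ?k (a(n := t))) \<longlongrightarrow> (a n - a n) * ?k (a(n := a n))) (at (a n))"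
    unfolding isCont_def by (intro tendsto_intros)
  moreover have "\<forall>\<^sub>F t in at (a n). (t - a n) * ?k (a(n := t)) = e (a(n := t)) / (t - a n) ^ j"
    unfolding eventually_at_filter ex by (intro always_eventually) auto
  ultimately have "((%t. e (a(n := t)) / (t - a n) ^ j) \<longlongrightarrow> 0) (at (a n))"
    using tendsto_cong by fastforce
  with L show False using tendsto_unique[OF _ L(2)] by (metis trivial_limit_at)
qed

lemma pd_eqI: "((%t. f (y(n := t))) has_real_derivative D) (at (y n)) ==> pd n f y = D"
  unfolding pd_def by (rule DERIV_imp_deriv)

lemma eventually_nhds_upd:
  fixes x :: "nat => real"
  assumes "\<forall>\<^sub>F y in nhds x. P y"
  shows "\<forall>\<^sub>F y in nhds x. \<forall>\<^sub>F t in nhds (y n). P (y(n := t :: real))"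
proof -
  obtain V where V: "open V" "x : V" "\<And>y. y : V ==> P y" using assms unfolding eventually_nhds by blast
  have "\<forall>\<^sub>F t in nhds (y n). P (y(n := t))" if "y : V" for y
  proof -
    have "isCont (%t. y(n := t)) (y n)" by (rule isCont_upd)
    then have "filterlim (%t. y(n := t)) (nhds y) (nhds (y n))"
      using isCont_nhds by fastforce
    moreover have "\<forall>\<^sub>F z in nhds y. P z" using V that unfolding eventually_nhds by blast
    ultimately show ?thesis unfolding filterlim_iff by blast
  qed
  then show ?thesis using V unfolding eventually_nhds[of _ x] by blast
qed

lemma pd_cong:
  assumes "\<forall>\<^sub>F y in nhds x. f y = g y"
  shows "\<forall>\<^sub>F y in nhds x. pd n f y = pd n g y"
  using eventually_nhds_upd[OF assms, of n]
  by (rule eventually_mono) (simp add: pd_def deriv_cong_ev)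

text \<open>Links the two descriptions of a Taylor coefficient. Divided differences suit
  factorizations, but their node is fixed; derivatives commute with a shift of the coordinate
  (\<open>pd_shift\<close>), which the Tschirnhaus step needs.\<close>

lemma pd_dd:
  assumes "ra S e x" "n : S"
  shows "(pd n ^^ i) e x = fact i * (dd n (x n) ^^ i) e x"
  using assms(1)
proof (induction i arbitrary: e)
  case (Suc i)
  let ?c = "x n"
  define k where "k = dd n ?c e"
  have k: "ra S k x" unfolding k_def by (rule ra_dd[OF Suc.prems assms(2)])
  have ex: "e y = e (y(n := ?c)) + (y n - ?c) * k y" for y
    unfolding k_def by (rule dd_expand)
  \<comment> \<open>Leibniz's rule for the product (y n - x n) k. It is claimed on a neighbourhood
    of x so that it can be differentiated again; at y = x itself the first summand
    disappears.\<close>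
  have C: "\<forall>\<^sub>F y in nhds x. (pd n ^^ Suc i) e y = (y n - ?c) * (pd n ^^ Suc i) k y + Suc i * (pd n ^^ i) k y"
  proof (induction i)
    case 0
    show ?case using ra_eventually[OF k]
    proof (rule eventually_mono)
      fix y assume y: "ra S k y"
      have ee: "(%t. e (y(n := t))) = (%t. e (y(n := ?c)) + (t - ?c) * k (y(n := t)))"
      proof
        fix t show "e (y(n := t)) = e (y(n := ?c)) + (t - ?c) * k (y(n := t))"
          using ex[of "y(n := t)"] unfolding fun_upd_upd fun_upd_same .
      qed
      have "((%t. e (y(n := t))) has_real_derivative (y n - ?c) * pd n k y + k y) (at (y n))"
      proof -
        have "((%t. t - ?c) has_real_derivative 1) (at (y n))" by (auto intro!: derivative_eq_intros)
        from DERIV_add[OF DERIV_const[of "e (y(n := ?c))"] DERIV_mult[OF this has_real_derivative_pd[OF y assms(2)]]]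
        show ?thesis unfolding ee by (simp add: algebra_simps del: fun_upd_apply)
      qed
      from pd_eqI[OF this] show "(pd n ^^ Suc 0) e y = (y n - ?c) * (pd n ^^ Suc 0) k y + Suc 0 * (pd n ^^ 0) k y"
        by simp
    qed
  next
    case (Suc i)
    from pd_cong[OF Suc, of n] ra_eventually[OF ra_pd_iter[OF k assms(2), of i]]
      ra_eventually[OF ra_pd_iter[OF k assms(2), of "Suc i"]]
    show ?case
    proof eventually_elim
      case (elim y)
      let ?f = "%y. (y n - ?c) * (pd n ^^ Suc i) k y + real (Suc i) * (pd n ^^ i) k y"
      have d1: "((%t. (pd n ^^ Suc i) k (y(n := t))) has_real_derivative (pd n ^^ Suc (Suc i)) k y) (at (y n))"
        using has_real_derivative_pd[OF elim(3) assms(2)] by simp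
      have d2: "((%t. (pd n ^^ i) k (y(n := t))) has_real_derivative (pd n ^^ Suc i) k y) (at (y n))"
        using has_real_derivative_pd[OF elim(2) assms(2)] by simp
      have "((%t. ?f (y(n := t))) has_real_derivative
          ((y n - ?c) * (pd n ^^ Suc (Suc i)) k y + (pd n ^^ Suc i) k y + real (Suc i) * (pd n ^^ Suc i) k y)) (at (y n))"
      proof -
        have "((%t. t - ?c) has_real_derivative 1) (at (y n))" by (auto intro!: derivative_eq_intros)
        from DERIV_add[OF DERIV_mult[OF this d1] DERIV_cmult[OF d2, of "real (Suc i)"]]
        show ?thesis by (simp add: algebra_simps del: funpow.simps of_nat_Suc)
      qed
      from pd_eqI[OF this] have "pd n ?f y = (y n - ?c) * (pd n ^^ Suc (Suc i)) k y + real (Suc (Suc i)) * (pd n ^^ Suc i) k y"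
        by (simp del: funpow.simps add: algebra_simps)
      with elim(1) show ?case by simp
    qed
  qed
  have "(pd n ^^ Suc i) e x = Suc i * (pd n ^^ i) k x"
    using eventually_nhds_x_imp_x[OF C] by (simp del: funpow.simps)
  also have "\<dots> = Suc i * (fact i * (dd n ?c ^^ i) k x)" using Suc.IH[OF k] by simp
  also have "(dd n ?c ^^ i) k = (dd n ?c ^^ Suc i) e" unfolding k_def by (simp add: funpow_swap1)
  finally show ?case by simp
qed simp

lemma deriv_shift: "deriv (%t. h (t + c)) x = deriv h (x + c)"
  for h :: "real => real"
  unfolding deriv_def by (simp add: DERIV_shift)

lemma pd_shift:
  assumes "dep S eta" "n \<notin> S"
  shows "(pd n ^^ i) (%x. e (x(n := x n + eta x))) y = (pd n ^^ i) e (y(n := y n + eta y))"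
proof (induction i arbitrary: y)
  case (Suc i)
  have eta: "eta (y(n := t)) = eta y" for t by (rule depD[OF assms(1)]) (use assms(2) in auto)
  have "(pd n ^^ Suc i) (%x. e (x(n := x n + eta x))) y =
      deriv (%t. (pd n ^^ i) e (y(n := t + eta y))) (y n)"
  proof -
    have "pd n ((pd n ^^ i) (%x. e (x(n := x n + eta x)))) y =
       deriv (%t. (pd n ^^ i) e ((y(n := t))(n := (y(n := t)) n + eta (y(n := t))))) (y n)"
      unfolding pd_def[of n _ y] Suc ..
    then show ?thesis unfolding eta fun_upd_upd fun_upd_same by simp
  qed
  also have "\<dots> = (pd n ^^ Suc i) e (y(n := y n + eta y))"
    using deriv_shift[of "%s. (pd n ^^ i) e (y(n := s))" "eta y" "y n"] by (simp add: pd_def)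
  finally show ?case .
qed simp

section \<open>Monomialization\<close>

text \<open>Normal crossings at v: a monomial in the coordinates centred at v, times a unit.\<close>

definition monom_at :: "nat set => ((nat => real) => real) => (nat => real) => bool" where
  "monom_at S f v \<longleftrightarrow> (EX alpha::nat => nat. EX u. ra S u v & u v ~= 0 &
     (\<forall>\<^sub>F x in nhds v. f x = (\<Prod>i\<in>S. (x i - v i) ^ alpha i) * u x))"

lemma monom_at_cong: "monom_at S f v ==> \<forall>\<^sub>F x in nhds v. g x = f x ==> monom_at S g v"
  unfolding monom_at_def
proof (elim exE conjE, intro exI conjI)
  fix alpha :: "nat => nat" and u
  assume a: "\<forall>\<^sub>F x in nhds v. g x = f x" "\<forall>\<^sub>F x in nhds v. f x = (\<Prod>i\<in>S. (x i - v i) ^ alpha i) * u x"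
  show "\<forall>\<^sub>F x in nhds v. g x = (\<Prod>i\<in>S. (x i - v i) ^ alpha i) * u x"
    using a by eventually_elim simp
qed

lemma monom_at_unit: "ra S u v ==> u v ~= 0 ==> monom_at S u v"
  unfolding monom_at_def by (intro exI[of _ "%_. 0"] exI[of _ u]) auto

lemma monom_at_mult:
  assumes "monom_at S f v" "monom_at S g v" shows "monom_at S (%x. f x * g x) v"
proof -
  obtain alpha u where u: "ra S u v" "u v ~= 0" "\<forall>\<^sub>F x in nhds v. f x = (\<Prod>i\<in>S. (x i - v i) ^ alpha i) * u x"
    using assms(1) unfolding monom_at_def by blast
  obtain beta w where w: "ra S w v" "w v ~= 0" "\<forall>\<^sub>F x in nhds v. g x = (\<Prod>i\<in>S. (x i - v i) ^ beta i) * w x"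
    using assms(2) unfolding monom_at_def by blast
  have "\<forall>\<^sub>F x in nhds v. f x * g x = (\<Prod>i\<in>S. (x i - v i) ^ (alpha i + beta i)) * (u x * w x)"
    using u(3) w(3) by eventually_elim (simp add: power_add prod.distrib mult_ac)
  then show ?thesis unfolding monom_at_def using ra_mult[OF u(1) w(1)] u(2) w(2)
    by (intro exI[of _ "%i. alpha i + beta i"] exI[of _ "%x. u x * w x"]) auto
qed

lemma monom_at_coord:
  assumes "finite S" "i : S" shows "monom_at S (%x. x i - c) v"
proof (cases "v i = c")
  case True
  have "x i - c = (\<Prod>j\<in>S. (x j - v j) ^ (if j = i then 1 else 0))" for x
  proof -
    have "(\<Prod>j\<in>S. (x j - v j) ^ (if j = i then 1 else 0)) = (\<Prod>j\<in>S. if j = i then x j - v j else 1)"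
      by (rule prod.cong) auto
    then show ?thesis using assms True by simp
  qed
  then show ?thesis unfolding monom_at_def using assms
    by (intro exI[of _ "%j. if j = i then 1 else 0"] exI[of _ "%_. 1"]) auto
next
  case False
  then show ?thesis by (intro monom_at_unit ra_diff ra_proj ra_const assms) auto
qed

lemma monom_at_power: "finite S ==> monom_at S f v ==> monom_at S (%x. f x ^ k) v"
  by (induction k) (auto intro: monom_at_mult monom_at_unit)

lemma monom_at_prod: "finite S ==> (\<And>j. j : J ==> monom_at S (f j) v) ==> monom_at S (%x. \<Prod>j\<in>J. f j x) v"
  by (induction J rule: infinite_finite_induct) (auto intro: monom_at_mult monom_at_unit)

lemma monom_at_monomial: "finite S ==> J \<subseteq> S ==> monom_at S (%x. \<Prod>j\<in>J. x j ^ alpha j) v"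
  using monom_at_coord[of S _ 0 v] by (intro monom_at_prod monom_at_power) auto

text \<open>The coordinates are prime elements. On the hyperplane x i = v i of an occurring
  coordinate the product vanishes, so one of the two factors does (\<open>ra_mult_zero\<close>) and
  can be divided by x i - v i. The induction is on the degree of the monomial; in degree 0 both
  factors are units.\<close>

lemma monom_at_factor:
  assumes "monom_at S (%x. f x * g x) v" "ra S f v" "ra S g v"
  shows "monom_at S f v"
proof -
  obtain alpha u where u: "ra S u v" "u v ~= 0" "\<forall>\<^sub>F x in nhds v. f x * g x = (\<Prod>i\<in>S. (x i - v i) ^ alpha i) * u x"
    using assms(1) unfolding monom_at_def by blast
  have fS: "finite S" using raD(1)[OF u(1)] .
  have "monom_at S f v" if "(\<Sum>i\<in>S. alpha i) = m" for m
    using that assms(2,3) u(3)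
  proof (induction m arbitrary: alpha f g)
    case 0
    then have "alpha i = 0" if "i : S" for i using that fS by simp
    then have "\<forall>\<^sub>F x in nhds v. f x * g x = u x" using 0(4) by simp
    then have "f v * g v = u v" by (rule eventually_nhds_x_imp_x)
    then show ?case using u(2) 0(2) by (intro monom_at_unit) auto
  next
    case (Suc m)
    then obtain i where i: "i : S" "alpha i > 0" by (metis sum.neutral neq0_conv nat.distinct(1))
    define sl where "sl h x = h (x(i := v i))" for h :: "(nat => real) => real" and x
    have rasl: "ra S (sl h) v" if "ra S h v" for h
      unfolding sl_def
    proof (rule ra_compose[where Phi = "%x. x(i := v i)"])
      show "ra S h (v(i := v i))" using that by simp
      show "ra S (%x. (x(i := v i)) j) v" if "j : S" for j using that fS by (cases "j = i") auto
    qed (rule fS)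
    have tl: "filterlim (%x. x(i := v i)) (nhds v) (nhds v)"
    proof -
      have "continuous_on UNIV (%x::nat=>real. x(i := v i))"
        by (rule continuous_on_coordinatewise_then_product, rename_tac j, case_tac "j = i")
          (auto intro: continuous_on_product_then_coordinatewise continuous_on_id)
      then have "isCont (%x. x(i := v i)) v" by (simp add: continuous_on_eq_continuous_at)
      then show ?thesis using isCont_nhds by fastforce
    qed
    have "\<forall>\<^sub>F x in nhds v. f (x(i := v i)) * g (x(i := v i)) = (\<Prod>j\<in>S. ((x(i := v i)) j - v j) ^ alpha j) * u (x(i := v i))"
      using Suc.prems(4) tl unfolding filterlim_iff by blast
    moreover have "(\<Prod>j\<in>S. ((x(i := v i)) j - v j) ^ alpha j) = 0" for x
      using i fS by (intro prod_zero bexI[of _ i]) auto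
    ultimately have "\<forall>\<^sub>F x in nhds v. sl f x * sl g x = 0" by (simp add: sl_def)
    from ra_mult_zero[OF rasl[OF Suc.prems(2)] rasl[OF Suc.prems(3)] this]
    have disj: "(\<forall>\<^sub>F x in nhds v. sl f x = 0) \<or> (\<forall>\<^sub>F x in nhds v. sl g x = 0)" .
    define beta where "beta = alpha(i := alpha i - 1)"
    have betasum: "(\<Sum>j\<in>S. beta j) = m"
    proof -
      have "(\<Sum>j\<in>S. alpha j) = alpha i + (\<Sum>j\<in>S-{i}. alpha j)" "(\<Sum>j\<in>S. beta j) = beta i + (\<Sum>j\<in>S-{i}. beta j)"
        using fS i by (auto simp: sum.remove)
      moreover have "(\<Sum>j\<in>S-{i}. beta j) = (\<Sum>j\<in>S-{i}. alpha j)" by (rule sum.cong) (auto simp: beta_def)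
      ultimately show ?thesis using Suc.prems(1) i(2) by (simp add: beta_def)
    qed
    have pr: "(\<Prod>j\<in>S. (x j - v j) ^ alpha j) = (x i - v i) * (\<Prod>j\<in>S. (x j - v j) ^ beta j)" for x
    proof -
      have "(\<Prod>j\<in>S. (x j - v j) ^ alpha j) = (x i - v i) ^ alpha i * (\<Prod>j\<in>S-{i}. (x j - v j) ^ alpha j)"
        "(\<Prod>j\<in>S. (x j - v j) ^ beta j) = (x i - v i) ^ beta i * (\<Prod>j\<in>S-{i}. (x j - v j) ^ beta j)"
        using fS i by (auto simp: prod.remove)
      moreover have "(\<Prod>j\<in>S-{i}. (x j - v j) ^ beta j) = (\<Prod>j\<in>S-{i}. (x j - v j) ^ alpha j)" by (rule prod.cong) (auto simp: beta_def)
      moreover have "(x i - v i) ^ alpha i = (x i - v i) * (x i - v i) ^ (alpha i - 1)"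
        using i(2) by (metis Suc_diff_1 power_Suc)
      ultimately show ?thesis by (simp add: beta_def)
    qed
    have div: "\<forall>\<^sub>F x in nhds v. h x = (x i - v i) * dd i (v i) h x" if "\<forall>\<^sub>F x in nhds v. sl h x = 0" for h
      using that
    proof (rule eventually_mono)
      fix x assume "sl h x = 0"
      then show "h x = (x i - v i) * dd i (v i) h x" using dd_expand[of h x i "v i"] unfolding sl_def by simp
    qed
    have canc: "\<forall>\<^sub>F x in nhds v. p x = q x" if "\<forall>\<^sub>F x in nhds v. (x i - v i) * p x = (x i - v i) * q x" "ra S p v" "ra S q v" for p q
    proof -
      have "\<forall>\<^sub>F x in nhds v. (x i - v i) * (p x - q x) = 0" using that(1) by (rule eventually_mono) (simp add: algebra_simps)
      then have "(\<forall>\<^sub>F x in nhds v. x i - v i = 0) \<or> (\<forall>\<^sub>F x in nhds v. p x - q x = 0)"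
        by (intro ra_mult_zero[of S] ra_diff that ra_proj ra_const fS i)
      moreover have "\<not> (\<forall>\<^sub>F x in nhds v. x i - v i = 0)"
      proof
        assume "\<forall>\<^sub>F x in nhds v. x i - v i = 0"
        then obtain V where V: "open V" "v : V" "\<And>x. x : V ==> x i - v i = 0" unfolding eventually_nhds by blast
        obtain r where r: "r > 0" "\<And>x. (ALL j:S. dist (x j) (v j) < r) ==> (ALL j. j \<notin> S --> x j = v j) ==> x : V"
          using open_fun_box[OF V(1,2) fS] by blast
        have "v(i := v i + r/2) : V" by (rule r(2)) (use r i in \<open>auto simp: dist_real_def\<close>)
        from V(3)[OF this] r(1) show False by simp
      qed
      ultimately show ?thesis by (auto elim: eventually_mono)
    qed
    have raR: "ra S (%x. (\<Prod>j\<in>S. (x j - v j) ^ beta j) * u x) v"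
      using fS u(1) by (intro ra_mult ra_prod ra_power ra_diff) auto
    from disj show ?case
    proof
      assume f0: "\<forall>\<^sub>F x in nhds v. sl f x = 0"
      let ?f = "dd i (v i) f"
      have raf: "ra S ?f v" by (rule ra_dd[OF Suc.prems(2) i(1)])
      have "\<forall>\<^sub>F x in nhds v. (x i - v i) * (?f x * g x) = (x i - v i) * ((\<Prod>j\<in>S. (x j - v j) ^ beta j) * u x)"
        using div[OF f0] Suc.prems(4) by eventually_elim (simp add: pr mult_ac)
      from canc[OF this ra_mult[OF raf Suc.prems(3)] raR]
      have "monom_at S ?f v" using Suc.IH[OF betasum raf Suc.prems(3)] by blast
      then have "monom_at S (%x. (x i - v i) * ?f x) v" using monom_at_coord[OF fS i(1)] monom_at_mult by blast
      then show ?case by (rule monom_at_cong) (rule div[OF f0])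
    next
      assume g0: "\<forall>\<^sub>F x in nhds v. sl g x = 0"
      let ?g = "dd i (v i) g"
      have rag: "ra S ?g v" by (rule ra_dd[OF Suc.prems(3) i(1)])
      have "\<forall>\<^sub>F x in nhds v. (x i - v i) * (f x * ?g x) = (x i - v i) * ((\<Prod>j\<in>S. (x j - v j) ^ beta j) * u x)"
        using div[OF g0] Suc.prems(4) by eventually_elim (simp add: pr mult_ac)
      from canc[OF this ra_mult[OF Suc.prems(2) rag] raR]
      show ?case using Suc.IH[OF betasum Suc.prems(2) rag] by blast
    qed
  qed
  then show ?thesis by blast
qed

lemma monom_at_prod_factor:
  assumes "monom_at S (%x. \<Prod>j\<in>J. f j x) v" "finite J" "\<And>j. j : J ==> ra S (f j) v" "k : J"
  shows "monom_at S (f k) v"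
proof (rule monom_at_factor[of S _ "%x. \<Prod>j\<in>J-{k}. f j x"])
  show "monom_at S (%x. f k x * (\<Prod>j\<in>J-{k}. f j x)) v"
    by (rule monom_at_cong[OF assms(1)]) (simp add: prod.remove[OF assms(2,4)])
  show "ra S (f k) v" "ra S (%x. \<Prod>j\<in>J-{k}. f j x) v"
    using assms(3,4) raD(1)[OF assms(3)[OF assms(4)]] by (auto intro!: ra_prod)
qed

section \<open>Analytic charts on cubes\<close>

definition rn :: "nat set => (nat => real) => bool" where
  "rn S x \<longleftrightarrow> (ALL i. i \<notin> S --> x i = 0)"

definition cube :: "nat set => (nat => real) set" where
  "cube S = {v. (ALL i:S. \<bar>v i\<bar> <= 1) & rn S v}"

lemma compact_fun_box:
  fixes l u :: "nat => real"
  shows "compact {x. ALL i. l i <= x i & x i <= u i}"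
proof -
  have "compactin (product_topology (%i. euclidean) UNIV) (\<Pi>\<^sub>E i\<in>UNIV. {l i..u i})"
    by (simp add: compactin_PiE)
  moreover have "(\<Pi>\<^sub>E i\<in>UNIV. {l i..u i}) = {x. ALL i. l i <= x i & x i <= u i}"
    by (auto simp: PiE_iff)
  ultimately show ?thesis by (simp add: euclidean_product_topology)
qed

lemma compact_cube: "compact (cube S)"
proof -
  have "cube S = {x. ALL i. (if i : S then -1 else 0) <= x i & x i <= (if i : S then 1 else 0)}"
    unfolding cube_def rn_def by (auto simp: abs_le_iff) (metis add.inverse_inverse neg_le_iff_le eq_iff)+
  then show ?thesis using compact_fun_box by simp
qed

text \<open>Normal crossings are demanded at each point of the compact cube, centred at that point,
  so that later constructions can start afresh anywhere on the cube.\<close>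

definition chart :: "nat set => ((nat => real) => real) => (nat => real) set => ((nat => real) => nat => real) => bool" where
  "chart S f W psi \<longleftrightarrow> (ALL v:cube S. (ALL i:S. ra S (%x. psi x i) v) & psi v : W & monom_at S (%x. f (psi x)) v) & (ALL x. rn S (psi x))"

text \<open>Of a composite of blow-ups only this is kept: finitely many charts into a given
  neighbourhood W, whose images cover all points of R^S near a. Charts may fail to be injective,
  which leaves room for power substitutions and for blow-downs.\<close>

definition monable :: "nat set => ((nat => real) => real) => (nat => real) => bool" where
  "monable S f a \<longleftrightarrow> (ALL W. open W & a : W --> (EX Psi. finite Psi & (ALL psi:Psi. chart S f W psi) &
     (\<forall>\<^sub>F x in nhds a. rn S x --> (EX psi:Psi. x : psi ` cube S))))"

lemma ra_map_nbhd:
  assumes "finite S" "\<And>i. i : S ==> ra T (%x. theta x i) b" "\<And>x. rn S (theta x)" "open W" "theta b : W"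
  obtains V where "open V" "b : V" "\<And>x. x : V ==> theta x : W" "\<And>x i. x : V ==> i : S ==> ra T (%x. theta x i) x"
    "continuous_on V theta"
proof -
  have "\<forall>\<^sub>F x in nhds b. ALL i:S. ra T (%x. theta x i) x"
    using assms(1,2) by (auto intro!: eventually_ball_finite ra_eventually)
  then obtain V where V: "open V" "b : V" "\<And>x i. x : V ==> i : S ==> ra T (%x. theta x i) x"
    unfolding eventually_nhds by blast
  have c: "continuous_on V theta"
  proof (rule continuous_on_coordinatewise_then_product)
    fix i show "continuous_on V (%x. theta x i)"
    proof (cases "i : S")
      case True then show ?thesis using V isCont_ra by (metis continuous_at_imp_continuous_on)
    next
      case False then show ?thesis using assms(3) by (simp add: rn_def)
    qed
  qed
  show ?thesis
  proof (rule that[of "V \<inter> theta -` W"])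
    show "open (V \<inter> theta -` W)" by (rule continuous_open_preimage[OF c V(1) assms(4)])
    show "continuous_on (V \<inter> theta -` W) theta" using c by (rule continuous_on_subset) auto
  qed (use V assms in auto)
qed

lemma bchoice2: "ALL b:K. EX x y. P b x y ==> EX f g. ALL b:K. P b (f b) (g b)"
  by metis

text \<open>Charts need only be controlled along the compact sets K: each b in K carries its own finite
  family of monomializing charts on a neighbourhood.\<close>

lemma monable_trans:
  assumes fS: "finite S" and main: "\<And>W. open W ==> a : W ==> EX Theta. finite Theta &
     (ALL p:Theta. compact (snd p) & (ALL x. rn S (fst p x)) &
        (ALL b:snd p. (ALL i:S. ra S (%x. fst p x i) b) & fst p b : W & monable S (%x. f (fst p x)) b)) &
     (ALL N. (ALL p:Theta. open (N p) & snd p \<subseteq> N p) -->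
        (\<forall>\<^sub>F x in nhds a. rn S x --> (EX p:Theta. EX v:N p. rn S v & x = fst p v)))"
  shows "monable S f a"
  unfolding monable_def
proof (intro allI impI, elim conjE)
  fix W assume W: "open W" "a : W"
  from main[OF W] obtain Theta where Theta1: "finite Theta"
     and Theta2: "ALL p:Theta. compact (snd p) & (ALL x. rn S (fst p x)) &
        (ALL b:snd p. (ALL i:S. ra S (%x. fst p x i) b) & fst p b : W & monable S (%x. f (fst p x)) b)"
     and Theta3: "ALL N. (ALL p:Theta. open (N p) & snd p \<subseteq> N p) -->
        (\<forall>\<^sub>F x in nhds a. rn S x --> (EX p:Theta. EX v:N p. rn S v & x = fst p v))"
    by (elim exE conjE)
  have "ALL p:Theta. EX N Psi. open N & snd p \<subseteq> N & finite Psi & (ALL psi:Psi. chart S f W (%x. fst p (psi x))) &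
      (ALL x:N. rn S x --> (EX psi:Psi. x : psi ` cube S))"
  proof
    fix p assume p: "p : Theta"
    define theta K where "theta = fst p" and "K = snd p"
    have t1: "compact K" and t2: "\<And>x. rn S (theta x)" and t3: "\<And>b i. b : K ==> i : S ==> ra S (%x. theta x i) b"
      and t4: "\<And>b. b : K ==> theta b : W" and t5: "\<And>b. b : K ==> monable S (%x. f (theta x)) b"
      using Theta2 p unfolding theta_def K_def by auto
    have "ALL b:K. EX N Psi. open N & b : N & finite Psi & (ALL psi:Psi. chart S f W (%x. theta (psi x))) &
      (ALL x:N. rn S x --> (EX psi:Psi. x : psi ` cube S))"
    proof
      fix b assume b: "b : K"
      obtain V where V: "open V" "b : V" "\<And>x. x : V ==> theta x : W" "\<And>x i. x : V ==> i : S ==> ra S (%x. theta x i) x"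
        using ra_map_nbhd[OF fS t3[OF b] t2 W(1) t4[OF b]] by metis
      have "EX Psi. finite Psi & (ALL psi:Psi. chart S (%x. f (theta x)) V psi) & (\<forall>\<^sub>F x in nhds b. rn S x --> (EX psi:Psi. x : psi ` cube S))"
        using t5[OF b] V(1,2) unfolding monable_def by simp
      then obtain Psi where Psi: "finite Psi" "ALL psi:Psi. chart S (%x. f (theta x)) V psi"
        "\<forall>\<^sub>F x in nhds b. rn S x --> (EX psi:Psi. x : psi ` cube S)" by (elim exE conjE)
      obtain N where N: "open N" "b : N" "ALL x:N. rn S x --> (EX psi:Psi. x : psi ` cube S)"
        using Psi(3) unfolding eventually_nhds by (elim exE conjE)
      have "chart S f W (%x. theta (psi x))" if "psi : Psi" for psi
      proof -
        have "chart S (%x. f (theta x)) V psi" using Psi(2) that by simp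
        then have c: "\<And>v i. v : cube S ==> i : S ==> ra S (%x. psi x i) v" "\<And>v. v : cube S ==> psi v : V"
          "\<And>v. v : cube S ==> monom_at S (%x. f (theta (psi x))) v"
          unfolding chart_def by auto
        show ?thesis unfolding chart_def
        proof (intro conjI ballI allI)
          fix v assume v: "v : cube S"
          show "ra S (%x. theta (psi x) i) v" if i: "i : S" for i
            by (rule ra_compose[where f = "%x. theta x i" and S = S and Phi = psi, OF V(4)[OF c(2)[OF v] i] fS c(1)[OF v]])
          show "theta (psi v) : W" by (rule V(3)[OF c(2)[OF v]])
          show "monom_at S (%x. f (theta (psi x))) v" by (rule c(3)[OF v])
        qed (rule t2)
      qed
      then show "EX N Psi. open N & b : N & finite Psi & (ALL psi:Psi. chart S f W (%x. theta (psi x))) &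
          (ALL x:N. rn S x --> (EX psi:Psi. x : psi ` cube S))"
        using N Psi(1) by (intro exI[of _ N] exI[of _ Psi]) simp
    qed
    from bchoice2[OF this] obtain N Psi where NPP: "ALL b:K. open (N b) & b : N b & finite (Psi b) & (ALL psi:Psi b. chart S f W (%x. theta (psi x))) &
      (ALL x:N b. rn S x --> (EX psi:Psi b. x : psi ` cube S))" by (elim exE)
    have NP: "\<And>b. b : K ==> open (N b)" "\<And>b. b : K ==> b : N b" "\<And>b. b : K ==> finite (Psi b)"
      "\<And>b psi. b : K ==> psi:Psi b ==> chart S f W (%x. theta (psi x))"
      "\<And>b x. b : K ==> x:N b ==> rn S x ==> (EX psi:Psi b. x : psi ` cube S)" using NPP by simp_all
    obtain C where C: "C \<subseteq> K" "finite C" "K \<subseteq> (\<Union>b\<in>C. N b)"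
      by (rule compactE_image[OF t1, where C = K and f = N]) (use NP(1,2) in auto)
    show "EX N Psi. open N & snd p \<subseteq> N & finite Psi & (ALL psi:Psi. chart S f W (%x. fst p (psi x))) &
      (ALL x:N. rn S x --> (EX psi:Psi. x : psi ` cube S))" unfolding theta_def[symmetric] K_def[symmetric]
    proof (intro exI[of _ "\<Union>b\<in>C. N b"] exI[of _ "\<Union>b\<in>C. Psi b"] conjI ballI impI)
      show "open (\<Union>b\<in>C. N b)" using NP(1) C(1) by blast
      show "K \<subseteq> (\<Union>b\<in>C. N b)" by (rule C(3))
      show "finite (\<Union>b\<in>C. Psi b)" using C NP(3) by blast
      show "chart S f W (%x. theta (psi x))" if "psi : (\<Union>b\<in>C. Psi b)" for psi using that NP(4) C(1) by blast
      show "EX psi:\<Union>b\<in>C. Psi b. x : psi ` cube S" if "x : (\<Union>b\<in>C. N b)" "rn S x" for x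
        using that NP(5) C(1) by blast
    qed
  qed
  from bchoice2[OF this] obtain N Psi where NPP: "ALL p:Theta. open (N p) & snd p \<subseteq> N p & finite (Psi p) & (ALL psi:Psi p. chart S f W (%x. fst p (psi x))) &
      (ALL x:N p. rn S x --> (EX psi:Psi p. x : psi ` cube S))" by (elim exE)
  have NP: "\<And>p. p : Theta ==> open (N p) & snd p \<subseteq> N p" "\<And>p. p : Theta ==> finite (Psi p)"
     "\<And>p psi. p : Theta ==> psi:Psi p ==> chart S f W (%x. fst p (psi x))"
     "\<And>p x. p : Theta ==> x:N p ==> rn S x ==> (EX psi:Psi p. x : psi ` cube S)" using NPP by simp_all
  define Omega where "Omega = (\<Union>p\<in>Theta. (%psi x. fst p (psi x)) ` Psi p)"
  have "\<forall>\<^sub>F x in nhds a. rn S x --> (EX p:Theta. EX v:N p. rn S v & x = fst p v)"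
    using Theta3 NP(1) by simp
  then have "\<forall>\<^sub>F x in nhds a. rn S x --> (EX psi:Omega. x : psi ` cube S)"
  proof (rule eventually_mono, intro impI)
    fix x assume x: "rn S x --> (EX p:Theta. EX v:N p. rn S v & x = fst p v)" "rn S x"
    then obtain p v where v: "p : Theta" "v : N p" "rn S v" "x = fst p v" by auto
    obtain psi where "psi : Psi p" "v : psi ` cube S" using NP(4)[OF v(1-3)] by blast
    then obtain w where w: "psi : Psi p" "w : cube S" "v = psi w" by blast
    show "EX psi:Omega. x : psi ` cube S"
    proof (rule bexI[of _ "%x. fst p (psi x)"])
      show "x : (%x. fst p (psi x)) ` cube S" using v w by blast
      show "(%x. fst p (psi x)) : Omega" unfolding Omega_def using v w by blast
    qed
  qed
  moreover have "finite Omega" unfolding Omega_def using Theta1 NP(2) by blast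
  moreover have "ALL psi:Omega. chart S f W psi" unfolding Omega_def using NP(3) by blast
  ultimately show "EX Psi. finite Psi & (ALL psi:Psi. chart S f W psi) & (\<forall>\<^sub>F x in nhds a. rn S x --> (EX psi:Psi. x : psi ` cube S))"
    by blast
qed

text \<open>One affine chart onto a small box about b is enough. At a point v of the cube with v i
  ~= 0 the factor x i turns into a unit; \<open>monom_at_coord\<close> covers both cases.\<close>

lemma monable_mono:
  assumes fS: "finite S" and b: "rn S b" and m: "monom_at S f b"
  shows "monable S f b"
  unfolding monable_def
proof (intro allI impI, elim conjE)
  fix W assume W: "open W" "b : W"
  obtain alpha u where u: "ra S u b" "u b ~= 0" "\<forall>\<^sub>F x in nhds b. f x = (\<Prod>i\<in>S. (x i - b i) ^ alpha i) * u x"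
    using m unfolding monom_at_def by blast
  have "\<forall>\<^sub>F x in nhds b. u x ~= 0"
    using isCont_ra[OF u(1)] u(2) by (simp add: isCont_def tendsto_at_iff_tendsto_nhds tendsto_imp_eventually_ne)
  moreover have "\<forall>\<^sub>F x in nhds b. x : W" using W eventually_nhds_in_open by blast
  ultimately have "\<forall>\<^sub>F x in nhds b. u x ~= 0 & x : W & ra S u x & f x = (\<Prod>i\<in>S. (x i - b i) ^ alpha i) * u x"
    using ra_eventually[OF u(1)] u(3) by eventually_elim blast
  then obtain V where V: "open V" "b : V" "\<And>x. x : V ==> u x ~= 0 & x : W & ra S u x & f x = (\<Prod>i\<in>S. (x i - b i) ^ alpha i) * u x"
    unfolding eventually_nhds by blast
  obtain r where r: "r > 0" "\<And>x. (ALL i:S. dist (x i) (b i) < r) ==> (ALL i. i \<notin> S --> x i = b i) ==> x : V"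
    using open_fun_box[OF V(1,2) fS] by blast
  define epsilon where "epsilon = r/2"
  define psi where "psi x = (%i. if i : S then b i + epsilon * x i else 0)" for x :: "nat => real"
  have epsilon: "epsilon > 0" "epsilon < r" using r by (auto simp: epsilon_def)
  have psiV: "psi v : V" if "v : cube S" for v
  proof (rule r(2))
    show "ALL i:S. dist (psi v i) (b i) < r"
    proof
      fix i assume "i : S"
      then have "epsilon * \<bar>v i\<bar> <= epsilon" using that epsilon by (auto simp: cube_def mult_left_le)
      then have "epsilon * \<bar>v i\<bar> < r" using epsilon by linarith
      then show "dist (psi v i) (b i) < r" using \<open>i : S\<close> epsilon by (simp add: psi_def dist_real_def abs_mult)
    qed
  qed (use b in \<open>auto simp: psi_def rn_def\<close>)
  have rapsi: "ra S (%x. psi x i) v" if "i : S" for i v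
    using that fS by (simp add: psi_def) (intro ra_add ra_mult ra_const ra_proj)
  have rnpsi: "rn S (psi x)" for x by (auto simp: psi_def rn_def)
  have "chart S f W psi"
    unfolding chart_def
  proof (intro conjI ballI allI)
    fix v assume v: "v : cube S"
    show "psi v : W" using V(3)[OF psiV[OF v]] by blast
    obtain V' where V': "open V'" "v : V'" "\<And>x. x : V' ==> psi x : V"
      using ra_map_nbhd[OF fS rapsi rnpsi V(1) psiV[OF v]] by metis
    have ev: "\<forall>\<^sub>F x in nhds v. f (psi x) = (\<Prod>i\<in>S. epsilon ^ alpha i * (x i - 0) ^ alpha i) * u (psi x)"
    proof -
      have "\<forall>\<^sub>F x in nhds v. x : V'" using V' eventually_nhds_in_open by blast
      then show ?thesis
      proof (rule eventually_mono)
        fix x assume "x : V'"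
        then have "f (psi x) = (\<Prod>i\<in>S. (psi x i - b i) ^ alpha i) * u (psi x)" using V V' by blast
        then show "f (psi x) = (\<Prod>i\<in>S. epsilon ^ alpha i * (x i - 0) ^ alpha i) * u (psi x)"
          by (simp add: psi_def power_mult_distrib)
      qed
    qed
    have "monom_at S (%x. (\<Prod>i\<in>S. epsilon ^ alpha i * (x i - 0) ^ alpha i) * u (psi x)) v"
    proof (rule monom_at_mult)
      show "monom_at S (%x. \<Prod>i\<in>S. epsilon ^ alpha i * (x i - 0) ^ alpha i) v"
        by (intro monom_at_prod monom_at_mult monom_at_power monom_at_coord monom_at_unit fS) (use epsilon fS in auto)
      show "monom_at S (%x. u (psi x)) v"
        by (rule monom_at_unit[OF ra_compose[where S = S]]) (use V(3)[OF psiV[OF v]] rapsi fS in auto)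
    qed
    then show "monom_at S (%x. f (psi x)) v" using ev by (rule monom_at_cong)
  qed (use rapsi rnpsi in auto)
  moreover have "\<forall>\<^sub>F x in nhds b. rn S x --> (EX psi':{psi}. x : psi' ` cube S)"
  proof -
    have "\<forall>\<^sub>F x in nhds b. x : {x. ALL i:S. dist (x i) (b i) < epsilon}"
      by (rule eventually_nhds_in_open[OF open_polybox[OF fS]]) (use epsilon in auto)
    then show ?thesis
    proof (rule eventually_mono, intro impI)
      fix x assume x: "x : {x. ALL i:S. dist (x i) (b i) < epsilon}" "rn S x"
      define v where "v = (%i. if i : S then (x i - b i) / epsilon else 0)"
      have "v : cube S" using x epsilon by (auto simp: cube_def rn_def v_def dist_real_def less_imp_le)
      moreover have "psi v = x" using x epsilon by (auto simp: psi_def v_def rn_def)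
      ultimately show "EX psi':{psi}. x : psi' ` cube S" by blast
    qed
  qed
  ultimately show "EX Psi. finite Psi & (ALL psi:Psi. chart S f W psi) & (\<forall>\<^sub>F x in nhds b. rn S x --> (EX psi:Psi. x : psi ` cube S))"
    by (intro exI[of _ "{psi}"]) auto
qed

section \<open>Comparability of monomial exponents\<close>

lemma zero_if_le_mult:
  fixes c :: real
  assumes "r > 0" "\<And>s. 0 < s ==> s < r ==> c <= K * s"
  shows "c <= 0"
proof (rule tendsto_lowerbound)
  show "((%s. K * s) \<longlongrightarrow> 0) (at_right 0)" by (auto intro!: tendsto_eq_intros)
  show "\<forall>\<^sub>F s in at_right 0. c <= K * s"
    using assms unfolding eventually_at_right_field by auto
qed simp

lemma power_le_self_real: "0 <= s ==> s <= 1 ==> 0 < p ==> s ^ p <= (s::real)"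
  using power_decreasing[of 1 p s] by simp

text \<open>A term of strictly smallest order in s whose coefficient stays away from 0 cannot be
  balanced by the two others: after division by s^a the right-hand side is at most 2 B s.\<close>

lemma two_monomials_aux:
  fixes U W Z :: "real => real"
  assumes r: "0 < r" "r <= 1" and m: "m > 0"
    and b: "\<And>s. 0 < s ==> s < r ==> m <= \<bar>U s\<bar>" "\<And>s. 0 < s ==> s < r ==> \<bar>W s\<bar> <= B" "\<And>s. 0 < s ==> s < r ==> \<bar>Z s\<bar> <= B"
    and eq: "\<And>s. 0 < s ==> s < r ==> s ^ a * U s = s ^ c * W s + s ^ e * Z s"
    and ac: "a < c" "a < e"
  shows False
proof -
  have "m <= 0"
  proof (rule zero_if_le_mult[OF r(1)])
    fix s :: real assume s: "0 < s" "s < r"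
    have "s ^ c = s ^ a * s ^ (c - a)" "s ^ e = s ^ a * s ^ (e - a)"
      using ac by (auto simp flip: power_add)
    with eq[OF s] have "s ^ a * U s = s ^ a * (s ^ (c-a) * W s + s ^ (e-a) * Z s)" by (simp add: algebra_simps)
    then have "U s = s ^ (c-a) * W s + s ^ (e-a) * Z s" using s by simp
    then have "\<bar>U s\<bar> <= s ^ (c-a) * \<bar>W s\<bar> + s ^ (e-a) * \<bar>Z s\<bar>"
      using abs_triangle_ineq[of "s ^ (c-a) * W s" "s ^ (e-a) * Z s"] s by (simp add: abs_mult)
    also have "\<dots> <= s * B + s * B"
      using s r ac b(2,3)[OF s] by (intro add_mono mult_mono power_le_self_real) auto
    finally show "m <= (2 * B) * s" using b(1)[OF s] by (simp add: algebra_simps)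
  qed
  with m show False by simp
qed

text \<open>Suppose alpha i < beta i and beta k < alpha k. Freeze the other coordinates and let the
  i-th and the k-th differ from v by s and t. If z vanishes, s -> 0 is already contradictory.
  Otherwise s -> 0 forces gamma i = alpha i and t -> 0 forces gamma k = beta k; on the diagonal s =
  t the right-hand side then has order alpha i + beta k, less than the order of either term on the
  left.\<close>

lemma monomials_comparable:
  fixes alpha beta gamma :: "nat => nat"
  assumes fS: "finite S" and u: "ra S u v" "u v ~= 0" and w: "ra S w v" "w v ~= 0" and z: "ra S z v"
    and ev: "\<forall>\<^sub>F x in nhds v. (\<Prod>i\<in>S. (x i - v i) ^ alpha i) * u x - (\<Prod>i\<in>S. (x i - v i) ^ beta i) * w x = (\<Prod>i\<in>S. (x i - v i) ^ gamma i) * z x"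
    and dis: "z v ~= 0 \<or> (\<forall>\<^sub>F x in nhds v. z x = 0)"
  shows "(ALL i:S. alpha i <= beta i) \<or> (ALL i:S. beta i <= alpha i)"
proof (rule ccontr)
  assume "\<not> ?thesis"
  then obtain i k where ik: "i : S" "k : S" "alpha i < beta i" "beta k < alpha k" by (meson not_le)
  have ne: "i ~= k" using ik by auto
  have unit: "\<forall>\<^sub>F x in nhds v. \<bar>h v\<bar>/2 <= \<bar>h x\<bar> & \<bar>h x\<bar> <= \<bar>h v\<bar> + 1" if "ra S h v" for h
  proof -
    have "((%x. \<bar>h x\<bar>) \<longlongrightarrow> \<bar>h v\<bar>) (nhds v)"
      using isCont_nhds[OF isCont_ra[OF that]] by (rule tendsto_rabs)
    then have 1: "\<forall>\<^sub>F x in nhds v. \<bar>h x\<bar> < \<bar>h v\<bar> + 1" and 2: "h v ~= 0 ==> \<forall>\<^sub>F x in nhds v. \<bar>h v\<bar>/2 < \<bar>h x\<bar>"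
      using order_tendstoD(2)[of "%x. \<bar>h x\<bar>" "\<bar>h v\<bar>" "nhds v" "\<bar>h v\<bar> + 1"]
        order_tendstoD(1)[of "%x. \<bar>h x\<bar>" "\<bar>h v\<bar>" "nhds v" "\<bar>h v\<bar>/2"] by auto
    show ?thesis
    proof (cases "h v = 0")
      case True then show ?thesis using 1 by (auto elim: eventually_mono)
    next
      case False
      show ?thesis using 1 2[OF False] by eventually_elim linarith
    qed
  qed
  have zz: "\<forall>\<^sub>F x in nhds v. z v = 0 --> z x = 0"
    using dis by (auto elim: eventually_mono)
  have "\<forall>\<^sub>F x in nhds v. (\<bar>u v\<bar>/2 <= \<bar>u x\<bar> & \<bar>u x\<bar> <= \<bar>u v\<bar> + 1) & (\<bar>w v\<bar>/2 <= \<bar>w x\<bar> & \<bar>w x\<bar> <= \<bar>w v\<bar> + 1) &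
     (\<bar>z v\<bar>/2 <= \<bar>z x\<bar> & \<bar>z x\<bar> <= \<bar>z v\<bar> + 1) & (z v = 0 --> z x = 0) &
     (\<Prod>i\<in>S. (x i - v i) ^ alpha i) * u x - (\<Prod>i\<in>S. (x i - v i) ^ beta i) * w x = (\<Prod>i\<in>S. (x i - v i) ^ gamma i) * z x"
    using unit[OF u(1)] unit[OF w(1)] unit[OF z] zz ev by eventually_elim blast
  then obtain V where V: "open V" "v : V" "\<And>x. x : V ==> (\<bar>u v\<bar>/2 <= \<bar>u x\<bar> & \<bar>u x\<bar> <= \<bar>u v\<bar> + 1) & (\<bar>w v\<bar>/2 <= \<bar>w x\<bar> & \<bar>w x\<bar> <= \<bar>w v\<bar> + 1) &
     (\<bar>z v\<bar>/2 <= \<bar>z x\<bar> & \<bar>z x\<bar> <= \<bar>z v\<bar> + 1) & (z v = 0 --> z x = 0) &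
     (\<Prod>i\<in>S. (x i - v i) ^ alpha i) * u x - (\<Prod>i\<in>S. (x i - v i) ^ beta i) * w x = (\<Prod>i\<in>S. (x i - v i) ^ gamma i) * z x"
    unfolding eventually_nhds by blast
  obtain r0 where r0: "r0 > 0" "\<And>x. (ALL j:S. dist (x j) (v j) < r0) ==> (ALL j. j \<notin> S --> x j = v j) ==> x : V"
    using open_fun_box[OF V(1,2) fS] by blast
  define r where "r = min 1 r0"
  have r: "0 < r" "r <= 1" "r <= r0" using r0 by (auto simp: r_def)
  define rho where "rho = r/2"
  have rho: "0 < rho" "rho < r" using r by (auto simp: rho_def)
  define p where "p s t = (%j. if j : S then (if j = i then v j + s else if j = k then v j + t else v j + rho) else v j)" for s t
  have pV: "p s t : V" if "0 < s" "s < r" "0 < t" "t < r" for s t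
    by (rule r0(2)) (use that r rho in \<open>auto simp: p_def dist_real_def\<close>)
  define A where "A eta = (\<Prod>j\<in>S-{i,k}. rho ^ eta j)" for eta :: "nat => nat"
  have A: "A eta > 0" for eta using rho by (auto simp: A_def intro!: prod_pos)
  have mon: "(\<Prod>j\<in>S. (p s t j - v j) ^ eta j) = s ^ eta i * t ^ eta k * A eta" for s t eta
  proof -
    have "(\<Prod>j\<in>S. (p s t j - v j) ^ eta j) = (p s t i - v i) ^ eta i * ((p s t k - v k) ^ eta k * (\<Prod>j\<in>S-{i}-{k}. (p s t j - v j) ^ eta j))"
      unfolding prod.remove[OF fS ik(1)] using fS ik ne by (subst prod.remove[of "S-{i}" k]) auto
    moreover have "(\<Prod>j\<in>S-{i}-{k}. (p s t j - v j) ^ eta j) = A eta"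
      unfolding A_def by (rule prod.cong) (auto simp: p_def)
    ultimately show ?thesis using ik ne by (simp add: p_def)
  qed
  define U where "U s t = A alpha * u (p s t)" for s t
  define W where "W s t = A beta * w (p s t)" for s t
  define Z where "Z s t = A gamma * z (p s t)" for s t
  have eq: "s ^ alpha i * t ^ alpha k * U s t - s ^ beta i * t ^ beta k * W s t = s ^ gamma i * t ^ gamma k * Z s t"
    if "0 < s" "s < r" "0 < t" "t < r" for s t
    using V(3)[OF pV[OF that]] unfolding mon U_def W_def Z_def by (simp add: mult.assoc)
  define B where "B = Max {A alpha * (\<bar>u v\<bar> + 1), A beta * (\<bar>w v\<bar> + 1), A gamma * (\<bar>z v\<bar> + 1)}"
  have Bd: "\<bar>U s t\<bar> <= B" "\<bar>W s t\<bar> <= B" "\<bar>Z s t\<bar> <= B" if "0 < s" "s < r" "0 < t" "t < r" for s t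
  proof -
    have "A alpha * (\<bar>u v\<bar> + 1) <= B" "A beta * (\<bar>w v\<bar> + 1) <= B" "A gamma * (\<bar>z v\<bar> + 1) <= B" by (auto simp: B_def)
    moreover have "\<bar>U s t\<bar> <= A alpha * (\<bar>u v\<bar> + 1)" "\<bar>W s t\<bar> <= A beta * (\<bar>w v\<bar> + 1)" "\<bar>Z s t\<bar> <= A gamma * (\<bar>z v\<bar> + 1)"
      using V(3)[OF pV[OF that]] A by (auto simp: U_def W_def Z_def abs_mult abs_of_pos intro!: mult_left_mono less_imp_le)
    ultimately show "\<bar>U s t\<bar> <= B" "\<bar>W s t\<bar> <= B" "\<bar>Z s t\<bar> <= B" by linarith+
  qed
  have B0: "B >= 0" using Bd(1)[of rho rho] rho by (meson abs_ge_zero order_trans)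
  \<comment> \<open>The entry 1 merely keeps the minimum positive when z v = 0; in that case Z is
    zero and no lower bound for it is claimed.\<close>
  define m where "m = Min {A alpha * (\<bar>u v\<bar>/2), A beta * (\<bar>w v\<bar>/2), (if z v = 0 then 1 else A gamma * (\<bar>z v\<bar>/2))}"
  have m0: "m > 0" using A u w by (auto simp: m_def)
  have Md: "m <= \<bar>U s t\<bar>" "m <= \<bar>W s t\<bar>" "z v ~= 0 ==> m <= \<bar>Z s t\<bar>" if "0 < s" "s < r" "0 < t" "t < r" for s t
  proof -
    have "A alpha * (\<bar>u v\<bar>/2) >= m" "A beta * (\<bar>w v\<bar>/2) >= m" "z v ~= 0 ==> A gamma * (\<bar>z v\<bar>/2) >= m" by (auto simp: m_def)
    moreover have "\<bar>U s t\<bar> >= A alpha * (\<bar>u v\<bar>/2)" "\<bar>W s t\<bar> >= A beta * (\<bar>w v\<bar>/2)" "\<bar>Z s t\<bar> >= A gamma * (\<bar>z v\<bar>/2)"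
      using V(3)[OF pV[OF that]] A
      by (auto simp: U_def W_def Z_def abs_mult abs_of_pos simp del: times_divide_eq_right intro!: mult_left_mono less_imp_le)
    ultimately show "m <= \<bar>U s t\<bar>" "m <= \<bar>W s t\<bar>" "z v ~= 0 ==> m <= \<bar>Z s t\<bar>" by linarith+
  qed
  have le1: "rho ^ q <= 1" "0 < rho ^ q" for q using rho r by (auto intro!: power_le_one)
  have lo: "m * rho ^ q <= \<bar>rho ^ q * X\<bar>" if "m <= \<bar>X\<bar>" for q X
    using that le1(2)[of q] by (simp add: abs_mult abs_of_pos mult.commute mult_left_mono)
  have hi: "\<bar>rho ^ q * X\<bar> <= B" if "\<bar>X\<bar> <= B" for q X
    using mult_mono[OF le1(1)[of q] that] le1(2)[of q] by (simp add: abs_mult abs_of_pos)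
  show False
  proof (cases "z v = 0")
    case True
    then have Z0: "Z s t = 0" if "0 < s" "s < r" "0 < t" "t < r" for s t
      using V(3)[OF pV[OF that]] by (simp add: Z_def)
    show False
    proof (rule two_monomials_aux[of r "m * rho ^ alpha k" "%s. rho ^ alpha k * U s rho" "%s. rho ^ beta k * W s rho" B "%_. 0" "alpha i" "beta i" "Suc (alpha i)"])
      show "s ^ alpha i * (rho ^ alpha k * U s rho) = s ^ beta i * (rho ^ beta k * W s rho) + s ^ Suc (alpha i) * 0" if "0 < s" "s < r" for s
        using eq[of s rho] Z0[of s rho] that rho by (simp add: algebra_simps)
    qed (use r m0 le1 lo hi Md Bd rho B0 ik in auto)
  next
    case False
    have e1: "gamma i = alpha i"
    proof (rule ccontr)
      assume "gamma i ~= alpha i"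
      then consider "gamma i < alpha i" | "alpha i < gamma i" by linarith
      then show False
      proof cases
        case 1
        show False
        proof (rule two_monomials_aux[of r "m * rho ^ gamma k" "%s. rho ^ gamma k * Z s rho" "%s. rho ^ alpha k * U s rho" B "%s. - (rho ^ beta k * W s rho)" "gamma i" "alpha i" "beta i"])
          show "s ^ gamma i * (rho ^ gamma k * Z s rho) = s ^ alpha i * (rho ^ alpha k * U s rho) + s ^ beta i * - (rho ^ beta k * W s rho)" if "0 < s" "s < r" for s
            using eq[of s rho] that rho by (simp add: algebra_simps)
        qed (use r m0 le1 lo hi Md Bd rho B0 ik 1 False in auto)
      next
        case 2
        show False
        proof (rule two_monomials_aux[of r "m * rho ^ alpha k" "%s. rho ^ alpha k * U s rho" "%s. rho ^ beta k * W s rho" B "%s. rho ^ gamma k * Z s rho" "alpha i" "beta i" "gamma i"])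
          show "s ^ alpha i * (rho ^ alpha k * U s rho) = s ^ beta i * (rho ^ beta k * W s rho) + s ^ gamma i * (rho ^ gamma k * Z s rho)" if "0 < s" "s < r" for s
            using eq[of s rho] that rho by (simp add: algebra_simps)
        qed (use r m0 le1 lo hi Md Bd rho B0 ik 2 in auto)
      qed
    qed
    have e2: "gamma k = beta k"
    proof (rule ccontr)
      assume "gamma k ~= beta k"
      then consider "gamma k < beta k" | "beta k < gamma k" by linarith
      then show False
      proof cases
        case 1
        show False
        proof (rule two_monomials_aux[of r "m * rho ^ gamma i" "%s. rho ^ gamma i * Z rho s" "%s. rho ^ alpha i * U rho s" B "%s. - (rho ^ beta i * W rho s)" "gamma k" "alpha k" "beta k"])
          show "s ^ gamma k * (rho ^ gamma i * Z rho s) = s ^ alpha k * (rho ^ alpha i * U rho s) + s ^ beta k * - (rho ^ beta i * W rho s)" if "0 < s" "s < r" for s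
            using eq[of rho s] that rho by (simp add: algebra_simps)
        qed (use r m0 le1 lo hi Md Bd rho B0 ik 1 False in auto)
      next
        case 2
        show False
        proof (rule two_monomials_aux[of r "m * rho ^ beta i" "%s. rho ^ beta i * W rho s" "%s. rho ^ alpha i * U rho s" B "%s. - (rho ^ gamma i * Z rho s)" "beta k" "alpha k" "gamma k"])
          show "s ^ beta k * (rho ^ beta i * W rho s) = s ^ alpha k * (rho ^ alpha i * U rho s) + s ^ gamma k * - (rho ^ gamma i * Z rho s)" if "0 < s" "s < r" for s
            using eq[of rho s] that rho by (simp add: algebra_simps)
        qed (use r m0 le1 lo hi Md Bd rho B0 ik 2 in auto)
      qed
    qed
    show False
    proof (rule two_monomials_aux[of r m "%s. Z s s" "%s. U s s" B "%s. - W s s" "alpha i + beta k" "alpha i + alpha k" "beta i + beta k"])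
      show "s ^ (alpha i + beta k) * Z s s = s ^ (alpha i + alpha k) * U s s + s ^ (beta i + beta k) * - W s s" if "0 < s" "s < r" for s
        using eq[of s s] that e1 e2 by (simp add: power_add algebra_simps)
    qed (use r m0 Md Bd ik False in auto)
  qed
qed

lemma ra_agree: "ra S f a ==> (\<And>i. i : S ==> a i = b i) ==> ra S f b"
proof -
  assume a: "ra S f a" "\<And>i. i : S ==> a i = b i"
  then have "poly_disc S (emb a) r = poly_disc S (emb b) r" for r
    by (auto simp: poly_disc_def emb_def)
  with a(1) show ?thesis by (simp add: ra_def)
qed

lemma monom_at_nonzero:
  assumes fS: "finite S" and m: "monom_at S f v" shows "\<not> (\<forall>\<^sub>F x in nhds v. f x = 0)"
proof
  assume ev: "\<forall>\<^sub>F x in nhds v. f x = 0"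
  obtain alpha u where u: "ra S u v" "u v ~= 0" "\<forall>\<^sub>F x in nhds v. f x = (\<Prod>i\<in>S. (x i - v i) ^ alpha i) * u x"
    using m unfolding monom_at_def by blast
  have "\<forall>\<^sub>F x in nhds v. u x ~= 0"
    using isCont_nhds[OF isCont_ra[OF u(1)]] u(2) by (rule tendsto_imp_eventually_ne)
  with u(3) ev have "\<forall>\<^sub>F x in nhds v. (\<Prod>i\<in>S. (x i - v i) ^ alpha i) = 0" by eventually_elim auto
  then obtain V where V: "open V" "v : V" "\<And>x. x : V ==> (\<Prod>i\<in>S. (x i - v i) ^ alpha i) = 0" unfolding eventually_nhds by blast
  obtain r where r: "r > 0" "\<And>x. (ALL j:S. dist (x j) (v j) < r) ==> (ALL j. j \<notin> S --> x j = v j) ==> x : V"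
    using open_fun_box[OF V(1,2) fS] by blast
  have "(%j. if j : S then v j + r/2 else v j) : V" by (rule r(2)) (use r in \<open>auto simp: dist_real_def\<close>)
  from V(3)[OF this] show False using r fS by simp
qed

lemma monable_cong:
  assumes "monable S f a" "\<forall>\<^sub>F x in nhds a. g x = f x"
  shows "monable S g a"
  unfolding monable_def
proof (intro allI impI, elim conjE)
  fix W assume W: "open W" "a : W"
  obtain V where V: "open V" "a : V" "ALL x:V. g x = f x" using assms(2) unfolding eventually_nhds by blast
  obtain Psi where Psi: "finite Psi" "ALL psi:Psi. chart S f (W \<inter> V) psi" "\<forall>\<^sub>F x in nhds a. rn S x --> (EX psi:Psi. x : psi ` cube S)"
    using assms(1)[unfolded monable_def, rule_format, of "W \<inter> V"] open_Int[OF W(1) V(1)] W(2) V(2) by blast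
  have "chart S g W psi" if "psi : Psi" for psi
  proof -
    have c: "chart S f (W \<inter> V) psi" using Psi that by blast
    show ?thesis unfolding chart_def
    proof (intro conjI ballI allI)
      fix v assume v: "v : cube S"
      show "ra S (%x. psi x i) v" if "i : S" for i using c v that unfolding chart_def by blast
      show "psi v : W" using c v unfolding chart_def by blast
      have m: "monom_at S (%x. f (psi x)) v" using c v unfolding chart_def by blast
      have fS: "finite S" using m raD(1) unfolding monom_at_def by blast
      obtain V' where V': "open V'" "v : V'" "\<And>x. x : V' ==> psi x : V"
        using ra_map_nbhd[OF fS _ _ V(1), of S psi v] c v unfolding chart_def by (metis IntD2)
      have "\<forall>\<^sub>F x in nhds v. g (psi x) = f (psi x)"
        using V' V(3) unfolding eventually_nhds by blast
      with m show "monom_at S (%x. g (psi x)) v" by (rule monom_at_cong)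
    qed (use c in \<open>auto simp: chart_def\<close>)
  qed
  with Psi show "EX Psi. finite Psi & (ALL psi:Psi. chart S g W psi) & (\<forall>\<^sub>F x in nhds a. rn S x --> (EX psi:Psi. x : psi ` cube S))" by blast
qed

text \<open>A Lebesgue number argument: halved radii leave room for the triangle inequality.
  Distances are measured coordinatewise on T, because the blow-up estimates are
  coordinatewise.\<close>

lemma compact_tube:
  fixes K :: "(nat => real) set"
  assumes K: "compact K" "K \<subseteq> N" "open N" and T: "finite T" "\<And>b. b : K ==> rn T b"
  obtains epsilon where "epsilon > 0" "\<And>x b. rn T x ==> b : K ==> (\<And>i. i : T ==> dist (x i) (b i) < epsilon) ==> x : N"
proof -
  have "EX r>0. ALL x. (ALL i:T. dist (x i) (b i) < r) --> rn T x --> x : N" if "b : K" for b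
  proof -
    have bN: "b : N" using K(2) that by blast
    obtain r where r: "r > 0" "\<And>x. (ALL i:T. dist (x i) (b i) < r) ==> (ALL i. i \<notin> T --> x i = b i) ==> x : N"
      using open_fun_box[OF K(3) bN T(1)] by blast
    then show ?thesis using T(2)[OF that] unfolding rn_def by metis
  qed
  then obtain r where r: "\<And>b. b : K ==> r b > 0" "\<And>b x. b : K ==> (ALL i:T. dist (x i) (b i) < r b) ==> rn T x ==> x : N"
    by metis
  define Nb where "Nb b = {x. ALL i:T. dist (x i) (b i) < r b / 2}" for b :: "nat => real"
  obtain C where C: "C \<subseteq> K" "finite C" "K \<subseteq> (\<Union>b\<in>C. Nb b)"
  proof (rule compactE_image[OF K(1), where C = K and f = Nb])
    show "open (Nb b)" for b unfolding Nb_def by (rule open_polybox[OF T(1)])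
    show "K \<subseteq> (\<Union>b\<in>K. Nb b)" using r(1) by (auto simp: Nb_def)
  qed
  define epsilon where "epsilon = Min (insert 1 ((%b. r b / 2) ` C))"
  have epsilon: "epsilon > 0" "\<And>b. b : C ==> epsilon <= r b / 2"
  proof -
    show "epsilon > 0" unfolding epsilon_def using C r(1) by (auto simp: subset_iff)
    show "epsilon <= r b / 2" if "b : C" for b unfolding epsilon_def by (rule Min_le) (use C that in auto)
  qed
  show thesis
  proof (rule that[OF epsilon(1)])
    fix x b assume x: "rn T x" "b : K" "\<And>i. i : T ==> dist (x i) (b i) < epsilon"
    then obtain c where c: "c : C" "b : Nb c" using C(3) by blast
    have "dist (x i) (c i) < r c" if "i : T" for i
    proof -
      have "dist (x i) (c i) <= dist (x i) (b i) + dist (b i) (c i)" by (rule dist_triangle)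
      then show ?thesis using x(3)[OF that] epsilon(2)[OF c(1)] c(2) that unfolding Nb_def by fastforce
    qed
    then show "x : N" using r(2)[of c x] c(1) C(1) x(1) by blast
  qed
qed

text \<open>The case of \<open>monable_trans\<close> with one map over one point. Continuity of iota
  at a is all that is asked of it, since it only has to show that theta covers a neighbourhood of
  a.\<close>

lemma monable_homeo:
  assumes fT: "finite T" and th: "\<And>i. i : T ==> ra T (%x. theta x i) b" "\<And>x. rn T (theta x)" "theta b = a"
    and io: "filterlim iota (nhds b) (nhds a)" "\<forall>\<^sub>F x in nhds a. rn T x --> rn T (iota x) & theta (iota x) = x"
    and m: "monable T (%x. f (theta x)) b"
  shows "monable T f a"
proof (rule monable_trans[OF fT])
  fix W assume W: "open W" "a : W"
  show "EX Theta. finite Theta &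
     (ALL p:Theta. compact (snd p) & (ALL x. rn T (fst p x)) &
        (ALL b:snd p. (ALL i:T. ra T (%x. fst p x i) b) & fst p b : W & monable T (%x. f (fst p x)) b)) &
     (ALL N. (ALL p:Theta. open (N p) & snd p \<subseteq> N p) -->
        (\<forall>\<^sub>F x in nhds a. rn T x --> (EX p:Theta. EX v:N p. rn T v & x = fst p v)))"
  proof (intro exI[of _ "{(theta,{b})}"] conjI allI impI)
    fix N :: "((nat => real) => nat => real) \<times> (nat => real) set => (nat => real) set"
    assume N: "ALL p:{(theta,{b})}. open (N p) & snd p \<subseteq> N p"
    then have "\<forall>\<^sub>F x in nhds b. x : N (theta,{b})" by (intro eventually_nhds_in_open) auto
    then have "\<forall>\<^sub>F x in nhds a. iota x : N (theta,{b})" using io(1) unfolding filterlim_iff by blast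
    with io(2) show "\<forall>\<^sub>F x in nhds a. rn T x --> (EX p:{(theta,{b})}. EX v:N p. rn T v & x = fst p v)"
      by eventually_elim (auto intro!: bexI[of _ "iota _"])
  qed (use th m W in auto)
qed

text \<open>A root c of multiplicity d would turn the polynomial into u0 (t - c)^d, whose
  coefficient of degree d-1 is - d c u0. The sum stops at i < d-1, so this coefficient is 0, which
  is impossible for c ~= 0. The multiplicity at c is therefore below d: this is the gain from the
  Tschirnhaus shift.\<close>

lemma polynomial_order:
  fixes u0 :: real and kappa :: "nat => real"
  assumes "u0 ~= 0" "c ~= 0" "d >= 1"
  shows "EX j<d. EX L. L ~= 0 & ((%t. (t ^ d * u0 + (\<Sum>i<d-1. kappa i * t ^ i)) / (t - c) ^ j) \<longlongrightarrow> L) (at c)"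
proof -
  define p where "p = monom u0 d + (\<Sum>i<d-1. monom (kappa i) i)"
  have pe: "poly p t = t ^ d * u0 + (\<Sum>i<d-1. kappa i * t ^ i)" for t
    by (simp add: p_def poly_sum poly_monom mult.commute)
  have cd: "coeff p d = u0"
  proof -
    have "(\<Sum>i<d-1. coeff (monom (kappa i) i) d) = 0" by (intro sum.neutral) auto
    then show ?thesis by (simp add: p_def coeff_sum)
  qed
  have cd1: "coeff p (d-1) = 0"
  proof -
    have "(\<Sum>i<d-1. coeff (monom (kappa i) i) (d-1)) = 0" by (intro sum.neutral) auto
    then show ?thesis using assms(3) by (simp add: p_def coeff_sum)
  qed
  have p0: "p ~= 0" using cd assms(1) by auto
  have "degree (\<Sum>i<d-1. monom (kappa i) i) <= d" by (rule degree_sum_le) (auto intro: order_trans[OF degree_monom_le])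
  then have deg: "degree p <= d" unfolding p_def by (intro degree_add_le degree_monom_le)
  define j where "j = order c p"
  obtain q where q: "p = [:- c, 1:] ^ j * q" "\<not> [:- c, 1:] dvd q"
    using order_decomp[OF p0, of c] by (auto simp: j_def)
  have q0: "poly q c ~= 0" using q(2) by (simp add: poly_eq_0_iff_dvd)
  then have qn: "q ~= 0" by auto
  have dq: "degree p = j + degree q" unfolding q(1)
    by (subst degree_mult_eq) (use qn in \<open>auto simp: degree_linear_power\<close>)
  have "j ~= d"
  proof
    assume jd: "j = d"
    then have "degree q = 0" using dq deg by simp
    then obtain k where k: "q = [:k:]" by (rule degree_eq_zeroE)
    have pp: "p = smult k ([:- c, 1:] ^ d)" using q(1) k jd by simp
    have "k ~= 0" using k qn by auto
    have "coeff ([:- c, 1:] ^ d) (d-1) = of_nat (d choose (d-1)) * 1 ^ (d-1) * (-c) ^ (d - (d-1))"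
      by (rule coeff_linear_poly_power) (use assms(3) in auto)
    then have "coeff p (d-1) = k * (of_nat (d choose (d-1)) * (-c))" using pp assms(3) by simp
    moreover have "(d choose (d-1)) ~= 0" using assms(3) by simp
    ultimately show False using cd1 \<open>k ~= 0\<close> assms(2) by simp
  qed
  then have jd: "j < d" using dq deg by simp
  have "((%t. poly q t) \<longlongrightarrow> poly q c) (at c)" by (intro tendsto_intros)
  moreover have "\<forall>\<^sub>F t in at c. poly q t = (t ^ d * u0 + (\<Sum>i<d-1. kappa i * t ^ i)) / (t - c) ^ j"
    unfolding eventually_at_filter pe[symmetric] by (intro always_eventually) (auto simp: q(1))
  ultimately have "((%t. (t ^ d * u0 + (\<Sum>i<d-1. kappa i * t ^ i)) / (t - c) ^ j) \<longlongrightarrow> poly q c) (at c)"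
    using tendsto_cong by fastforce
  with jd q0 show ?thesis by blast
qed

section \<open>Blow-ups of codimension two\<close>

lemma compact_axis_segment:
  fixes C :: real
  shows "compact {x::nat=>real. (ALL i. i ~= n --> x i = 0) & \<bar>x n\<bar> <= C}"
proof -
  have "{x::nat=>real. (ALL i. i ~= n --> x i = 0) & \<bar>x n\<bar> <= C} =
     {x. ALL i. (if i = n then - C else 0) <= x i & x i <= (if i = n then C else 0)}"
  proof (intro set_eqI iffI)
    fix x :: "nat => real" assume "x : {x. ALL i. (if i = n then - C else 0) <= x i & x i <= (if i = n then C else 0)}"
    then have x: "(if i = n then - C else 0) <= x i" "x i <= (if i = n then C else 0)" for i by auto
    show "x : {x. (ALL i. i ~= n --> x i = 0) & \<bar>x n\<bar> <= C}"
      using x[of n] by (auto simp: abs_le_iff) (use x in \<open>metis antisym\<close>)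
  qed (auto simp: abs_le_iff)
  then show ?thesis using compact_fun_box by simp
qed

lemma prod_upd_power:
  fixes x :: "nat => 'a::comm_semiring_1"
  assumes "finite S" "j : S"
  shows "(\<Prod>i\<in>S. (x(j := x j * y)) i ^ eta i) = y ^ eta j * (\<Prod>i\<in>S. x i ^ eta i)"
proof -
  have "(\<Prod>i\<in>S. (x(j := x j * y)) i ^ eta i) = (x j * y) ^ eta j * (\<Prod>i\<in>S-{j}. x i ^ eta i)"
    unfolding prod.remove[OF assms] by (auto intro!: arg_cong2[of _ _ _ _ "(*)"] prod.cong)
  also have "\<dots> = y ^ eta j * (x j ^ eta j * (\<Prod>i\<in>S-{j}. x i ^ eta i))"
    by (simp add: power_mult_distrib mult_ac)
  finally show ?thesis unfolding prod.remove[OF assms] .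
qed

lemma prod_power_upd:
  fixes x :: "nat => 'a::comm_semiring_1"
  assumes "finite S" "j : S"
  shows "(\<Prod>i\<in>S. x i ^ (eta(j := eta j + k)) i) = x j ^ k * (\<Prod>i\<in>S. x i ^ eta i)"
proof -
  have "(\<Prod>i\<in>S. x i ^ (eta(j := eta j + k)) i) = x j ^ (eta j + k) * (\<Prod>i\<in>S-{j}. x i ^ eta i)"
    unfolding prod.remove[OF assms] by (auto intro!: arg_cong2[of _ _ _ _ "(*)"] prod.cong)
  also have "\<dots> = x j ^ k * (x j ^ eta j * (\<Prod>i\<in>S-{j}. x i ^ eta i))"
    by (simp add: power_add mult_ac)
  finally show ?thesis unfolding prod.remove[OF assms] .
qed

definition mon :: "nat set => (nat => nat) => (nat => real) => real" where
  "mon S eta x = (\<Prod>i\<in>S. x i ^ eta i)"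

lemma ra_mon: "finite T ==> S \<subseteq> T ==> ra T (mon S eta) a"
  unfolding mon_def[abs_def] by (intro ra_prod ra_power ra_proj) auto

lemma mon_cong: "(\<And>i. i : S ==> x i = y i) ==> mon S eta x = mon S eta y"
  unfolding mon_def by (intro prod.cong) auto

lemma monom_at_mon: "finite T ==> S \<subseteq> T ==> monom_at T (mon S eta) v"
  unfolding mon_def[abs_def] by (rule monom_at_monomial)

text \<open>The blow-up of the codimension two plane where x j and x n vanish, in its two charts;
  each one lowers the weight gamma or produces a monomial.\<close>

lemma blowup_monable:
  fixes c :: "nat => (nat => real) => real"
  assumes fS: "finite S" and n: "n \<notin> S" and d: "d >= 1"
    and IHd: "\<And>e g a. rn (insert n S) a ==> ra (insert n S) e a ==> ra S g a ==> \<not> (\<forall>\<^sub>F x in nhds a. g x = 0) ==>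
       (EX j<d. (dd n (a n) ^^ j) e a ~= 0) ==> monable (insert n S) (%x. g x * e x) a"
    and g0: "ra S g0 (%_. 0)" "g0 (%_. 0) ~= 0"
    and c: "\<And>i. i < d - 1 ==> ra S (c i) (%_. 0)" "EX i<d-1. c i (%_. 0) ~= 0"
    and u: "ra (insert n S) u (%_. 0)" "u (%_. 0) ~= 0"
    and m: "(\<Sum>i\<in>S. gamma i) = m"
  shows "monable (insert n S) (%x. mon S delta x * g0 x * (x n ^ d * u x + (\<Sum>i<d-1. mon S (%j. (d-i) * gamma j) x * c i x * x n ^ i))) (%_. 0)"
  using u m
proof (induction m arbitrary: gamma delta u)
  case 0
  let ?T = "insert n S" and ?z = "%_::nat. 0::real"
  have fT: "finite ?T" using fS by auto
  define E where "E x = x n ^ d * u x + (\<Sum>i<d-1. mon S (%j. (d-i) * gamma j) x * c i x * x n ^ i)" for x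
  have gamma0: "gamma j = 0" if "j : S" for j using 0(3) fS that by simp
  have mon1: "mon S (%j. (d-i) * gamma j) x = 1" for i x
    unfolding mon_def by (intro prod.neutral) (auto simp: gamma0)
  have raE: "ra ?T E ?z" unfolding E_def
    by (intro ra_add ra_mult ra_power ra_sum ra_proj fT 0 ra_mon ra_mono[OF c(1)]) auto
  have cz: "c i (?z(n := t)) = c i ?z" if "i < d - 1" for i t
    by (rule depD[OF raD(2)[OF c(1)[OF that]]]) (use n in auto)
  \<comment> \<open>With all gamma j = 0 the monomials in front of the c i are 1. On the x n axis
    the lowest power with a nonzero coefficient is then i0 < d, and the hypothesis for orders below
    d applies.\<close>
  define i0 where "i0 = (LEAST i. i < d - 1 & c i ?z ~= 0)"
  have i0: "i0 < d - 1" "c i0 ?z ~= 0" using LeastI_ex[OF c(2)] by (auto simp: i0_def)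
  have i0z: "c i ?z = 0" if "i < i0" for i
    using not_less_Least[of i "%i. i < d - 1 & c i ?z ~= 0"] that i0(1) by (auto simp: i0_def)
  have "((%t. E (?z(n := t)) / (t - ?z n) ^ i0) \<longlongrightarrow> c i0 ?z) (at (?z n))"
  proof -
    have ut: "((%t. u (?z(n := t))) \<longlongrightarrow> u ?z) (at 0)"
    proof -
      have "isCont u (?z(n := 0))" using isCont_ra[OF 0(1)] by (simp add: fun_upd_idem)
      then have "isCont (%t. u (?z(n := t))) 0"
        by (intro isCont_o2[OF isCont_upd])
      then show ?thesis by (simp add: isCont_def fun_upd_idem)
    qed
    have "((%t. t ^ (d - i0) * u (?z(n := t)) + (\<Sum>i\<in>{i0..<d-1}. c i ?z * t ^ (i - i0))) \<longlongrightarrow>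
        0 ^ (d - i0) * u ?z + (\<Sum>i\<in>{i0..<d-1}. c i ?z * 0 ^ (i - i0))) (at 0)"
      by (intro tendsto_intros ut)
    moreover have "(\<Sum>i\<in>{i0..<d-1}. c i ?z * 0 ^ (i - i0)) = c i0 ?z"
    proof -
      have "(\<Sum>i\<in>{i0..<d-1}. c i ?z * 0 ^ (i - i0)) = (\<Sum>i\<in>{i0..<d-1}. if i = i0 then c i ?z else 0)"
        by (rule sum.cong) auto
      then show ?thesis using i0 by simp
    qed
    moreover have "(0::real) ^ (d - i0) = 0" using i0 by (simp add: zero_power)
    ultimately have l: "((%t. t ^ (d - i0) * u (?z(n := t)) + (\<Sum>i\<in>{i0..<d-1}. c i ?z * t ^ (i - i0))) \<longlongrightarrow> c i0 ?z) (at 0)"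
      by simp
    have "\<forall>\<^sub>F t in at 0. t ^ (d - i0) * u (?z(n := t)) + (\<Sum>i\<in>{i0..<d-1}. c i ?z * t ^ (i - i0)) = E (?z(n := t)) / (t - ?z n) ^ i0"
      unfolding eventually_at_filter
    proof (intro always_eventually allI impI)
      fix t :: real assume t: "t ~= 0"
      have "(\<Sum>i<d-1. c i (?z(n := t)) * t ^ i) = (\<Sum>i<d-1. c i ?z * t ^ i)" by (rule sum.cong) (auto simp: cz)
      also have "\<dots> = (\<Sum>i\<in>{i0..<d-1}. c i ?z * t ^ i)"
        by (rule sum.mono_neutral_right) (auto simp: i0z)
      also have "\<dots> = (\<Sum>i\<in>{i0..<d-1}. (c i ?z * t ^ (i - i0)) * t ^ i0)"
        by (rule sum.cong) (auto simp flip: power_add)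
      finally have "(\<Sum>i<d-1. c i (?z(n := t)) * t ^ i) = (\<Sum>i\<in>{i0..<d-1}. c i ?z * t ^ (i - i0)) * t ^ i0"
        by (simp add: sum_distrib_right)
      moreover have "t ^ d = t ^ (d - i0) * t ^ i0" using i0 by (simp flip: power_add)
      ultimately have "E (?z(n := t)) = (t ^ (d - i0) * u (?z(n := t)) + (\<Sum>i\<in>{i0..<d-1}. c i ?z * t ^ (i - i0))) * t ^ i0"
        unfolding E_def mon1 by (simp add: algebra_simps del: fun_upd_apply) (simp add: algebra_simps)
      then show "t ^ (d - i0) * u (?z(n := t)) + (\<Sum>i\<in>{i0..<d-1}. c i ?z * t ^ (i - i0)) = E (?z(n := t)) / (t - ?z n) ^ i0"
        using t by simp
    qed
    with l show ?thesis using tendsto_cong by fastforce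
  qed
  from order_dd[OF raE _ i0(2) this] obtain j where "j <= i0" "(dd n (?z n) ^^ j) E ?z ~= 0" by auto
  then have j: "EX j<d. (dd n (?z n) ^^ j) E ?z ~= 0" using i0 by (intro exI[of _ j]) auto
  have "monable ?T (%x. (mon S delta x * g0 x) * E x) ?z"
  proof (rule IHd[OF _ raE _ _ j])
    show "rn ?T ?z" by (simp add: rn_def)
    show "ra S (%x. mon S delta x * g0 x) ?z" by (intro ra_mult ra_mon fS g0) auto
    show "\<not> (\<forall>\<^sub>F x in nhds ?z. mon S delta x * g0 x = 0)"
      by (rule monom_at_nonzero[OF fS monom_at_mult[OF monom_at_mon monom_at_unit]]) (use fS g0 in auto)
  qed
  then show ?case unfolding E_def .
next
  case (Suc m)
  let ?T = "insert n S" and ?z = "%_::nat. 0::real"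
  have fT: "finite ?T" using fS by auto
  obtain j where j: "j : S" "gamma j > 0" using Suc.prems(3) by (metis sum.neutral neq0_conv nat.distinct(1))
  have jn: "j ~= n" using j n by auto
  define gamma' where "gamma' = gamma(j := gamma j - 1)"
  have gamma'sum: "(\<Sum>i\<in>S. gamma' i) = m"
  proof -
    have "(\<Sum>i\<in>S. gamma i) = gamma j + (\<Sum>i\<in>S-{j}. gamma i)" "(\<Sum>i\<in>S. gamma' i) = gamma' j + (\<Sum>i\<in>S-{j}. gamma' i)"
      using fS j by (auto simp: sum.remove)
    moreover have "(\<Sum>i\<in>S-{j}. gamma' i) = (\<Sum>i\<in>S-{j}. gamma i)" by (rule sum.cong) (auto simp: gamma'_def)
    ultimately show ?thesis using Suc.prems(3) j(2) by (simp add: gamma'_def)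
  qed
  define f where "f x = mon S delta x * g0 x * (x n ^ d * u x + (\<Sum>i<d-1. mon S (%j. (d-i) * gamma j) x * c i x * x n ^ i))" for x
  define Q where "Q = (\<Sum>i<d-1. \<bar>c i ?z\<bar>)"
  \<comment> \<open>In the second chart |x j / x n| <= 1 / C, so the lower coefficients contribute
    at most Q / C there; this C keeps Q / C below |u| at the origin, and the unit survives.\<close>
  define C where "C = 1 + Q / \<bar>u ?z\<bar>"
  have Q0: "Q >= 0" by (simp add: Q_def sum_nonneg)
  have C1: "C >= 1" using Q0 by (simp add: C_def)
  have "\<bar>u ?z\<bar> * C = \<bar>u ?z\<bar> + Q" using Suc.prems(2) by (simp add: C_def distrib_left)
  then have QC: "Q / C < \<bar>u ?z\<bar>" using C1 Suc.prems(2) by (simp add: pos_divide_less_eq)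
  define theta1 where "theta1 x = (%i. if i : ?T then (x(n := x j * x n)) i else 0)" for x :: "nat => real"
  define theta2 where "theta2 x = (%i. if i : ?T then (x(j := x j * x n)) i else 0)" for x :: "nat => real"
  \<comment> \<open>K1 and K2 are the parts of the exceptional fibre over the origin in the two
    charts. Slopes x n / x j of modulus at most C and slopes x j / x n of modulus at most 1 / C
    exhaust all directions.\<close>
  define K1 where "K1 = {x::nat=>real. (ALL i. i ~= n --> x i = 0) & \<bar>x n\<bar> <= C}"
  define K2 where "K2 = {x::nat=>real. (ALL i. i ~= j --> x i = 0) & \<bar>x j\<bar> <= 1/C}"
  have cK: "compact K1" "compact K2" unfolding K1_def K2_def by (rule compact_axis_segment)+
  have rnK: "b : K1 ==> rn ?T b" "b : K2 ==> rn ?T b" for b using j by (auto simp: K1_def K2_def rn_def)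
  have rntheta: "rn ?T (theta1 x)" "rn ?T (theta2 x)" for x by (auto simp: theta1_def theta2_def rn_def)
  have ratheta: "ra ?T (%x. theta1 x i) b" "ra ?T (%x. theta2 x i) b" for i b
  proof -
    show "ra ?T (%x. theta1 x i) b" using fT j unfolding theta1_def
      by (cases "i = n"; cases "i : S") (auto intro!: ra_mult ra_proj ra_const)
    show "ra ?T (%x. theta2 x i) b" using fT j jn unfolding theta2_def
      by (cases "i = j"; cases "i : ?T") (auto intro!: ra_mult ra_proj ra_const)
  qed
  have thetaK: "b : K1 ==> theta1 b = ?z" "b : K2 ==> theta2 b = ?z" for b
    using j jn n by (auto simp: theta1_def theta2_def K1_def K2_def fun_eq_iff)
  have ra1: "ra ?T (%x. h (theta1 x)) b" if "ra ?T h ?z" "b : K1" for h b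
    by (rule ra_compose[where Phi = theta1, OF _ fT ratheta(1)]) (use that thetaK in auto)
  have ra2: "ra ?T (%x. h (theta2 x)) b" if "ra ?T h ?z" "b : K2" for h b
    by (rule ra_compose[where Phi = theta2, OF _ fT ratheta(2)]) (use that thetaK in auto)
  have cT: "ra ?T (c i) ?z" if "i < d-1" for i by (rule ra_mono[OF c(1)[OF that]]) (use fT in auto)
  have g0T: "ra ?T g0 ?z" by (rule ra_mono[OF g0(1)]) (use fT in auto)
  have M1: "monable ?T (%x. f (theta1 x)) b" if b: "b : K1" for b
  proof -
    define u' where "u' x = u (theta1 x)" for x
    \<comment> \<open>In the first chart every term of the bracket acquires the factor x j ^ d,
      which joins the monomial prefactor; what is left has the same shape with gamma j lowered by
      one.\<close>
    define delta' where "delta' = delta(j := delta j + d)"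
    define e where "e x = x n ^ d * u' x + (\<Sum>i<d-1. mon S (%j. (d-i) * gamma' j) x * c i x * x n ^ i)" for x
    have fe: "f (theta1 x) = mon S delta' x * g0 x * e x" for x
    proof -
      have thetaS: "theta1 x i = x i" if "i : S" for i using that n by (auto simp: theta1_def)
      have thetan: "theta1 x n = x j * x n" by (simp add: theta1_def)
      have g: "g0 (theta1 x) = g0 x" by (rule depD[OF raD(2)[OF g0(1)]]) (rule thetaS)
      have ci: "c i (theta1 x) = c i x" if "i < d-1" for i by (rule depD[OF raD(2)[OF c(1)[OF that]]]) (rule thetaS)
      have mm: "mon S eta (theta1 x) = mon S eta x" for eta by (rule mon_cong) (rule thetaS)
      have t: "mon S (%j. (d-i) * gamma j) x * c i x * (x j * x n) ^ i = x j ^ d * (mon S (%j. (d-i) * gamma' j) x * c i x * x n ^ i)"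
        if "i < d-1" for i
      proof -
        have "(%j. (d-i) * gamma j) = (%j. (d-i) * gamma' j)(j := (d-i) * gamma' j + (d-i))"
          using j(2) by (auto simp: gamma'_def fun_eq_iff) (metis Suc_pred add.commute mult_Suc_right)
        then have "mon S (%j. (d-i) * gamma j) x = mon S ((%j. (d-i) * gamma' j)(j := (d-i) * gamma' j + (d-i))) x"
          by (rule arg_cong)
        also have "\<dots> = x j ^ (d-i) * mon S (%j. (d-i) * gamma' j) x"
          unfolding mon_def by (rule prod_power_upd[OF fS j(1)])
        finally have "mon S (%j. (d-i) * gamma j) x = x j ^ (d-i) * mon S (%j. (d-i) * gamma' j) x" .
        moreover have "x j ^ d = x j ^ (d-i) * x j ^ i" using that by (simp flip: power_add)
        ultimately show ?thesis by (simp add: power_mult_distrib mult_ac)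
      qed
      have "(\<Sum>i<d-1. mon S (%j. (d-i) * gamma j) x * c i (theta1 x) * (x j * x n) ^ i) = x j ^ d * (\<Sum>i<d-1. mon S (%j. (d-i) * gamma' j) x * c i x * x n ^ i)"
        unfolding sum_distrib_left by (rule sum.cong) (auto simp: ci t)
      then have "f (theta1 x) = mon S delta x * g0 x * (x j ^ d * e x)"
        unfolding f_def mm thetan g e_def u'_def by (simp add: power_mult_distrib algebra_simps)
      moreover have "mon S delta' x = x j ^ d * mon S delta x"
        unfolding mon_def delta'_def by (rule prod_power_upd[OF fS j(1)])
      ultimately show ?thesis by (simp add: mult_ac)
    qed
    have rau': "ra ?T u' b" unfolding u'_def by (rule ra1[OF Suc.prems(1) b])
    show ?thesis
    \<comment> \<open>At the origin of the chart the weight has gone down and the induction on m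
      takes over. At the other points of K1 the polynomial in x n has a root of multiplicity below d
      (\<open>polynomial_order\<close>), so the order drops.\<close>
    proof (cases "b n = 0")
      case True
      then have bz: "b = ?z" using b by (auto simp: K1_def fun_eq_iff)
      have "u' ?z ~= 0" using Suc.prems(2) thetaK(1)[OF b] bz by (simp add: u'_def)
      from Suc.IH[OF rau'[unfolded bz] this gamma'sum, of delta'] show ?thesis unfolding fe e_def bz .
    next
      case False
      have bS: "i : S ==> ?z i = b i" for i using b n by (auto simp: K1_def)
      have cb: "ra S (c i) b" if "i < d-1" for i by (rule ra_agree[OF c(1)[OF that] bS])
      have g0b: "ra S g0 b" by (rule ra_agree[OF g0(1) bS])
      have rae: "ra ?T e b" unfolding e_def
        by (intro ra_add ra_mult ra_power ra_sum ra_proj fT rau' ra_mon ra_mono[OF cb]) auto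
      have et: "e (b(n := t)) = t ^ d * u ?z + (\<Sum>i<d-1. (mon S (%j. (d-i) * gamma' j) ?z * c i ?z) * t ^ i)" for t
      proof -
        have "theta1 (b(n := t)) = ?z" using b j jn by (auto simp: K1_def theta1_def fun_eq_iff)
        moreover have "c i (b(n := t)) = c i ?z" if "i < d-1" for i
          by (rule depD[OF raD(2)[OF c(1)[OF that]]]) (use b n in \<open>auto simp: K1_def\<close>)
        moreover have "mon S eta (b(n := t)) = mon S eta ?z" for eta by (rule mon_cong) (use b n in \<open>auto simp: K1_def\<close>)
        ultimately show ?thesis by (simp add: e_def u'_def)
      qed
      obtain k L where k: "k < d" "L ~= 0" "((%t. (t ^ d * u ?z + (\<Sum>i<d-1. (mon S (%j. (d-i) * gamma' j) ?z * c i ?z) * t ^ i)) / (t - b n) ^ k) \<longlongrightarrow> L) (at (b n))"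
        using polynomial_order[OF Suc.prems(2) False d, of "%i. mon S (%j. (d-i) * gamma' j) ?z * c i ?z"] by blast
      have "((%t. e (b(n := t)) / (t - b n) ^ k) \<longlongrightarrow> L) (at (b n))" unfolding et by (rule k(3))
      from order_dd[OF rae _ k(2) this] obtain i where i: "i <= k" "(dd n (b n) ^^ i) e b ~= 0" by auto
      have "monable ?T (%x. (mon S delta' x * g0 x) * e x) b"
      proof (rule IHd[OF rnK(1)[OF b] rae])
        show "ra S (%x. mon S delta' x * g0 x) b" by (intro ra_mult ra_mon fS g0b) auto
        have "g0 b ~= 0" using g0(2) depD[OF raD(2)[OF g0(1)], of ?z b] bS by auto
        then show "\<not> (\<forall>\<^sub>F x in nhds b. mon S delta' x * g0 x = 0)"
          by (intro monom_at_nonzero[OF fS monom_at_mult[OF monom_at_mon monom_at_unit]]) (use fS g0b in auto)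
        show "EX j<d. (dd n (b n) ^^ j) e b ~= 0" using i k(1) by (intro exI[of _ i]) auto
      qed
      then show ?thesis unfolding fe .
    qed
  qed
  have M2: "monable ?T (%x. f (theta2 x)) b" if b: "b : K2" for b
  proof (rule monable_mono[OF fT rnK(2)[OF b]])
    \<comment> \<open>In the second chart x n ^ d can be factored out completely. The remaining
      factor U is nonzero on K2 by the choice of C, so the pullback is a monomial times a
      unit.\<close>
    define U where "U x = u (theta2 x) + (\<Sum>i<d-1. mon S (%j. (d-i) * gamma j) x * x n ^ ((d-i) * (gamma j - 1)) * c i (theta2 x))" for x
    have fe: "f (theta2 x) = mon S delta x * x n ^ delta j * g0 (theta2 x) * (x n ^ d * U x)" for x
    proof -
      have thetan: "theta2 x n = x n" using jn by (simp add: theta2_def)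
      have mm: "mon S eta (theta2 x) = x n ^ eta j * mon S eta x" for eta
      proof -
        have "mon S eta (theta2 x) = mon S eta (x(j := x j * x n))" by (rule mon_cong) (simp add: theta2_def)
        then show ?thesis unfolding mon_def prod_upd_power[OF fS j(1)] .
      qed
      have t: "x n ^ ((d-i) * gamma j) * mon S (%j. (d-i) * gamma j) x * c i (theta2 x) * x n ^ i =
          x n ^ d * (mon S (%j. (d-i) * gamma j) x * x n ^ ((d-i) * (gamma j - 1)) * c i (theta2 x))" if "i < d-1" for i
      proof -
        obtain g where "gamma j = Suc g" using j(2) gr0_conv_Suc by blast
        then have "(d-i) * gamma j = (d-i) + (d-i) * (gamma j - 1)" by simp
        then have "(d-i) * gamma j + i = d + (d-i) * (gamma j - 1)" using that by simp
        then have "x n ^ ((d-i) * gamma j) * x n ^ i = x n ^ d * x n ^ ((d-i) * (gamma j - 1))" by (metis power_add)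
        then show ?thesis by (simp add: mult_ac)
      qed
      have "(\<Sum>i<d-1. x n ^ ((d-i) * gamma j) * mon S (%j. (d-i) * gamma j) x * c i (theta2 x) * x n ^ i) =
          x n ^ d * (\<Sum>i<d-1. mon S (%j. (d-i) * gamma j) x * x n ^ ((d-i) * (gamma j - 1)) * c i (theta2 x))"
        unfolding sum_distrib_left by (rule sum.cong) (auto simp: t)
      then show ?thesis unfolding f_def mm thetan U_def by (simp add: algebra_simps)
    qed
    have raU: "ra ?T U b" unfolding U_def
      by (intro ra_add ra_mult ra_power ra_sum ra_proj fT ra2[OF Suc.prems(1) b] ra_mon ra2[OF cT b]) auto
    have "U b ~= 0"
    proof -
      have bj: "\<bar>b j\<bar> <= 1/C" "1/C <= 1" using b C1 by (auto simp: K2_def)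
      have le: "\<bar>mon S (%j. (d-i) * gamma j) b\<bar> <= 1/C" if "i < d-1" for i
      proof -
        have "\<bar>mon S (%j. (d-i) * gamma j) b\<bar> = \<bar>b j\<bar> ^ ((d-i) * gamma j) * (\<Prod>l\<in>S-{j}. \<bar>b l\<bar> ^ ((d-i) * gamma l))"
          unfolding mon_def abs_prod power_abs by (rule prod.remove[OF fS j(1)])
        also have "\<dots> <= \<bar>b j\<bar> * 1"
        proof (rule mult_mono)
          show "\<bar>b j\<bar> ^ ((d-i) * gamma j) <= \<bar>b j\<bar>"
            by (rule power_le_self_real) (use bj j that in auto)
          have "\<bar>b l\<bar> ^ k <= 1" if "l : S - {j}" for l k
            using b that by (auto simp: K2_def power_0_left)
          then show "(\<Prod>l\<in>S-{j}. \<bar>b l\<bar> ^ ((d-i) * gamma l)) <= 1" by (intro prod_le_1) auto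
        qed (auto intro: prod_nonneg)
        finally show ?thesis using bj by simp
      qed
      have "\<bar>\<Sum>i<d-1. mon S (%j. (d-i) * gamma j) b * b n ^ ((d-i) * (gamma j - 1)) * c i (theta2 b)\<bar> <= (\<Sum>i<d-1. 1/C * \<bar>c i ?z\<bar>)"
      proof (rule order_trans[OF sum_abs], rule sum_mono)
        fix i assume "i : {..<d-1}"
        then have i: "i < d-1" by simp
        have "b n = 0" using b jn by (auto simp: K2_def)
        then have "\<bar>b n ^ ((d-i) * (gamma j - 1))\<bar> <= 1" by (simp add: power_0_left)
        then have "\<bar>mon S (%j. (d-i) * gamma j) b\<bar> * \<bar>b n ^ ((d-i) * (gamma j - 1))\<bar> <= 1/C * 1"
          using le[OF i] C1 by (intro mult_mono) auto
        then show "\<bar>mon S (%j. (d-i) * gamma j) b * b n ^ ((d-i) * (gamma j - 1)) * c i (theta2 b)\<bar> <= 1/C * \<bar>c i ?z\<bar>"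
          unfolding thetaK(2)[OF b] abs_mult by (intro mult_right_mono) auto
      qed
      also have "\<dots> = Q / C" by (simp add: Q_def sum_divide_distrib)
      finally have "\<bar>\<Sum>i<d-1. mon S (%j. (d-i) * gamma j) b * b n ^ ((d-i) * (gamma j - 1)) * c i (theta2 b)\<bar> < \<bar>u ?z\<bar>" using QC by simp
      then show ?thesis unfolding U_def thetaK(2)[OF b] by auto
    qed
    moreover have "g0 (theta2 b) ~= 0" using g0(2) thetaK(2)[OF b] by simp
    moreover have "monom_at ?T (%x. x n ^ k) b" for k
      using monom_at_power[OF fT monom_at_coord[OF fT, of n 0 b], of k] by simp
    ultimately show "monom_at ?T (%x. f (theta2 x)) b"
      unfolding fe
      by (intro monom_at_mult[OF monom_at_mult[OF monom_at_mult[OF monom_at_mon[OF fT]] monom_at_unit] monom_at_mult[OF _ monom_at_unit]]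
          raU ra2[OF g0T b]) auto
  qed
  have "monable ?T f ?z"
  proof (rule monable_trans[OF fT])
    fix W :: "(nat => real) set" assume W: "open W" "?z : W"
    show "EX Theta. finite Theta &
     (ALL p:Theta. compact (snd p) & (ALL x. rn ?T (fst p x)) &
        (ALL b:snd p. (ALL i:?T. ra ?T (%x. fst p x i) b) & fst p b : W & monable ?T (%x. f (fst p x)) b)) &
     (ALL N. (ALL p:Theta. open (N p) & snd p \<subseteq> N p) -->
        (\<forall>\<^sub>F x in nhds ?z. rn ?T x --> (EX p:Theta. EX v:N p. rn ?T v & x = fst p v)))"
    proof (intro exI[of _ "{(theta1,K1),(theta2,K2)}"] conjI allI impI)
      show "ALL p:{(theta1,K1),(theta2,K2)}. compact (snd p) & (ALL x. rn ?T (fst p x)) &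
        (ALL b:snd p. (ALL i:?T. ra ?T (%x. fst p x i) b) & fst p b : W & monable ?T (%x. f (fst p x)) b)"
        using cK rntheta ratheta thetaK M1 M2 W by simp
      fix N :: "((nat => real) => nat => real) \<times> (nat => real) set => (nat => real) set"
      assume N: "ALL p:{(theta1,K1),(theta2,K2)}. open (N p) & snd p \<subseteq> N p"
      obtain epsilon1 where epsilon1: "epsilon1 > 0" "\<And>x b. rn ?T x ==> b : K1 ==> (\<And>i. i : ?T ==> dist (x i) (b i) < epsilon1) ==> x : N (theta1,K1)"
        using compact_tube[OF cK(1) _ _ fT rnK(1), of "N (theta1,K1)"] N by auto
      obtain epsilon2 where epsilon2: "epsilon2 > 0" "\<And>x b. rn ?T x ==> b : K2 ==> (\<And>i. i : ?T ==> dist (x i) (b i) < epsilon2) ==> x : N (theta2,K2)"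
        using compact_tube[OF cK(2) _ _ fT rnK(2), of "N (theta2,K2)"] N by auto
      have "\<forall>\<^sub>F x in nhds ?z. x : {x. ALL i:?T. dist (x i) (?z i) < min epsilon1 epsilon2}"
        by (rule eventually_nhds_in_open[OF open_polybox[OF fT]]) (use epsilon1 epsilon2 in auto)
      then show "\<forall>\<^sub>F x in nhds ?z. rn ?T x --> (EX p:{(theta1,K1),(theta2,K2)}. EX v:N p. rn ?T v & x = fst p v)"
      proof (rule eventually_mono, intro impI)
        fix x :: "nat => real" assume "x : {x. ALL i:?T. dist (x i) (?z i) < min epsilon1 epsilon2}" and rx: "rn ?T x"
        then have x: "\<And>i. i : ?T ==> \<bar>x i\<bar> < epsilon1" "\<And>i. i : ?T ==> \<bar>x i\<bar> < epsilon2" by (auto simp: dist_real_def)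
        show "EX p:{(theta1,K1),(theta2,K2)}. EX v:N p. rn ?T v & x = fst p v"
        proof (cases "\<bar>x n\<bar> <= C * \<bar>x j\<bar>")
          case True
          \<comment> \<open>If x j = 0 then x n = 0 in this case, and division by zero supplies the
            value 0 that the preimage needs.\<close>
          define v where "v = x(n := x n / x j)"
          define b where "b = ?z(n := x n / x j)"
          have "\<bar>x n / x j\<bar> <= C" using True C1 by (cases "x j = 0") (auto simp: abs_divide field_simps)
          then have "b : K1" by (auto simp: b_def K1_def)
          moreover have rv: "rn ?T v" using rx by (auto simp: v_def rn_def)
          ultimately have "v : N (theta1,K1)" using x(1) epsilon1(1) by (intro epsilon1(2)[of v b]) (auto simp: v_def b_def dist_real_def)
          moreover have "x = theta1 v" using rx jn True by (cases "x j = 0") (auto simp: theta1_def v_def rn_def fun_eq_iff)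
          ultimately show ?thesis using rv by force
        next
          case False
          define v where "v = x(j := x j / x n)"
          define b where "b = ?z(j := x j / x n)"
          have xn: "x n ~= 0" using False C1 by auto
          have "C * \<bar>x j\<bar> <= \<bar>x n\<bar>" using False by simp
          then have "\<bar>x j / x n\<bar> <= 1/C" using xn C1 by (simp add: abs_divide field_simps)
          then have "b : K2" by (auto simp: b_def K2_def)
          moreover have rv: "rn ?T v" using rx j by (auto simp: v_def rn_def)
          ultimately have "v : N (theta2,K2)" using x(2) epsilon2(1) by (intro epsilon2(2)[of v b]) (auto simp: v_def b_def dist_real_def)
          moreover have "x = theta2 v" using rx jn xn by (auto simp: theta2_def v_def rn_def fun_eq_iff)
          ultimately show ?thesis using rv by force
        qed
      qed
    qed auto
  qed
  then show ?case unfolding f_def .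
qed

text \<open>An index with the least total sum works: for pairwise comparable families a smaller
  entry anywhere would give a smaller sum.\<close>

lemma ex_pointwise_minimal:
  fixes q :: "nat => nat => nat"
  assumes "finite I" "I ~= {}" "finite S"
    and tot: "\<And>i k. i : I ==> k : I ==> (ALL j:S. q i j <= q k j) \<or> (ALL j:S. q k j <= q i j)"
  obtains i0 where "i0 : I" "\<And>i j. i : I ==> j : S ==> q i0 j <= q i j"
proof -
  obtain i0 where i0: "i0 : I" "\<And>i. i : I ==> (\<Sum>j\<in>S. q i0 j) <= (\<Sum>j\<in>S. q i j)"
    using ex_min_if_finite[of "(%i. \<Sum>j\<in>S. q i j) ` I"] assms(1,2) by (auto simp: not_less)
  show thesis
  proof (rule that[OF i0(1)])
    fix i j assume ij: "i : I" "j : S"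
    from tot[OF i0(1) ij(1)] show "q i0 j <= q i j"
    proof
      assume le: "ALL j:S. q i j <= q i0 j"
      show ?thesis
      proof (rule ccontr)
        assume "\<not> ?thesis"
        then have "(\<Sum>j\<in>S. q i j) < (\<Sum>j\<in>S. q i0 j)"
          using sum_strict_mono_ex1[OF assms(3) le] ij(2) by (auto simp: not_le)
        then show False using i0(2)[OF ij(1)] by simp
      qed
    qed (use ij in auto)
  qed
qed

lemma root_less_iff_power:
  assumes "D > 0" "0 <= x" "0 < r" "x < r ^ D" shows "root D x < r"
  using assms by (metis real_root_less_iff real_root_power_cancel less_imp_le)

text \<open>The coefficient of x n ^ i has weight d - i, so the exponents to compare are beta i /
  (d-i). The least of them need not be integral. Substituting a signed power of exponent D = d! for
  each coordinate in S makes it an integral gamma, and coefficient i becomes the monomial of (d-i)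
  gamma times some c i, with c i0 a unit. This is the form that \<open>blowup_monable\<close>
  requires.\<close>

lemma monomial_coeffs_monable:
  fixes w :: "nat => (nat => real) => real" and beta :: "nat => nat => nat"
  assumes fS: "finite S" and n: "n \<notin> S"
    and IHd: "\<And>e g a. rn (insert n S) a ==> ra (insert n S) e a ==> ra S g a ==> \<not> (\<forall>\<^sub>F x in nhds a. g x = 0) ==>
       (EX j<d. (dd n (a n) ^^ j) e a ~= 0) ==> monable (insert n S) (%x. g x * e x) a"
    and g0: "ra S g0 (%_. 0)" "g0 (%_. 0) ~= 0"
    and I: "I \<subseteq> {..<d-1}" and w: "\<And>i. i : I ==> ra S (w i) (%_. 0)" "\<And>i. i : I ==> w i (%_. 0) ~= 0"
    and u: "ra (insert n S) u (%_. 0)" "u (%_. 0) ~= 0"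
    and cmp: "\<And>i k. i : I ==> k : I ==> (ALL j:S. fact d div (d-i) * beta i j <= fact d div (d-k) * beta k j) \<or>
        (ALL j:S. fact d div (d-k) * beta k j <= fact d div (d-i) * beta i j)"
  shows "monable (insert n S) (%x. mon S delta x * g0 x * (x n ^ d * u x +
       (\<Sum>i<d-1. (if i : I then mon S (beta i) x * w i x else 0) * x n ^ i))) (%_. 0)"
proof -
  let ?T = "insert n S" and ?z = "%_::nat. 0::real"
  have fT: "finite ?T" using fS by auto
  define f where "f x = mon S delta x * g0 x * (x n ^ d * u x +
       (\<Sum>i<d-1. (if i : I then mon S (beta i) x * w i x else 0) * x n ^ i))" for x
  have "monable ?T f ?z"
  proof (cases "I = {}")
    case True
    have "f = (%x. mon S delta x * g0 x * (x n ^ d * u x))" using True by (auto simp: f_def)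
    moreover have "monom_at ?T (%x. x n ^ d) ?z"
      using monom_at_power[OF fT monom_at_coord[OF fT, of n 0 ?z], of d] by simp
    ultimately have "monom_at ?T f ?z"
      using monom_at_mult[OF monom_at_mult[OF monom_at_mon[OF fT] monom_at_unit[OF ra_mono[OF g0(1)] g0(2)]]
          monom_at_mult[OF _ monom_at_unit[OF u]]] fT by auto
    then show ?thesis by (rule monable_mono[OF fT, rotated]) (simp add: rn_def)
  next
    case False
    have fI: "finite I" using I finite_subset by blast
    obtain i0 where i0: "i0 : I" "\<And>i j. i : I ==> j : S ==> fact d div (d-i0) * beta i0 j <= fact d div (d-i) * beta i j"
      using ex_pointwise_minimal[OF fI False fS, of "%i j. fact d div (d-i) * beta i j"] cmp by blast
    have d: "d >= 1" "i0 < d - 1" using i0(1) I by auto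
    define D :: nat where "D = fact d"
    define gamma where "gamma j = fact d div (d-i0) * beta i0 j" for j
    have D0: "D > 0" by (simp add: D_def)
    have pd: "(d-i) * (fact d div (d-i)) = D" if "i < d" for i
      unfolding D_def by (rule dvd_mult_div_cancel, rule dvd_fact) (use that in auto)
    have gammale: "(d-i) * gamma j <= D * beta i j" if "i : I" "j : S" for i j
    proof -
      have "i < d" using that I by auto
      have "(d-i) * gamma j <= (d-i) * (fact d div (d-i) * beta i j)" using i0(2)[OF that] by (simp add: gamma_def)
      also have "\<dots> = D * beta i j" using pd[OF \<open>i < d\<close>] by (metis mult.assoc)
      finally show ?thesis .
    qed
    have gammaeq: "(d-i0) * gamma j = D * beta i0 j" for j
      using pd[of i0] d by (simp add: gamma_def flip: mult.assoc)
    \<comment> \<open>D-th powers reach only one orthant when D is even; the signs indexed by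
      subsets A of S supply the others.\<close>
    define sn where "sn A j = (if j : A then -1 else 1 :: real)" for A :: "nat set" and j :: nat
    define sg where "sg A eta = (\<Prod>j\<in>S. sn A j ^ eta j)" for A :: "nat set" and eta :: "nat => nat"
    have sg0: "sg A eta ~= 0" for A eta using fS by (auto simp: sg_def sn_def)
    define theta where "theta A x = (%i. if i : S then sn A i * x i ^ D else if i = n then x n else 0)" for A :: "nat set" and x :: "nat => real"
    have raS: "ra S (%x. theta A x i) ?z" if "i : S" for i A
      using that fS by (simp add: theta_def) (intro ra_mult ra_power ra_const ra_proj)
    have raT: "ra ?T (%x. theta A x i) ?z" if "i : ?T" for i A
    proof (cases "i = n")
      case True then show ?thesis using n fT by (simp add: theta_def)
    next
      case False then show ?thesis using that fT by (intro ra_mono[OF raS]) auto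
    qed
    have thetaz: "theta A ?z = ?z" for A using D0 by (auto simp: theta_def fun_eq_iff)
    have rntheta: "rn ?T (theta A x)" for A x by (auto simp: theta_def rn_def)
    have cS: "ra S (%x. h (theta A x)) ?z" if "ra S h ?z" for h A
      by (rule ra_compose[where Phi = "theta A", OF _ fS raS]) (use that thetaz in auto)
    have cT: "ra ?T (%x. h (theta A x)) ?z" if "ra ?T h ?z" for h A
      by (rule ra_compose[where Phi = "theta A", OF _ fT raT]) (use that thetaz in auto)
    have mtheta: "mon S eta (theta A x) = sg A eta * mon S (%j. D * eta j) x" for A eta x
      unfolding mon_def sg_def prod.distrib[symmetric]
      by (rule prod.cong) (simp_all add: theta_def power_mult_distrib power_mult)
    have M: "monable ?T (%x. f (theta A x)) ?z" for A
    proof -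
      define c where "c i x = (if i : I then sg A (beta i) * mon S (%j. D * beta i j - (d-i) * gamma j) x * w i (theta A x) else 0)" for i x
      have "f (theta A x) = mon S (%j. D * delta j) x * (sg A delta * g0 (theta A x)) * (x n ^ d * u (theta A x) +
          (\<Sum>i<d-1. mon S (%j. (d-i) * gamma j) x * c i x * x n ^ i))" for x
      proof -
        have thetan: "theta A x n = x n" using n by (simp add: theta_def)
        have "(\<Sum>i<d-1. (if i : I then mon S (beta i) (theta A x) * w i (theta A x) else 0) * x n ^ i) =
            (\<Sum>i<d-1. mon S (%j. (d-i) * gamma j) x * c i x * x n ^ i)"
        proof (rule sum.cong[OF refl])
          fix i
          show "(if i : I then mon S (beta i) (theta A x) * w i (theta A x) else 0) * x n ^ i = mon S (%j. (d-i) * gamma j) x * c i x * x n ^ i"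
          proof (cases "i : I")
            case True
            have "mon S (%j. D * beta i j) x = mon S (%j. (d-i) * gamma j) x * mon S (%j. D * beta i j - (d-i) * gamma j) x"
              unfolding mon_def prod.distrib[symmetric] power_add[symmetric]
              by (rule prod.cong) (auto simp: gammale[OF True])
            then show ?thesis using True by (simp add: c_def mtheta)
          qed (simp add: c_def)
        qed
        note s = this
        have "f (theta A x) = mon S delta (theta A x) * g0 (theta A x) * (x n ^ d * u (theta A x) +
            (\<Sum>i<d-1. mon S (%j. (d-i) * gamma j) x * c i x * x n ^ i))"
          unfolding f_def thetan s ..
        also have "mon S delta (theta A x) * g0 (theta A x) = mon S (%j. D * delta j) x * (sg A delta * g0 (theta A x))"
          unfolding mtheta[of delta A x] by (simp only: mult_ac)
        finally show ?thesis .
      qed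
      moreover have "monable ?T (%x. mon S (%j. D * delta j) x * (sg A delta * g0 (theta A x)) * (x n ^ d * u (theta A x) +
          (\<Sum>i<d-1. mon S (%j. (d-i) * gamma j) x * c i x * x n ^ i))) ?z"
      proof (rule blowup_monable[OF fS n d(1) IHd _ _ _ _ _ _ refl])
        show "ra S (%x. sg A delta * g0 (theta A x)) ?z" by (rule ra_mult[OF ra_const[OF fS] cS[OF g0(1)]])
        show "sg A delta * g0 (theta A ?z) ~= 0" using sg0 g0 thetaz by simp
        show "ra S (c i) ?z" for i unfolding c_def
          by (cases "i : I") (auto intro!: ra_mult cS w ra_const fS ra_mon)
        have "mon S (%j. D * beta i0 j - (d-i0) * gamma j) ?z = 1" unfolding mon_def by (rule prod.neutral) (simp add: gammaeq)
        then have "c i0 ?z ~= 0" using i0(1) sg0 w thetaz by (simp add: c_def)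
        then show "EX i<d-1. c i ?z ~= 0" using d by blast
        show "ra ?T (%x. u (theta A x)) ?z" by (rule cT[OF u(1)])
        show "u (theta A ?z) ~= 0" using u thetaz by simp
      qed
      ultimately show ?thesis by simp
    qed
    show ?thesis
    proof (rule monable_trans[OF fT])
      fix W :: "(nat => real) set" assume W: "open W" "?z : W"
      let ?Theta = "(%A. (theta A, {?z})) ` Pow S"
      show "EX Theta. finite Theta &
       (ALL p:Theta. compact (snd p) & (ALL x. rn ?T (fst p x)) &
          (ALL b:snd p. (ALL i:?T. ra ?T (%x. fst p x i) b) & fst p b : W & monable ?T (%x. f (fst p x)) b)) &
       (ALL N. (ALL p:Theta. open (N p) & snd p \<subseteq> N p) -->
          (\<forall>\<^sub>F x in nhds ?z. rn ?T x --> (EX p:Theta. EX v:N p. rn ?T v & x = fst p v)))"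
      proof (intro exI[of _ ?Theta] conjI allI impI)
        show "finite ?Theta" using fS by simp
        show "ALL p:?Theta. compact (snd p) & (ALL x. rn ?T (fst p x)) &
          (ALL b:snd p. (ALL i:?T. ra ?T (%x. fst p x i) b) & fst p b : W & monable ?T (%x. f (fst p x)) b)"
          using rntheta raT thetaz W M by simp
        fix N :: "((nat => real) => nat => real) \<times> (nat => real) set => (nat => real) set"
        assume N: "ALL p:?Theta. open (N p) & snd p \<subseteq> N p"
        define N0 where "N0 = (\<Inter>p\<in>?Theta. N p)"
        have "open N0" "?z : N0" using N fS by (auto simp: N0_def intro!: open_INT)
        then obtain r where r: "r > 0" "\<And>x. (ALL i:?T. dist (x i) (?z i) < r) ==> (ALL i. i \<notin> ?T --> x i = ?z i) ==> x : N0"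
          using open_fun_box[OF _ _ fT, of N0 ?z] by blast
        \<comment> \<open>Coordinates in S are replaced by D-th roots and must be below r ^ D, while
          x n is kept and must be below r.\<close>
        define s where "s = min r (r ^ D)"
        have s: "s > 0" "s <= r" "s <= r ^ D" using r by (auto simp: s_def)
        have "\<forall>\<^sub>F x in nhds ?z. x : {x. ALL i:?T. dist (x i) (?z i) < s}"
          by (rule eventually_nhds_in_open[OF open_polybox[OF fT]]) (use s in auto)
        then show "\<forall>\<^sub>F x in nhds ?z. rn ?T x --> (EX p:?Theta. EX v:N p. rn ?T v & x = fst p v)"
        proof (rule eventually_mono, intro impI)
          fix x :: "nat => real" assume "x : {x. ALL i:?T. dist (x i) (?z i) < s}" and rx: "rn ?T x"
          then have x: "\<And>i. i : ?T ==> \<bar>x i\<bar> < s" by (auto simp: dist_real_def)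
          define A where "A = {i:S. x i < 0}"
          define v where "v = (%i. if i : S then root D \<bar>x i\<bar> else x i)"
          have rv: "rn ?T v" using rx by (auto simp: v_def rn_def)
          have "v : N0"
          proof (rule r(2))
            show "ALL i:?T. dist (v i) (?z i) < r"
            proof
              fix i assume i: "i : ?T"
              show "dist (v i) (?z i) < r"
              proof (cases "i : S")
                case True
                have "root D \<bar>x i\<bar> < r" by (rule root_less_iff_power) (use D0 r s x[OF i] in auto)
                moreover have "0 <= root D \<bar>x i\<bar>" using D0 by simp
                ultimately show ?thesis using True by (simp add: v_def dist_real_def)
              next
                case False
                then show ?thesis using x[OF i] s by (simp add: v_def dist_real_def)
              qed
            qed
          qed (use rv in \<open>auto simp: rn_def\<close>)
          then have "v : N (theta A, {?z})" by (auto simp: N0_def A_def)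
          moreover have "x = theta A v"
          proof
            fix i
            have "root D \<bar>x i\<bar> ^ D = \<bar>x i\<bar>" using D0 by simp
            then show "x i = theta A v i"
              using rx n by (cases "i : S") (auto simp: theta_def v_def A_def sn_def rn_def abs_if)
          qed
          ultimately show "EX p:?Theta. EX v:N p. rn ?T v & x = fst p v"
          proof (intro bexI[of _ "(theta A, {?z})"] bexI[of _ v] conjI)
            show "(theta A, {?z}) : ?Theta" by (auto simp: A_def)
          qed (use rv in simp_all)
        qed
      qed
    qed
  qed
  then show ?thesis unfolding f_def .
qed

text \<open>Charts that monomialize P in the variables S are extended by the identity in x n. They
  move only the coefficients of f, and f remains to be treated over the points of the cube.\<close>

lemma monable_lift:
  assumes fS: "finite S" and n: "n \<notin> S" and a: "rn S a" and P: "monable S P a" and W0: "open W0" "a : W0"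
    and main: "\<And>psi v. chart S P W0 psi ==> v : cube S ==> monable (insert n S) (%x. f ((psi x)(n := x n))) v"
  shows "monable (insert n S) f a"
proof (rule monable_trans)
  let ?T = "insert n S"
  show fT: "finite ?T" using fS by simp
  fix W assume W: "open W" "a : W"
  obtain Psi where Psi: "finite Psi" "ALL psi:Psi. chart S P (W \<inter> W0) psi" "\<forall>\<^sub>F x in nhds a. rn S x --> (EX psi:Psi. x : psi ` cube S)"
    using P[unfolded monable_def, rule_format, of "W \<inter> W0"] open_Int[OF W(1) W0(1)] W(2) W0(2) by blast
  define theta where "theta psi x = (psi x)(n := x n)" for psi :: "(nat => real) => nat => real" and x
  have ch: "chart S P W0 psi" if "psi : Psi" for psi using Psi(2) that unfolding chart_def by blast
  have cu0: "b n = 0" if "b : cube S" for b using that n by (auto simp: cube_def rn_def)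
  have rnpsi: "rn S (psi x)" if "psi : Psi" for psi x using Psi(2) that unfolding chart_def by blast
  have rapsi: "ra S (%x. psi x i) b" if "psi : Psi" "b : cube S" "i : S" for psi b i using Psi(2) that unfolding chart_def by blast
  have Wpsi: "psi b : W" if "psi : Psi" "b : cube S" for psi b using Psi(2) that unfolding chart_def by blast
  have rnc: "rn ?T b" if "b : cube S" for b using that by (auto simp: cube_def rn_def)
  let ?Theta = "(%psi. (theta psi, cube S)) ` Psi"
  show "EX Theta. finite Theta &
     (ALL p:Theta. compact (snd p) & (ALL x. rn ?T (fst p x)) &
        (ALL b:snd p. (ALL i:?T. ra ?T (%x. fst p x i) b) & fst p b : W & monable ?T (%x. f (fst p x)) b)) &
     (ALL N. (ALL p:Theta. open (N p) & snd p \<subseteq> N p) -->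
        (\<forall>\<^sub>F x in nhds a. rn ?T x --> (EX p:Theta. EX v:N p. rn ?T v & x = fst p v)))"
  proof (intro exI[of _ ?Theta] conjI allI impI)
    show "finite ?Theta" using Psi(1) by simp
    have 1: "rn ?T (theta psi x)" if "psi : Psi" for psi x using rnpsi[OF that, of x] by (auto simp: theta_def rn_def)
    have 2: "ra ?T (%x. theta psi x i) b" if "psi : Psi" "b : cube S" "i : ?T" for psi b i
      using that ra_mono[OF rapsi[OF that(1,2)], of i ?T] fT n by (cases "i = n") (auto simp: theta_def)
    have 3: "theta psi b : W" if "psi : Psi" "b : cube S" for psi b
    proof -
      have "theta psi b = psi b" using cu0[OF that(2)] rnpsi[OF that(1), of b] n by (auto simp: theta_def rn_def)
      then show ?thesis using Wpsi[OF that] by simp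
    qed
    have 4: "monable ?T (%x. f (theta psi x)) b" if "psi : Psi" "b : cube S" for psi b
      unfolding theta_def by (rule main[OF ch[OF that(1)] that(2)])
    show "ALL p:?Theta. compact (snd p) & (ALL x. rn ?T (fst p x)) &
        (ALL b:snd p. (ALL i:?T. ra ?T (%x. fst p x i) b) & fst p b : W & monable ?T (%x. f (fst p x)) b)"
      using 1 2 3 4 compact_cube by simp
    fix N :: "((nat => real) => nat => real) \<times> (nat => real) set => (nat => real) set"
    assume N: "ALL p:?Theta. open (N p) & snd p \<subseteq> N p"
    define N0 where "N0 = (\<Inter>p\<in>?Theta. N p)"
    have N0: "open N0" "cube S \<subseteq> N0" using N Psi(1) by (auto simp: N0_def intro!: open_INT)
    obtain epsilon where epsilon: "epsilon > 0" "\<And>x b. rn ?T x ==> b : cube S ==> (\<And>i. i : ?T ==> dist (x i) (b i) < epsilon) ==> x : N0"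
      using compact_tube[OF compact_cube N0(2,1) fT rnc] by blast
    have an: "a n = 0" using a n by (auto simp: rn_def)
    have "\<forall>\<^sub>F x in nhds a. x : {x. ALL i:{n}. dist (x i) (a i) < epsilon}"
      by (rule eventually_nhds_in_open[OF open_polybox]) (use epsilon in auto)
    moreover have "\<forall>\<^sub>F x in nhds a. rn S (x(n := 0)) --> (EX psi:Psi. x(n := 0) : psi ` cube S)"
    proof -
      have "continuous_on UNIV (%x::nat=>real. x(n := 0))"
        by (rule continuous_on_coordinatewise_then_product, rename_tac j, case_tac "j = n")
          (auto intro: continuous_on_product_then_coordinatewise continuous_on_id)
      then have "isCont (%x::nat=>real. x(n := 0)) a" by (simp add: continuous_on_eq_continuous_at)
      moreover have "a(n := 0) = a" using an by auto
      ultimately have "filterlim (%x. x(n := 0)) (nhds a) (nhds a)" using isCont_nhds by fastforce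
      then show ?thesis using Psi(3) unfolding filterlim_iff by blast
    qed
    ultimately show "\<forall>\<^sub>F x in nhds a. rn ?T x --> (EX p:?Theta. EX v:N p. rn ?T v & x = fst p v)"
    proof (rule eventually_elim2, intro impI)
      fix x assume x: "x : {x. ALL i:{n}. dist (x i) (a i) < epsilon}" "rn S (x(n := 0)) --> (EX psi:Psi. x(n := 0) : psi ` cube S)" "rn ?T x"
      have "rn S (x(n := 0))" using x(3) by (auto simp: rn_def)
      then obtain psi v where v: "psi : Psi" "v : cube S" "x(n := 0) = psi v" using x(2) by blast
      define v' where "v' = v(n := x n)"
      have rv: "rn ?T v'" using rnc[OF v(2)] by (auto simp: v'_def rn_def)
      have "v' : N0"
        by (rule epsilon(2)[OF rv v(2)]) (use x(1) an cu0[OF v(2)] epsilon(1) in \<open>auto simp: v'_def\<close>)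
      then have "v' : N (theta psi, cube S)" using v(1) by (auto simp: N0_def)
      moreover have "x = theta psi v'"
      proof
        fix i
        have "psi v' i = psi v i" if "i : S"
          by (rule depD[OF raD(2)[OF rapsi[OF v(1,2) that]]]) (use n in \<open>auto simp: v'_def\<close>)
        moreover have "psi v' i = psi v i" if "i \<notin> S" using rnpsi[OF v(1)] that by (auto simp: rn_def)
        ultimately have "psi v' i = (x(n := 0)) i" using v(3) by metis
        then show "x i = theta psi v' i" by (auto simp: theta_def v'_def split: if_splits)
      qed
      ultimately show "EX p:?Theta. EX v:N p. rn ?T v & x = fst p v"
        using rv v(1) by (intro bexI[of _ "(theta psi, cube S)"] bexI[of _ v']) auto
    qed
  qed
qed

section \<open>Reduction of a germ to one with monomial coefficients\<close>

lemma nonzero_germ_prod: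
  assumes "finite J" "finite S" "\<And>j. j : J ==> ra S (f j) a" "\<And>j. j : J ==> \<not> (\<forall>\<^sub>F x in nhds a. f j x = 0)"
  shows "\<not> (\<forall>\<^sub>F x in nhds a. (\<Prod>j\<in>J. f j x) = 0)"
  using assms(1,3,4)
proof (induction J rule: finite_induct)
  case (insert j J)
  have "ra S (%x. \<Prod>j\<in>J. f j x) a" using insert assms(2) by (intro ra_prod) auto
  then show ?case using insert ra_mult_zero[of S "f j" a "%x. \<Prod>j\<in>J. f j x"] by auto
qed simp

lemma prod_power_power:
  fixes y :: "nat => real"
  shows "(\<Prod>j\<in>S. y j ^ beta j) ^ q = (\<Prod>j\<in>S. y j ^ (q * beta j))"
  unfolding prod_power_distrib by (rule prod.cong) (simp_all add: mult.commute flip: power_mult)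

lemma monomE:
  assumes "monom_at S f v"
  obtains alpha u where "ra S u v" "u v ~= 0" "\<forall>\<^sub>F x in nhds v. f x = (\<Prod>i\<in>S. (x i - v i) ^ alpha i) * u x"
  using assms unfolding monom_at_def by blast

text \<open>One application of the hypothesis in the variables S makes everything monomial: P is the
  product of g, of the nonzero coefficients and of the nonzero differences C i ^ p i - C k ^ p k,
  where p i = d! / (d-i) equalizes the weights. Factors of P inherit normal crossings, and by
  \<open>monomials_comparable\<close> the differences make the exponents of the C i
  comparable.\<close>

lemma depressed_monable:
  fixes C :: "nat => (nat => real) => real"
  assumes fS: "finite S" and n: "n \<notin> S"
    and IHS: "\<And>f a. ra S f a ==> rn S a ==> \<not> (\<forall>\<^sub>F x in nhds a. f x = 0) ==> monable S f a"
    and IHd: "\<And>e g a. rn (insert n S) a ==> ra (insert n S) e a ==> ra S g a ==> \<not> (\<forall>\<^sub>F x in nhds a. g x = 0) ==>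
       (EX j<d. (dd n (a n) ^^ j) e a ~= 0) ==> monable (insert n S) (%x. g x * e x) a"
    and b: "rn S b" and g: "ra S g b" "\<not> (\<forall>\<^sub>F x in nhds b. g x = 0)"
    and C: "\<And>i. i < d ==> ra S (C i) b" and u: "ra (insert n S) u b" "u b ~= 0"
    and dep0: "d >= 1 ==> \<forall>\<^sub>F x in nhds b. C (d-1) x = 0"
  shows "monable (insert n S) (%x. g x * ((\<Sum>i<d. C i x * x n ^ i) + x n ^ d * u x)) b"
proof -
  let ?T = "insert n S" and ?z = "%_::nat. 0::real"
  have fT: "finite ?T" using fS by auto
  define I where "I = {i. i < d & \<not> (\<forall>\<^sub>F x in nhds b. C i x = 0)}"
  have fI: "finite I" by (simp add: I_def)
  have Id: "I \<subseteq> {..<d-1}"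
  proof
    fix i assume "i : I"
    then have "i < d" "i ~= d - 1" using dep0 by (auto simp: I_def)
    then show "i : {..<d-1}" by auto
  qed
  define p where "p i = fact d div (d-i)" for i :: nat
  define D where "D q x = C (fst q) x ^ p (fst q) - C (snd q) x ^ p (snd q)" for q x
  have raDq: "ra S (D q) b" if "q : I \<times> I" for q
    using that unfolding D_def by (intro ra_diff ra_power C) (auto simp: I_def)
  \<comment> \<open>Differences that vanish identically are left out, since P must be a nonzero
    germ; for those pairs comparability is obtained with z = 0.\<close>
  define J where "J = {q : I \<times> I. \<not> (\<forall>\<^sub>F x in nhds b. D q x = 0)}"
  have fJ: "finite J" unfolding J_def using fI by auto
  define P where "P x = g x * ((\<Prod>i\<in>I. C i x) * (\<Prod>q\<in>J. D q x))" for x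
  have raCI: "ra S (C i) b" if "i : I" for i using that C by (auto simp: I_def)
  have raP1: "ra S (%x. \<Prod>i\<in>I. C i x) b" and raP2: "ra S (%x. \<Prod>q\<in>J. D q x) b"
    using fS raCI raDq by (auto intro!: ra_prod simp: J_def)
  have raP: "ra S P b" unfolding P_def by (intro ra_mult g raP1 raP2)
  have nz1: "\<not> (\<forall>\<^sub>F x in nhds b. (\<Prod>i\<in>I. C i x) = 0)"
    by (rule nonzero_germ_prod[OF fI fS raCI]) (auto simp: I_def)
  have nz2: "\<not> (\<forall>\<^sub>F x in nhds b. (\<Prod>q\<in>J. D q x) = 0)"
    by (rule nonzero_germ_prod[OF fJ fS raDq]) (auto simp: J_def)
  have nzP: "\<not> (\<forall>\<^sub>F x in nhds b. P x = 0)"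
    using ra_mult_zero[OF g(1) ra_mult[OF raP1 raP2]] ra_mult_zero[OF raP1 raP2] g(2) nz1 nz2
    unfolding P_def by blast
  have mP: "monable S P b" by (rule IHS[OF raP b nzP])
  have "\<forall>\<^sub>F x in nhds b. ra S g x & ra ?T u x & u x ~= 0 & (ALL i:I. ra S (C i) x) &
      (ALL i:{..<d} - I. C i x = 0) & (ALL q:I\<times>I - J. D q x = 0)"
  proof (intro eventually_conj eventually_ball_finite ballI ra_eventually)
    show "\<forall>\<^sub>F x in nhds b. u x ~= 0"
      using isCont_nhds[OF isCont_ra[OF u(1)]] u(2) by (rule tendsto_imp_eventually_ne)
  qed (use g u fI raCI in \<open>auto simp: I_def J_def\<close>)
  then obtain W0 where W0: "open W0" "b : W0" "\<And>x. x : W0 ==> ra S g x & ra ?T u x & u x ~= 0 & (ALL i:I. ra S (C i) x) &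
      (ALL i:{..<d} - I. C i x = 0) & (ALL q:I\<times>I - J. D q x = 0)"
    unfolding eventually_nhds by blast
  show ?thesis
  proof (rule monable_lift[OF fS n b mP W0(1,2)])
    fix psi v assume ch: "chart S P W0 psi" and v: "v : cube S"
    have rapsi: "ra S (%x. psi x i) v" if "i : S" for i using ch v that unfolding chart_def by blast
    have rnpsi: "rn S (psi x)" for x using ch unfolding chart_def by blast
    have psiW: "psi v : W0" using ch v unfolding chart_def by blast
    have mpsi: "monom_at S (%x. P (psi x)) v" using ch v unfolding chart_def by blast
    have rv: "rn S v" using v by (simp add: cube_def)
    have vn: "v n = 0" using rv n by (auto simp: rn_def)
    obtain V where V: "open V" "v : V" "\<And>x. x : V ==> psi x : W0"
      using ra_map_nbhd[OF fS rapsi rnpsi W0(1) psiW] by metis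
    have comp: "ra S (%x. h (psi x)) v" if "ra S h (psi v)" for h
      by (rule ra_compose[where Phi = psi, OF that fS rapsi])
    have rag: "ra S (%x. g (psi x)) v" using W0(3)[OF psiW] by (intro comp) blast
    have raC: "ra S (%x. C i (psi x)) v" if "i : I" for i using W0(3)[OF psiW] that by (intro comp) blast
    have raDpsi: "ra S (%x. D q (psi x)) v" if "q : I \<times> I" for q
      using that unfolding D_def by (intro ra_diff ra_power raC) auto
    have r1: "ra S (%x. \<Prod>i\<in>I. C i (psi x)) v" and r2: "ra S (%x. \<Prod>q\<in>J. D q (psi x)) v"
      using fS raC raDpsi by (auto intro!: ra_prod simp: J_def)
    have mg: "monom_at S (%x. g (psi x)) v"
      by (rule monom_at_factor[OF mpsi[unfolded P_def] rag ra_mult[OF r1 r2]])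
    have "monom_at S (%x. ((\<Prod>i\<in>I. C i (psi x)) * (\<Prod>q\<in>J. D q (psi x))) * g (psi x)) v"
      using mpsi by (simp add: P_def mult.commute)
    then have m12: "monom_at S (%x. (\<Prod>i\<in>I. C i (psi x)) * (\<Prod>q\<in>J. D q (psi x))) v"
      by (rule monom_at_factor[OF _ ra_mult[OF r1 r2] rag])
    have m1: "monom_at S (%x. \<Prod>i\<in>I. C i (psi x)) v" by (rule monom_at_factor[OF m12 r1 r2])
    have m2: "monom_at S (%x. \<Prod>q\<in>J. D q (psi x)) v"
      by (rule monom_at_factor[OF _ r2 r1]) (use m12 in \<open>simp add: mult.commute\<close>)
    have mC: "monom_at S (%x. C i (psi x)) v" if "i : I" for i
      by (rule monom_at_prod_factor[OF m1 fI _ that]) (rule raC)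
    have mD: "monom_at S (%x. D q (psi x)) v" if "q : J" for q
      by (rule monom_at_prod_factor[OF m2 fJ _ that]) (use raDpsi in \<open>auto simp: J_def\<close>)
    obtain delta g0 where g0: "ra S g0 v" "g0 v ~= 0" "\<forall>\<^sub>F x in nhds v. g (psi x) = (\<Prod>i\<in>S. (x i - v i) ^ delta i) * g0 x"
      by (rule monomE[OF mg])
    have "ALL i:I. EX beta w. ra S w v & w v ~= 0 & (\<forall>\<^sub>F x in nhds v. C i (psi x) = (\<Prod>j\<in>S. (x j - v j) ^ beta j) * w x)"
    proof
      fix i assume "i : I"
      from mC[OF this] show "EX beta w. ra S w v & w v ~= 0 & (\<forall>\<^sub>F x in nhds v. C i (psi x) = (\<Prod>j\<in>S. (x j - v j) ^ beta j) * w x)"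
        unfolding monom_at_def .
    qed
    from bchoice2[OF this] obtain beta :: "nat => nat => nat" and w where bw: "ALL i:I. ra S (w i) v & w i v ~= 0 &
        (\<forall>\<^sub>F x in nhds v. C i (psi x) = (\<Prod>j\<in>S. (x j - v j) ^ beta i j) * w i x)" by (elim exE)
    have cmp: "(ALL j:S. p i * beta i j <= p k * beta k j) \<or> (ALL j:S. p k * beta k j <= p i * beta i j)" if ik: "i : I" "k : I" for i k
    proof -
      have e: "\<forall>\<^sub>F x in nhds v. (\<Prod>j\<in>S. (x j - v j) ^ (p i * beta i j)) * w i x ^ p i - (\<Prod>j\<in>S. (x j - v j) ^ (p k * beta k j)) * w k x ^ p k = D (i,k) (psi x)"
      proof -
        have "\<forall>\<^sub>F x in nhds v. C i (psi x) = (\<Prod>j\<in>S. (x j - v j) ^ beta i j) * w i x" "\<forall>\<^sub>F x in nhds v. C k (psi x) = (\<Prod>j\<in>S. (x j - v j) ^ beta k j) * w k x"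
          using bw ik by auto
        then show ?thesis
          by eventually_elim (simp add: D_def power_mult_distrib prod_power_power)
      qed
      have "EX gamma z. ra S z v & (z v ~= 0 \<or> (\<forall>\<^sub>F x in nhds v. z x = 0)) & (\<forall>\<^sub>F x in nhds v. D (i,k) (psi x) = (\<Prod>j\<in>S. (x j - v j) ^ gamma j) * z x)"
      proof (cases "(i,k) : J")
        case True then show ?thesis using mD[OF True] unfolding monom_at_def by blast
      next
        case False
        have "D (i,k) (psi x) = 0" if "x : V" for x
          using W0(3)[OF V(3)[OF that]] False ik by auto
        then have "\<forall>\<^sub>F x in nhds v. D (i,k) (psi x) = 0" using V(1,2) unfolding eventually_nhds by blast
        then show ?thesis using fS by (intro exI[of _ "%_. 0"] exI[of _ "%_. 0"]) auto
      qed
      then obtain gamma z where z: "ra S z v" "z v ~= 0 \<or> (\<forall>\<^sub>F x in nhds v. z x = 0)" "\<forall>\<^sub>F x in nhds v. D (i,k) (psi x) = (\<Prod>j\<in>S. (x j - v j) ^ gamma j) * z x" by blast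
      show ?thesis
      proof (rule monomials_comparable[OF fS, of "%x. w i x ^ p i" v "%x. w k x ^ p k" z "%j. p i * beta i j" "%j. p k * beta k j" gamma])
        show "\<forall>\<^sub>F x in nhds v. (\<Prod>j\<in>S. (x j - v j) ^ (p i * beta i j)) * w i x ^ p i - (\<Prod>j\<in>S. (x j - v j) ^ (p k * beta k j)) * w k x ^ p k = (\<Prod>j\<in>S. (x j - v j) ^ gamma j) * z x"
          using e z(3) by eventually_elim simp
      qed (use bw ik z in \<open>auto intro: ra_power\<close>)
    qed
    \<comment> \<open>Translation of v to the origin, where \<open>monomial_coeffs_monable\<close>
      applies.\<close>
    define theta where "theta x = (%i. if i : ?T then x i + v i else 0)" for x :: "nat => real"
    have thetaz: "theta ?z = v" using rv by (auto simp: theta_def rn_def)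
    have ratheta: "ra U (%x. theta x i) ?z" if "i : U" "U \<subseteq> ?T" "finite U" for U i
    proof -
      have "i : ?T" using that by auto
      then show ?thesis using that by (simp only: theta_def if_True) (intro ra_add ra_proj ra_const)
    qed
    have rntheta: "rn ?T (theta x)" for x by (auto simp: theta_def rn_def)
    have conttheta: "filterlim theta (nhds v) (nhds ?z)"
    proof -
      obtain V' where "open V'" "?z : V'" "continuous_on V' theta"
        using ra_map_nbhd[OF fT ratheta[OF _ subset_refl fT] rntheta open_UNIV UNIV_I] by metis
      then have "isCont theta ?z" using continuous_on_eq_continuous_at by blast
      then show ?thesis using isCont_nhds thetaz by metis
    qed
    have evtheta: "\<forall>\<^sub>F x in nhds ?z. Q (theta x)" if "\<forall>\<^sub>F x in nhds v. Q x" for Q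
      using that conttheta unfolding filterlim_iff by blast
    have ctheta: "ra S (%x. h (theta x)) ?z" if "ra S h v" for h
      by (rule ra_compose[where Phi = theta and S = S]) (use that thetaz ratheta fS in auto)
    define u' where "u' x = u ((psi (theta x))(n := x n))" for x
    have rau': "ra ?T u' ?z" unfolding u'_def
    proof (rule ra_compose[where Phi = "%x. (psi (theta x))(n := x n)" and S = ?T])
      have "(psi (theta ?z))(n := 0) = psi v" using thetaz rnpsi[of v] n by (auto simp: rn_def)
      then show "ra ?T u ((psi (theta ?z))(n := 0))" using W0(3)[OF psiW] by simp
      show "ra ?T (%x. ((psi (theta x))(n := x n)) i) ?z" if "i : ?T" for i
      proof (cases "i = n")
        case False
        then have "ra S (%x. psi (theta x) i) ?z" using that by (intro ctheta rapsi) auto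
        from ra_mono[OF this, of ?T] False fT show ?thesis by auto
      qed (use fT in auto)
    qed (rule fT)
    have u'0: "u' ?z ~= 0"
    proof -
      have "(psi (theta ?z))(n := 0) = psi v" using thetaz rnpsi[of v] n by (auto simp: rn_def)
      then show ?thesis using W0(3)[OF psiW] by (simp add: u'_def)
    qed
    have main: "monable ?T (%x. mon S delta x * g0 (theta x) * (x n ^ d * u' x +
       (\<Sum>i<d-1. (if i : I then mon S (beta i) x * w i (theta x) else 0) * x n ^ i))) ?z"
      by (rule monomial_coeffs_monable[OF fS n IHd _ _ Id])
        (use g0 bw thetaz rau' u'0 cmp[unfolded p_def] in \<open>auto intro: ctheta\<close>)
    show "monable ?T (%x. g ((psi x)(n := x n)) * ((\<Sum>i<d. C i ((psi x)(n := x n)) * ((psi x)(n := x n)) n ^ i) +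
        ((psi x)(n := x n)) n ^ d * u ((psi x)(n := x n)))) v"
    proof (rule monable_homeo[OF fT, where theta = theta and b = ?z and iota = "%x i. x i - v i"])
      show "filterlim (%x i. x i - v i) (nhds ?z) (nhds v)"
      proof -
        have "continuous_on UNIV (%x i. x i - v i)"
          by (intro continuous_on_coordinatewise_then_product continuous_on_diff continuous_on_const
              continuous_on_product_then_coordinatewise[OF continuous_on_id])
        then have "isCont (%x i. x i - v i) v" by (simp add: continuous_on_eq_continuous_at)
        then show ?thesis using isCont_nhds by fastforce
      qed
      show "\<forall>\<^sub>F x in nhds v. rn ?T x --> rn ?T (%i. x i - v i) & theta (%i. x i - v i) = x"
        using rv by (intro always_eventually) (auto simp: rn_def theta_def fun_eq_iff)
      show "monable ?T (%x. g ((psi (theta x))(n := theta x n)) * ((\<Sum>i<d. C i ((psi (theta x))(n := theta x n)) * ((psi (theta x))(n := theta x n)) n ^ i) +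
        ((psi (theta x))(n := theta x n)) n ^ d * u ((psi (theta x))(n := theta x n)))) ?z"
      proof (rule monable_cong[OF main])
        have "\<forall>\<^sub>F x in nhds v. ALL i:I. C i (psi x) = (\<Prod>j\<in>S. (x j - v j) ^ beta i j) * w i x"
          using fI bw by (intro eventually_ball_finite) auto
        moreover have "\<forall>\<^sub>F x in nhds v. x : V" using V eventually_nhds_in_open by blast
        ultimately have "\<forall>\<^sub>F x in nhds v. (ALL i:I. C i (psi x) = (\<Prod>j\<in>S. (x j - v j) ^ beta i j) * w i x) & x : V & g (psi x) = (\<Prod>i\<in>S. (x i - v i) ^ delta i) * g0 x"
          using g0(3) by eventually_elim blast
        from evtheta[OF this]
        show "\<forall>\<^sub>F x in nhds ?z. g ((psi (theta x))(n := theta x n)) * ((\<Sum>i<d. C i ((psi (theta x))(n := theta x n)) * ((psi (theta x))(n := theta x n)) n ^ i) +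
          ((psi (theta x))(n := theta x n)) n ^ d * u ((psi (theta x))(n := theta x n))) =
          mon S delta x * g0 (theta x) * (x n ^ d * u' x + (\<Sum>i<d-1. (if i : I then mon S (beta i) x * w i (theta x) else 0) * x n ^ i))"
        proof (rule eventually_mono, elim conjE)
          fix x assume x: "ALL i:I. C i (psi (theta x)) = (\<Prod>j\<in>S. (theta x j - v j) ^ beta i j) * w i (theta x)" "theta x : V"
            "g (psi (theta x)) = (\<Prod>i\<in>S. (theta x i - v i) ^ delta i) * g0 (theta x)"
          have thetan: "theta x n = x n" using vn by (simp add: theta_def)
          have mo: "(\<Prod>j\<in>S. (theta x j - v j) ^ eta j) = mon S eta x" for eta
            unfolding mon_def by (rule prod.cong) (auto simp: theta_def)
          have gg: "g ((psi (theta x))(n := x n)) = mon S delta x * g0 (theta x)"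
          proof -
            have "g ((psi (theta x))(n := x n)) = g (psi (theta x))" by (rule depD[OF raD(2)[OF g(1)]]) (use n in auto)
            then show ?thesis using x(3) mo by simp
          qed
          have CC: "C i ((psi (theta x))(n := x n)) = (if i : I then mon S (beta i) x * w i (theta x) else 0)" if "i < d" for i
          proof -
            have "C i ((psi (theta x))(n := x n)) = C i (psi (theta x))" by (rule depD[OF raD(2)[OF C[OF that]]]) (use n in auto)
            then show ?thesis using x(1) mo W0(3)[OF V(3)[OF x(2)]] that by auto
          qed
          have "(\<Sum>i<d. C i ((psi (theta x))(n := x n)) * x n ^ i) = (\<Sum>i<d. (if i : I then mon S (beta i) x * w i (theta x) else 0) * x n ^ i)"
            by (rule sum.cong) (auto simp: CC)
          also have "\<dots> = (\<Sum>i<d-1. (if i : I then mon S (beta i) x * w i (theta x) else 0) * x n ^ i)"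
            by (rule sum.mono_neutral_right) (use Id in auto)
          finally have "(\<Sum>i<d. C i ((psi (theta x))(n := x n)) * x n ^ i) = (\<Sum>i<d-1. (if i : I then mon S (beta i) x * w i (theta x) else 0) * x n ^ i)" .
          note s = this
          show "g ((psi (theta x))(n := theta x n)) * ((\<Sum>i<d. C i ((psi (theta x))(n := theta x n)) * ((psi (theta x))(n := theta x n)) n ^ i) +
            ((psi (theta x))(n := theta x n)) n ^ d * u ((psi (theta x))(n := theta x n))) =
            mon S delta x * g0 (theta x) * (x n ^ d * u' x + (\<Sum>i<d-1. (if i : I then mon S (beta i) x * w i (theta x) else 0) * x n ^ i))"
            unfolding thetan fun_upd_same gg s u'_def by (simp only: add.commute)
        qed
      qed
    qed (use ratheta[OF _ subset_refl fT] thetaz rntheta in simp_all)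
  qed
qed

text \<open>Prepares the linear change of coordinates after which f has finite order in x n. The
  germ is nonzero at some p near a, and the restriction to the line through a and p factors as a
  power of t times a nonvanishing holomorphic function. The condition p n ~= a n allows this line to
  become the x n axis.\<close>

lemma finite_order_direction:
  assumes f: "ra T f a" and nz: "\<not> (\<forall>\<^sub>F x in nhds a. f x = 0)" and n: "n : T"
  obtains p j L where "p n ~= a n" "\<And>i. i \<notin> T ==> p i = a i" "L ~= 0"
    "((%t. f (%i. a i + t * (p i - a i)) / t ^ j) \<longlongrightarrow> L) (at 0)"
proof -
  have fT: "finite T" using raD f by blast
  have cl: "isCont (%t i. a i + t * (p i - a i)) s" for p :: "nat => real" and s :: real
  proof -
    have "continuous_on UNIV (%t i. a i + t * (p i - a i))"
      by (intro continuous_on_coordinatewise_then_product continuous_intros)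
    then show ?thesis by (simp add: continuous_on_eq_continuous_at)
  qed
  show thesis
  proof (cases "f a = 0")
    case False
    let ?p = "a(n := a n + 1)"
    show thesis
    proof (rule that[of ?p "f a" 0])
      have "isCont (%t. f (%i. a i + t * (?p i - a i))) 0"
        by (rule isCont_o2[OF cl]) (use isCont_ra[OF f] in simp)
      then show "((%t. f (%i. a i + t * (?p i - a i)) / t ^ 0) \<longlongrightarrow> f a) (at 0)" by (simp add: isCont_def)
    qed (use n False in auto)
  next
    case True
    obtain r F where r: "r > 0" "hol (poly_disc T (emb a) r) F"
      "\<And>x. emb x : poly_disc T (emb a) r ==> F (emb x) = of_real (f x)" using raE[OF f] by blast
    obtain p0 where p0: "\<And>i. i : T ==> dist (p0 i) (a i) < r" "f p0 ~= 0"
      using not_eventually_box[OF nz fT r(1)] by blast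
    have "ra T f p0" by (rule raI[OF fT raD(2)[OF f] r(2)]) (use p0 r in \<open>auto simp: emb_poly_disc\<close>)
    then have "isCont f (p0(n := p0 n))" using isCont_ra by simp
    then have "isCont (%t. f (p0(n := t))) (p0 n)" by (rule isCont_o2[OF isCont_upd])
    from tendsto_imp_eventually_ne[OF isCont_nhds[OF this], of 0] p0(2)
    have "\<forall>\<^sub>F t in nhds (p0 n). f (p0(n := t)) ~= 0" by simp
    moreover have "\<forall>\<^sub>F t in nhds (p0 n). t : ball (a n) r"
      by (rule eventually_nhds_in_open) (use p0(1)[OF n] in \<open>auto simp: dist_commute\<close>)
    ultimately have "\<forall>\<^sub>F t in nhds (p0 n). f (p0(n := t)) ~= 0 & t : ball (a n) r" by eventually_elim blast
    then obtain e where e: "e > 0" "\<And>t. dist t (p0 n) < e ==> f (p0(n := t)) ~= 0 & t : ball (a n) r"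
      unfolding eventually_nhds_metric by blast
    \<comment> \<open>If necessary p0 is moved a little in the coordinate n, to leave the hyperplane
      x n = a n without losing f ~= 0.\<close>
    obtain t where t: "dist t (p0 n) < e" "t ~= a n"
    proof (cases "p0 n = a n")
      case True then show ?thesis using that[of "p0 n + e/2"] e by (auto simp: dist_real_def)
    next
      case False then show ?thesis using that[of "p0 n"] e by auto
    qed
    define p where "p = (%i. if i : T then (p0(n := t)) i else a i)"
    have fp: "f p ~= 0"
    proof -
      have "f p = f (p0(n := t))" by (rule depD[OF raD(2)[OF f]]) (simp add: p_def)
      then show ?thesis using e(2)[OF t(1)] by simp
    qed
    have pr: "dist (p i) (a i) < r" if "i : T" for i
      using that p0(1)[OF that] e(2)[OF t(1)] by (auto simp: p_def dist_commute)
    let ?gamma = "%t i. complex_of_real (a i) + t * of_real (p i - a i)"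
    obtain D where D: "open D" "convex D" "of_real ` {0..1} \<subseteq> D" "(%t. F (?gamma t)) holomorphic_on D"
      "\<And>t. t : D ==> ?gamma t : poly_disc T (emb a) r"
      using hol_segment[OF r(2) _ pr fT, of a] r(1) by auto
    have "complex_of_real 0 : D" "complex_of_real 1 : D" using D(3) by fastforce+
    then have D01: "0 : D" "1 : D" by auto
    have gammae: "?gamma (of_real t) = emb (%i. a i + t * (p i - a i))" for t by (auto simp: emb_def)
    have Fr: "F (?gamma (of_real t)) = of_real (f (%i. a i + t * (p i - a i)))" if "of_real t : D" for t
      using r(3) D(5)[OF that] unfolding gammae by blast
    have F0: "F (?gamma 0) = 0" using Fr[of 0] D01 True by simp
    have F1: "F (?gamma 1) ~= 0" using Fr[of 1] D01 fp by simp
    obtain g rho k where g: "0 < k" "0 < rho" "ball 0 rho \<subseteq> D" "g holomorphic_on ball 0 rho"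
      "\<And>w. w : ball 0 rho ==> F (?gamma w) = (w - 0) ^ k * g w" "\<And>w. w : ball 0 rho ==> g w ~= 0"
    proof (rule holomorphic_factor_zero_nonconstant[OF D(4,1) convex_connected[OF D(2)] D01(1) F0])
      show "\<not> (%t. F (?gamma t)) constant_on D" using F0 F1 D01 unfolding constant_on_def by metis
    qed blast
    have "isCont g 0" using g(2,4) continuous_on_eq_continuous_at holomorphic_on_imp_continuous_on
      by (metis centre_in_ball open_ball)
    moreover have "((%t. complex_of_real t) \<longlongrightarrow> 0) (at 0)" by (auto intro!: tendsto_eq_intros)
    ultimately have gl: "((%t. g (complex_of_real t)) \<longlongrightarrow> g 0) (at (0::real))" by (rule isCont_tendsto_compose)
    have ev: "\<forall>\<^sub>F t in at (0::real). g (of_real t) = of_real (f (%i. a i + t * (p i - a i)) / t ^ k)"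
      unfolding eventually_at
    proof (intro exI[of _ rho] conjI ballI impI g(2))
      fix t :: real assume t: "t ~= 0 & dist t 0 < rho"
      then have "complex_of_real t : ball 0 rho" by (simp add: dist_norm)
      then have "F (?gamma (of_real t)) = (of_real t) ^ k * g (of_real t)" "of_real t : D"
        using g(3) g(5)[of "of_real t"] by auto
      with Fr[OF this(2)] have "of_real (f (%i. a i + t * (p i - a i))) = (of_real t) ^ k * g (of_real t)" by simp
      then show "g (of_real t) = of_real (f (%i. a i + t * (p i - a i)) / t ^ k)" using t by simp
    qed
    then have l: "((%t. complex_of_real (f (%i. a i + t * (p i - a i)) / t ^ k)) \<longlongrightarrow> g 0) (at 0)"
      using gl tendsto_cong by fastforce
    from tendsto_Re[OF l] have l1: "((%t. f (%i. a i + t * (p i - a i)) / t ^ k) \<longlongrightarrow> Re (g 0)) (at 0)"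
      by (simp only: Re_complex_of_real)
    from tendsto_Im[OF l] have "((%t::real. 0) \<longlongrightarrow> Im (g 0)) (at 0)" by (simp only: Im_complex_of_real)
    then have "Im (g 0) = 0" using tendsto_unique[OF _ _ tendsto_const] by (metis trivial_limit_at)
    then have "Re (g 0) ~= 0" using g(2) g(6)[of 0] by (auto simp: complex_eq_iff)
    with l1 show thesis by (intro that[of p "Re (g 0)" k]) (use t n in \<open>auto simp: p_def\<close>)
  qed
qed

text \<open>When the order in x n is exactly d, the derivative of order d-1 in x n has a simple zero
  at a, so it vanishes on a graph x n = eta. Shifting this graph to x n = 0 makes the coefficient of
  degree d-1 vanish; eta does not involve x n, hence derivatives in x n commute with the
  shift.\<close>

lemma tschirnhaus_monable:
  assumes fS: "finite S" and n: "n \<notin> S"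
    and IHS: "\<And>f a. ra S f a ==> rn S a ==> \<not> (\<forall>\<^sub>F x in nhds a. f x = 0) ==> monable S f a"
    and IHd: "\<And>e g a. rn (insert n S) a ==> ra (insert n S) e a ==> ra S g a ==> \<not> (\<forall>\<^sub>F x in nhds a. g x = 0) ==>
       (EX j<d. (dd n (a n) ^^ j) e a ~= 0) ==> monable (insert n S) (%x. g x * e x) a"
    and a: "rn (insert n S) a" and e: "ra (insert n S) e a" and g: "ra S g a" "\<not> (\<forall>\<^sub>F x in nhds a. g x = 0)"
    and ord: "\<And>j. j < d ==> (dd n (a n) ^^ j) e a = 0" "(dd n (a n) ^^ d) e a ~= 0"
  shows "monable (insert n S) (%x. g x * e x) a"
proof -
  let ?T = "insert n S"
  have fT: "finite ?T" using fS by auto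
  have nT: "n : ?T" by simp
  obtain eta where eta: "ra S eta a" "eta a = a n" "d >= 1 ==> \<forall>\<^sub>F x in nhds a. (pd n ^^ (d-1)) e (x(n := eta x)) = 0"
  proof (cases "d = 0")
    \<comment> \<open>For d = 0 there is no coefficient to remove, and any eta with the value a n
      serves.\<close>
    case True then show ?thesis using that[of "%_. a n"] fS by simp
  next
    case False
    then obtain k where k: "d = Suc k" by (cases d) auto
    have 1: "(pd n ^^ k) e a = 0" using pd_dd[OF e nT, of k] ord(1)[of k] k by simp
    have 2: "pd n ((pd n ^^ k) e) a ~= 0" using pd_dd[OF e nT, of d] ord(2) k by simp
    from ra_implicit[OF ra_pd_iter[OF e nT] n 1 2] obtain eta where
      "ra S eta a" "eta a = a n" "\<forall>\<^sub>F x in nhds a. (pd n ^^ k) e (x(n := eta x)) = 0" by blast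
    then show ?thesis using that[of eta] k by simp
  qed
  define b where "b = a(n := 0)"
  have bS: "a i = b i" if "i : S" for i using that n by (auto simp: b_def)
  have rnb: "rn S b" using a by (auto simp: b_def rn_def)
  have etab: "ra S eta b" by (rule ra_agree[OF eta(1) bS])
  have etaab: "eta b = a n" using depD[OF raD(2)[OF eta(1)], of a b] bS eta(2) by auto
  define theta where "theta x = (%i. if i : ?T then (x(n := x n + eta x)) i else 0)" for x :: "nat => real"
  define e1 where "e1 x = e (x(n := x n + eta x))" for x
  have upd: "ra ?T (%x. (x(n := x n + eta x)) i) y" if "i : ?T" "ra S eta y" for i y
    using that fT ra_mono[OF that(2), of ?T] by (cases "i = n") (auto intro!: ra_add)
  have e1ra: "ra ?T e1 b" unfolding e1_def
  proof (rule ra_compose[where Phi = "%x. x(n := x n + eta x)" and S = ?T])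
    have "b(n := b n + eta b) = a" using etaab by (auto simp: b_def)
    then show "ra ?T e (b(n := b n + eta b))" using e by simp
  qed (use fT upd etab in auto)
  have gb: "ra S g b" by (rule ra_agree[OF g(1) bS])
  have gnz: "\<not> (\<forall>\<^sub>F x in nhds b. g x = 0)"
  proof
    assume "\<forall>\<^sub>F x in nhds b. g x = 0"
    moreover have "filterlim (%x. x(n := 0)) (nhds b) (nhds a)"
    proof -
      have "continuous_on UNIV (%x::nat=>real. x(n := 0))"
        by (rule continuous_on_coordinatewise_then_product, rename_tac j, case_tac "j = n")
          (auto intro: continuous_on_product_then_coordinatewise continuous_on_id)
      then have "isCont (%x::nat=>real. x(n := 0)) a" by (simp add: continuous_on_eq_continuous_at)
      then show ?thesis using isCont_nhds unfolding b_def by fastforce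
    qed
    ultimately have "\<forall>\<^sub>F x in nhds a. g (x(n := 0)) = 0" unfolding filterlim_iff by blast
    moreover have "g (x(n := 0)) = g x" for x by (rule depD[OF raD(2)[OF g(1)]]) (use n in auto)
    ultimately show False using g(2) by simp
  qed
  \<comment> \<open>Taylor's formula of order d in x n takes the place of Weierstrass preparation:
    the first d coefficients are free of x n, whereas the unit u may still depend on it.\<close>
  define C where "C i x = (dd n 0 ^^ i) e1 (x(n := 0))" for i x
  define u where "u = (dd n 0 ^^ d) e1"
  have bn: "b n = 0" by (simp add: b_def)
  have rau: "ra ?T u b" unfolding u_def using ra_dd_iter[OF e1ra nT, of d] bn by simp
  have u0: "u b ~= 0"
  proof -
    have "(pd n ^^ d) e1 b = (pd n ^^ d) e (b(n := b n + eta b))" unfolding e1_def by (rule pd_shift[OF raD(2)[OF eta(1)] n])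
    moreover have "b(n := b n + eta b) = a" using etaab by (auto simp: b_def)
    ultimately have "fact d * (dd n (b n) ^^ d) e1 b = fact d * (dd n (a n) ^^ d) e a"
      using pd_dd[OF e1ra nT, of d] pd_dd[OF e nT, of d] by simp
    then show ?thesis using ord(2) bn by (simp add: u_def)
  qed
  have raC: "ra S (C i) b" for i
    unfolding C_def
  proof (rule ra_compose[where Phi = "%x. x(n := 0)" and S = ?T])
    have "b(n := 0) = b" by (auto simp: b_def)
    then show "ra ?T ((dd n 0 ^^ i) e1) (b(n := 0))" using ra_dd_iter[OF e1ra nT, of i] bn by simp
    show "ra S (%x. (x(n := 0)) j) b" if "j : ?T" for j using that fS by (cases "j = n") auto
  qed (rule fS)
  have C0: "\<forall>\<^sub>F x in nhds b. C (d-1) x = 0" if d: "d >= 1"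
  proof -
    have lim: "filterlim (%x. x(n := c)) (nhds (b(n := c))) (nhds b)" for c
    proof -
      have "continuous_on UNIV (%x::nat=>real. x(n := c))"
        by (rule continuous_on_coordinatewise_then_product, rename_tac j, case_tac "j = n")
          (auto intro: continuous_on_product_then_coordinatewise continuous_on_id)
      then have "isCont (%x::nat=>real. x(n := c)) b" by (simp add: continuous_on_eq_continuous_at)
      then show ?thesis using isCont_nhds by fastforce
    qed
    have e1: "b(n := a n) = a" "b(n := 0) = b" by (auto simp: b_def)
    have "\<forall>\<^sub>F x in nhds b. (pd n ^^ (d-1)) e ((x(n := a n))(n := eta (x(n := a n)))) = 0"
      using lim[of "a n"] eta(3)[OF d] unfolding filterlim_iff e1 by (elim allE impE)
    moreover have "\<forall>\<^sub>F x in nhds b. ra ?T e1 (x(n := 0))"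
      using lim[of 0] ra_eventually[OF e1ra] unfolding filterlim_iff e1 by (elim allE impE)
    ultimately show ?thesis
    proof eventually_elim
      case (elim x)
      have etax: "eta (x(n := c)) = eta x" for c by (rule depD[OF raD(2)[OF eta(1)]]) (use n in auto)
      have "(pd n ^^ (d-1)) e1 (x(n := 0)) = (pd n ^^ (d-1)) e ((x(n := 0))(n := (x(n := 0)) n + eta (x(n := 0))))"
        unfolding e1_def by (rule pd_shift[OF raD(2)[OF eta(1)] n])
      also have "\<dots> = 0" using elim(1) unfolding etax by simp
      finally have "fact (d-1) * (dd n ((x(n := 0)) n) ^^ (d-1)) e1 (x(n := 0)) = 0"
        using pd_dd[OF elim(2) nT, of "d-1"] by simp
      then show ?case by (simp add: C_def)
    qed
  qed
  have ex: "e1 x = (\<Sum>i<d. C i x * x n ^ i) + x n ^ d * u x" for x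
    using dd_taylor[of e1 x n 0 d] by (simp add: C_def u_def mult.commute)
  have m1: "monable ?T (%x. g x * e1 x) b"
    unfolding ex
  proof (rule depressed_monable[OF fS n IHS _ rnb gb gnz _ rau u0])
    show "\<forall>\<^sub>F x in nhds b. C (d-1) x = 0" if "1 <= d" by (rule C0[OF that])
  qed (use IHd raC in blast)+
  show ?thesis
  proof (rule monable_homeo[OF fT, where theta = theta and b = b and iota = "%x. x(n := x n - eta x)"])
    show "ra ?T (%x. theta x i) b" if "i : ?T" for i using upd[OF that etab] that by (simp only: theta_def if_True)
    show "rn ?T (theta x)" for x by (auto simp: theta_def rn_def)
    show "theta b = a" using etaab a by (auto simp: theta_def b_def rn_def fun_eq_iff)
    have etax: "eta (x(n := c)) = eta x" for x c by (rule depD[OF raD(2)[OF eta(1)]]) (use n in auto)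
    show "\<forall>\<^sub>F x in nhds a. rn ?T x --> rn ?T (x(n := x n - eta x)) & theta (x(n := x n - eta x)) = x"
      by (intro always_eventually) (auto simp: rn_def theta_def etax fun_eq_iff)
    show "filterlim (%x. x(n := x n - eta x)) (nhds b) (nhds a)"
    proof -
      obtain V where V: "open V" "a : V" "\<And>x. x : V ==> ra S eta x" using ra_eventually[OF eta(1)] unfolding eventually_nhds by blast
      have "continuous_on V (%x. x(n := x n - eta x))"
      proof (rule continuous_on_coordinatewise_then_product)
        fix j
        have "continuous_on V eta" using V isCont_ra by (meson continuous_at_imp_continuous_on)
        moreover have "continuous_on V (%x::nat=>real. x k)" for k by (rule continuous_on_product_then_coordinatewise[OF continuous_on_id])
        ultimately show "continuous_on V (%x. (x(n := x n - eta x)) j)" by (cases "j = n") (auto intro!: continuous_on_diff)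
      qed
      then have "isCont (%x. x(n := x n - eta x)) a" using V continuous_on_eq_continuous_at by blast
      from isCont_nhds[OF this]
      show ?thesis using eta(2) by (simp only: b_def) simp
    qed
    show "monable ?T (%x. g (theta x) * e (theta x)) b"
    proof -
      have "g (theta x) = g x" for x by (rule depD[OF raD(2)[OF g(1)]]) (use n in \<open>auto simp: theta_def\<close>)
      moreover have "e (theta x) = e1 x" for x unfolding e1_def by (rule depD[OF raD(2)[OF e]]) (simp add: theta_def)
      ultimately show ?thesis using m1 by simp
    qed
  qed
qed

text \<open>After a linear change of coordinates f has some finite order in x n. The inner induction
  lowers a bound for this order; the outer hypothesis, in the variables without n, takes care of the
  coefficients.\<close>

theorem monomialization:
  assumes "finite S" "ra S f a" "rn S a" "\<not> (\<forall>\<^sub>F x in nhds a. f x = 0)"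
  shows "monable S f a"
  using assms
proof (induction S arbitrary: f a rule: finite_induct)
  case empty
  have "f x = f a" for x by (rule depD[OF raD(2)[OF empty(1)]]) auto
  then have "f a ~= 0" using empty(3) by auto
  then show ?case by (intro monable_mono monom_at_unit empty) auto
next
  case (insert n S)
  let ?T = "insert n S" and ?z = "%_::nat. 0::real"
  have fT: "finite ?T" using insert by auto
  \<comment> \<open>The factor g free of x n belongs to the inductive claim because blow-ups split
    off powers of the exceptional coordinate.\<close>
  have H: "monable ?T (%x. g x * e x) b"
    if "rn ?T b" "ra ?T e b" "ra S g b" "\<not> (\<forall>\<^sub>F x in nhds b. g x = 0)" "EX j<d. (dd n (b n) ^^ j) e b ~= 0" for d e g b
    using that
  proof (induction d arbitrary: e g b)
    case (Suc d)
    show ?case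
    proof (cases "EX j<d. (dd n (b n) ^^ j) e b ~= 0")
      case True then show ?thesis using Suc by blast
    next
      case False
      then have z: "(dd n (b n) ^^ j) e b = 0" if "j < d" for j using that by blast
      then have nz: "(dd n (b n) ^^ d) e b ~= 0" using Suc.prems(5) less_Suc_eq by metis
      show ?thesis by (rule tschirnhaus_monable[OF insert.hyps(1,2) insert.IH Suc.IH Suc.prems(1-4) z nz])
    qed
  qed simp
  obtain p j L where p: "p n ~= a n" "\<And>i. i \<notin> ?T ==> p i = a i" "L ~= 0"
    "((%t. f (%i. a i + t * (p i - a i)) / t ^ j) \<longlongrightarrow> L) (at 0)"
    by (rule finite_order_direction[OF insert.prems(1,3) insertI1]) (rule that; assumption)
  \<comment> \<open>Affine coordinates in which the x n axis is the line through a and p; iota is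
    the inverse.\<close>
  define theta where "theta x = (%i. if i : ?T then a i + (if i = n then 0 else x i) + x n * (p i - a i) else 0)" for x :: "nat => real"
  define iota where "iota y = (%i. if i = n then (y n - a n) / (p n - a n) else if i : S then y i - a i - (y n - a n) / (p n - a n) * (p i - a i) else 0)" for y :: "nat => real"
  have ratheta: "ra ?T (%x. theta x i) ?z" if "i : ?T" for i
    using that fT unfolding theta_def by (cases "i = n") (auto intro!: ra_add ra_mult)
  have thetaz: "theta ?z = a" using insert.prems(2) by (auto simp: theta_def rn_def)
  show ?case
  proof (rule monable_homeo[OF fT, where theta = theta and b = ?z and iota = iota])
    show "ra ?T (%x. theta x i) ?z" if "i : ?T" for i by (rule ratheta[OF that])
    show "rn ?T (theta x)" for x by (auto simp: theta_def rn_def)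
    show "theta ?z = a" by (rule thetaz)
    show "filterlim iota (nhds ?z) (nhds a)"
    proof -
      have c: "continuous_on UNIV (%x::nat=>real. x k)" for k by (rule continuous_on_product_then_coordinatewise[OF continuous_on_id])
      have "continuous_on UNIV iota"
      proof (rule continuous_on_coordinatewise_then_product)
        fix i
        have "continuous_on UNIV (%y. (y n - a n) / (p n - a n))" using p(1) by (intro continuous_intros c) auto
        moreover have "continuous_on UNIV (%y. y i - a i - (y n - a n) / (p n - a n) * (p i - a i))"
          using p(1) by (intro continuous_intros c) auto
        ultimately show "continuous_on UNIV (%y. iota y i)" unfolding iota_def by (cases "i = n"; cases "i : S") auto
      qed
      then have "isCont iota a" by (simp add: continuous_on_eq_continuous_at)
      moreover have "iota a = ?z" by (auto simp: iota_def)
      ultimately show ?thesis using isCont_nhds by metis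
    qed
    show "\<forall>\<^sub>F x in nhds a. rn ?T x --> rn ?T (iota x) & theta (iota x) = x"
    proof (intro always_eventually allI impI conjI)
      fix x assume x: "rn ?T x"
      show "rn ?T (iota x)" by (auto simp: iota_def rn_def)
      show "theta (iota x) = x"
      proof
        fix i show "theta (iota x) i = x i" using p(1) x insert.hyps(2) by (cases "i = n"; cases "i : S") (auto simp: theta_def iota_def rn_def)
      qed
    qed
    define e where "e x = f (theta x)" for x
    have rae: "ra ?T e ?z" unfolding e_def
      by (rule ra_compose[where Phi = theta, OF _ fT ratheta]) (use thetaz insert.prems(1) in auto)
    have "e (?z(n := t)) = f (%i. a i + t * (p i - a i))" for t
    proof -
      have "theta (?z(n := t)) = (%i. a i + t * (p i - a i))"
        using insert.prems(2) p(2) by (auto simp: theta_def rn_def fun_eq_iff)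
      then show ?thesis by (simp add: e_def)
    qed
    then have "((%t. e (?z(n := t)) / (t - ?z n) ^ j) \<longlongrightarrow> L) (at (?z n))" using p(4) by simp
    from order_dd[OF rae _ p(3) this] obtain k where k: "k <= j" "(dd n (?z n) ^^ k) e ?z ~= 0" by auto
    have "monable ?T (%x. 1 * e x) ?z"
    proof (rule H[of _ _ "%_. 1" "Suc j"])
      show "EX i<Suc j. (dd n (?z n) ^^ i) e ?z ~= 0" using k by (intro exI[of _ k]) auto
    qed (use rae insert.hyps in \<open>auto simp: rn_def\<close>)
    then show "monable ?T (%x. f (theta x)) ?z" by (simp add: e_def)
  qed
qed

section \<open>Uniformization of closed subanalytic sets\<close>

text \<open>Convergence in the sense of \<open>has_sum\<close> is unconditional, hence absolute over
  the reals. At a corner of a cube inside the ball it bounds the complexified terms on a polydisc,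
  and their uniform limit is the holomorphic extension. Composing with \<open>projN\<close> makes
  the function depend on the first N coordinates only.\<close>

lemma analytic_near_ra:
  assumes an: "analytic_near N g a r" and r: "r > 0"
  shows "ra {..<N} (%x. g (projN N x)) a"
proof -
  define A where "A = {alpha::nat=>nat. ALL i>=N. alpha i = 0}"
  obtain c where c: "\<And>y. y : nball N a r ==> ((%alpha. c alpha * (\<Prod>i<N. (y i - a i) ^ alpha i)) has_sum g y) A"
    using an unfolding analytic_near_def A_def by blast
  \<comment> \<open>N rho^2 < r^2, so a cube of half side rho about a lies in the ball, corners
    included.\<close>
  define rho where "rho = r / (N + 1)"
  have rho: "rho > 0" using r by (simp add: rho_def)
  have Nrho: "real N * rho\<^sup>2 < r\<^sup>2"
  proof -
    have "real N < (real N + 1)\<^sup>2" by (simp add: power2_eq_square algebra_simps add_pos_nonneg)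
    then show ?thesis using r by (simp add: rho_def power_divide divide_less_eq add.commute)
  qed
  have nb: "y : nball N a r" if "inR N y" "\<And>i. i < N ==> \<bar>y i - a i\<bar> <= rho" for y
  proof -
    have "(\<Sum>i<N. (y i - a i)\<^sup>2) <= (\<Sum>i<N. rho\<^sup>2)"
      by (rule sum_mono) (use that(2) rho in \<open>auto simp: abs_le_square_iff[symmetric]\<close>)
    then show ?thesis using Nrho that(1) by (simp add: nball_def)
  qed
  \<comment> \<open>The corner of that cube: here the monomials take the largest modulus that occurs
    on the polydisc.\<close>
  define y0 where "y0 = (%i. if i < N then a i + rho else 0)"
  have "y0 : nball N a r" by (rule nb) (use rho in \<open>auto simp: y0_def inR_def\<close>)
  from c[OF this] have "(%alpha. c alpha * (\<Prod>i<N. (y0 i - a i) ^ alpha i)) summable_on A" by (rule has_sum_imp_summable)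
  then have "(%alpha. c alpha * (\<Prod>i<N. rho ^ alpha i)) summable_on A"
    by (rule summable_on_cong[THEN iffD1, rotated]) (auto simp: y0_def)
  then have B: "(%alpha. \<bar>c alpha\<bar> * (\<Prod>i<N. rho ^ alpha i)) summable_on A"
    by (rule summable_on_cong[THEN iffD1, OF _ summable_on_iff_abs_summable_on_real[THEN iffD1], rotated])
      (use rho in \<open>simp add: abs_mult abs_prod\<close>)
  let ?P = "poly_disc {..<N} (emb a) rho"
  define t where "t alpha z = complex_of_real (c alpha) * (\<Prod>i<N. (z i - emb a i) ^ alpha i)" for alpha z
  have tB: "norm (t alpha z) <= \<bar>c alpha\<bar> * (\<Prod>i<N. rho ^ alpha i)" if "z : ?P" for alpha z
  proof -
    have "(\<Prod>i<N. norm (z i - emb a i) ^ alpha i) <= (\<Prod>i<N. rho ^ alpha i)"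
      by (intro prod_mono conjI power_mono) (use that in \<open>auto simp: poly_disc_def dist_norm less_imp_le\<close>)
    then show ?thesis unfolding t_def norm_mult norm_of_real prod_norm[symmetric] norm_power
      by (intro mult_left_mono) auto
  qed
  have ul: "uniform_limit ?P (%X z. \<Sum>alpha\<in>X. t alpha z) (%z. \<Sum>\<^sub>\<infinity>alpha\<in>A. t alpha z) (finite_subsets_at_top A)"
    by (rule Weierstrass_m_test_general[OF _ B]) (rule tB)
  have prodh: "hol ?P (%z. \<Prod>i\<in>J. F i z)" if "\<And>i. i : J ==> hol ?P (F i)" "finite J" for J F
    using that(2,1) by (induction J rule: finite_induct) (auto intro: hol_mult)
  have powh: "hol ?P (%z. F z ^ k)" if "hol ?P F" for F k
    by (induction k) (auto intro: hol_mult that)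
  have th: "hol ?P (t alpha)" for alpha
    unfolding t_def by (intro hol_mult prodh powh hol_diff hol_const hol_proj) auto
  have sumh: "hol ?P (%z. \<Sum>alpha\<in>X. t alpha z)" for X
  proof (cases "finite X")
    case True then show ?thesis by (induction X rule: finite_induct) (auto intro: hol_add th)
  qed simp
  have hF: "hol ?P (%z. \<Sum>\<^sub>\<infinity>alpha\<in>A. t alpha z)"
    by (rule hol_uniform_limit[OF sumh ul]) simp
  show ?thesis
  proof (rule raI[OF _ _ hF])
    show "dep {..<N} (%x. g (projN N x))"
      by (rule depI, rule arg_cong[where f = g]) (auto simp: projN_def)
    show "emb a : ?P" using rho by simp
    fix x assume x: "emb x : ?P"
    have "projN N x : nball N a r"
      by (rule nb) (use x in \<open>auto simp: projN_def inR_def emb_poly_disc dist_real_def less_imp_le\<close>)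
    from has_sum_bounded_linear[OF bounded_linear_of_real[where 'a = complex] c[OF this]]
    have "((%alpha. complex_of_real (c alpha * (\<Prod>i<N. (projN N x i - a i) ^ alpha i))) has_sum of_real (g (projN N x))) A"
      by (simp only: o_def)
    moreover have "complex_of_real (c alpha * (\<Prod>i<N. (projN N x i - a i) ^ alpha i)) = t alpha (emb x)" for alpha
      unfolding t_def by (auto simp: projN_def emb_def intro!: prod.cong)
    ultimately show "(\<Sum>\<^sub>\<infinity>alpha\<in>A. t alpha (emb x)) = of_real (g (projN N x))" by (simp add: infsumI)
  qed simp
qed

section \<open>Unit cubes as charts of semianalytic and subanalytic sets\<close>

lemma rn_inR: "rn {..<N} = inR N"
  by (auto simp: rn_def inR_def fun_eq_iff)

definition ucube :: "nat => (nat => real) set" where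
  "ucube M = {t. (ALL i<M. 0 <= t i & t i <= 1) & (ALL i>=M. t i = 0)}"

text \<open>Half-open, as signs of monomials are constant only where the parameters are strictly
  positive. The missing faces are regained by closure once the set is closed.\<close>

definition pcube :: "nat => (nat => real) set" where
  "pcube M = {t. (ALL i<M. 0 < t i & t i <= 1) & (ALL i>=M. t i = 0)}"

lemma pcube_ucube: "t : pcube M ==> t : ucube M"
  by (auto simp: pcube_def ucube_def less_imp_le)

text \<open>Analytic on the closed cube, but only the half-open cube has to go into A, because a
  semianalytic set need not be closed.\<close>

definition achart :: "nat => (nat => real) set => ((nat => real) => nat => real) => bool" where
  "achart M A phi \<longleftrightarrow> (ALL t:ucube M. ALL i<M. ra {..<M} (%x. phi x i) t) & (ALL x. inR M (phi x)) & (ALL t:pcube M. phi t : A)"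

text \<open>Monomials times units have constant sign on every open face of every orthant at v.\<close>

lemma orthant_charts:
  assumes v: "inR M v" and fQ: "finite Q"
    and q: "\<And>q. q : Q ==> monom_at {..<M} (%x. q (psi x)) v \<or> (\<forall>\<^sub>F x in nhds v. q (psi x) = 0)"
    and psi: "\<And>i. i < M ==> ra {..<M} (%x. psi x i) v" "\<And>x. inR M (psi x)"
    and W: "open W" "psi v : W"
    and A: "\<And>x y. x : W ==> y : W ==> inR M x ==> inR M y ==> (\<And>q. q : Q ==> sgn (q x) = sgn (q y)) ==> x : A ==> y : A"
  shows "EX N Phi. open N & v : N & finite Phi & (ALL phi:Phi. achart M A phi) &
     (ALL x:N. inR M x --> psi x : A --> (EX phi:Phi. psi x : phi ` pcube M))"
proof -
  let ?S = "{..<M}"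
  have "ALL q:Q. EX alpha u. (ra ?S u v & (u v ~= 0 \<or> u = (%_. 0))) & (\<forall>\<^sub>F x in nhds v. q (psi x) = (\<Prod>i\<in>?S. (x i - v i) ^ alpha i) * u x)"
  proof
    fix q' assume "q' : Q"
    from q[OF this] show "EX alpha u. (ra ?S u v & (u v ~= 0 \<or> u = (%_. 0))) & (\<forall>\<^sub>F x in nhds v. q' (psi x) = (\<Prod>i\<in>?S. (x i - v i) ^ alpha i) * u x)"
    proof
      assume "monom_at ?S (%x. q' (psi x)) v" then show ?thesis unfolding monom_at_def by blast
    next
      assume "\<forall>\<^sub>F x in nhds v. q' (psi x) = 0"
      then show ?thesis by (intro exI[of _ "%_. 0"] exI[of _ "%_. 0"]) auto
    qed
  qed
  from bchoice2[OF this] obtain alpha :: "_ => nat => nat" and u where au: "ALL q:Q. (ra ?S (u q) v & (u q v ~= 0 \<or> u q = (%_. 0))) &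
      (\<forall>\<^sub>F x in nhds v. q (psi x) = (\<Prod>i\<in>?S. (x i - v i) ^ alpha q i) * u q x)" by (elim exE)
  have sgnu: "\<forall>\<^sub>F x in nhds v. sgn (u q x) = sgn (u q v)" if "q : Q" for q
  proof (cases "u q v = 0")
    case True then show ?thesis using au that by auto
  next
    case False
    have l: "(u q \<longlongrightarrow> u q v) (nhds v)" using isCont_nhds[OF isCont_ra] au that by blast
    show ?thesis
    proof (cases "u q v > 0")
      case True
      from order_tendstoD(1)[OF l True] show ?thesis by (rule eventually_mono) (use True in simp)
    next
      case f2: False
      then have "u q v < 0" using False by simp
      from order_tendstoD(2)[OF l this] show ?thesis by (rule eventually_mono) (use \<open>u q v < 0\<close> in simp)
    qed
  qed
  obtain V0 where V0: "open V0" "v : V0" "\<And>x. x : V0 ==> psi x : W" "\<And>x i. x : V0 ==> i : ?S ==> ra ?S (%x. psi x i) x"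
    using ra_map_nbhd[of ?S ?S psi v W] psi W unfolding rn_inR by (metis finite_lessThan lessThan_iff)
  have "\<forall>\<^sub>F x in nhds v. x : V0 & (ALL q:Q. sgn (u q x) = sgn (u q v)) & (ALL q:Q. q (psi x) = (\<Prod>i\<in>?S. (x i - v i) ^ alpha q i) * u q x)"
    using fQ sgnu au V0 by (intro eventually_conj eventually_ball_finite eventually_nhds_in_open) auto
  then obtain V where V: "open V" "v : V" "\<And>x. x : V ==> x : V0 & (ALL q:Q. sgn (u q x) = sgn (u q v)) & (ALL q:Q. q (psi x) = (\<Prod>i\<in>?S. (x i - v i) ^ alpha q i) * u q x)"
    unfolding eventually_nhds by blast
  obtain r where r: "r > 0" "\<And>x. (ALL i:?S. dist (x i) (v i) < r) ==> (ALL i. i \<notin> ?S --> x i = v i) ==> x : V"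
    using open_fun_box[OF V(1,2), of ?S] by blast
  define epsilon where "epsilon = r/2"
  have epsilon: "epsilon > 0" "epsilon < r" using r by (auto simp: epsilon_def)
  \<comment> \<open>B lists the coordinates that leave v, and C tells in which of them they
    decrease; the other coordinates stay at v i. Each pair (B, C) stands for one open face of one
    orthant.\<close>
  define sn where "sn B C i = (if i : B then (if i : C then -1 else 1) else 0 :: real)" for B C :: "nat set" and i
  define omega where "omega B C t = (%i. if i < M then v i + sn B C i * epsilon * t i else 0)" for B C and t :: "nat => real"
  have omegaV: "omega B C t : V" if "t : ucube M" for B C t
  proof (rule r(2))
    show "ALL i:?S. dist (omega B C t i) (v i) < r"
    proof
      fix i assume i: "i : ?S"
      then have "\<bar>sn B C i * epsilon * t i\<bar> <= 1 * epsilon * 1"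
        unfolding abs_mult using that epsilon by (intro mult_mono) (auto simp: sn_def ucube_def)
      then show "dist (omega B C t i) (v i) < r" using i epsilon by (simp add: omega_def dist_real_def)
    qed
  qed (use v in \<open>auto simp: omega_def inR_def\<close>)
  have inomega: "inR M (omega B C t)" for B C t by (auto simp: omega_def inR_def)
  have sgnq: "sgn (q (psi (omega B C t))) = (\<Prod>i\<in>?S. sn B C i ^ alpha q i) * sgn (u q v)" if "q : Q" "t : pcube M" for q B C t
  proof -
    have x: "omega B C t : V" using omegaV pcube_ucube that by blast
    have "q (psi (omega B C t)) = (\<Prod>i\<in>?S. (omega B C t i - v i) ^ alpha q i) * u q (omega B C t)" using V(3)[OF x] that by blast
    moreover have "sgn (\<Prod>i\<in>?S. (omega B C t i - v i) ^ alpha q i) = (\<Prod>i\<in>?S. sn B C i ^ alpha q i)"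
    proof -
      have "sgn (\<Prod>i\<in>?S. f i) = (\<Prod>i\<in>?S. sgn (f i))" for f :: "nat => real"
        by (induction M) (auto simp: sgn_mult lessThan_Suc)
      moreover have "sgn (omega B C t i - v i) = sn B C i" if "i : ?S" for i
        using that \<open>t : pcube M\<close> epsilon by (auto simp: omega_def sn_def pcube_def sgn_mult)
      moreover have "sgn (x ^ k) = sgn x ^ k" for x :: real and k by (induction k) (auto simp: sgn_mult)
      ultimately show ?thesis by (auto intro!: prod.cong)
    qed
    moreover have "sgn (u q (omega B C t)) = sgn (u q v)" using V(3)[OF x] that by blast
    ultimately show ?thesis by (simp add: sgn_mult)
  qed
  have const: "psi (omega B C t) : A" if "t : pcube M" "t' : pcube M" "psi (omega B C t') : A" for B C t t'
  proof (rule A[OF _ _ _ _ _ that(3)])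
    show "psi (omega B C t') : W" "psi (omega B C t) : W" using V(3) V0(3) omegaV pcube_ucube that by blast+
  qed (use psi(2) sgnq that in auto)
  define I where "I = {(B,C). B \<subseteq> ?S & C \<subseteq> ?S & (EX t:pcube M. psi (omega B C t) : A)}"
  have "I \<subseteq> Pow ?S \<times> Pow ?S" by (auto simp: I_def)
  then have fI: "finite I" by (rule finite_subset) simp
  define Phi where "Phi = (%(B,C) t. psi (omega B C t)) ` I"
  have ach: "achart M A phi" if "phi : Phi" for phi
  proof -
    note phi = that
    obtain w where w: "w : I" "phi = (%(B,C) t. psi (omega B C t)) w" using phi unfolding Phi_def by blast
    obtain B C where "w = (B,C)" by (cases w)
    then have BC: "(B,C) : I" "phi = (%t. psi (omega B C t))" using w by auto
    have raomega: "ra ?S (%x. omega B C x i) t" if "i : ?S" for i t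
      using that by (simp add: omega_def) (intro ra_add ra_mult ra_const ra_proj; simp)
    show ?thesis unfolding achart_def BC(2)
    proof (intro conjI ballI allI impI)
      fix t i assume t: "t : ucube M" and i: "i < M"
      show "ra ?S (%x. psi (omega B C x) i) t"
        by (rule ra_compose[where f = "%x. psi x i" and Phi = "omega B C" and S = ?S]) (use V(3)[OF omegaV[OF t]] V0(4) i raomega in auto)
    next
      fix t assume "t : pcube M"
      then show "psi (omega B C t) : A" using const BC(1) unfolding I_def by blast
    qed (rule psi(2))
  qed
  have cov: "EX phi:Phi. psi x : phi ` pcube M" if x: "ALL i:?S. dist (x i) (v i) < epsilon" "inR M x" "psi x : A" for x
  proof -
    define B where "B = {i:?S. x i ~= v i}"
    define C where "C = {i:?S. x i < v i}"
    \<comment> \<open>Coordinates with x i = v i receive the value 1 since \<open>pcube\<close> asks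
      for positive entries; their factor \<open>sn B C i\<close> is 0, so the point is
      unaffected.\<close>
    define t where "t = (%i. if i < M then (if x i = v i then 1 else \<bar>x i - v i\<bar> / epsilon) else 0)"
    have t: "t : pcube M" using x(1) epsilon by (auto simp: pcube_def t_def dist_real_def less_imp_le)
    have e: "omega B C t = x"
    proof
      fix i
      have "sn B C i * epsilon * t i = x i - v i" if "i < M"
      proof (cases "x i = v i")
        case False
        then have "sn B C i = (if x i < v i then -1 else 1)" using that by (auto simp: sn_def B_def C_def)
        moreover have "t i = \<bar>x i - v i\<bar> / epsilon" using that False by (simp add: t_def)
        ultimately show ?thesis using epsilon by (auto simp: abs_if)
      qed (auto simp: sn_def B_def)
      then show "omega B C t i = x i" using x(2) by (auto simp: omega_def inR_def)
    qed
    have "EX t:pcube M. psi (omega B C t) : A" by (rule bexI[OF _ t]) (simp add: e x(3))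
    then have "(B,C) : I" unfolding I_def by (auto simp: B_def C_def)
    from imageI[OF this, of "%(B,C) t. psi (omega B C t)"] have "(%t. psi (omega B C t)) : Phi" by (simp add: Phi_def)
    moreover have "psi x : (%t. psi (omega B C t)) ` pcube M" by (rule image_eqI[OF _ t]) (simp add: e)
    ultimately show ?thesis by (intro bexI[of _ "%t. psi (omega B C t)"])
  qed
  show ?thesis
  proof (intro exI[of _ "{x. ALL i:?S. dist (x i) (v i) < epsilon}"] exI[of _ Phi] conjI ballI impI)
    show "open {x. ALL i:?S. dist (x i) (v i) < epsilon}" by (rule open_polybox) simp
    show "v : {x. ALL i:?S. dist (x i) (v i) < epsilon}" using epsilon by simp
    show "finite Phi" using fI by (simp add: Phi_def)
  qed (use ach cov in auto)
qed

text \<open>Near y, in A or not, membership in A is decided by the signs of finitely many analytic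
  functions. The product of those that do not vanish identically near y is monomialized, its factors
  inherit normal crossings in the charts, and \<open>orthant_charts\<close> separates the
  signs.\<close>

lemma semianalytic_charts:
  assumes A: "semianalytic M A" and y: "inR M y"
  obtains Phi N where "finite Phi" "\<And>phi. phi : Phi ==> achart M A phi" "open N" "y : N"
    "\<And>x. x : N ==> x : A ==> EX phi:Phi. x : phi ` pcube M"
proof -
  let ?S = "{..<M}"
  have inA: "\<And>x. x : A ==> inR M x" using A unfolding semianalytic_def by blast
  obtain r m and p :: "nat => nat" and q :: "nat => nat" and g h :: "nat => nat => (nat => real) => real" where
    r: "r > 0" and
    g: "ALL k<m. ALL j<p k. analytic_onN M (nball M y r) (g k j)" and
    h: "ALL k<m. ALL j<q k. analytic_onN M (nball M y r) (h k j)" and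
    AA: "A \<inter> nball M y r = (\<Union>k<m. {x : nball M y r. (ALL j<p k. g k j x = 0) & (ALL j<q k. h k j x > 0)})"
    using A[unfolded semianalytic_def, THEN conjunct2, rule_format, OF y] by (elim exE conjE) (rule that; assumption)
  define ext where "ext f = (%x. f (projN M x))" for f :: "(nat => real) => real"
  define Q where "Q = (\<Union>k<m. (%j. ext (g k j)) ` {..<p k}) \<union> (\<Union>k<m. (%j. ext (h k j)) ` {..<q k})"
  have fQ: "finite Q" unfolding Q_def by auto
  have ynb: "y : nball M y r" using y r by (simp add: nball_def)
  have raext: "ra ?S (ext f) y" if "analytic_onN M (nball M y r) f" for f
  proof -
    note an = that[unfolded analytic_onN_def, rule_format, OF ynb]
    then obtain r' where "r' > 0" "analytic_near M f y r'" by blast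
    then show ?thesis unfolding ext_def by (intro analytic_near_ra)
  qed
  have raQ: "ra ?S f y" if "f : Q" for f using that g h raext unfolding Q_def by auto
  define Q' where "Q' = {f:Q. \<not> (\<forall>\<^sub>F x in nhds y. f x = 0)}"
  have fQ': "finite Q'" using fQ by (simp add: Q'_def)
  define P where "P x = (\<Prod>f\<in>Q'. f x)" for x
  have raP: "ra ?S P y" unfolding P_def using raQ by (intro ra_prod) (auto simp: Q'_def)
  have nzP: "\<not> (\<forall>\<^sub>F x in nhds y. P x = 0)" unfolding P_def
    by (rule nonzero_germ_prod[OF fQ' finite_lessThan[of M], where f = "%f. f"]) (use raQ in \<open>auto simp: Q'_def\<close>)
  have mP: "monable ?S P y" by (rule monomialization[OF _ raP _ nzP]) (use y rn_inR in auto)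
  have prid: "projN M x = x" if "inR M x" for x using that by (auto simp: projN_def inR_def)
  define Nb where "Nb = {x::nat=>real. (\<Sum>i<M. (x i - y i)\<^sup>2) < r\<^sup>2}"
  have oNb: "open Nb"
  proof -
    have "continuous_on UNIV (%x::nat=>real. \<Sum>i<M. (x i - y i)\<^sup>2)"
      by (intro continuous_intros continuous_on_product_then_coordinatewise[OF continuous_on_id])
    then show ?thesis unfolding Nb_def by (intro open_Collect_less) auto
  qed
  have yNb: "y : Nb" using r by (simp add: Nb_def)
  have Nbnb: "x : nball M y r" if "x : Nb" "inR M x" for x using that by (simp add: Nb_def nball_def)
  have "\<forall>\<^sub>F x in nhds y. x : Nb & (ALL f:Q. ra ?S f x) & (ALL f:Q-Q'. f x = 0)"
    using fQ raQ oNb yNb by (intro eventually_conj eventually_ball_finite eventually_nhds_in_open ballI ra_eventually)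
      (auto simp: Q'_def)
  then obtain W where W: "open W" "y : W" "\<And>x. x : W ==> x : Nb & (ALL f:Q. ra ?S f x) & (ALL f:Q-Q'. f x = 0)"
    unfolding eventually_nhds by blast
  have Asgn: "z : A" if xz: "x : W" "z : W" "inR M x" "inR M z" and sg: "\<And>f. f : Q ==> sgn (f x) = sgn (f z)" and xA: "x : A" for x z
  proof -
    have nb: "x : nball M y r" "z : nball M y r" using xz W(3) Nbnb by blast+
    have "x : A \<inter> nball M y r" using xA nb by simp
    then obtain k where k: "k < m" "ALL j<p k. g k j x = 0" "ALL j<q k. h k j x > 0" unfolding AA by auto
    have e: "ext f x = f x" "ext f z = f z" for f using xz prid by (auto simp: ext_def)
    have "g k j z = 0" if "j < p k" for j
    proof -
      have "ext (g k j) : Q" using k(1) that unfolding Q_def by blast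
      from sg[OF this] show ?thesis
        using k(2) that unfolding e by (metis sgn_zero_iff)
    qed
    moreover have "h k j z > 0" if "j < q k" for j
    proof -
      have "ext (h k j) : Q" using k(1) that unfolding Q_def by blast
      from sg[OF this] show ?thesis
        using k(3) that unfolding e by (metis sgn_1_pos sgn_pos)
    qed
    ultimately have "z : A \<inter> nball M y r" unfolding AA using k(1) nb by auto
    then show ?thesis by simp
  qed
  obtain Psi where Psi: "finite Psi" "ALL psi:Psi. chart ?S P W psi" "\<forall>\<^sub>F x in nhds y. rn ?S x --> (EX psi:Psi. x : psi ` cube ?S)"
    using mP[unfolded monable_def, rule_format, of W] W(1,2) by blast
  have "ALL psi:Psi. EX Phi. finite Phi & (ALL phi:Phi. achart M A phi) & (ALL x:cube ?S. psi x : A --> (EX phi:Phi. psi x : phi ` pcube M))"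
  proof
    fix psi assume "psi : Psi"
    then have ch: "chart ?S P W psi" using Psi by blast
    have "ALL v:cube ?S. EX N Phi. open N & v : N & finite Phi & (ALL phi:Phi. achart M A phi) &
       (ALL x:N. inR M x --> psi x : A --> (EX phi:Phi. psi x : phi ` pcube M))"
    proof
      fix v assume v: "v : cube ?S"
      have rapsi: "ra ?S (%x. psi x i) v" if "i : ?S" for i using ch v that unfolding chart_def by blast
      have rnpsi: "rn ?S (psi x)" for x using ch unfolding chart_def by blast
      have psiW: "psi v : W" using ch v unfolding chart_def by blast
      have mpsi: "monom_at ?S (%x. P (psi x)) v" using ch v unfolding chart_def by blast
      obtain V where V: "open V" "v : V" "\<And>x. x : V ==> psi x : W"
        using ra_map_nbhd[OF _ rapsi rnpsi W(1) psiW] by (metis finite_lessThan)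
      have raf: "ra ?S (%x. f (psi x)) v" if "f : Q" for f
        by (rule ra_compose[where Phi = psi and S = ?S]) (use W(3)[OF psiW] that rapsi in auto)
      have mf: "monom_at ?S (%x. f (psi x)) v \<or> (\<forall>\<^sub>F x in nhds v. f (psi x) = 0)" if "f : Q" for f
      proof (cases "f : Q'")
        case True
        have "monom_at ?S (%x. f (psi x)) v"
          by (rule monom_at_prod_factor[where J = Q' and f = "%f x. f (psi x)" and k = f]) (use mpsi fQ' raf True in \<open>auto simp: P_def Q'_def\<close>)
        then show ?thesis by blast
      next
        case False
        have "ALL x:V. f (psi x) = 0" using W(3) V(3) that False by blast
        then show ?thesis using V(1,2) unfolding eventually_nhds by blast
      qed
      show "EX N Phi. open N & v : N & finite Phi & (ALL phi:Phi. achart M A phi) &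
         (ALL x:N. inR M x --> psi x : A --> (EX phi:Phi. psi x : phi ` pcube M))"
      proof (rule orthant_charts[of M v Q psi W A])
        show "inR M v" using v rn_inR by (auto simp: cube_def)
        show "z : A" if "x : W" "z : W" "inR M x" "inR M z" "\<And>f. f : Q ==> sgn (f x) = sgn (f z)" "x : A" for x z
          by (rule Asgn[OF that])
      qed (use fQ mf rapsi rnpsi rn_inR W psiW in auto)
    qed
    from bchoice2[OF this] obtain N Phi where NP: "ALL v:cube ?S. open (N v) & v : N v & finite (Phi v) & (ALL phi:Phi v. achart M A phi) &
       (ALL x:N v. inR M x --> psi x : A --> (EX phi:Phi v. psi x : phi ` pcube M))" by (elim exE)
    obtain C where C: "C \<subseteq> cube ?S" "finite C" "cube ?S \<subseteq> (\<Union>v\<in>C. N v)"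
      by (rule compactE_image[OF compact_cube, of "cube ?S" N ?S]) (use NP in auto)
    show "EX Phi. finite Phi & (ALL phi:Phi. achart M A phi) & (ALL x:cube ?S. psi x : A --> (EX phi:Phi. psi x : phi ` pcube M))"
    proof (intro exI[of _ "\<Union>v\<in>C. Phi v"] conjI ballI impI)
      show "finite (\<Union>v\<in>C. Phi v)" using C NP by blast
      show "achart M A phi" if "phi : (\<Union>v\<in>C. Phi v)" for phi using that C NP by blast
      fix x assume x: "x : cube ?S" "psi x : A"
      obtain v where v: "v : C" "x : N v" using C(3) x(1) by blast
      have "inR M x" using x(1) rn_inR by (auto simp: cube_def)
      then show "EX phi:\<Union>v\<in>C. Phi v. psi x : phi ` pcube M" using NP C(1) v x(2) by blast
    qed
  qed
  then obtain Phi where Phi: "\<And>psi. psi:Psi ==> finite (Phi psi)" "\<And>psi phi. psi:Psi ==> phi:Phi psi ==> achart M A phi"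
    "\<And>psi x. psi:Psi ==> x:cube ?S ==> psi x : A ==> (EX phi:Phi psi. psi x : phi ` pcube M)" by metis
  obtain N where N: "open N" "y : N" "ALL x:N. rn ?S x --> (EX psi:Psi. x : psi ` cube ?S)"
    using Psi(3) unfolding eventually_nhds by blast
  show thesis
  proof (rule that[of "\<Union>psi\<in>Psi. Phi psi" N])
    show "finite (\<Union>psi\<in>Psi. Phi psi)" using Psi(1) Phi(1) by blast
    show "achart M A phi" if "phi : (\<Union>psi\<in>Psi. Phi psi)" for phi using that Phi(2) by blast
    fix x assume x: "x : N" "x : A"
    then have "rn ?S x" using inA rn_inR by auto
    then obtain psi v where v: "psi : Psi" "v : cube ?S" "x = psi v" using N(3) x(1) by blast
    then show "EX phi:\<Union>psi\<in>Psi. Phi psi. x : phi ` pcube M" using Phi(3)[OF v(1,2)] x(2) by blast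
  qed (use N in auto)
qed

text \<open>Points are moved along the segment towards the vertex (1,...,1).\<close>

lemma ucube_closure: "ucube M \<subseteq> closure (pcube M)"
proof
  fix t assume t: "t : ucube M"
  define f where "f s = (%i. if i < M then (1 - s) * t i + s else 0)" for s :: real
  have c: "continuous_on UNIV f" unfolding f_def
    by (rule continuous_on_coordinatewise_then_product, rename_tac i, case_tac "i < M") (auto intro!: continuous_intros)
  have f0: "f 0 = t" using t by (auto simp: f_def ucube_def)
  have "f s : pcube M" if "0 < s" "s <= 1" for s
  proof -
    have "0 < (1 - s) * t i + s & (1 - s) * t i + s <= 1" if "i < M" for i
    proof -
      have "0 <= t i" "t i <= 1" using t that by (auto simp: ucube_def)
      then have "0 <= (1 - s) * t i" "(1 - s) * t i <= (1 - s) * 1" using \<open>s <= 1\<close> by (simp, intro mult_left_mono, auto)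
      then show ?thesis using \<open>0 < s\<close> by auto
    qed
    then show ?thesis by (auto simp: f_def pcube_def)
  qed
  then have sub: "f ` {0<..1} \<subseteq> pcube M" by auto
  have "f ` closure {0<..1} \<subseteq> closure (f ` {0<..1})"
    by (rule image_closure_subset[OF continuous_on_subset[OF c] closed_closure closure_subset]) auto
  moreover have "0 : closure {0<..1::real}" by (simp add: closure_greaterThanAtMost)
  ultimately have "f 0 : closure (f ` {0<..1})" by blast
  then show "t : closure (pcube M)" using f0 closure_mono[OF sub] by auto
qed

text \<open>Near a, X is a projection of a bounded semianalytic set A. Charts of A are collected
  over the compact fibre of the closure of A above a. They send the half-open cube into X, and the
  closed one as well because X is closed.\<close>

theorem uniformization:
  fixes X :: "(real^'n) set"
  assumes X: "subanalytic_set X" "closed X" and a: "a : X"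
  obtains M and Phi :: "((nat => real) => real^'n) set" where "finite Phi"
    "\<And>phi t. phi : Phi ==> t : ucube M ==> phi t : X" "\<And>phi t k. phi : Phi ==> t : ucube M ==> ra {..<M} (%x. vec_nth (phi x) k) t"
    "\<forall>\<^sub>F x in nhds a. x : X --> (EX phi:Phi. x : phi ` ucube M)"
proof -
  define d where "d = CARD('n)"
  obtain e where e: "bij_betw e {..<d} (UNIV :: 'n set)"
    and sub: "subanalytic d ((%x i. if i < d then vec_nth x (e i) else 0) ` X)"
    using X(1) unfolding subanalytic_set_def d_def by blast
  define J where "J x = (%i. if i < d then vec_nth x (e i) else 0)" for x :: "real^'n"
  define e' where "e' = inv_into {..<d} e"
  have e': "e' k < d" "e (e' k) = k" for k
    using bij_betw_inv_into[OF e] bij_betw_inv_into_right[OF e] by (auto simp: e'_def bij_betw_def)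
  have e'e: "e' (e i) = i" if "i < d" for i using bij_betw_inv_into_left[OF e] that by (auto simp: e'_def)
  define R where "R y = vec_lambda (%k. y (e' k))" for y :: "nat => real"
  have RJ: "R (J x) = x" for x using e' by (simp add: R_def J_def vec_eq_iff)
  have inJ: "inR d (J x)" for x by (simp add: J_def inR_def)
  obtain r m A where r: "r > 0" and A: "semianalytic (d + m) A" "boundedN (d + m) A" and
    XA: "J ` X \<inter> nball d (J a) r = projN d ` A"
    using sub[unfolded subanalytic_def, THEN conjunct2, rule_format, OF inJ[of a]] unfolding J_def by blast
  define M where "M = d + m"
  have inA: "inR M x" if "x : A" for x using A(1) that unfolding semianalytic_def M_def by blast
  obtain B where B: "ALL x:A. (\<Sum>i<M. (x i)\<^sup>2) <= B" using A(2) unfolding boundedN_def M_def by blast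
  define Bx where "Bx = {x::nat=>real. ALL i. (if i < M then - sqrt B else 0) <= x i & x i <= (if i < M then sqrt B else 0)}"
  have cB: "compact Bx" unfolding Bx_def by (rule compact_fun_box)
  have ABx: "A \<subseteq> Bx"
  proof
    fix x assume x: "x : A"
    have "\<bar>x i\<bar> <= sqrt B" if "i < M" for i
    proof -
      have "(x i)\<^sup>2 <= (\<Sum>i<M. (x i)\<^sup>2)" by (rule member_le_sum) (use that in auto)
      then have "(x i)\<^sup>2 <= B" using B x by force
      then show ?thesis using real_sqrt_le_mono by fastforce
    qed
    then show "x : Bx" using inA[OF x] by (auto simp: Bx_def inR_def abs_le_iff) (metis minus_le_iff)
  qed
  have clA: "closure A \<subseteq> Bx" using ABx compact_imp_closed[OF cB] by (rule closure_minimal)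
  have ccl: "compact (closure A)" using compact_Int_closed[OF cB closed_closure[of A]] clA by (simp add: inf.absorb2)
  have inBx: "inR M x" if "x : Bx" for x using that by (auto simp: Bx_def inR_def) (metis not_less antisym)
  have cp: "continuous_on UNIV (projN d)" unfolding projN_def
    by (rule continuous_on_coordinatewise_then_product, rename_tac i, case_tac "i < d")
      (auto intro: continuous_on_product_then_coordinatewise continuous_on_id)
  \<comment> \<open>The fibre is taken in the closure of A: points of A whose projections tend to a
    may accumulate outside A, and the charts exist near such points too.\<close>
  define K where "K = closure A \<inter> projN d -` {J a}"
  have cK: "compact K" unfolding K_def
    by (intro compact_Int_closed ccl closed_vimage cp) auto
  have "ALL y:K. EX N Phi. open N & y : N & finite Phi & (ALL phi:Phi. achart M A phi) & (ALL x:N. x : A --> (EX phi:Phi. x : phi ` pcube M))"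
  proof
    fix y assume "y : K"
    then have "inR M y" using inBx clA by (auto simp: K_def)
    from semianalytic_charts[OF A(1)[folded M_def] this]
    obtain Phi N where "finite Phi" "\<And>phi. phi : Phi ==> achart M A phi" "open N" "y : N"
      "\<And>x. x : N ==> x : A ==> EX phi:Phi. x : phi ` pcube M" by metis
    then show "EX N Phi. open N & y : N & finite Phi & (ALL phi:Phi. achart M A phi) & (ALL x:N. x : A --> (EX phi:Phi. x : phi ` pcube M))"
      by (intro exI[of _ N] exI[of _ Phi]) simp
  qed
  from bchoice2[OF this] obtain N Psi where NP: "ALL y:K. open (N y) & y : N y & finite (Psi y) & (ALL phi:Psi y. achart M A phi) & (ALL x:N y. x : A --> (EX phi:Psi y. x : phi ` pcube M))"
    by (elim exE)
  obtain C where C: "C \<subseteq> K" "finite C" "K \<subseteq> (\<Union>y\<in>C. N y)"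
    by (rule compactE_image[OF cK, of K N]) (use NP in auto)
  define NN where "NN = (\<Union>y\<in>C. N y)"
  have oNN: "open NN" using C NP by (auto simp: NN_def)
  define Phi0 where "Phi0 = (\<Union>y\<in>C. Psi y)"
  have fin: "finite Phi0" using C NP by (auto simp: Phi0_def)
  have ach: "achart M A phi" if "phi : Phi0" for phi using that C NP by (auto simp: Phi0_def)
  have cov: "EX phi:Phi0. x : phi ` pcube M" if "x : NN" "x : A" for x
    using that C NP unfolding NN_def Phi0_def by blast
  \<comment> \<open>Over O' every point of A lies in NN, so it is reached by the chosen charts;
    compactness of the remaining part of the closure makes O' open.\<close>
  define O' where "O' = - projN d ` (closure A - NN)"
  have "compact (projN d ` (closure A - NN))"
    by (intro compact_continuous_image continuous_on_subset[OF cp] compact_diff ccl oNN) auto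
  then have oO: "open O'" unfolding O'_def by (simp add: compact_imp_closed open_Compl)
  have aO: "J a : O'" using C(3) by (auto simp: O'_def K_def NN_def)
  have cJ: "isCont J a"
  proof -
    have "continuous_on UNIV J" unfolding J_def
      by (rule continuous_on_coordinatewise_then_product, rename_tac i, case_tac "i < d")
        (auto intro!: continuous_intros)
    then show ?thesis by (simp add: continuous_on_eq_continuous_at)
  qed
  define Phi where "Phi = (%phi x. R (phi x)) ` Phi0"
  have dM: "d <= M" by (simp add: M_def)
  have coord: "vec_nth (R y) k = y (e' k)" for y k by (simp add: R_def)
  have Xp: "R (phi t) : X" if phi: "phi : Phi0" and t: "t : pcube M" for phi t
  proof -
    have "phi t : A" using ach[OF phi] t unfolding achart_def by blast
    then have "projN d (phi t) : J ` X" using XA by blast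
    then obtain x where x: "x : X" "projN d (phi t) = J x" by blast
    have "R (phi t) = R (projN d (phi t))" using e' by (simp add: vec_eq_iff coord projN_def)
    then show ?thesis using x RJ by simp
  qed
  have raphi: "ra {..<M} (%x. vec_nth (R (phi x)) k) t" if "phi : Phi0" "t : ucube M" for phi t k
    unfolding coord using ach[OF that(1)] that(2) e'(1)[of k] dM unfolding achart_def by auto
  have Xu: "R (phi t) : X" if phi: "phi : Phi0" and t: "t : ucube M" for phi t
  proof -
    have "isCont (%x. vec_nth (R (phi x)) k) t" for k by (rule isCont_ra[OF raphi[OF that]])
    then have ic: "isCont (%x. R (phi x)) t" unfolding isCont_def by (intro vec_tendstoI)
    have "t : closure (pcube M)" using t ucube_closure by blast
    then obtain s where s: "\<And>n. s n : pcube M" "s \<longlonglongrightarrow> t" using closure_sequential by blast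
    have "(%n. R (phi (s n))) \<longlonglongrightarrow> R (phi t)" by (rule isCont_tendsto_compose[OF ic s(2)])
    then show ?thesis by (rule closed_sequentially[OF X(2), rotated]) (use Xp[OF phi s(1)] in auto)
  qed
  show thesis
  proof (rule that[of Phi M])
    show "finite Phi" using fin by (simp add: Phi_def)
    show "phi t : X" if "phi : Phi" "t : ucube M" for phi t using that Xu by (auto simp: Phi_def)
    show "ra {..<M} (%x. vec_nth (phi x) k) t" if "phi : Phi" "t : ucube M" for phi t k using that raphi by (auto simp: Phi_def)
    have "\<forall>\<^sub>F x in nhds a. J x : O'"
      using isCont_nhds[OF cJ] eventually_nhds_in_open[OF oO aO] unfolding filterlim_iff by blast
    moreover have "\<forall>\<^sub>F x in nhds a. (\<Sum>i<d. (J x i - J a i)\<^sup>2) < r\<^sup>2"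
    proof -
      have "continuous_on UNIV (%x. \<Sum>i<d. (J x i - J a i)\<^sup>2)" unfolding J_def by (auto intro!: continuous_intros)
      then have "isCont (%x. \<Sum>i<d. (J x i - J a i)\<^sup>2) a" by (simp add: continuous_on_eq_continuous_at)
      from order_tendstoD(2)[OF isCont_nhds[OF this], of "r\<^sup>2"] r show ?thesis by simp
    qed
    ultimately show "\<forall>\<^sub>F x in nhds a. x : X --> (EX phi:Phi. x : phi ` ucube M)"
    proof (rule eventually_elim2, intro impI)
      fix x assume x: "J x : O'" "(\<Sum>i<d. (J x i - J a i)\<^sup>2) < r\<^sup>2" "x : X"
      have "J x : J ` X \<inter> nball d (J a) r" using x inJ by (auto simp: nball_def)
      then obtain z where z: "z : A" "J x = projN d z" using XA by blast
      have "z : NN" using x(1) z closure_subset[of A] by (auto simp: O'_def)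
      from cov[OF this z(1)] obtain phi t where t: "phi : Phi0" "t : pcube M" "z = phi t" by blast
      have "x = R (J x)" using RJ by simp
      also have "\<dots> = R (phi t)" using z(2) t(3) e' by (simp add: vec_eq_iff coord projN_def)
      finally have "x : (%x. R (phi x)) ` ucube M" using pcube_ucube[OF t(2)] by blast
      then show "EX phi:Phi. x : phi ` ucube M" using t(1) unfolding Phi_def by (intro bexI[of _ "%x. R (phi x)"]) auto
    qed
  qed
qed

section \<open>Sard's theorem for analytic maps\<close>

lemma isCont_finite_coords:
  fixes m :: "'a::t2_space => nat => real"
  assumes "finite S" "\<And>i. i : S ==> isCont (%t. m t i) t0" "\<And>i t. i \<notin> S ==> m t i = m t0 i"
  shows "isCont m t0"
  unfolding isCont_def
proof (rule topological_tendstoI)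
  fix V assume V: "open V" "m t0 : V"
  obtain r where r: "r > 0" "\<And>x. (ALL i:S. dist (x i) (m t0 i) < r) ==> (ALL i. i \<notin> S --> x i = m t0 i) ==> x : V"
    using open_fun_box[OF V assms(1)] by blast
  have "\<forall>\<^sub>F t in at t0. ALL i:S. dist (m t i) (m t0 i) < r"
    using assms(1,2) r(1) unfolding isCont_def by (auto intro!: eventually_ball_finite tendstoD)
  then show "\<forall>\<^sub>F t in at t0. m t : V"
    by (rule eventually_mono) (use r(2) assms(3) in blast)
qed

lemma DERIV_mult_isCont:
  fixes h k :: "real => real"
  assumes "(h has_real_derivative h') (at t0)" "h t0 = 0" "isCont k t0"
  shows "((%t. h t * k t) has_real_derivative h' * k t0) (at t0)"
proof -
  have "((%t. (h t - h t0) / (t - t0) * k t) \<longlongrightarrow> h' * k t0) (at t0)"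
    using assms unfolding has_field_derivative_iff isCont_def by (intro tendsto_mult) auto
  then show ?thesis unfolding has_field_derivative_iff using assms(2) by simp
qed

text \<open>The coordinates are released one at a time (\<open>m U\<close>). Each newly moving one
  contributes (gamma j - c) times a divided difference; the second factor is only continuous along
  the curve, and this suffices since the first vanishes at t0
  (\<open>DERIV_mult_isCont\<close>).\<close>

lemma ra_chain:
  assumes f: "ra S f (gamma t0)" and g: "\<And>i. i : S ==> ((%t. gamma t i) has_real_derivative gamma' i) (at t0)"
  shows "((%t. f (gamma t)) has_real_derivative (\<Sum>i\<in>S. pd i f (gamma t0) * gamma' i)) (at t0)"
proof -
  have fS: "finite S" using raD f by blast
  define m where "m U t = (%i. if i : U then gamma t i else gamma t0 i)" for U t
  have "((%t. f (m U t)) has_real_derivative (\<Sum>i\<in>U. pd i f (gamma t0) * gamma' i)) (at t0)" if "U \<subseteq> S" for U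
    using finite_subset[OF that fS] that
  proof (induction U rule: finite_induct)
    case empty
    then show ?case by (simp add: m_def)
  next
    case (insert j U)
    let ?c = "gamma t0 j"
    let ?k = "%t. dd j ?c f (m (insert j U) t)"
    have e: "f (m (insert j U) t) = f (m U t) + (gamma t j - ?c) * ?k t" for t
    proof -
      have "(m (insert j U) t)(j := ?c) = m U t" using insert.hyps by (auto simp: m_def)
      moreover have "m (insert j U) t j = gamma t j" by (simp add: m_def)
      ultimately show ?thesis using dd_expand[of f "m (insert j U) t" j ?c] by simp
    qed
    have mt0: "m V t0 = gamma t0" for V by (auto simp: m_def)
    have "isCont (m (insert j U)) t0"
    proof (rule isCont_finite_coords[OF fS])
      fix i show "isCont (%t. m (insert j U) t i) t0" if "i : S"
      proof (cases "i : insert j U")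
        case True then show ?thesis using DERIV_isCont[OF g[OF that]] by (simp add: m_def)
      next
        case False then show ?thesis by (simp add: m_def)
      qed
      show "m (insert j U) t i = m (insert j U) t0 i" if "i \<notin> S" for t using that insert.prems by (auto simp: m_def)
    qed
    moreover have "isCont (dd j ?c f) (m (insert j U) t0)"
      using isCont_ra[OF ra_dd[OF f]] insert.prems unfolding mt0 by auto
    ultimately have k: "isCont ?k t0" by (rule isCont_o2)
    have "((%t. gamma t j - ?c) has_real_derivative gamma' j) (at t0)"
      using insert.prems g[of j] by (auto intro!: derivative_eq_intros)
    from DERIV_mult_isCont[OF this _ k] have d2: "((%t. (gamma t j - ?c) * ?k t) has_real_derivative gamma' j * ?k t0) (at t0)" by simp
    have "?k t0 = pd j f (gamma t0)" unfolding mt0 by (simp add: dd_def)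
    then have "((%t. f (m U t) + (gamma t j - ?c) * ?k t) has_real_derivative (\<Sum>i\<in>U. pd i f (gamma t0) * gamma' i) + pd j f (gamma t0) * gamma' j) (at t0)"
      using DERIV_add[OF insert.IH d2] insert.prems by (simp add: mult.commute)
    then show ?case using insert.hyps unfolding e[symmetric] by (simp add: add.commute)
  qed
  from this[of S] have "((%t. f (m S t)) has_real_derivative (\<Sum>i\<in>S. pd i f (gamma t0) * gamma' i)) (at t0)" by simp
  moreover have "f (m S t) = f (gamma t)" for t by (rule depD[OF raD(2)[OF f]]) (simp add: m_def)
  ultimately show ?thesis by simp
qed

definition dird :: "nat set => (nat => real) => ((nat => real) => real) => (nat => real) => real" where
  "dird S w f v = (\<Sum>l\<in>S. pd l f v * w l)"

text \<open>Surjectivity of the Jacobian, witnessed by a right inverse whose columns are the w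
  j.\<close>

definition full_rank :: "nat set => 'k set => ((nat => real) => 'k => real) => (nat => real) => bool" where
  "full_rank S J phi v \<longleftrightarrow> (EX w. ALL i:J. ALL j:J. dird S (w j) (%x. phi x i) v = (if i = j then 1 else 0))"

text \<open>The image of C contains an open box of R^J. This takes over the part of positive measure
  in the usual proof of Sard's theorem, and \<open>fills_peel\<close> that of additivity.\<close>

definition fills :: "'k set => ((nat => real) => 'k => real) => (nat => real) set => bool" where
  "fills J phi C \<longleftrightarrow> (EX p. EX epsilon>0. ALL x. (ALL j:J. \<bar>x j - p j\<bar> < epsilon) --> (EX v:C. ALL j:J. phi v j = x j))"

lemma ra_dird: "ra S f a ==> ra S (dird S w f) a"
  unfolding dird_def by (intro ra_sum ra_mult ra_pd ra_const) (auto dest: raD)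

lemma ra_dird_iter: "ra S f a ==> ra S ((dird S w ^^ k) f) a"
  by (induction k) (auto intro: ra_dird)

text \<open>The image of the compact set C1 is closed and misses a point x0 of a smaller concentric
  box, hence a whole box about x0. The part of C that maps into the closed box is compact, avoids C1
  and still fills.\<close>

lemma fills_peel:
  fixes phi :: "(nat => real) => 'k => real"
  assumes J: "finite J" and C: "compact C" "compact C1" "C1 \<subseteq> C"
    and c: "\<And>j. j : J ==> continuous_on C (%v. phi v j)" and f: "fills J phi C" "\<not> fills J phi C1"
  obtains C' where "compact C'" "C' \<subseteq> C - C1" "fills J phi C'"
proof -
  obtain p epsilon where p: "epsilon > 0" "\<And>x. (ALL j:J. \<bar>x j - p j\<bar> < epsilon) ==> (EX v:C. ALL j:J. phi v j = x j)"
    using f(1) unfolding fills_def by blast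
  have "\<not> (ALL x. (ALL j:J. \<bar>x j - p j\<bar> < epsilon/2) --> (EX v:C1. ALL j:J. phi v j = x j))"
  proof
    assume "ALL x. (ALL j:J. \<bar>x j - p j\<bar> < epsilon/2) --> (EX v:C1. ALL j:J. phi v j = x j)"
    then have "fills J phi C1" unfolding fills_def using p(1) by (intro exI[of _ p] exI[of _ "epsilon/2"]) simp
    with f(2) show False by simp
  qed
  then obtain x0 where x0: "ALL j:J. \<bar>x0 j - p j\<bar> < epsilon/2" "ALL v:C1. EX j:J. phi v j ~= x0 j"
    by (auto simp del: less_divide_eq_numeral1)
  define g where "g v = (\<Sum>j\<in>J. \<bar>phi v j - x0 j\<bar>)" for v
  have cg: "continuous_on C1 g" unfolding g_def
    by (intro continuous_on_sum continuous_on_rabs continuous_on_diff continuous_on_const continuous_on_subset[OF c C(3)])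
  have gpos: "g v > 0" if v: "v : C1" for v
  proof -
    obtain j where j: "j : J" "phi v j ~= x0 j" using x0(2) v by blast
    then show ?thesis unfolding g_def by (intro sum_pos2[OF J j(1)]) auto
  qed
  obtain mu where mu: "mu > 0" "\<And>v. v : C1 ==> mu <= g v"
  proof (cases "C1 = {}")
    case True then show ?thesis using that[of 1] by simp
  next
    case False
    obtain v0 where "v0 : C1" "ALL v:C1. g v0 <= g v" using continuous_attains_inf[OF C(2) False cg] by blast
    then show ?thesis using that[of "g v0"] gpos by auto
  qed
  \<comment> \<open>A point of C1 within eta of x0 in every coordinate would have l1 distance at
    most card J * eta < mu from x0, contrary to the minimum mu on C1.\<close>
  define eta where "eta = min (epsilon/2) (mu / (2 * (real (card J) + 1)))"
  have "eta > 0" unfolding eta_def using p(1) mu(1) by (simp add: add_nonneg_pos)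
  moreover have "eta <= epsilon/2" unfolding eta_def by (rule min.cobounded1)
  moreover have "eta <= mu / (2 * (real (card J) + 1))" unfolding eta_def by (rule min.cobounded2)
  ultimately have eta: "eta > 0" "eta <= epsilon/2" "eta <= mu / (2 * (real (card J) + 1))" by auto
  define C' where "C' = {v:C. ALL j:J. \<bar>phi v j - x0 j\<bar> <= eta}"
  have "compact C'"
  proof -
    have "closedin (top_of_set C) {v:C. \<bar>phi v j - x0 j\<bar> <= eta}" if "j : J" for j
    proof -
      have "continuous_on C (%v. \<bar>phi v j - x0 j\<bar>)"
        by (intro continuous_on_rabs continuous_on_diff continuous_on_const c[OF that])
      from continuous_closedin_preimage[OF this, of "{..eta}"] show ?thesis
        by (simp add: vimage_def Int_def)
    qed
    then have "closedin (top_of_set C) (C \<inter> (\<Inter>j\<in>J. {v:C. \<bar>phi v j - x0 j\<bar> <= eta}))"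
      by (cases "J = {}") (auto intro!: closedin_Inter)
    moreover have "C \<inter> (\<Inter>j\<in>J. {v:C. \<bar>phi v j - x0 j\<bar> <= eta}) = C'" by (auto simp: C'_def)
    ultimately show ?thesis using closedin_compact[OF C(1)] by simp
  qed
  moreover have "C' \<subseteq> C - C1"
  proof
    fix v assume v: "v : C'"
    have "v \<notin> C1"
    proof
      assume "v : C1"
      then have "mu <= g v" by (rule mu)
      also have "g v <= (\<Sum>j\<in>J. eta)" unfolding g_def by (rule sum_mono) (use v in \<open>auto simp: C'_def\<close>)
      also have "\<dots> = real (card J) * eta" by simp
      also have "\<dots> <= real (card J) * (mu / (2 * (real (card J) + 1)))" using eta by (intro mult_left_mono) auto
      also have "\<dots> < mu" using mu(1) add_nonneg_pos[of "mu * real (card J)" "mu * 2"] by (simp add: field_simps)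
      finally show False by simp
    qed
    then show "v : C - C1" using v by (auto simp: C'_def)
  qed
  moreover have "fills J phi C'"
    unfolding fills_def
  proof (intro exI[of _ x0] exI[of _ eta] conjI allI impI)
    fix x assume x: "ALL j:J. \<bar>x j - x0 j\<bar> < eta"
    have "ALL j:J. \<bar>x j - p j\<bar> < epsilon"
    proof
      fix j assume j: "j : J"
      have "\<bar>x j - x0 j\<bar> < eta" "\<bar>x0 j - p j\<bar> < epsilon/2" using x x0(1) j by blast+
      then show "\<bar>x j - p j\<bar> < epsilon" using eta(2) by linarith
    qed
    then obtain v where v: "v : C" "ALL j:J. phi v j = x j" using p(2) by blast
    then have "v : C'" using x by (auto simp: C'_def less_imp_le)
    then show "EX v:C'. ALL j:J. phi v j = x j" using v by blast
  qed (rule eta)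
  ultimately show ?thesis by (rule that)
qed

lemma not_fills_empty: "\<not> fills J phi {}"
proof
  assume "fills J phi {}"
  then obtain p epsilon where "epsilon > 0" "ALL x. (ALL j:J. \<bar>x j - p j\<bar> < epsilon) --> (EX v:{}. ALL j:J. phi v j = x j)"
    unfolding fills_def by blast
  from this(2)[rule_format, of p] this(1) show False by simp
qed

text \<open>Finitely many closed balls cover C; they are peeled off one by one until the empty set
  would have to fill.\<close>

lemma fills_local:
  fixes phi :: "(nat => real) => 'k => real"
  assumes J: "finite J" and C: "compact C" and c: "\<And>j. j : J ==> continuous_on C (%v. phi v j)"
    and loc: "\<And>v. v : C ==> EX N. open N & v : N & (ALL C'. compact C' --> C' \<subseteq> C \<inter> N --> \<not> fills J phi C')"
  shows "\<not> fills J phi C"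
proof -
  have "ALL v:C. EX r>0. ALL C'. compact C' --> C' \<subseteq> C \<inter> cball v r --> \<not> fills J phi C'"
  proof
    fix v assume v: "v : C"
    from loc[OF v] obtain N where N: "open N" "v : N" "ALL C'. compact C' --> C' \<subseteq> C \<inter> N --> \<not> fills J phi C'" by blast
    obtain r where "r > 0" "cball v r \<subseteq> N" using N(1,2) open_contains_cball by blast
    then show "EX r>0. ALL C'. compact C' --> C' \<subseteq> C \<inter> cball v r --> \<not> fills J phi C'" using N(3) by blast
  qed
  from bchoice[OF this] obtain r where rr: "ALL v:C. r v > 0 & (ALL C'. compact C' --> C' \<subseteq> C \<inter> cball v (r v) --> \<not> fills J phi C')" by (elim exE)
  have r: "\<And>v. v : C ==> r v > 0" "\<And>v C'. v : C ==> compact C' ==> C' \<subseteq> C \<inter> cball v (r v) ==> \<not> fills J phi C'"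
    using rr by simp_all
  obtain F where F: "F \<subseteq> C" "finite F" "C \<subseteq> (\<Union>v\<in>F. ball v (r v))"
    by (rule compactE_image[OF C, of C "%v. ball v (r v)"]) (use r(1) in auto)
  have "\<not> fills J phi C0" if "compact C0" "C0 \<subseteq> C" "C0 \<subseteq> (\<Union>v\<in>G. cball v (r v))" "finite G" "G \<subseteq> C" for C0 G
    using that(4,1,2,3,5)
  proof (induction G arbitrary: C0 rule: finite_induct)
    case empty then show ?case using not_fills_empty by auto
  next
    case (insert v G)
    show ?case
    proof
      assume f: "fills J phi C0"
      have c1: "compact (C0 \<inter> cball v (r v))" using insert.prems(1) by (intro compact_Int_closed) auto
      have "\<not> fills J phi (C0 \<inter> cball v (r v))" by (rule r(2)[OF _ c1]) (use insert.prems in auto)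
      then obtain C' where C': "compact C'" "C' \<subseteq> C0 - C0 \<inter> cball v (r v)" "fills J phi C'"
        using fills_peel[OF J insert.prems(1) c1 _ continuous_on_subset[OF c insert.prems(2)] f] by blast
      have "\<not> fills J phi C'" by (rule insert.IH[OF C'(1)]) (use C'(2) insert.prems in auto)
      with C'(3) show False by simp
    qed
  qed
  from this[OF C _ _ F(2,1)] F(3) ball_subset_cball show ?thesis by blast
qed

text \<open>The chain rule on the graph x i = eta: a direction w in the remaining variables lifts to
  the tangent direction of the graph, with i-th component the derivative of eta along w.\<close>

lemma graph_rank:
  fixes phi :: "(nat => real) => 'k => real"
  assumes fS: "finite S" and i: "i : S" and eta: "ra (S - {i}) eta y" and y: "y i = 0"
    and ph: "\<And>j. j : J ==> ra S (%x. phi x j) (y(i := eta y))"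
  shows "\<And>j w. j : J ==> dird (S - {i}) w (%x. phi (x(i := eta x)) j) y =
      dird S (w(i := dird (S - {i}) w eta y)) (%x. phi x j) (y(i := eta y))"
proof -
  fix j w assume j: "j : J"
  let ?S = "S - {i}" and ?x = "y(i := eta y)" and ?f = "%x. phi x j"
  have pdl: "pd l (%x. phi (x(i := eta x)) j) y = pd l ?f ?x + pd i ?f ?x * pd l eta y" if l: "l : ?S" for l
  proof (rule pd_eqI)
    have li: "l ~= i" using l by simp
    let ?gamma = "%t. (y(l := t))(i := eta (y(l := t)))"
    have g0: "?gamma (y l) = ?x" by simp
    have "((%t. ?f (?gamma t)) has_real_derivative (\<Sum>s\<in>S. pd s ?f (?gamma (y l)) * (if s = l then 1 else if s = i then pd l eta y else 0))) (at (y l))"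
    proof (rule ra_chain)
      show "ra S ?f (?gamma (y l))" unfolding g0 by (rule ph[OF j])
      fix s assume "s : S"
      show "((%t. ?gamma t s) has_real_derivative (if s = l then 1 else if s = i then pd l eta y else 0)) (at (y l))"
        using li has_real_derivative_pd[OF eta l] by (cases "s = l"; cases "s = i") auto
    qed
    moreover have "(\<Sum>s\<in>S. pd s ?f ?x * (if s = l then 1 else if s = i then pd l eta y else 0)) = pd l ?f ?x + pd i ?f ?x * pd l eta y"
    proof -
      have "(\<Sum>s\<in>S. pd s ?f ?x * (if s = l then 1 else if s = i then pd l eta y else 0)) =
        (\<Sum>s\<in>S. (if s = l then pd l ?f ?x else 0) + (if s = i then pd i ?f ?x * pd l eta y else 0))"
        by (rule sum.cong) (use li in auto)
      then show ?thesis using fS l i by (simp add: sum.distrib)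
    qed
    ultimately show "((%t. phi ((y(l := t))(i := eta (y(l := t)))) j) has_real_derivative pd l ?f ?x + pd i ?f ?x * pd l eta y) (at (y l))"
      unfolding g0 by simp
  qed
  have "dird ?S w (%x. phi (x(i := eta x)) j) y = (\<Sum>l\<in>?S. pd l ?f ?x * w l) + pd i ?f ?x * (\<Sum>l\<in>?S. pd l eta y * w l)"
    unfolding dird_def sum_distrib_left sum.distrib[symmetric]
    by (rule sum.cong) (auto simp: pdl algebra_simps)
  also have "\<dots> = dird S (w(i := dird ?S w eta y)) ?f ?x"
    unfolding dird_def sum.remove[OF fS i] by (auto intro!: sum.cong simp: add.commute)
  finally show "dird ?S w (%x. phi (x(i := eta x)) j) y = dird S (w(i := dird ?S w eta y)) ?f ?x" .
qed

lemma dird_add: "dird S (%l. a l + b l) f v = dird S a f v + dird S b f v"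
  unfolding dird_def by (simp add: distrib_left sum.distrib)

lemma dird_scale: "dird S (%l. c * a l) f v = c * dird S a f v"
  unfolding dird_def by (simp add: sum_distrib_left mult_ac)

lemma dird_sum: "dird S (%l. \<Sum>j\<in>J. a j l) f v = (\<Sum>j\<in>J. dird S (a j) f v)"
  unfolding dird_def by (simp add: sum_distrib_left) (rule sum.swap)

text \<open>The w j already annihilate the component j1. A direction e that does not is normalized
  on j1 and then corrected by multiples of the w k until it annihilates the other
  components.\<close>

lemma full_rank_extend:
  assumes J: "finite J" "j1 : J"
    and w: "\<And>i j. i : J - {j1} ==> j : J - {j1} ==> dird S (w j) (%x. phi x i) v = (if i = j then 1 else 0)"
    and w0: "\<And>j. j : J - {j1} ==> dird S (w j) (%x. phi x j1) v = 0"
    and e: "dird S e (%x. phi x j1) v ~= 0"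
  shows "full_rank S J phi v"
proof -
  let ?J = "J - {j1}"
  define c where "c = dird S e (%x. phi x j1) v"
  define e1 where "e1 = (%l. e l / c)"
  define W where "W = (%l. e1 l + (\<Sum>k\<in>?J. (- dird S e1 (%x. phi x k) v) * w k l))"
  have e1: "dird S e1 (%x. phi x j1) v = 1"
    using dird_scale[of S "1/c" e] e by (simp add: e1_def c_def)
  have W: "dird S W (%x. phi x i) v = dird S e1 (%x. phi x i) v - (\<Sum>k\<in>?J. dird S e1 (%x. phi x k) v * dird S (w k) (%x. phi x i) v)" for i
    unfolding W_def dird_add dird_sum dird_scale by (simp add: sum_negf)
  have W1: "dird S W (%x. phi x j1) v = 1" unfolding W e1 using w0 by simp
  have Wi: "dird S W (%x. phi x i) v = 0" if "i : ?J" for i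
  proof -
    have "(\<Sum>k\<in>?J. dird S e1 (%x. phi x k) v * dird S (w k) (%x. phi x i) v) = (\<Sum>k\<in>?J. if k = i then dird S e1 (%x. phi x k) v else 0)"
      by (rule sum.cong) (use w that in auto)
    then show ?thesis unfolding W using that J by simp
  qed
  show ?thesis unfolding full_rank_def
  proof (intro exI[of _ "w(j1 := W)"] ballI)
    fix i j assume ij: "i : J" "j : J"
    show "dird S ((w(j1 := W)) j) (%x. phi x i) v = (if i = j then 1 else 0)"
      using ij w[of i j] w0[of j] W1 Wi[of i] by (cases "j = j1"; cases "i = j1") auto
  qed
qed

lemma line_derivatives:
  assumes "\<And>t. t : {0..h} ==> ra S f (%i. v i + t * w i)" "t : {0..h}"
  shows "((%t. (dird S w ^^ k) f (%i. v i + t * w i)) has_real_derivative (dird S w ^^ Suc k) f (%i. v i + t * w i)) (at t)"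
proof -
  have r: "ra S ((dird S w ^^ k) f) (%i. v i + t * w i)" by (rule ra_dird_iter[OF assms(1)[OF assms(2)]])
  have "((%t. (dird S w ^^ k) f (%i. v i + t * w i)) has_real_derivative (\<Sum>i\<in>S. pd i ((dird S w ^^ k) f) (%i. v i + t * w i) * w i)) (at t)"
    by (rule ra_chain[where gamma = "%t i. v i + t * w i" and gamma' = w, OF r]) (auto intro!: derivative_eq_intros)
  then show ?thesis by (simp add: dird_def)
qed

text \<open>On some line through v the difference f - f v has finite order j. If all iterated
  derivatives along it vanished at v, Taylor's formula of order j+1 would force the quotient by t^j
  to 0.\<close>

lemma nonconstant_dird:
  assumes f: "ra S f v" and nc: "\<not> (\<forall>\<^sub>F x in nhds v. f x = f v)" and S: "S ~= {}"
  obtains w k where "1 <= k" "(dird S w ^^ k) f v ~= 0"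
proof -
  have fS: "finite S" using raD f by blast
  obtain n where n: "n : S" using S by blast
  have f': "ra S (%x. f x - f v) v" by (intro ra_diff f ra_const fS)
  have nz: "\<not> (\<forall>\<^sub>F x in nhds v. f x - f v = 0)" using nc by simp
  obtain p j L where L: "L ~= 0" and l: "((%t. (f (%i. v i + t * (p i - v i)) - f v) / t ^ j) \<longlongrightarrow> L) (at 0)"
    by (rule finite_order_direction[OF f' nz n]) (rule that; assumption)
  define w where "w = (%i. p i - v i)"
  define g where "g k t = (dird S w ^^ k) f (%i. v i + t * w i)" for k t
  have cont_line: "isCont (%t i. v i + t * w i) 0"
  proof -
    have "continuous_on UNIV (%t i. v i + t * w i)"
      by (intro continuous_on_coordinatewise_then_product continuous_intros)
    then show ?thesis by (simp add: continuous_on_eq_continuous_at)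
  qed
  have "\<forall>\<^sub>F t in nhds (0::real). ra S f (%i. v i + t * w i)"
    using isCont_nhds[OF cont_line] ra_eventually[OF f] unfolding filterlim_iff by simp
  then obtain h where h: "h > 0" "\<And>t. dist t 0 < h ==> ra S f (%i. v i + t * w i)"
    unfolding eventually_nhds_metric by blast
  note outer = that
  show thesis
  proof (rule ccontr)
    assume neg: "\<not> thesis"
    have z: "g k 0 = 0" if "1 <= k" for k
      using outer[OF that, of w] neg by (auto simp: g_def)
    define N where "N = Suc j"
    have isg: "isCont (g N) 0" unfolding g_def
      by (rule isCont_o2[OF cont_line]) (use isCont_ra[OF ra_dird_iter[OF f]] in simp)
    have "\<forall>\<^sub>F t in nhds 0. \<bar>g N t\<bar> < \<bar>g N 0\<bar> + 1"
      using order_tendstoD(2)[OF tendsto_rabs[OF isCont_nhds[OF isg]], of "\<bar>g N 0\<bar> + 1"] by simp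
    then obtain h2 where h2: "h2 > 0" "\<And>t. dist t 0 < h2 ==> \<bar>g N t\<bar> < \<bar>g N 0\<bar> + 1"
      unfolding eventually_nhds_metric by blast
    have bd: "\<bar>(f (%i. v i + t * (p i - v i)) - f v) / t ^ j\<bar> <= (\<bar>g N 0\<bar> + 1) * t" if t: "0 < t" "t < min h h2" for t
    proof -
      have d: "ALL m s. m < N & 0 <= s & s <= t --> DERIV (g m) s :> g (Suc m) s"
      proof (intro allI impI)
        fix m s assume "m < N & 0 <= s & s <= t"
        then show "DERIV (g m) s :> g (Suc m) s" unfolding g_def
          by (intro line_derivatives[of t]) (use h t in \<open>auto simp: dist_real_def\<close>)
      qed
      obtain s where s: "0 < s" "s < t" "g 0 t = (\<Sum>m<N. g m 0 / fact m * t ^ m) + g N s / fact N * t ^ N"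
        using Maclaurin[OF t(1) _ _ d, of "g 0"] by (auto simp: N_def)
      have "(\<Sum>m<N. g m 0 / fact m * t ^ m) = g 0 0"
      proof -
        have "(\<Sum>m<N. g m 0 / fact m * t ^ m) = (\<Sum>m<N. if m = 0 then g 0 0 else 0)"
          by (rule sum.cong) (use z in auto)
        then show ?thesis by (simp add: N_def)
      qed
      then have "g 0 t - g 0 0 = g N s / fact N * t ^ N" using s(3) by simp
      moreover have "g 0 t = f (%i. v i + t * (p i - v i))" "g 0 0 = f v" by (auto simp: g_def w_def)
      ultimately have "(f (%i. v i + t * (p i - v i)) - f v) / t ^ j = g N s / fact N * t ^ N / t ^ j" by simp
      also have "\<dots> = g N s / fact N * t" using t by (simp add: N_def)
      finally have "(f (%i. v i + t * (p i - v i)) - f v) / t ^ j = g N s / fact N * t" .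
      moreover have "\<bar>g N s / fact N * t\<bar> <= (\<bar>g N 0\<bar> + 1) * t"
      proof -
        have "\<bar>g N s\<bar> < \<bar>g N 0\<bar> + 1" by (rule h2(2)) (use s t in \<open>auto simp: dist_real_def\<close>)
        moreover have "\<bar>g N s\<bar> * 1 <= \<bar>g N s\<bar> * fact N" by (intro mult_left_mono fact_ge_1) auto
        then have "\<bar>g N s\<bar> / fact N <= \<bar>g N s\<bar>" by (simp add: pos_divide_le_eq)
        ultimately have "\<bar>g N s\<bar> / fact N * t <= (\<bar>g N 0\<bar> + 1) * t" using t by (intro mult_right_mono) auto
        then show ?thesis using t by (simp add: abs_mult)
      qed
      ultimately show ?thesis by simp
    qed
    have "((%t. (f (%i. v i + t * (p i - v i)) - f v) / t ^ j) \<longlongrightarrow> 0) (at_right 0)"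
    proof (rule Lim_null_comparison)
      show "\<forall>\<^sub>F t in at_right 0. norm ((f (%i. v i + t * (p i - v i)) - f v) / t ^ j) <= (\<bar>g N 0\<bar> + 1) * t"
        unfolding eventually_at_right_field using bd h(1) h2(1) by (intro exI[of _ "min h h2"]) auto
      show "((%t. (\<bar>g N 0\<bar> + 1) * t) \<longlongrightarrow> 0) (at_right 0)" by (auto intro!: tendsto_eq_intros)
    qed
    moreover have "((%t. (f (%i. v i + t * (p i - v i)) - f v) / t ^ j) \<longlongrightarrow> L) (at_right 0)"
      using l by (rule tendsto_within_subset) auto
    ultimately show False using L tendsto_unique[OF trivial_limit_at_right_real] by blast
  qed
qed

text \<open>The induction removes one variable at a time: where a partial derivative of the
  first component is nonzero one slices by its level sets, and the critical set of that component is
  exhausted by hypersurfaces on which an iterated directional derivative vanishes to first order.\<close>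

theorem analytic_sard:
  fixes phi :: "(nat => real) => 'k => real"
  assumes "finite S" "finite J" "compact K" "\<And>v. v : K ==> rn S v"
    "\<And>v j. v : K ==> j : J ==> ra S (%x. phi x j) v" "fills J phi K"
  shows "EX v:K. full_rank S J phi v"
  using assms
proof (induction "card S" arbitrary: S J phi K rule: less_induct)
  case less
  note fS = less.prems(1) and fJ = less.prems(2) and cK = less.prems(3) and rnK = less.prems(4)
    and raK = less.prems(5)
  show ?case
  proof (cases "J = {}")
    case True
    have "K ~= {}" using less.prems(6) not_fills_empty by blast
    then show ?thesis using True by (auto simp: full_rank_def)
  next
    case False
    then obtain j1 where j1: "j1 : J" by blast
    define f where "f x = phi x j1" for x
    show ?thesis
    proof (rule ccontr)
      assume neg: "\<not> ?thesis"
      have raf: "ra S f v" if "v : K" for v unfolding f_def using raK[OF that j1] .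
      have contphi: "continuous_on C (%v. phi v j)" if "C \<subseteq> K" "j : J" for C j
        by (intro continuous_at_imp_continuous_on ballI isCont_ra[OF raK]) (use that in auto)
      \<comment> \<open>On a hypersurface h = 0 with nonzero differential one coordinate is solved
        for, and the outer induction hypothesis is applied to phi on the graph, with one variable
        fewer. The directions obtained are lifted to the graph, so they annihilate h.\<close>
      have graph: "EX N. open N & v : N & (ALL C'. compact C' --> C' \<subseteq> K \<inter> N --> (ALL x:C'. h x = 0) --> fills J' phi C' -->
          (EX x:C'. EX w. (ALL k:J'. ALL j:J'. dird S (w j) (%x. phi x k) x = (if k = j then 1 else 0)) &
             (ALL j:J'. dird S (w j) h x = 0)))"
        if v: "v : K" and h: "ra S h v" "h v = 0" "i : S" "pd i h v ~= 0" and J': "J' \<subseteq> J" for v h i J'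
      proof -
        let ?S = "S - {i}"
        have S: "insert i ?S = S" using h(3) by blast
        obtain eta where eta: "ra ?S eta v" "eta v = v i" "\<forall>\<^sub>F x in nhds v. h (x(i := eta x)) = 0" "\<forall>\<^sub>F x in nhds v. h x = 0 --> x i = eta x"
        proof -
          have "ra (insert i ?S) h v" using h(1) S by simp
          from ra_implicit[OF this _ h(2,4)] that show thesis by blast
        qed
        have "\<forall>\<^sub>F x in nhds v. ra ?S eta x & ra S h x & h (x(i := eta x)) = 0 & (h x = 0 --> x i = eta x)"
          using ra_eventually[OF eta(1)] ra_eventually[OF h(1)] eta(3,4) by eventually_elim blast
        then obtain N where N: "open N" "v : N" "\<And>x. x : N ==> ra ?S eta x & ra S h x & h (x(i := eta x)) = 0 & (h x = 0 --> x i = eta x)"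
          unfolding eventually_nhds by blast
        show ?thesis
        proof (intro exI[of _ N] conjI allI impI N(1,2))
          fix C' assume C': "compact C'" "C' \<subseteq> K \<inter> N" "ALL x:C'. h x = 0" "fills J' phi C'"
          have etau: "eta (x(i := c)) = eta x" for x c by (rule depD[OF raD(2)[OF eta(1)]]) auto
          have bak: "(x(i := 0))(i := eta (x(i := 0))) = x" if "x : C'" for x
          proof -
            have "x : N" "h x = 0" using C'(2,3) that by auto
            then have "x i = eta x" using N(3) by blast
            then show ?thesis unfolding etau by auto
          qed
          define phi' where "phi' x = phi (x(i := eta x))" for x
          let ?C = "(%x. x(i := 0)) ` C'"
          have raeta: "ra ?S eta (x(i := 0))" if "x : C'" for x
            by (rule ra_agree[of _ _ x]) (use N(3)[of x] C'(2) that in auto)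
          have rag: "ra ?S (%x. g (x(i := eta x))) (x(i := 0))" if x: "x : C'" and g: "ra S g x" for g x
          proof (rule ra_compose[where Phi = "%x. x(i := eta x)" and S = S])
            show "ra S g ((x(i := 0))(i := eta (x(i := 0))))" using bak[OF x] g by simp
            show "ra ?S (%x. (x(i := eta x)) l) (x(i := 0))" if "l : S" for l
              using that raeta[OF x] fS by (cases "l = i") auto
          qed (use fS in simp)
          have "EX y:?C. full_rank ?S J' phi' y"
          proof (rule less.hyps)
            show "card ?S < card S" by (rule card_Diff1_less[OF fS h(3)])
            show "finite ?S" "finite J'" using fS fJ J' finite_subset by auto
            show "compact ?C"
              by (intro compact_continuous_image C'(1) continuous_on_coordinatewise_then_product, rename_tac l, case_tac "l = i")
                (auto intro: continuous_on_product_then_coordinatewise continuous_on_id)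
            show "rn ?S y" if "y : ?C" for y using that rnK C'(2) by (auto simp: rn_def)
            show "ra ?S (%x. phi' x j) y" if "y : ?C" "j : J'" for y j
            proof -
              note yj = that
              obtain x where x: "x : C'" "y = x(i := 0)" using yj by blast
              show ?thesis unfolding phi'_def x(2) by (rule rag[OF x(1)]) (use raK x(1) C'(2) J' yj(2) in auto)
            qed
            show "fills J' phi' ?C"
            proof -
              obtain p epsilon where p: "epsilon > 0" "ALL x. (ALL j:J'. \<bar>x j - p j\<bar> < epsilon) --> (EX v:C'. ALL j:J'. phi v j = x j)"
                using C'(4) unfolding fills_def by blast
              show ?thesis unfolding fills_def
              proof (intro exI[of _ p] exI[of _ epsilon] conjI p(1) allI impI)
                fix x assume "ALL j:J'. \<bar>x j - p j\<bar> < epsilon"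
                then obtain v where v: "v : C'" "ALL j:J'. phi v j = x j" using p(2) by blast
                have "phi' (v(i := 0)) = phi v" unfolding phi'_def bak[OF v(1)] ..
                then show "EX v:?C. ALL j:J'. phi' v j = x j" using v by (intro bexI[of _ "v(i := 0)"]) auto
              qed
            qed
          qed
          then obtain x w where x: "x : C'" and w: "ALL k:J'. ALL j:J'. dird ?S (w j) (%x. phi' x k) (x(i := 0)) = (if k = j then 1 else 0)"
            unfolding full_rank_def by blast
          let ?y = "x(i := 0)"
          let ?w = "%j. (w j)(i := dird ?S (w j) eta ?y)"
          have gr: "dird ?S (w j) (%x. g (x(i := eta x))) ?y = dird S (?w j) g x" if "ra S g x" for g j
            using graph_rank[OF fS h(3) raeta[OF x], where phi = "%x _::unit. g x" and J = UNIV and w = "w j"] that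
            unfolding bak[OF x] by simp
          show "EX x:C'. EX w. (ALL k:J'. ALL j:J'. dird S (w j) (%x. phi x k) x = (if k = j then 1 else 0)) & (ALL j:J'. dird S (w j) h x = 0)"
          proof (intro bexI[OF _ x] exI[of _ ?w] conjI ballI)
            fix k j assume kj: "k : J'" "j : J'"
            have "ra S (%x. phi x k) x" using raK x C'(2) J' kj by blast
            from gr[OF this, of j] w kj show "dird S (?w j) (%x. phi x k) x = (if k = j then 1 else 0)"
              unfolding phi'_def by simp
          next
            fix j assume "j : J'"
            have hx: "ra S h x" using N(3)[of x] x C'(2) by blast
            have "\<forall>\<^sub>F y in nhds ?y. h (y(i := eta y)) = 0"
            proof -
              have "filterlim (%y. y(i := x i)) (nhds x) (nhds ?y)"
              proof -
                have "continuous_on UNIV (%y::nat=>real. y(i := x i))"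
                  by (rule continuous_on_coordinatewise_then_product, rename_tac l, case_tac "l = i")
                    (auto intro: continuous_on_product_then_coordinatewise continuous_on_id)
                then have "isCont (%y. y(i := x i)) ?y" by (simp add: continuous_on_eq_continuous_at)
                then show ?thesis using isCont_nhds by fastforce
              qed
              moreover have "\<forall>\<^sub>F y in nhds x. y : N" using N(1) x C'(2) by (intro eventually_nhds_in_open) auto
              ultimately have "\<forall>\<^sub>F y in nhds ?y. y(i := x i) : N" unfolding filterlim_iff by blast
              then show ?thesis
              proof (rule eventually_mono)
                fix y assume "y(i := x i) : N"
                from N(3)[OF this] show "h (y(i := eta y)) = 0" unfolding etau by simp
              qed
            qed
            then have "pd l (%x. h (x(i := eta x))) ?y = pd l (%_. 0) ?y" for l
              by (intro eventually_nhds_x_imp_x[OF pd_cong])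
            moreover have "pd l (%_. 0) ?y = 0" for l by (simp add: pd_def)
            ultimately have "dird ?S (w j) (%x. h (x(i := eta x))) ?y = 0" unfolding dird_def by simp
            then show "dird S (?w j) h x = 0" using gr[OF hx, of j] by simp
          qed
        qed
      qed
      have nofull: "\<not> full_rank S J phi x" if "x : K" for x using neg that by blast
      \<comment> \<open>Where the differential of f is nonzero: on a level set of f the other
        components still fill, \<open>graph\<close> yields directions tangent to it, and one
        transverse direction completes the rank.\<close>
      have caseA: "\<not> fills J phi C" if C: "compact C" "C \<subseteq> K" and nz: "\<And>x. x : C ==> EX i:S. pd i f x ~= 0" for C
      proof
        assume "fills J phi C"
        then obtain p epsilon where p: "epsilon > 0" "ALL x. (ALL j:J. \<bar>x j - p j\<bar> < epsilon) --> (EX v:C. ALL j:J. phi v j = x j)"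
          unfolding fills_def by blast
        let ?J = "J - {j1}"
        define C0 where "C0 = {x:C. f x = p j1}"
        have cf: "continuous_on C f" unfolding f_def by (rule contphi[OF C(2) j1])
        have cC0: "compact C0"
        proof -
          have "closedin (top_of_set C) (C \<inter> f -` {p j1})" by (rule continuous_closedin_preimage[OF cf]) simp
          moreover have "C \<inter> f -` {p j1} = C0" by (auto simp: C0_def)
          ultimately show ?thesis using closedin_compact[OF C(1)] by simp
        qed
        have "fills ?J phi C0" unfolding fills_def
        proof (intro exI[of _ p] exI[of _ epsilon] conjI p(1) allI impI)
          fix x assume x: "ALL j:?J. \<bar>x j - p j\<bar> < epsilon"
          let ?x = "x(j1 := p j1)"
          have "ALL j:J. \<bar>?x j - p j\<bar> < epsilon" using x p(1) by auto
          then obtain v where v: "v : C" "ALL j:J. phi v j = ?x j" using p(2) by blast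
          then have "v : C0" using j1 by (auto simp: C0_def f_def)
          moreover have "ALL j:?J. phi v j = x j" using v(2) by auto
          ultimately show "EX v:C0. ALL j:?J. phi v j = x j" by blast
        qed
        moreover have "\<not> fills ?J phi C0"
        proof (rule fills_local[OF _ cC0])
          show "finite ?J" using fJ by simp
          show "continuous_on C0 (%v. phi v j)" if "j : ?J" for j
            by (rule contphi) (use that C in \<open>auto simp: C0_def\<close>)
          fix v assume v: "v : C0"
          then have vK: "v : K" using C by (auto simp: C0_def)
          obtain i where i: "i : S" "pd i f v ~= 0" using nz v by (auto simp: C0_def)
          let ?h = "%x. f x - p j1"
          have pdh: "pd l ?h x = pd l f x" if "x : K" "l : S" for l x
            by (rule pd_eqI) (use has_real_derivative_pd[OF raf[OF that(1)] that(2)] in \<open>auto intro!: derivative_eq_intros\<close>)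
          have rah: "ra S ?h v" by (intro ra_diff raf vK ra_const fS)
          have h0: "?h v = 0" using v by (simp add: C0_def)
          have pi: "pd i ?h v ~= 0" using pdh[OF vK i(1)] i(2) by simp
          from graph[OF vK rah h0 i(1) pi, of ?J]
          obtain N where N: "open N" "v : N" "ALL C'. compact C' --> C' \<subseteq> K \<inter> N --> (ALL x:C'. ?h x = 0) --> fills ?J phi C' -->
            (EX x:C'. EX w. (ALL k:?J. ALL j:?J. dird S (w j) (%x. phi x k) x = (if k = j then 1 else 0)) & (ALL j:?J. dird S (w j) ?h x = 0))"
            by auto
          show "EX N. open N & v : N & (ALL C'. compact C' --> C' \<subseteq> C0 \<inter> N --> \<not> fills ?J phi C')"
          proof (intro exI[of _ N] conjI N(1,2) allI impI notI)
            fix C' assume C': "compact C'" "C' \<subseteq> C0 \<inter> N" "fills ?J phi C'"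
            have "C' \<subseteq> K \<inter> N" "ALL x:C'. ?h x = 0" using C'(2) C(2) by (auto simp: C0_def)
            note res = N(3)[THEN spec, THEN mp, OF C'(1), THEN mp, OF this(1), THEN mp, OF this(2), THEN mp, OF C'(3)]
            then obtain x w where x: "x : C'"
              and w: "ALL k:?J. ALL j:?J. dird S (w j) (%x. phi x k) x = (if k = j then 1 else 0)" and w0: "ALL j:?J. dird S (w j) ?h x = 0"
              by (elim bexE exE conjE)
            have xK: "x : K" using x \<open>C' \<subseteq> K \<inter> N\<close> by blast
            have dh: "dird S e ?h x = dird S e (%x. phi x j1) x" for e
              unfolding dird_def using pdh[OF xK] by (auto simp: f_def[abs_def] intro!: sum.cong)
            have "x : C" using x C'(2) by (auto simp: C0_def)
            then obtain i' where i': "i' : S" "pd i' f x ~= 0" using nz by blast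
            have "full_rank S J phi x"
            proof (rule full_rank_extend[OF fJ j1, where w = w and e = "%l. if l = i' then 1 else 0"])
              show "dird S (%l. if l = i' then 1 else 0) (%x. phi x j1) x ~= 0"
                using i' fS unfolding dird_def f_def[abs_def] by (simp add: if_distrib[of "(*) _"] cong: if_cong)
            qed (use w w0 dh in auto)
            then show False using nofull xK by blast
          qed
        qed
        ultimately show False by simp
      qed
      \<comment> \<open>m bounds the order of the first iterated directional derivative of f that
        does not vanish. The induction on m ends in \<open>caseA\<close>.\<close>
      have order: "\<not> fills J phi C" if "compact C" "C \<subseteq> K" "\<And>x. x : C ==> EX w k. 1 <= k & k <= m & (dird S w ^^ k) f x ~= 0" for C m
        using that
      proof (induction m arbitrary: C)
        case 0
        then have "C = {}" by fastforce
        then show ?case using not_fills_empty by blast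
      next
        case (Suc m)
        have dz: "EX i:S. pd i h x ~= 0" if "dird S w h x ~= 0" for h w x
          using that unfolding dird_def by (metis (no_types, lifting) mult_eq_0_iff sum.neutral)
        show ?case
        proof (cases "m = 0")
          case True
          show ?thesis
          proof (rule caseA[OF Suc.prems(1,2)])
            fix x assume "x : C"
            then obtain w k where "1 <= k" "k <= Suc m" "(dird S w ^^ k) f x ~= 0" using Suc.prems(3) by blast
            then have "dird S w f x ~= 0" using True by (cases k) auto
            then show "EX i:S. pd i f x ~= 0" by (rule dz)
          qed
        next
          case False
          \<comment> \<open>On C1 all derivatives of order 1 to m vanish. Near a point of C1 the set
            lies in the zero set of one derivative h of order m whose differential is nonzero there,
            so \<open>graph\<close> applies with all of J. Off C1 the bound is m.\<close>
          define C1 where "C1 = {x:C. ALL w k. 1 <= k & k <= m --> (dird S w ^^ k) f x = 0}"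
          have cC1: "compact C1"
          proof -
            have cl: "closedin (top_of_set C) {x:C. (dird S w ^^ k) f x = 0}" for w k
            proof -
              have "continuous_on C ((dird S w ^^ k) f)"
                by (intro continuous_at_imp_continuous_on ballI isCont_ra[OF ra_dird_iter[OF raf]]) (use Suc.prems in auto)
              from continuous_closedin_preimage[OF this, of "{0}"] show ?thesis by (simp add: vimage_def Int_def)
            qed
            let ?F = "insert C ((%(w,k). {x:C. (dird S w ^^ k) f x = 0}) ` (UNIV \<times> {1..m}))"
            have "closedin (top_of_set C) (\<Inter>?F)" by (rule closedin_Inter) (use cl in auto)
            moreover have "\<Inter>?F = C1" by (auto simp: C1_def)
            ultimately show ?thesis using closedin_compact[OF Suc.prems(1)] by simp
          qed
          have C1C: "C1 \<subseteq> C" by (auto simp: C1_def)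
          have nC1: "\<not> fills J phi C1"
          proof (rule fills_local[OF fJ cC1])
            show "continuous_on C1 (%v. phi v j)" if "j : J" for j by (rule contphi) (use that C1C Suc.prems in auto)
            fix v assume v: "v : C1"
            then have vK: "v : K" using C1C Suc.prems by auto
            obtain w k where k: "1 <= k" "k <= Suc m" "(dird S w ^^ k) f v ~= 0" using Suc.prems(3) v C1C by blast
            have "k = Suc m" using k v by (auto simp: C1_def le_Suc_eq)
            define h where "h = (dird S w ^^ m) f"
            have "dird S w h v ~= 0" using k(3) \<open>k = Suc m\<close> by (simp add: h_def)
            then obtain i where i: "i : S" "pd i h v ~= 0" using dz by blast
            have hz: "h x = 0" if "x : C1" for x using that False by (auto simp: C1_def h_def)
            have rah: "ra S h v" unfolding h_def by (rule ra_dird_iter[OF raf[OF vK]])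
            from graph[OF vK rah hz[OF v] i, of J]
            obtain N where N: "open N" "v : N" "ALL C'. compact C' --> C' \<subseteq> K \<inter> N --> (ALL x:C'. h x = 0) --> fills J phi C' -->
              (EX x:C'. EX w. (ALL k:J. ALL j:J. dird S (w j) (%x. phi x k) x = (if k = j then 1 else 0)) & (ALL j:J. dird S (w j) h x = 0))"
              by auto
            show "EX N. open N & v : N & (ALL C'. compact C' --> C' \<subseteq> C1 \<inter> N --> \<not> fills J phi C')"
            proof (intro exI[of _ N] conjI N(1,2) allI impI notI)
              fix C' assume C': "compact C'" "C' \<subseteq> C1 \<inter> N" "fills J phi C'"
              have "C' \<subseteq> K \<inter> N" "ALL x:C'. h x = 0" using C'(2) C1C Suc.prems(2) hz by auto
              note res = N(3)[THEN spec, THEN mp, OF C'(1), THEN mp, OF this(1), THEN mp, OF this(2), THEN mp, OF C'(3)]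
              then obtain x w where x: "x : C'"
                and w: "ALL k:J. ALL j:J. dird S (w j) (%x. phi x k) x = (if k = j then 1 else 0)" by (elim bexE exE conjE)
              then have "full_rank S J phi x" unfolding full_rank_def by blast
              then show False using nofull x \<open>C' \<subseteq> K \<inter> N\<close> by blast
            qed
          qed
          show ?thesis
          proof
            assume "fills J phi C"
            then obtain C' where C': "compact C'" "C' \<subseteq> C - C1" "fills J phi C'"
              using fills_peel[OF fJ Suc.prems(1) cC1 C1C contphi[OF Suc.prems(2)] _ nC1] by blast
            have "\<not> fills J phi C'"
            proof (rule Suc.IH[OF C'(1)])
              show "C' \<subseteq> K" using C' Suc.prems by auto
              show "EX w k. 1 <= k & k <= m & (dird S w ^^ k) f x ~= 0" if "x : C'" for x
                using that C'(2) by (auto simp: C1_def)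
            qed
            with C'(3) show False by simp
          qed
        qed
      qed
      have "\<not> fills J phi K"
      proof (rule fills_local[OF fJ cK contphi])
        fix v assume v: "v : K"
        show "EX N. open N & v : N & (ALL C'. compact C' --> C' \<subseteq> K \<inter> N --> \<not> fills J phi C')"
        proof (cases "(\<forall>\<^sub>F x in nhds v. f x = f v) \<or> S = {}")
          \<comment> \<open>Where f is locally constant the image lies in a hyperplane and contains
            no box.\<close>
          case True
          then have "\<forall>\<^sub>F x in nhds v. f x = f v"
          proof
            assume "S = {}"
            then have "f x = f v" for x using depD[OF raD(2)[OF raf[OF v]], of x v] by simp
            then show ?thesis by simp
          qed
          then obtain N where N: "open N" "v : N" "ALL x:N. f x = f v" unfolding eventually_nhds by blast
          show ?thesis
          proof (intro exI[of _ N] conjI N(1,2) allI impI notI)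
            fix C' assume C': "compact C'" "C' \<subseteq> K \<inter> N" "fills J phi C'"
            then obtain p epsilon where p: "epsilon > 0" "ALL x. (ALL j:J. \<bar>x j - p j\<bar> < epsilon) --> (EX v:C'. ALL j:J. phi v j = x j)"
              unfolding fills_def by blast
            obtain v1 where v1: "v1 : C'" "ALL j:J. phi v1 j = p j" using p(2)[rule_format, of p] p(1) by auto
            have "ALL j:J. \<bar>(p(j1 := p j1 + epsilon/2)) j - p j\<bar> < epsilon" using p(1) by auto
            then obtain v2 where v2: "v2 : C'" "ALL j:J. phi v2 j = (p(j1 := p j1 + epsilon/2)) j" using p(2) by blast
            have "f v1 = p j1" "f v2 = p j1 + epsilon/2" using v1 v2 j1 by (auto simp: f_def)
            moreover have "f v1 = f v2" using N(3) v1(1) v2(1) C'(2) by (metis IntD2 subsetD)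
            ultimately show False using p(1) by simp
          qed
        next
          case False
          then obtain w k where wk: "1 <= k" "(dird S w ^^ k) f v ~= 0" using nonconstant_dird[OF raf[OF v]] by blast
          have "\<forall>\<^sub>F x in nhds v. (dird S w ^^ k) f x ~= 0"
            using isCont_nhds[OF isCont_ra[OF ra_dird_iter[OF raf[OF v]]]] wk(2) by (rule tendsto_imp_eventually_ne)
          then obtain N where N: "open N" "v : N" "ALL x:N. (dird S w ^^ k) f x ~= 0" unfolding eventually_nhds by blast
          show ?thesis
          proof (intro exI[of _ N] conjI N(1,2) allI impI)
            fix C' assume C': "compact C'" "C' \<subseteq> K \<inter> N"
            show "\<not> fills J phi C'" by (rule order[OF C'(1), of k]) (use C'(2) N(3) wk(1) in blast)+
          qed
        qed
      qed simp_all
      with less.prems(6) show False by simp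
    qed
  qed
qed


section \<open>Horns\<close>

text \<open>Connectedness of the interval: the points with a neighbourhood of zeros and the points
  with a punctured neighbourhood free of zeros form disjoint open sets.\<close>

lemma isolated_zeros_propagate:
  fixes g :: "real => real"
  assumes iso: "\<And>t. t : {a..b} ==> (\<forall>\<^sub>F s in nhds t. g s = 0) \<or> (\<forall>\<^sub>F s in at t. g s ~= 0)"
    and t0: "t0 : {a..b}" "\<forall>\<^sub>F s in nhds t0. g s = 0" and t: "t : {a..b}"
  shows "\<forall>\<^sub>F s in nhds t. g s = 0"
proof (rule ccontr)
  assume neg: "\<not> ?thesis"
  define U where "U = {t. \<forall>\<^sub>F s in nhds t. g s = 0}"
  define V where "V = {t. \<forall>\<^sub>F s in at t. g s ~= 0}"
  have oU: "open U" unfolding open_subopen[of U]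
  proof
    fix x assume "x : U"
    then have "\<forall>\<^sub>F y in nhds x. \<forall>\<^sub>F s in nhds y. g s = 0" by (simp add: U_def eventually_eventually)
    then show "EX T. open T & x : T & T \<subseteq> U" unfolding eventually_nhds[of _ x] U_def by blast
  qed
  have oV: "open V" unfolding open_subopen[of V]
  proof
    fix x assume "x : V"
    then obtain T where T: "open T" "x : T" "ALL s:T. s ~= x --> g s ~= 0"
      unfolding V_def eventually_at_topological by auto
    have "y : V" if "y : T" for y
    proof (cases "y = x")
      case True then show ?thesis using \<open>x : V\<close> by simp
    next
      case False
      have "\<forall>\<^sub>F s in nhds y. s : T - {x}" using T(1) that False by (intro eventually_nhds_in_open open_delete) auto
      then have "\<forall>\<^sub>F s in nhds y. g s ~= 0" by (rule eventually_mono) (use T(3) in auto)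
      then show ?thesis unfolding V_def by (auto simp: eventually_at_filter elim: eventually_mono)
    qed
    then show "EX T. open T & x : T & T \<subseteq> V" using T(1,2) by blast
  qed
  have "{a..b} \<subseteq> U \<union> V"
  proof
    fix x assume "x : {a..b}"
    from iso[OF this] show "x : U \<union> V" by (auto simp: U_def V_def)
  qed
  moreover have "U \<inter> V = {}"
  proof (rule ccontr)
    assume "U \<inter> V ~= {}"
    then obtain x where x: "\<forall>\<^sub>F s in nhds x. g s = 0" "\<forall>\<^sub>F s in at x. g s ~= 0" by (auto simp: U_def V_def)
    have "\<forall>\<^sub>F s in at x. g s = 0" using x(1) by (auto simp: eventually_at_filter elim: eventually_mono)
    with x(2) have "\<forall>\<^sub>F s in at x. False" by eventually_elim simp
    then show False by (simp add: trivial_limit_def[symmetric])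
  qed
  ultimately have "U \<inter> {a..b} = {} \<or> V \<inter> {a..b} = {}"
    using connectedD[OF connected_Icc[of a b] oU oV] by blast
  moreover have "t0 : U \<inter> {a..b}" using t0 by (simp add: U_def)
  moreover have "t : V \<inter> {a..b}" using iso[OF t] neg t by (auto simp: V_def)
  ultimately show False by blast
qed

lemma ra1_isolated:
  assumes f: "ra {0} e x"
  shows "(\<forall>\<^sub>F s in nhds (x 0). e (x(0 := s)) = 0) \<or>
     (EX j L. L ~= 0 & ((%s. e (x(0 := x 0 + s)) / s ^ j) \<longlongrightarrow> L) (at 0))"
proof (cases "\<forall>\<^sub>F y in nhds x. e y = 0")
  case True
  have "isCont (%s. x(0 := s)) (x 0)" by (rule isCont_upd)
  then have "filterlim (%s. x(0 := s)) (nhds x) (nhds (x 0))" using isCont_nhds by fastforce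
  then show ?thesis using True unfolding filterlim_iff by blast
next
  case False
  obtain p j L where p: "p 0 ~= x 0" "L ~= 0" "((%t. e (%i. x i + t * (p i - x i)) / t ^ j) \<longlongrightarrow> L) (at 0)"
    by (rule finite_order_direction[OF f False singletonI]) (rule that; assumption)
  define c where "c = p 0 - x 0"
  have c0: "c ~= 0" using p(1) by (simp add: c_def)
  have e: "e (%i. x i + t * (p i - x i)) = e (x(0 := x 0 + t * c))" for t
    by (rule depD[OF raD(2)[OF f]]) (simp add: c_def)
  have "filterlim (%s. s / c) (at 0) (at 0)"
    unfolding filterlim_at
  proof
    show "\<forall>\<^sub>F s in at 0. s / c : UNIV & s / c ~= 0" using c0 by (simp add: eventually_at_filter)
    show "((%s. s / c) \<longlongrightarrow> 0) (at 0)" using c0 by (auto intro!: tendsto_eq_intros)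
  qed
  from filterlim_compose[OF p(3) this]
  have "((%s. e (x(0 := x 0 + s)) / (s / c) ^ j) \<longlongrightarrow> L) (at 0)" unfolding e using c0 by simp
  from tendsto_mult[OF this tendsto_const[of "1 / c ^ j"]]
  have "((%s. e (x(0 := x 0 + s)) / s ^ j) \<longlongrightarrow> L / c ^ j) (at 0)"
    using c0 by (simp add: power_divide)
  then show ?thesis using p(2) c0 by (intro disjI2 exI[of _ j] exI[of _ "L / c ^ j"]) simp
qed

text \<open>Being nonzero at 1, the function is not identically zero near 0, so it has a finite
  order p there. This one-variable Lojasiewicz inequality is the source of the exponent of the
  horn.\<close>

lemma analytic_lower_bound:
  assumes e: "\<And>x. x 0 : {0..1} ==> ra {0} e x" and nz: "e ((%_. 0)(0 := 1)) ~= 0"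
  obtains p c tau where "c > 0" "0 < tau" "tau <= 1" "\<And>t. 0 < t ==> t <= tau ==> c * t ^ p <= \<bar>e ((%_. 0)(0 := t))\<bar>"
proof -
  let ?z = "%_::nat. 0::real"
  define g where "g t = e (?z(0 := t))" for t
  have iso: "(\<forall>\<^sub>F s in nhds t. g s = 0) \<or> (EX j L. L ~= 0 & ((%s. g (t + s) / s ^ j) \<longlongrightarrow> L) (at 0))" if "t : {0..1}" for t
    using ra1_isolated[OF e[of "?z(0 := t)"]] that by (simp add: g_def)
  have iso2: "(\<forall>\<^sub>F s in nhds t. g s = 0) \<or> (\<forall>\<^sub>F s in at t. g s ~= 0)" if t: "t : {0..1}" for t
    using iso[OF t]
  proof
    assume "EX j L. L ~= 0 & ((%s. g (t + s) / s ^ j) \<longlongrightarrow> L) (at 0)"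
    then obtain j L where "L ~= 0" "((%s. g (t + s) / s ^ j) \<longlongrightarrow> L) (at 0)" by blast
    from tendsto_imp_eventually_ne[OF this(2,1)] have "\<forall>\<^sub>F s in at 0. g (t + s) ~= 0" by (rule eventually_mono) auto
    then show ?thesis by (simp add: at_to_0[of t] eventually_filtermap add.commute)
  qed simp
  have "\<not> (\<forall>\<^sub>F s in nhds 0. g s = 0)"
  proof
    assume "\<forall>\<^sub>F s in nhds 0. g s = 0"
    then have "\<forall>\<^sub>F s in nhds 1. g s = 0" using isolated_zeros_propagate[of 0 1 g 0 1] iso2 by auto
    then have "g 1 = 0" by (rule eventually_nhds_x_imp_x)
    with nz show False by (simp add: g_def)
  qed
  with iso[of 0] obtain j L where L: "L ~= 0" "((%s. g s / s ^ j) \<longlongrightarrow> L) (at 0)" by auto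
  from order_tendstoD(1)[OF tendsto_rabs[OF L(2)], of "\<bar>L\<bar>/2"] L(1)
  have "\<forall>\<^sub>F s in at 0. \<bar>L\<bar>/2 < \<bar>g s / s ^ j\<bar>" by simp
  then obtain tau where tau: "tau > 0" "\<And>s. s ~= 0 ==> dist s 0 < tau ==> \<bar>L\<bar>/2 < \<bar>g s / s ^ j\<bar>"
    unfolding eventually_at by blast
  show thesis
  proof (rule that[of "\<bar>L\<bar>/2" "min 1 (tau/2)" j])
    fix t assume t: "0 < t" "t <= min 1 (tau/2)"
    have "\<bar>L\<bar>/2 < \<bar>g t / t ^ j\<bar>" by (rule tau(2)) (use t tau(1) in \<open>auto simp: dist_real_def\<close>)
    then show "\<bar>L\<bar>/2 * t ^ j <= \<bar>e (?z(0 := t))\<bar>" using t by (simp add: g_def abs_divide pos_less_divide_eq less_imp_le)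
  qed (use L tau in auto)
qed

section \<open>Quantitative inversion where the Jacobian degenerates\<close>

lemma det_bound:
  fixes A :: "real^'n^'n"
  assumes "\<And>i j. \<bar>A$i$j\<bar> <= B"
  shows "\<bar>det A\<bar> <= fact CARD('n) * B ^ CARD('n)"
proof -
  have "\<bar>det A\<bar> <= (\<Sum>p | p permutes (UNIV::'n set). \<bar>of_int (sign p) * (\<Prod>i\<in>UNIV. A$i$p i)\<bar>)"
    unfolding det_def by (rule sum_abs)
  also have "\<dots> <= (\<Sum>p | p permutes (UNIV::'n set). B ^ CARD('n))"
  proof (rule sum_mono)
    fix p :: "'n => 'n"
    have "\<bar>of_int (sign p) * (\<Prod>i\<in>UNIV. A$i$p i)\<bar> = (\<Prod>i\<in>UNIV. \<bar>A$i$p i\<bar>)"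
      by (simp add: abs_mult abs_prod sign_def)
    also have "\<dots> <= (\<Prod>i\<in>(UNIV::'n set). B)" by (rule prod_mono) (use assms in auto)
    finally show "\<bar>of_int (sign p) * (\<Prod>i\<in>UNIV. A$i$p i)\<bar> <= B ^ CARD('n)" by simp
  qed
  also have "\<dots> = fact CARD('n) * B ^ CARD('n)" by (simp add: card_permutations)
  finally show ?thesis .
qed

text \<open>By Cramer's rule the inverse of a matrix with bounded entries is of size 1 / |det A|.
  Along the arc of a horn this costs only a power of t.\<close>

lemma linear_solution_bound:
  fixes A :: "real^'n^'n"
  assumes A: "\<And>i j. \<bar>A$i$j\<bar> <= B" and B: "B >= 1" and d: "det A ~= 0"
  obtains x where "A *v x = b" "norm x <= real CARD('n) * fact CARD('n) * B ^ CARD('n) / \<bar>det A\<bar> * norm b"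
proof (cases "b = 0")
  case True then show ?thesis using that[of 0] by simp
next
  case False
  \<comment> \<open>Normalized so that its entries are at most 1 <= B and \<open>det_bound\<close>
    covers the matrices of Cramer's rule.\<close>
  define b' where "b' = b /\<^sub>R norm b"
  define x where "x = (\<chi> k. det (\<chi> i j. if j = k then b'$i else A$i$j) / det A)"
  have Ax: "A *v x = b'" using cramer[OF d, of x b'] by (simp add: x_def)
  have b1: "\<bar>b'$i\<bar> <= 1" for i
  proof -
    have "\<bar>b'$i\<bar> <= norm b'" by (rule component_le_norm_cart)
    also have "norm b' = 1" using False by (simp add: b'_def)
    finally show ?thesis .
  qed
  have "\<bar>x$k\<bar> <= fact CARD('n) * B ^ CARD('n) / \<bar>det A\<bar>" for k
  proof -
    have "\<bar>det (\<chi> i j. if j = k then b'$i else A$i$j)\<bar> <= fact CARD('n) * B ^ CARD('n)"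
      by (rule det_bound) (use A B order_trans[OF b1] in auto)
    then show ?thesis using d by (simp add: x_def abs_divide divide_right_mono)
  qed
  then have "norm x <= (\<Sum>k\<in>(UNIV::'n set). fact CARD('n) * B ^ CARD('n) / \<bar>det A\<bar>)"
    using norm_le_l1_cart[of x] sum_mono[of UNIV "%k. \<bar>x$k\<bar>" "%k. fact CARD('n) * B ^ CARD('n) / \<bar>det A\<bar>"] by simp
  then have nx: "norm x <= real CARD('n) * fact CARD('n) * B ^ CARD('n) / \<bar>det A\<bar>" by simp
  show ?thesis
  proof (rule that[of "norm b *\<^sub>R x"])
    have "A *v (norm b *\<^sub>R x) = norm b *\<^sub>R (A *v x)" by (simp add: matrix_vector_mult_scaleR)
    then show "A *v (norm b *\<^sub>R x) = b" using Ax False by (simp add: b'_def)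
    show "norm (norm b *\<^sub>R x) <= real CARD('n) * fact CARD('n) * B ^ CARD('n) / \<bar>det A\<bar> * norm b"
      using mult_right_mono[OF nx norm_ge_zero[of b]] by (simp add: mult.commute)
  qed
qed


lemma ra_taylor1:
  assumes S: "finite S" and r: "\<And>t. t : {0..1} ==> ra S f (%i. v i + t * w i)"
    and B: "\<And>l m t. l : S ==> m : S ==> t : {0..1} ==> \<bar>pd m (pd l f) (%i. v i + t * w i)\<bar> <= B"
  shows "\<bar>f (%i. v i + w i) - f v - dird S w f v\<bar> <= B * (\<Sum>l\<in>S. \<bar>w l\<bar>)\<^sup>2"
proof -
  let ?g = "%t i. v i + t * w i" and ?N = "\<Sum>l\<in>S. \<bar>w l\<bar>"
  have d: "((%t. F (?g t)) has_real_derivative dird S w F (?g t)) (at t)"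
    if "t : {0..1}" "ra S F (?g t)" for t F
    unfolding dird_def using that by (intro ra_chain[where gamma = ?g]) (auto intro!: derivative_eq_intros)
  have lip: "\<bar>pd l f (?g t) - pd l f v\<bar> <= B * ?N" if l: "l : S" and t: "0 < t" "t < 1" for l t
  proof -
    have "EX z>0. z < t & pd l f (?g t) - pd l f (?g 0) = (t - 0) * dird S w (pd l f) (?g z)"
      by (rule MVT2) (use t in \<open>auto intro!: d ra_pd r l\<close>)
    then obtain z where z: "z > 0" "z < t" "pd l f (?g t) - pd l f v = t * dird S w (pd l f) (?g z)" by auto
    have "\<bar>dird S w (pd l f) (?g z)\<bar> <= (\<Sum>m\<in>S. B * \<bar>w m\<bar>)" unfolding dird_def
      by (rule order_trans[OF sum_abs], rule sum_mono)
        (use B[OF l] z t in \<open>auto simp: abs_mult intro!: mult_right_mono\<close>)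
    then have "t * \<bar>dird S w (pd l f) (?g z)\<bar> <= 1 * (B * ?N)"
      by (intro mult_mono) (use t in \<open>auto simp: sum_distrib_left\<close>)
    then show ?thesis using z t by (simp add: abs_mult)
  qed
  have "EX z>0. z < 1 & f (?g 1) - f (?g 0) = (1 - 0) * dird S w f (?g z)"
    by (rule MVT2) (auto intro!: d r)
  then obtain z where z: "z > 0" "z < 1" "f (?g 1) - f v = dird S w f (?g z)" by auto
  have "\<bar>f (?g 1) - f v - dird S w f v\<bar> = \<bar>\<Sum>l\<in>S. (pd l f (?g z) - pd l f v) * w l\<bar>"
    using z(3) by (simp add: dird_def left_diff_distrib sum_subtractf)
  also have "\<dots> <= (\<Sum>l\<in>S. B * ?N * \<bar>w l\<bar>)"
    by (rule order_trans[OF sum_abs], rule sum_mono) (use lip z in \<open>auto simp: abs_mult intro!: mult_right_mono\<close>)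
  also have "\<dots> = B * ?N\<^sup>2" by (simp add: sum_distrib_left power2_eq_square mult_ac)
  finally show ?thesis by simp
qed

text \<open>A solution of Psi u = p is a fixed point of u - A^(-1) (Psi u - p). The bound p says
  that this map sends the ball of radius rho into itself, so Brouwer's theorem applies to a merely
  continuous Psi.\<close>

lemma quantitative_surjectivity:
  fixes A :: "real^'n^'n"
  assumes A: "\<And>i j. \<bar>A$i$j\<bar> <= B" and B: "B >= 1" and d: "det A ~= 0" and rho: "rho > 0"
    and c: "continuous_on (cball 0 rho) Psi" and R: "\<And>u. norm u <= rho ==> norm (Psi u - c - A *v u) <= R"
    and p: "real CARD('n) * fact CARD('n) * B ^ CARD('n) / \<bar>det A\<bar> * (norm (p - c) + R) <= rho"
  obtains u where "norm u <= rho" "Psi u = p"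
proof -
  let ?K = "real CARD('n) * fact CARD('n) * B ^ CARD('n) / \<bar>det A\<bar>"
  have inv: "invertible A" using d invertible_det_nz by blast
  then obtain N where NA: "N ** A = mat 1" "A ** N = mat 1" unfolding invertible_def by blast
  have nN: "norm (N *v b) <= ?K * norm b" for b
  proof -
    obtain x where x: "A *v x = b" "norm x <= ?K * norm b" by (rule linear_solution_bound[OF A B d])
    have "N *v b = x" unfolding x(1)[symmetric] by (simp add: matrix_vector_mul_assoc NA)
    with x show ?thesis by simp
  qed
  have K0: "?K >= 0" using B by simp
  obtain u where u: "u : cball 0 rho" "u - N *v (Psi u - p) = u"
  proof (rule brouwer_ball[OF rho])
    show "continuous_on (cball 0 rho) (%u. u - N *v (Psi u - p))"
      by (intro continuous_intros c linear_continuous_on_compose[OF _ matrix_vector_mul_linear])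
    show "(%u. u - N *v (Psi u - p)) : cball 0 rho \<rightarrow> cball 0 rho"
    proof
      fix u assume u: "u : cball (0::real^'n) rho"
      have "u - N *v (Psi u - p) = N *v ((p - c) - (Psi u - c - A *v u))"
        by (simp add: matrix_vector_mult_diff_distrib matrix_vector_right_distrib matrix_vector_mul_assoc NA)
      also have "norm \<dots> <= ?K * norm ((p - c) - (Psi u - c - A *v u))" by (rule nN)
      also have "\<dots> <= ?K * (norm (p - c) + R)"
        by (intro mult_left_mono[OF _ K0] order_trans[OF norm_triangle_ineq4] add_left_mono R) (use u in auto)
      finally show "u - N *v (Psi u - p) : cball 0 rho" using p by simp
    qed
  qed
  have "N *v (Psi u - p) = 0" using u(2) by simp
  then have "A *v (N *v (Psi u - p)) = 0" by simp
  then have "Psi u = p" by (simp add: matrix_vector_mul_assoc NA)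
  then show thesis using that u(1) by auto
qed

lemma compact_ucube: "compact (ucube M)"
proof -
  have "ucube M = {x. ALL i. 0 <= x i & x i <= (if i < M then 1 else 0)}"
    unfolding ucube_def by (auto simp: not_less)
  then show ?thesis using compact_fun_box[of "%_. 0"] by simp
qed

lemma ucube_segment:
  assumes "p : ucube M" "q : ucube M" "0 <= t" "t <= 1"
  shows "(%i. p i + t * (q i - p i)) : ucube M"
proof -
  have "0 <= p i + t * (q i - p i) & p i + t * (q i - p i) <= 1" if "i < M" for i
  proof -
    have "p i : {0..1}" "q i : {0..1}" using assms that by (auto simp: ucube_def)
    then have "(1 - t) *\<^sub>R p i + t *\<^sub>R q i : {0..1}" using assms by (intro convexD) auto
    then show ?thesis by (simp add: algebra_simps)
  qed
  then show ?thesis using assms by (auto simp: ucube_def)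
qed

lemma compact_common_bound:
  assumes "compact K" "finite I" "\<And>i. i : I ==> continuous_on K (f i :: _ => real)"
  obtains B where "B >= 1" "\<And>i x. i : I ==> x : K ==> \<bar>f i x\<bar> <= B"
proof -
  have "EX B. ALL x:K. \<bar>f i x\<bar> <= B" if "i : I" for i
    using compact_imp_bounded[OF compact_continuous_image[OF assms(3)[OF that] assms(1)]]
    by (auto simp: bounded_iff)
  then obtain b where b: "\<And>i x. i : I ==> x : K ==> \<bar>f i x\<bar> <= b i" by metis
  show thesis
  proof (rule that[of "1 + (\<Sum>i\<in>I. \<bar>b i\<bar>)"])
    fix i x assume ix: "i : I" "x : K"
    have "\<bar>b i\<bar> <= (\<Sum>i\<in>I. \<bar>b i\<bar>)" by (rule member_le_sum) (use ix assms in auto)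
    then show "\<bar>f i x\<bar> <= 1 + (\<Sum>i\<in>I. \<bar>b i\<bar>)" using b[OF ix] by linarith
  qed (simp add: sum_nonneg)
qed

text \<open>Along the segment from v0 to y1 the determinant of G is at least c0 t^p. On a ball of
  radius eta t^(p+1) of directions the quadratic error is of order t^(2p+2). Inverting the linear
  part costs t^(-p), so the image contains a ball of radius epsilon t^(2p+1) about phi (y
  t).\<close>

lemma horn:
  fixes phi :: "(nat => real) => real^'n"
  assumes ra: "\<And>t k. t : ucube M ==> ra {..<M} (%x. phi x $ k) t"
    and v0: "v0 : ucube M" and v: "v : ucube M" and fr: "full_rank {..<M} UNIV (%x k. phi x $ k) v"
  obtains y1 q epsilon tau where "y1 : ucube M" "epsilon > 0" "0 < tau" "tau <= 1" "q >= 1"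
    "\<And>t x. 0 <= t ==> t <= tau ==> dist x (phi (%i. v0 i + t * (y1 i - v0 i))) <= epsilon * t ^ q ==> x : phi ` ucube M"
proof -
  let ?S = "{..<M}"
  obtain w where w: "\<And>k j. dird ?S (w j) (%x. phi x $ k) v = (if k = j then 1 else 0)"
    using fr unfolding full_rank_def by auto
  \<comment> \<open>The directions w are kept fixed, which makes G a square matrix with analytic
    entries; it is the identity at v.\<close>
  define G where "G y = (\<chi> k j. dird ?S (w j) (%x. phi x $ k) y)" for y
  have raG: "ra ?S (%y. G y $ k $ j) y" if "y : ucube M" for y k j
    using ra_dird[OF ra[OF that]] by (simp add: G_def)
  have raD: "ra {0} (%x. det (G (%i. p i + x 0 * (q i - p i)))) x"
    if "p : ucube M" "q : ucube M" "x 0 : {0..1}" for p q x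
    unfolding det_def
    by (intro ra_sum ra_mult ra_prod ra_const
        ra_compose[where f = "%y. G y $ _ $ _" and S = ?S, OF raG ] ra_add ra_proj ra_diff)
      (use that ucube_segment in auto)
  define m where "m = (%i. if i < M then 1/2 else 0 :: real)"
  have m: "m : ucube M" by (auto simp: ucube_def m_def)
  let ?z = "%_::nat. 0::real"
  have "isCont (%x. det (G (%i. v i + x 0 * (m i - v i)))) ?z" by (rule isCont_ra[OF raD[OF v m]]) simp
  moreover have "isCont (%s. ?z(0 := s)) 0" by (rule isCont_upd)
  moreover have "?z(0 := 0) = ?z" by auto
  ultimately have "isCont (%s. det (G (%i. v i + s * (m i - v i)))) 0"
    using isCont_o2[where f = "%s. ?z(0 := s)" and a = 0 and g = "%x. det (G (%i. v i + x 0 * (m i - v i)))"] by simp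
  moreover have "G v = mat 1" by (simp add: G_def w mat_def vec_eq_iff)
  ultimately have "\<forall>\<^sub>F s in at 0. det (G (%i. v i + s * (m i - v i))) ~= 0"
    unfolding isCont_def by (intro tendsto_imp_eventually_ne[where c = 1]) auto
  then obtain delta where delta: "delta > 0" "\<And>s. s ~= 0 ==> \<bar>s\<bar> < delta ==> det (G (%i. v i + s * (m i - v i))) ~= 0"
    unfolding eventually_at by (auto simp: dist_real_def)
  define s where "s = min 1 (delta/2)"
  have s: "0 < s" "s <= 1" "s < delta" using delta(1) by (auto simp: s_def)
  \<comment> \<open>v may lie on the boundary of the cube. It is moved towards the centre m: far
    enough to gain the margin kappa from all faces, but not so far that the determinant of G could
    vanish.\<close>
  define y1 where "y1 = (%i. v i + s * (m i - v i))"
  have y1: "y1 : ucube M" unfolding y1_def by (rule ucube_segment[OF v m]) (use s in auto)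
  define kappa where "kappa = s / 2"
  have kappa: "kappa > 0" using s by (simp add: kappa_def)
  have y1kappa: "kappa <= y1 i" "y1 i <= 1 - kappa" if "i < M" for i
  proof -
    have "0 <= (1 - s) * v i" "0 <= (1 - s) * (1 - v i)" using v that s by (auto simp: ucube_def)
    then show "kappa <= y1 i" "y1 i <= 1 - kappa" using that by (simp_all add: y1_def kappa_def m_def algebra_simps)
  qed
  define y where "y t = (%i. v0 i + t * (y1 i - v0 i))" for t
  have yt: "y t : ucube M" if "0 <= t" "t <= 1" for t
    unfolding y_def by (rule ucube_segment[OF v0 y1 that])
  \<comment> \<open>By convexity y t keeps the distance t * kappa from the faces, so perturbations
    of this size stay in the cube.\<close>
  have yin: "(%i. y t i + W i) : ucube M" if t: "0 <= t" "t <= 1"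
    and W: "\<And>i. i < M ==> \<bar>W i\<bar> <= t * kappa" "\<And>i. i >= M ==> W i = 0" for t W
  proof -
    have "0 <= y t i + W i & y t i + W i <= 1" if i: "i < M" for i
    proof -
      have "0 <= (1 - t) * v0 i" "0 <= (1 - t) * (1 - v0 i)" using v0 i t by (auto simp: ucube_def)
      moreover have "t * kappa <= t * y1 i" "t * y1 i <= t * (1 - kappa)" using y1kappa[OF i] t by (auto intro: mult_left_mono)
      ultimately show ?thesis using W(1)[OF i] by (auto simp: y_def algebra_simps abs_le_iff)
    qed
    then show ?thesis using v0 y1 W(2) by (auto simp: ucube_def y_def)
  qed
  obtain p c0 tau where c0: "c0 > 0" "0 < tau" "tau <= 1" "\<And>t. 0 < t ==> t <= tau ==> c0 * t ^ p <= \<bar>det (G (y t))\<bar>"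
  proof (rule analytic_lower_bound[of "%x. det (G (%i. v0 i + x 0 * (y1 i - v0 i)))"])
    show "ra {0} (%x. det (G (%i. v0 i + x 0 * (y1 i - v0 i)))) x" if "x 0 : {0..1}" for x
      by (rule raD[OF v0 y1]) (use that in auto)
    show "det (G (%i. v0 i + (?z(0 := 1)) 0 * (y1 i - v0 i))) ~= 0"
      using delta(2)[of s] s by (simp add: y1_def)
  qed (use that in \<open>auto simp: y_def\<close>)
  have cont: "continuous_on (ucube M) g" if "\<And>v. v : ucube M ==> ra ?S g v" for g
    using isCont_ra that continuous_at_imp_continuous_on by blast
  obtain B1 where B1: "B1 >= 1" "\<And>k j y. y : ucube M ==> \<bar>G y $ k $ j\<bar> <= B1"
    by (rule compact_common_bound[OF compact_ucube, where I = UNIV and f = "%(k, j) y. G y $ k $ j"])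
      (auto intro!: cont raG)
  obtain B2 where B2: "B2 >= 1" "\<And>k l m' y. l < M ==> m' < M ==> y : ucube M ==> \<bar>pd m' (pd l (%x. phi x $ k)) y\<bar> <= B2"
  proof (rule compact_common_bound[OF compact_ucube, where I = "UNIV \<times> ?S \<times> ?S" and f = "%(k, l, m') y. pd m' (pd l (%x. phi x $ k)) y"])
    show "continuous_on (ucube M) (case i of (k, l, m') => pd m' (pd l (%x. phi x $ k)))" if "i : UNIV \<times> ?S \<times> ?S" for i
      using that by (auto intro!: cont ra_pd ra)
    fix B assume B: "B >= 1" "\<And>i x. i : UNIV \<times> ?S \<times> ?S ==> x : ucube M ==> \<bar>(case i of (k, l, m') => pd m' (pd l (%x. phi x $ k))) x\<bar> <= B"
    show thesis
      by (rule that[OF B(1)]) (use B(2)[of "(_, _, _)"] in auto)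
  qed auto
  define H where "H = 1 + (\<Sum>l<M. \<Sum>j\<in>UNIV. \<bar>w j l\<bar>)"
  have H: "H >= 1" by (simp add: H_def sum_nonneg)
  define W where "W u = (%l. if l < M then \<Sum>j\<in>UNIV. u $ j * w j l else 0)" for u :: "real^'n"
  have Wsum: "(\<Sum>l<M. \<bar>W u l\<bar>) <= H * norm u" for u
  proof -
    have "(\<Sum>l<M. \<bar>W u l\<bar>) <= (\<Sum>l<M. \<Sum>j\<in>UNIV. \<bar>w j l\<bar> * norm u)"
      by (rule sum_mono) (auto simp: W_def abs_mult mult.commute intro!: order_trans[OF sum_abs] sum_mono mult_right_mono mult_left_mono component_le_norm_cart)
    also have "\<dots> <= H * norm u" by (simp add: H_def sum_distrib_right distrib_right)
    finally show ?thesis .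
  qed
  have W1: "\<bar>W u l\<bar> <= H * norm u" if "l < M" for u l
    by (rule order_trans[OF member_le_sum Wsum]) (use that in auto)
  have WG: "dird ?S (W u) (%x. phi x $ k) y = (G y *v u) $ k" for u k y
  proof -
    have "dird ?S (W u) (%x. phi x $ k) y = dird ?S (%l. \<Sum>j\<in>UNIV. u $ j * w j l) (%x. phi x $ k) y"
      by (simp add: dird_def W_def)
    also have "\<dots> = (\<Sum>j\<in>UNIV. u $ j * dird ?S (w j) (%x. phi x $ k) y)"
      by (simp add: dird_sum dird_scale)
    finally show ?thesis by (simp add: matrix_vector_mult_def G_def mult.commute)
  qed
  define K where "K = real CARD('n) * fact CARD('n) * B1 ^ CARD('n)"
  have K: "K > 0" using B1(1) by (simp add: K_def)
  define L where "L = real CARD('n) * B2 * H\<^sup>2"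
  have L: "L > 0" using B2(1) H by (simp add: L_def)
  \<comment> \<open>The first bound keeps the perturbed parameters in the cube. The second lets the
    quadratic error use up half of rho; epsilon below is fitted to the other half.\<close>
  define eta where "eta = min (kappa / H) (c0 / (2 * K * L))"
  have eta: "eta > 0" "eta * H <= kappa" "K * L * eta <= c0 / 2"
  proof -
    show "eta > 0" using kappa H K L c0 by (simp add: eta_def)
    have "eta <= kappa / H" by (simp add: eta_def)
    then show "eta * H <= kappa" using H by (simp add: pos_le_divide_eq)
    have "eta <= c0 / (2 * K * L)" by (simp add: eta_def)
    then show "K * L * eta <= c0 / 2" using K L by (simp add: pos_le_divide_eq mult_ac)
  qed
  define epsilon where "epsilon = eta * c0 / (2 * K)"
  have key: "x : phi ` ucube M" if t: "0 < t" "t <= tau" and x: "dist x (phi (y t)) <= epsilon * t ^ (2 * p + 1)" for t x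
  proof -
    define rho where "rho = eta * t ^ (p + 1)"
    have rho: "rho > 0" using eta t by (simp add: rho_def)
    have t1: "t <= 1" using t c0 by simp
    have "t ^ (p + 1) <= t" using power_le_one[of t p] t t1 by (simp add: mult_left_le)
    then have "eta * t ^ (p + 1) * H <= eta * t * H" using eta H by (intro mult_right_mono mult_left_mono) auto
    also have "\<dots> <= t * kappa" using eta(2) t by (simp add: mult.commute mult.left_commute mult_left_mono)
    finally have rhoH: "H * rho <= t * kappa" by (simp add: rho_def mult_ac)
    define Psi where "Psi u = phi (%i. y t i + W u i)" for u
    have inu: "(%i. y t i + s * W u i) : ucube M" if u: "norm u <= rho" and s: "0 <= s" "s <= 1" for u s
    proof (rule yin)
      fix i assume i: "i < M"
      have "\<bar>W u i\<bar> <= H * rho" by (rule order_trans[OF W1[OF i]]) (use u H in \<open>auto intro: mult_left_mono\<close>)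
      then have "s * \<bar>W u i\<bar> <= 1 * (t * kappa)" using rhoH s by (intro mult_mono) auto
      then show "\<bar>s * W u i\<bar> <= t * kappa" using s by (simp add: abs_mult)
    qed (use t t1 in \<open>auto simp: W_def\<close>)
    have D: "c0 * t ^ p <= \<bar>det (G (y t))\<bar>" by (rule c0(4)[OF t])
    have D0: "0 < c0 * t ^ p" using c0 t by simp
    have R: "norm (Psi u - phi (y t) - G (y t) *v u) <= L * rho\<^sup>2" if u: "norm u <= rho" for u
    proof -
      have "\<bar>(Psi u - phi (y t) - G (y t) *v u) $ k\<bar> <= B2 * (H * rho)\<^sup>2" for k
      proof -
        have "\<bar>(Psi u - phi (y t) - G (y t) *v u) $ k\<bar> <= B2 * (\<Sum>l<M. \<bar>W u l\<bar>)\<^sup>2"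
          unfolding vector_minus_component WG[symmetric] Psi_def
          by (rule ra_taylor1) (use inu[OF u] ra B2(2) in auto)
        also have "\<dots> <= B2 * (H * rho)\<^sup>2"
          by (intro mult_left_mono power_mono order_trans[OF Wsum] sum_nonneg) (use u H B2 in auto)
        finally show ?thesis .
      qed
      then have "norm (Psi u - phi (y t) - G (y t) *v u) <= (\<Sum>k\<in>(UNIV::'n set). B2 * (H * rho)\<^sup>2)"
        by (intro order_trans[OF norm_le_l1_cart] sum_mono) auto
      then show ?thesis by (simp add: L_def power_mult_distrib mult_ac)
    qed
    have cW: "continuous_on UNIV (%u. (%i. y t i + W u i))"
    proof (rule continuous_on_coordinatewise_then_product)
      fix i show "continuous_on UNIV (%u. y t i + W u i)"
        by (cases "i < M") (auto simp: W_def intro!: continuous_intros)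
    qed
    have cPsi: "continuous_on (cball 0 rho) Psi"
    proof -
      have "continuous_on (cball 0 rho) (%u. phi (%i. y t i + W u i) $ k)" for k
        by (rule continuous_on_compose2[OF cont[of "%x. phi x $ k", OF ra] continuous_on_subset[OF cW subset_UNIV]])
          (use inu[of _ 1] in auto)
      then have "continuous_on (cball 0 rho) (%u. \<chi> k. phi (%i. y t i + W u i) $ k)"
        by (intro continuous_on_vec_lambda)
      then show ?thesis by (simp add: Psi_def[abs_def])
    qed
    have e1: "norm (x - phi (y t)) + L * rho\<^sup>2 <= epsilon * t ^ (2 * p + 1) + L * rho\<^sup>2" using x by (simp add: dist_norm)
    have "K / \<bar>det (G (y t))\<bar> * (norm (x - phi (y t)) + L * rho\<^sup>2) <= K / (c0 * t ^ p) * (epsilon * t ^ (2 * p + 1) + L * rho\<^sup>2)"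
      by (intro mult_mono divide_left_mono e1 D) (use K L D0 D in \<open>auto intro!: mult_pos_pos\<close>)
    also have "\<dots> <= rho"
    proof -
      have pw: "t ^ (2 * p + 1) = t ^ p * t ^ (p + 1)" by (simp flip: power_add add: mult_2)
      have a: "K * (epsilon * t ^ (2 * p + 1)) = rho * (c0 * t ^ p) / 2"
        using K unfolding epsilon_def rho_def pw by simp
      have "K * (L * rho\<^sup>2) = K * L * eta * (t ^ (p + 1) * rho)" by (simp add: rho_def power2_eq_square mult_ac)
      also have "\<dots> <= (c0 / 2) * (t ^ p * rho)"
        by (intro mult_mono eta) (use t t1 rho c0 in \<open>auto simp: mult_left_le_one_le\<close>)
      finally have "K * (epsilon * t ^ (2 * p + 1) + L * rho\<^sup>2) <= rho * (c0 * t ^ p)"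
        using a by (simp add: distrib_left mult_ac)
      then show ?thesis using D0 by (simp add: pos_divide_le_eq mult_ac)
    qed
    finally have fin: "K / \<bar>det (G (y t))\<bar> * (norm (x - phi (y t)) + L * rho\<^sup>2) <= rho" .
    obtain u where "norm u <= rho" "Psi u = x"
      by (rule quantitative_surjectivity[OF B1(2)[OF yt] B1(1) _ rho cPsi R fin[unfolded K_def]]) (use t t1 D D0 in auto)
    then show ?thesis using inu[of u 1] unfolding Psi_def by (auto intro!: image_eqI[where x = "%i. y t i + W u i"])
  qed
  show thesis
  proof (rule that[of y1 epsilon tau "2 * p + 1"])
    fix t x assume t: "0 <= t" "t <= tau" and x: "dist x (phi (%i. v0 i + t * (y1 i - v0 i))) <= epsilon * t ^ (2 * p + 1)"
    show "x : phi ` ucube M"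
    proof (cases "t = 0")
      case True then show ?thesis using x v0 by auto
    next
      case False then show ?thesis using key[of t x] t x by (simp add: y_def)
    qed
  qed (use y1 eta c0 K in \<open>auto simp: epsilon_def\<close>)
qed


section \<open>Cauchy estimates along analytic curves\<close>

abbreviation ra1 :: "(real => real) => real => bool" where
  "ra1 g t \<equiv> ra {0} (%x. g (x 0)) (%_. t)"

lemma ra1_holomorphic:
  assumes "ra1 g t"
  obtains r h where "r > 0" "h holomorphic_on ball (of_real t) r" "\<And>s. \<bar>s - t\<bar> < r ==> h (of_real s) = of_real (g s)"
proof -
  let ?a = "%_::nat. t"
  obtain r F where r: "r > 0" "hol (poly_disc {0} (emb ?a) r) F"
    "\<And>x. emb x : poly_disc {0} (emb ?a) r ==> F (emb x) = of_real (g (x 0))"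
    using raE[OF assms] by blast
  have "(%z. F ((emb ?a)(0 := z))) holomorphic_on ball (emb ?a 0) r"
    by (rule hol_slice[OF r(2)]) (use r(1) in auto)
  moreover have "F ((emb ?a)(0 := of_real s)) = of_real (g s)" if "\<bar>s - t\<bar> < r" for s
    using r(3)[of "?a(0 := s)"] that unfolding emb_poly_disc by (simp add: emb_upd dist_real_def)
  ultimately show thesis using that[of r] r(1) by (simp add: emb_def)
qed

lemma ra1I:
  assumes r: "r > 0" and h: "h holomorphic_on ball (of_real t) r" "\<And>s. \<bar>s - t\<bar> < r ==> h (of_real s) = of_real (g s)"
  shows "ra1 g t"
proof (rule raI[where U = "poly_disc {0} (emb (%_. t)) r" and F = "%z. h (z 0)"])
  show "hol (poly_disc {0} (emb (%_. t)) r) (%z. h (z 0))"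
  proof (rule holI)
    show "continuous_on (poly_disc {0} (emb (%_. t)) r) (%z. h (z 0))"
      by (rule continuous_on_compose2[OF holomorphic_on_imp_continuous_on[OF h(1)]])
        (auto simp: poly_disc_def emb_def dist_commute intro: continuous_on_subset[OF continuous_on_product_coordinates])
    fix D :: "complex set" and gamma :: "complex => nat => complex"
    assume "\<And>i. (%t. gamma t i) holomorphic_on D" "gamma ` D \<subseteq> poly_disc {0} (emb (%_. t)) r"
    then show "(%t. h (gamma t 0)) holomorphic_on D"
      by (intro holomorphic_on_compose_gen[OF _ h(1), of "%t. gamma t 0", unfolded o_def])
        (auto simp: poly_disc_def emb_def dist_commute)
  qed simp
qed (use r h in \<open>auto simp: dep_def emb_poly_disc dist_real_def, auto simp: emb_def\<close>)

lemma real_analytic_fun_iff: "real_analytic_fun g \<longleftrightarrow> (ALL t. ra1 g t)"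
proof
  assume g: "ALL t. ra1 g t"
  show "real_analytic_fun g" unfolding real_analytic_fun_def
  proof
    fix t
    obtain r h where r: "r > 0" "h holomorphic_on ball (of_real t) r" "\<And>s. \<bar>s - t\<bar> < r ==> h (of_real s) = of_real (g s)"
      using ra1_holomorphic g by blast
    define a where "a n = Re ((deriv ^^ n) h (of_real t) / fact n)" for n
    have "(%n. a n * (s - t) ^ n) sums g s" if "\<bar>s - t\<bar> < r" for s
    proof -
      have "of_real s : ball (complex_of_real t) r" using that by (simp add: dist_real_def)
      from sums_Re[OF holomorphic_power_series[OF r(2) this]]
      have "(%n. Re ((deriv ^^ n) h (of_real t) / fact n * of_real ((s - t) ^ n))) sums Re (of_real (g s))"
        unfolding r(3)[OF that] by simp
      then show ?thesis unfolding Re_complex_of_real times_complex.sel Im_complex_of_real a_def by simp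
    qed
    then show "EX r>0. EX a. ALL s. \<bar>s - t\<bar> < r --> (%n. a n * (s - t) ^ n) sums g s" using r(1) by blast
  qed
next
  assume g: "real_analytic_fun g"
  show "ALL t. ra1 g t"
  proof
    fix t
    obtain r a where r: "r > 0" "\<And>s. \<bar>s - t\<bar> < r ==> (%n. a n * (s - t) ^ n) sums g s"
      using g unfolding real_analytic_fun_def by blast
    define h where "h z = (\<Sum>n. of_real (a n) * (z - of_real t) ^ n)" for z :: complex
    show "ra1 g t"
    proof (rule ra1I[OF r(1)])
      show "h holomorphic_on ball (of_real t) r"
      proof (rule power_series_holomorphic)
        fix w :: complex assume w: "w : ball (of_real t) r"
        obtain s where s: "norm (w - of_real t) < s" "s < r" using w dense[of "norm (w - of_real t)" r]
          by (auto simp: dist_norm norm_minus_commute)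
        have "summable (%n. a n * s ^ n)" using r(2)[of "t + s"] s norm_ge_zero[of "w - of_real t"] by (auto simp: sums_iff)
        then have "summable (%n. complex_of_real (a n * s ^ n))" by (simp only: summable_of_real)
        then have "summable (%n. complex_of_real (a n) * of_real s ^ n)" by simp
        then have "summable (%n. complex_of_real (a n) * (w - of_real t) ^ n)"
          by (rule powser_inside) (use s norm_ge_zero[of "w - of_real t"] in auto)
        then show "(%n. of_real (a n) * (w - of_real t) ^ n) sums h w" unfolding h_def by (rule summable_sums)
      qed
      fix s assume s: "\<bar>s - t\<bar> < r"
      from sums_of_real[OF r(2)[OF s], where 'a = complex]
      show "h (of_real s) = of_real (g s)" by (simp add: h_def sums_iff)
    qed
  qed
qed

lemma ra1_sin2: "ra1 (%s. c * sin s ^ 2) t"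
proof -
  have "ra1 sin t" by (rule ra1I[of 1 sin]) (auto simp: sin_of_real intro!: holomorphic_intros)
  then show ?thesis by (intro ra_mult ra_power ra_const) auto
qed

lemma ra1_compose:
  assumes "ra S f (\<Gamma> t)" "\<And>i. i : S ==> ra1 (%s. \<Gamma> s i) t"
  shows "ra1 (%s. f (\<Gamma> s)) t"
  by (rule ra_compose[where Phi = "%x. \<Gamma> (x 0)"]) (use assms in auto)

text \<open>Flatness at 0 excludes a finite order there, and the identity principle on an interval
  carries the zeros to t.\<close>

lemma real_analytic_flat_zero:
  assumes g: "\<And>t. ra1 g t" and flat: "\<And>j. EX C. \<forall>\<^sub>F s in at 0. \<bar>g s\<bar> <= C * \<bar>s\<bar> ^ Suc j"
  shows "g t = 0"
proof -
  have iso: "(\<forall>\<^sub>F s in nhds t. g s = 0) \<or> (EX j L. L ~= 0 & ((%s. g (t + s) / s ^ j) \<longlongrightarrow> L) (at 0))" for t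
    using ra1_isolated[OF g[of t]] by simp
  have iso2: "(\<forall>\<^sub>F s in nhds t. g s = 0) \<or> (\<forall>\<^sub>F s in at t. g s ~= 0)" for t
    using iso[of t]
  proof
    assume "EX j L. L ~= 0 & ((%s. g (t + s) / s ^ j) \<longlongrightarrow> L) (at 0)"
    then obtain j L where "L ~= 0" "((%s. g (t + s) / s ^ j) \<longlongrightarrow> L) (at 0)" by blast
    from tendsto_imp_eventually_ne[OF this(2,1)] have "\<forall>\<^sub>F s in at 0. g (t + s) ~= 0" by (rule eventually_mono) auto
    then show ?thesis by (simp add: at_to_0[of t] eventually_filtermap add.commute)
  qed simp
  have "\<forall>\<^sub>F s in nhds 0. g s = 0"
  proof (rule ccontr)
    assume "\<not> ?thesis"
    with iso[of 0] obtain j L where L: "L ~= 0" "((%s. g s / s ^ j) \<longlongrightarrow> L) (at 0)" by auto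
    obtain C where C: "\<forall>\<^sub>F s in at 0. \<bar>g s\<bar> <= C * \<bar>s\<bar> ^ Suc j" using flat by blast
    have "((%s. g s / s ^ j) \<longlongrightarrow> 0) (at 0)"
    proof (rule Lim_null_comparison)
      show "\<forall>\<^sub>F s in at 0. norm (g s / s ^ j) <= C * \<bar>s\<bar>"
        using C eventually_neq_at_within[of "0::real"]
      proof eventually_elim
        case (elim s)
        then show ?case by (simp add: abs_divide power_abs pos_divide_le_eq mult_ac)
      qed
      show "((%s. C * \<bar>s\<bar>) \<longlongrightarrow> 0) (at 0)" by (auto intro!: tendsto_eq_intros)
    qed
    then have "L = 0" using tendsto_unique[OF at_neq_bot L(2)] by blast
    with L(1) show False by simp
  qed
  then have "\<forall>\<^sub>F s in nhds t. g s = 0"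
    by (intro isolated_zeros_propagate[of "-\<bar>t\<bar>" "\<bar>t\<bar>" g 0 t] iso2) auto
  then show ?thesis by (rule eventually_nhds_x_imp_x)
qed

text \<open>Reads a coefficient off a limit instead of a derivative: below, the sum g is controlled
  only through finite differences near 0.\<close>

lemma powser_coeff_limit:
  fixes A :: "nat => real"
  assumes "r > 0" "\<And>s. \<bar>s\<bar> < r ==> (%n. A n * s ^ n) sums g s" "((%s. g s / s ^ m) \<longlongrightarrow> L) (at 0)"
  shows "A m = L"
  using assms(2,3)
proof (induction m arbitrary: A g)
  case 0
  have "(g \<longlongrightarrow> A 0) (at 0)" by (rule powser_limit_0[OF assms(1)]) (use 0 in auto)
  then show ?case using 0(2) tendsto_unique[OF _ _ 0(2)] by auto
next
  case (Suc m)
  have "(g \<longlongrightarrow> A 0) (at 0)" by (rule powser_limit_0[OF assms(1)]) (use Suc in auto)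
  moreover have "((%s. g s / s ^ Suc m * s ^ Suc m) \<longlongrightarrow> L * 0 ^ Suc m) (at 0)"
    by (intro tendsto_intros Suc.prems)
  then have "(g \<longlongrightarrow> 0) (at 0)"
    by (rule Lim_transform_eventually[THEN tendsto_eq_rhs]) (auto simp: eventually_at_filter)
  ultimately have A0: "A 0 = 0" using tendsto_unique[of "at 0" g "A 0" 0] by auto
  define g' where "g' s = (if s = 0 then A 1 else g s / s)" for s
  show ?case
  proof (rule Suc.IH[of "%n. A (Suc n)" g'])
    fix s assume s: "\<bar>s\<bar> < r"
    show "(%n. A (Suc n) * s ^ n) sums g' s"
    proof (cases "s = 0")
      case True then show ?thesis using powser_sums_zero[of "%n. A (Suc n)"] by (simp add: g'_def)
    next
      case False
      have "(%n. A (Suc n) * s ^ Suc n) sums g s"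
        using sums_Suc_iff[of "%n. A n * s ^ n" "g s"] Suc.prems(1)[OF s] A0 by simp
      from sums_divide[OF this, of s] show ?thesis using False by (simp add: g'_def)
    qed
  next
    show "((%s. g' s / s ^ m) \<longlongrightarrow> L) (at 0)"
      by (rule Lim_transform_eventually[OF Suc.prems(2)]) (auto simp: eventually_at_filter g'_def field_simps)
  qed
qed

text \<open>Coefficient sequences with |a n| <= M^(n+1), written as a product of intervals so that
  compactness is Tychonoff's theorem.\<close>

definition cauchy_box :: "nat => (nat => real) set" where
  "cauchy_box M = {a. ALL n. - (real M ^ Suc n) <= a n & a n <= real M ^ Suc n}"

lemma cauchy_box_term:
  assumes "a : cauchy_box M" "M >= 1" "\<bar>s\<bar> <= 1 / (2 * real M)"
  shows "\<bar>a n * s ^ n\<bar> <= real M * (1/2) ^ n"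
proof -
  have "\<bar>a n * s ^ n\<bar> <= real M ^ Suc n * (1 / (2 * real M)) ^ n"
    unfolding abs_mult power_abs using assms
    by (intro mult_mono power_mono) (auto simp: cauchy_box_def abs_le_iff minus_le_iff)
  also have "\<dots> = real M * (1/2) ^ n" using assms(2) by (simp add: power_divide power_mult_distrib)
  finally show ?thesis .
qed

text \<open>E M collects the parameters whose power series obeys the Cauchy estimates with M. It is
  closed as a projection of a compact set of pairs (u, a): the box is compact and the series
  converges uniformly on it. The sets E M exhaust the ball, so by Baire's theorem one of them has an
  interior point.\<close>

lemma baire_cauchy_box:
  fixes g :: "real^'n => real => real"
  assumes epsilon: "epsilon > 0" and an: "\<And>u. u : cball 0 epsilon ==> real_analytic_fun (g u)"
    and c: "\<And>s. continuous_on (cball 0 epsilon) (%u. g u s)"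
  obtains u0 epsilon' M where "epsilon' > 0" "M >= 1" "cball u0 epsilon' \<subseteq> cball 0 epsilon"
    "\<And>u. u : cball u0 epsilon' ==> EX a:cauchy_box M. ALL s. \<bar>s\<bar> < 1 / (2 * real M) --> (%n. a n * s ^ n) sums g u s"
proof -
  define I where "I M = {s. \<bar>s\<bar> < 1 / (2 * real M)}" for M
  define E where "E M = {u : cball 0 epsilon. EX a:cauchy_box M. ALL s:I M. (%n. a n * s ^ n) sums g u s}" for M
  have sm: "summable (%n. a n * s ^ n)" if "a : cauchy_box M" "M >= 1" "s : I M" for a M s
    by (rule summable_comparison_test'[of "%n. real M * (1/2) ^ n" 0])
      (use cauchy_box_term[OF that(1,2), of s] that(3) in \<open>auto simp: I_def intro!: summable_mult summable_geometric\<close>)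
  have cE: "closed (E M)" if M: "M >= 1" for M
  proof -
    let ?K = "cball (0::real^'n) epsilon \<times> cauchy_box M"
    have cK: "compact ?K"
      unfolding cauchy_box_def by (intro compact_Times compact_cball compact_fun_box)
    have cs: "continuous_on ?K (%(u, a). g u s - (\<Sum>n. a n * s ^ n))" if s: "s : I M" for s
    proof -
      have "continuous_on ?K (%x. \<Sum>n. snd x n * s ^ n)"
      proof (rule uniform_limit_theorem)
        show "uniform_limit ?K (%N x. \<Sum>n<N. snd x n * s ^ n) (%x. \<Sum>n. snd x n * s ^ n) sequentially"
          by (rule Weierstrass_m_test[of _ _ "%n. real M * (1/2) ^ n"])
            (use cauchy_box_term[OF _ M, of _ s] s in \<open>auto simp: I_def intro!: summable_mult summable_geometric\<close>)
        have "continuous_on ?K (%x. snd x n)" for n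
          by (rule continuous_on_product_then_coordinatewise[OF continuous_on_snd[OF continuous_on_id]])
        then show "\<forall>\<^sub>F N in sequentially. continuous_on ?K (%x. \<Sum>n<N. snd x n * s ^ n)"
          by (auto intro!: always_eventually continuous_intros)
      qed simp
      moreover have "continuous_on ?K (%x. g (fst x) s)"
        by (rule continuous_on_compose2[OF c continuous_on_fst[OF continuous_on_id]]) auto
      ultimately show ?thesis unfolding case_prod_unfold by (intro continuous_on_diff)
    qed
    have "compact (?K \<inter> (\<Inter>s\<in>I M. {x : ?K. (case x of (u, a) => g u s - (\<Sum>n. a n * s ^ n)) = 0}))"
      by (intro compact_Int_closed[OF cK] closed_INT ballI continuous_closed_preimage_constant cs compact_imp_closed[OF cK])
    then have "compact (fst ` (?K \<inter> (\<Inter>s\<in>I M. {x : ?K. (case x of (u, a) => g u s - (\<Sum>n. a n * s ^ n)) = 0})))"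
      by (rule compact_continuous_image[OF continuous_on_fst[OF continuous_on_id]])
    moreover have "fst ` (?K \<inter> (\<Inter>s\<in>I M. {x : ?K. (case x of (u, a) => g u s - (\<Sum>n. a n * s ^ n)) = 0})) = E M" (is "?L = _")
    proof (rule equalityI; rule subsetI)
      fix u assume "u : ?L"
      then obtain a where a: "u : cball 0 epsilon" "a : cauchy_box M" "\<And>s. s : I M ==> g u s = (\<Sum>n. a n * s ^ n)" by fastforce
      have "(%n. a n * s ^ n) sums g u s" if "s : I M" for s
        using summable_sums[OF sm[OF a(2) M that]] a(3)[OF that] by simp
      then show "u : E M" using a by (auto simp: E_def)
    next
      fix u assume "u : E M"
      then obtain a where a: "u : cball 0 epsilon" "a : cauchy_box M" "\<And>s. s : I M ==> (%n. a n * s ^ n) sums g u s"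
        by (auto simp: E_def)
      then show "u : ?L" by (intro image_eqI[where x = "(u, a)"]) (auto simp: sums_iff)
    qed
    ultimately show ?thesis using compact_imp_closed by simp
  qed
  have cov: "EX M>=1. u : E M" if u: "u : cball 0 epsilon" for u
  proof -
    obtain r a where r: "r > 0" "\<And>s. \<bar>s\<bar> < r ==> (%n. a n * s ^ n) sums g u s"
      using an[OF u] unfolding real_analytic_fun_def by (metis diff_zero)
    have "summable (%n. a n * (r/2) ^ n)" using r(2)[of "r/2"] r(1) by (auto simp: sums_iff)
    then have "Bseq (%n. a n * (r/2) ^ n)" using summable_LIMSEQ_zero by (intro convergent_imp_Bseq) (auto simp: convergent_def)
    then obtain C where C: "\<And>n. \<bar>a n * (r/2) ^ n\<bar> <= C" unfolding Bseq_def by auto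
    \<comment> \<open>M >= C and M >= 2 / r turn |a n| <= C (2/r)^n into |a n| <= M^(n+1), and the
      second bound also gives 1 / (2 M) < r.\<close>
    obtain M where M: "max (max 1 C) (2 / r) <= real M" using real_arch_simple by blast
    have "\<bar>a n\<bar> <= real M ^ Suc n" for n
    proof -
      have "\<bar>a n\<bar> * (r/2) ^ n <= C" using C[of n] r(1) by (simp add: abs_mult)
      then have "\<bar>a n\<bar> <= C * (2 / r) ^ n" using r(1) by (simp add: power_divide field_simps)
      also have "\<dots> <= real M * real M ^ n" using M r(1) by (intro mult_mono power_mono) auto
      finally show ?thesis by simp
    qed
    then have "a : cauchy_box M" unfolding cauchy_box_def by (auto simp: abs_le_iff minus_le_iff)
    moreover have "\<bar>s\<bar> < r" if "s : I M" for s
    proof -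
      have "2 / r <= real M" using M by simp
      then have "1 / (2 * real M) < r" using r(1) M by (simp add: field_simps)
      then show ?thesis using that by (simp add: I_def)
    qed
    ultimately show ?thesis using M u r(2) by (intro exI[of _ M]) (auto simp: E_def)
  qed
  have "EX M>=1. interior (E M) ~= {}"
  proof (rule ccontr)
    assume neg: "\<not> ?thesis"
    have "UNIV \<subseteq> closure (\<Inter> ((%M. - E M) ` {1..}))"
    proof (rule Baire)
      fix T assume "T : (%M. - E M) ` {1..}"
      then obtain M where M: "M >= 1" "T = - E M" by auto
      have "interior (E M) = {}" using neg M by blast
      then show "openin (top_of_set UNIV) T & UNIV \<subseteq> closure T"
        using cE[OF M(1)] M(2) by (simp add: closure_complement open_Compl)
    qed auto
    moreover have "\<Inter> ((%M. - E M) ` {1..}) \<subseteq> - ball 0 epsilon"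
    proof
      fix u assume u: "u : \<Inter> ((%M. - E M) ` {1..})"
      show "u : - ball 0 epsilon"
      proof
        assume "u : ball 0 epsilon"
        then obtain M where "M >= 1" "u : E M" using cov[of u] by auto
        then show False using u by auto
      qed
    qed
    then have "closure (\<Inter> ((%M. - E M) ` {1..})) \<subseteq> - ball 0 epsilon" by (intro closure_minimal) auto
    ultimately show False using epsilon by (metis UNIV_I centre_in_ball ComplD subsetD)
  qed
  then obtain M u0 where M: "M >= 1" "u0 : interior (E M)" by auto
  then obtain e where e: "e > 0" "cball u0 e \<subseteq> E M" unfolding mem_interior_cball by auto
  show thesis
    by (rule that[OF e(1) M(1)]) (use e(2) in \<open>unfold E_def I_def, blast\<close>)+
qed


section \<open>A horn inside a fat set\<close>

lemma finite_Union_interior: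
  assumes "finite \<A>" "\<And>A. A : \<A> ==> closed A" "interior (\<Union>\<A>) ~= {}"
  shows "EX A:\<A>. interior A ~= {}"
  using assms
proof (induction rule: finite_induct)
  case (insert A \<A>)
  show ?case
  proof (cases "interior (\<Union>\<A>) = {}")
    case True
    then have "interior (A \<union> \<Union>\<A>) = interior A"
      by (intro interior_closed_Un_empty_interior) (use insert in auto)
    then show ?thesis using insert.prems by auto
  next
    case False then show ?thesis using insert by auto
  qed
qed simp

lemma ra1_deriv:
  assumes "ra1 g t" obtains D where "(g has_real_derivative D) (at t)"
  using has_real_derivative_pd[OF assms singletonI] that by simp

lemma ra1_isCont: "ra1 g t ==> isCont g t"
  by (metis ra1_deriv DERIV_isCont)

lemma continuous_chart:
  fixes phi :: "(nat => real) => real^'n"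
  assumes "\<And>t k. t : ucube M ==> ra {..<M} (%x. phi x $ k) t"
  shows "t : ucube M ==> isCont phi t" "continuous_on (ucube M) phi" "compact (phi ` ucube M)"
proof -
  show 1: "isCont phi t" if "t : ucube M" for t
    using isCont_ra[OF assms[OF that]] unfolding isCont_def by (rule vec_tendstoI)
  show 2: "continuous_on (ucube M) phi" using 1 continuous_at_imp_continuous_on by blast
  show "compact (phi ` ucube M)" by (rule compact_continuous_image[OF 2 compact_ucube])
qed

text \<open>By fatness every neighbourhood of a meets the interior of X. The finitely many closed
  images of charts through a cover an open set, so one of them has an interior point and its chart
  fills. Sard's theorem then gives a point of full rank, and the arc of the horn starts at a
  preimage of a.\<close>

lemma horn_in_fat:
  fixes X :: "(real^'n) set" and Phi :: "((nat => real) => real^'n) set"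
  assumes X: "fat X" and a: "a : X" and Phi: "finite Phi" "\<And>phi t. phi : Phi ==> t : ucube M ==> phi t : X"
    "\<And>phi t k. phi : Phi ==> t : ucube M ==> ra {..<M} (%x. phi x $ k) t"
    "\<forall>\<^sub>F x in nhds a. x : X --> (EX phi:Phi. x : phi ` ucube M)"
  obtains c :: "real => real^'n" and q epsilon tau where "c 0 = a" "epsilon > 0" "0 < tau" "tau <= 1" "q >= 1"
    "\<And>t k. t : {0..1} ==> ra1 (%t. c t $ k) t" "\<And>t x. 0 <= t ==> t <= tau ==> dist x (c t) <= epsilon * t ^ q ==> x : X"
proof -
  let ?I = "%phi. phi ` ucube M"
  define Psi where "Psi = {phi : Phi. a : ?I phi}"
  have cl: "closed (?I phi)" if "phi : Phi" for phi using continuous_chart(3)[OF Phi(3)[OF that]] compact_imp_closed by blast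
  obtain N where N: "open N" "a : N" "\<And>x. x : N ==> x : X ==> EX phi:Phi. x : ?I phi"
    using Phi(4) unfolding eventually_nhds by blast
  \<comment> \<open>Discards the charts whose closed images miss a, so that the chart found below is
    sure to pass through a.\<close>
  define N' where "N' = N \<inter> (\<Inter>phi\<in>Phi - Psi. - ?I phi)"
  have "open N'" unfolding N'_def using N(1) cl Phi(1) by (intro open_Int open_INT ballI open_Compl) auto
  moreover have "a : N'" using N(2) by (auto simp: N'_def Psi_def)
  moreover have "a : closure (interior X)" using X a unfolding fat_def by auto
  ultimately have "N' \<inter> interior X ~= {}" using open_Int_closure_eq_empty[of N' "interior X"] by blast
  moreover have "N' \<inter> interior X \<subseteq> \<Union> (?I ` Psi)"
  proof
    fix x assume x: "x : N' \<inter> interior X"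
    then have "x : X" using interior_subset by blast
    then obtain phi where phi: "phi : Phi" "x : ?I phi" using N(3)[of x] x by (auto simp: N'_def)
    then have "phi : Psi" using x by (auto simp: N'_def)
    then show "x : \<Union> (?I ` Psi)" using phi by blast
  qed
  then have "N' \<inter> interior X \<subseteq> interior (\<Union> (?I ` Psi))" using \<open>open N'\<close> by (intro interior_maximal) auto
  ultimately have ne: "interior (\<Union> (?I ` Psi)) ~= {}" by blast
  have "EX A:?I ` Psi. interior A ~= {}"
    by (rule finite_Union_interior[OF _ _ ne]) (use Phi(1) cl in \<open>auto simp: Psi_def\<close>)
  then obtain phi x where phi: "phi : Phi" "a : ?I phi" and x: "x : interior (?I phi)" unfolding Psi_def by blast
  note ra = Phi(3)[OF phi(1)]
  obtain e where e: "e > 0" "ball x e \<subseteq> ?I phi" using x unfolding mem_interior by blast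
  have fl: "fills UNIV (%v k. phi v $ k) (ucube M)" unfolding fills_def
  proof (intro exI[of _ "%k. x $ k"] exI[of _ "e / real CARD('n)"] conjI allI impI)
    fix y :: "'n => real" assume y: "ALL j:UNIV. \<bar>y j - x $ j\<bar> < e / real CARD('n)"
    have "norm ((\<chi> k. y k) - x) <= (\<Sum>k\<in>UNIV. \<bar>y k - x $ k\<bar>)" using norm_le_l1_cart[of "(\<chi> k. y k) - x"] by simp
    also have "\<dots> < (\<Sum>k\<in>(UNIV::'n set). e / real CARD('n))" by (rule sum_strict_mono) (use y in auto)
    finally have "(\<chi> k. y k) : ball x e" by (simp add: dist_norm norm_minus_commute)
    then obtain v where "v : ucube M" "phi v = (\<chi> k. y k)" using e(2) by auto
    then show "EX v:ucube M. ALL j:UNIV. phi v $ j = y j" by (intro bexI[of _ v]) auto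
  qed (use e in auto)
  obtain v where v: "v : ucube M" "full_rank {..<M} UNIV (%v k. phi v $ k) v"
    using analytic_sard[OF _ _ compact_ucube _ _ fl, of "{..<M}"] ra by (auto simp: rn_inR inR_def ucube_def)
  obtain v0 where v0: "v0 : ucube M" "phi v0 = a" using phi(2) by auto
  obtain y1 q epsilon tau where h: "y1 : ucube M" "epsilon > 0" "0 < tau" "tau <= 1" "q >= 1"
    "\<And>t x. 0 <= t ==> t <= tau ==> dist x (phi (%i. v0 i + t * (y1 i - v0 i))) <= epsilon * t ^ q ==> x : ?I phi"
    by (rule horn[OF ra v0(1) v]) (assumption, (rule that; assumption))
  show thesis
  proof (rule that[where c = "%t. phi (%i. v0 i + t * (y1 i - v0 i))", OF _ h(2-5)])
    show "ra1 (%t. phi (%i. v0 i + t * (y1 i - v0 i)) $ k) t" if "t : {0..1}" for t k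
      by (rule ra1_compose[where f = "%x. phi x $ k", OF ra])
        (use that ucube_segment[OF v0(1) h(1)] in \<open>auto intro!: ra_add ra_mult\<close>)
    show "x : X" if "0 <= t" "t <= tau" "dist x (phi (%i. v0 i + t * (y1 i - v0 i))) <= epsilon * t ^ q" for t x
      using h(6)[OF that] Phi(2)[OF phi(1)] by blast
  qed (use v0 in auto)
qed

section \<open>Iterated derivatives and finite differences\<close>

definition pdv :: "'n => (real^'n => real) => real^'n => real" where
  "pdv k F x = frechet_derivative F (at x) (axis k 1)"

lemma smooth_pdv: "smooth_on_open U F ==> smooth_on_open U (pdv k F)"
  unfolding smooth_on_open_def
proof (intro conjI allI)
  fix j assume "open U & (ALL k. Ck_on k U F)"
  then have "Ck_on (Suc j) U F" by blast
  moreover have "axis k 1 : (Basis :: (real^'a) set)" by (simp add: axis_in_Basis_iff)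
  ultimately show "Ck_on j U (pdv k F)" by (auto simp: pdv_def[abs_def])
qed auto

lemma smooth_continuous: "smooth_on_open U F ==> x : U ==> isCont F x"
  unfolding smooth_on_open_def by (metis Ck_on.simps(1) continuous_on_eq_continuous_at)

lemma smooth_line_derivative:
  fixes F :: "real^'n => real"
  assumes F: "smooth_on_open U F" and x: "x + t *\<^sub>R h : U"
  shows "((%t. F (x + t *\<^sub>R h)) has_real_derivative (\<Sum>k\<in>UNIV. h $ k * pdv k F (x + t *\<^sub>R h))) (at t)"
proof -
  let ?y = "x + t *\<^sub>R h" and ?L = "frechet_derivative F (at (x + t *\<^sub>R h))"
  have "Ck_on (Suc 0) U F" and U: "open U" using F unfolding smooth_on_open_def by blast+
  then have "F differentiable at ?y" using x by (auto simp: differentiable_on_def at_within_open[OF x U])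
  then have d: "(F has_derivative ?L) (at ?y)" using frechet_derivative_works by blast
  have "((%t. x + t *\<^sub>R h) has_derivative (%s. s *\<^sub>R h)) (at t)" by (auto intro!: derivative_eq_intros)
  from has_derivative_compose[OF this d]
  have "((%t. F (x + t *\<^sub>R h)) has_derivative (%s. ?L (s *\<^sub>R h))) (at t)" .
  moreover have lin: "linear ?L" using d has_derivative_linear by blast
  then have "?L (s *\<^sub>R h) = (\<Sum>k\<in>UNIV. h $ k * pdv k F ?y) * s" for s
  proof -
    have "?L h = ?L (\<Sum>k\<in>UNIV. h $ k *\<^sub>R axis k 1)"
      using basis_expansion[of h] by (simp add: scalar_mult_eq_scaleR)
    also have "\<dots> = (\<Sum>k\<in>UNIV. h $ k * pdv k F ?y)" by (simp add: linear_sum[OF lin] linear_cmul[OF lin] pdv_def)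
    finally show ?thesis by (simp add: linear_cmul[OF lin])
  qed
  ultimately show ?thesis unfolding has_field_derivative_def by simp
qed

text \<open>Derivatives are indexed by lists of directions instead of multi-indices: each induction
  treats one direction at a time, and no symmetry of mixed derivatives is invoked.\<close>

primrec dl :: "'n list => (real^'n => real) => real^'n => real" where
  "dl [] F = F"
| "dl (k # l) F = dl l (pdv k F)"

primrec fd :: "real => 'n list => (real^'n => real) => real^'n => real" where
  "fd h [] F x = F x"
| "fd h (k # l) F x = fd h l F (x + h *\<^sub>R axis k 1) - fd h l F x"

lemma smooth_dl: "smooth_on_open U F ==> smooth_on_open U (dl l F)"
  by (induction l arbitrary: F) (auto simp: smooth_pdv)

lemma cball_step:
  assumes "0 <= z" "z <= h"
  shows "cball (x + z *\<^sub>R axis k 1) (real n * h) \<subseteq> cball (x :: real^'n) (real (Suc n) * h)"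
proof
  fix y assume "y : cball (x + z *\<^sub>R axis k 1) (real n * h)"
  moreover have "dist x (x + z *\<^sub>R axis k 1) <= h" using assms by (simp add: dist_norm norm_axis_1)
  ultimately show "y : cball x (real (Suc n) * h)"
    using dist_triangle[of x y "x + z *\<^sub>R axis k 1"] by (simp add: algebra_simps)
qed

lemma fd_deriv:
  assumes F: "smooth_on_open U F" and h: "h >= 0" and x: "cball x (real (length l) * h) \<subseteq> U"
  shows "((%t. fd h l F (x + t *\<^sub>R axis k 1)) has_real_derivative fd h l (pdv k F) x) (at 0)"
  using x
proof (induction l arbitrary: x)
  case Nil
  then have "x + 0 *\<^sub>R axis k 1 : U" by simp
  from smooth_line_derivative[OF F this] show ?case
    by (simp add: axis_def if_distrib[of "%x. x * _"] sum.delta cong: if_cong)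
next
  case (Cons j l)
  have 1: "((%t. fd h l F ((x + h *\<^sub>R axis j 1) + t *\<^sub>R axis k 1)) has_real_derivative fd h l (pdv k F) (x + h *\<^sub>R axis j 1)) (at 0)"
    by (rule Cons.IH[OF order_trans[OF cball_step]]) (use Cons.prems h in auto)
  have 2: "((%t. fd h l F (x + t *\<^sub>R axis k 1)) has_real_derivative fd h l (pdv k F) x) (at 0)"
    by (rule Cons.IH) (use Cons.prems cball_step[of 0 h x j "length l"] h in auto)
  show ?case using DERIV_diff[OF 1 2] by (simp add: add_ac)
qed

text \<open>The mean value theorem in the first direction turns one difference into h times a
  derivative; differences commute with derivatives (\<open>fd_deriv\<close>), so the induction
  continues with \<open>pdv k F\<close>.\<close>

lemma fd_mvt:
  assumes F: "smooth_on_open U F" and h: "h >= 0" and x: "cball x (real (length l) * h) \<subseteq> U"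
  shows "EX xi:cball x (real (length l) * h). fd h l F x = h ^ length l * dl l F xi"
  using F x
proof (induction l arbitrary: x F)
  case (Cons k l)
  show ?case
  proof (cases "h = 0")
    case False
    then have h0: "h > 0" using h by simp
    have sub: "cball (x + z *\<^sub>R axis k 1) (real (length l) * h) \<subseteq> cball x (real (length (k # l)) * h)" if "0 <= z" "z <= h" for z
      using cball_step[OF that] by simp
    have "((%t. fd h l F (x + t *\<^sub>R axis k 1)) has_real_derivative fd h l (pdv k F) (x + z *\<^sub>R axis k 1)) (at z)"
      if z: "0 <= z" "z <= h" for z
    proof -
      have "((%t. fd h l F ((x + z *\<^sub>R axis k 1) + t *\<^sub>R axis k 1)) has_real_derivative fd h l (pdv k F) (x + z *\<^sub>R axis k 1)) (at 0)"
        by (rule fd_deriv[OF Cons.prems(1) h order_trans[OF sub[OF z] Cons.prems(2)]])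
      then show ?thesis using DERIV_shift[of "%t. fd h l F (x + t *\<^sub>R axis k 1)" _ 0 z] by (simp add: scaleR_add_left add_ac)
    qed
    then have "EX z>0. z < h & fd h l F (x + h *\<^sub>R axis k 1) - fd h l F (x + 0 *\<^sub>R axis k 1) = (h - 0) * fd h l (pdv k F) (x + z *\<^sub>R axis k 1)"
      by (intro MVT2 h0) auto
    then obtain z where z: "z > 0" "z < h" "fd h (k # l) F x = h * fd h l (pdv k F) (x + z *\<^sub>R axis k 1)" by auto
    obtain xi where "xi : cball (x + z *\<^sub>R axis k 1) (real (length l) * h)"
      "fd h l (pdv k F) (x + z *\<^sub>R axis k 1) = h ^ length l * dl l (pdv k F) xi"
      using Cons.IH[OF smooth_pdv[OF Cons.prems(1), of k] order_trans[OF sub Cons.prems(2)], of z] z by auto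
    then show ?thesis using sub[of z] z by (intro bexI[of _ xi]) auto
  qed auto
qed auto

lemma fd_cong:
  assumes "h >= 0" "\<And>y. y : cball x (real (length l) * h) ==> F y = G y"
  shows "fd h l F x = fd h l G x"
  using assms(2)
proof (induction l arbitrary: x)
  case (Cons k l)
  have "fd h l F (x + z *\<^sub>R axis k 1) = fd h l G (x + z *\<^sub>R axis k 1)" if "0 <= z" "z <= h" for z
    by (rule Cons.IH, rule Cons.prems) (use subsetD[OF cball_step[OF that, of x k "length l"]] in simp)
  from this[of 0] this[of h] show ?case using assms(1) by simp
qed simp

text \<open>A step h in the parameter is a step T * h of the point. With the k differences of
  \<open>derivative_bounds\<close> and T s ^ q in place of T, this is the source of the factor that
  singles out the power s ^ (2 q k).\<close>

lemma fd_affine: "fd h l (%u. F (p + T *\<^sub>R u)) u = fd (T * h) l F (p + T *\<^sub>R u)"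
  by (induction l arbitrary: u) (simp_all add: scaleR_add_right add_ac)

text \<open>Each difference subtracts two series with the same bounds and doubles the
  constant.\<close>

lemma fd_powser:
  fixes g :: "real^'n => real => real"
  assumes h: "h >= 0" and "\<And>u. u : cball u0 (real (length l) * h) ==> EX a:cauchy_box M. ALL s. \<bar>s\<bar> < delta --> (%n. a n * s ^ n) sums g u s"
  shows "EX A. (ALL n. \<bar>A n\<bar> <= 2 ^ length l * real M ^ Suc n) & (ALL s. \<bar>s\<bar> < delta --> (%n. A n * s ^ n) sums fd h l (%u. g u s) u0)"
  using assms(2)
proof (induction l arbitrary: u0)
  case Nil
  then obtain a where "a : cauchy_box M" "ALL s. \<bar>s\<bar> < delta --> (%n. a n * s ^ n) sums g u0 s" by (auto simp del: power_Suc)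
  then show ?case by (intro exI[of _ a]) (auto simp: cauchy_box_def abs_le_iff minus_le_iff simp del: power_Suc)
next
  case (Cons k l)
  have ex: "EX A. (ALL n. \<bar>A n\<bar> <= 2 ^ length l * real M ^ Suc n) & (ALL s. \<bar>s\<bar> < delta --> (%n. A n * s ^ n) sums fd h l (%u. g u s) (u0 + z *\<^sub>R axis k 1))"
    if "0 <= z" "z <= h" for z
    by (rule Cons.IH, rule Cons.prems) (use cball_step[OF that, of u0 k "length l"] in auto)
  obtain A where A: "\<And>n. \<bar>A n\<bar> <= 2 ^ length l * real M ^ Suc n" "\<And>s. \<bar>s\<bar> < delta ==> (%n. A n * s ^ n) sums fd h l (%u. g u s) (u0 + h *\<^sub>R axis k 1)"
    using ex[of h] h by blast
  obtain B where B: "\<And>n. \<bar>B n\<bar> <= 2 ^ length l * real M ^ Suc n" "\<And>s. \<bar>s\<bar> < delta ==> (%n. B n * s ^ n) sums fd h l (%u. g u s) (u0 + 0 *\<^sub>R axis k 1)"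
    using ex[of 0] h by blast
  show ?case
  proof (intro exI[of _ "%n. A n - B n"] conjI allI impI)
    fix n show "\<bar>A n - B n\<bar> <= 2 ^ length (k # l) * real M ^ Suc n"
      using A(1)[of n] B(1)[of n] by (simp del: power_Suc add: power_Suc[of 2])
  next
    fix s assume "\<bar>s\<bar> < delta"
    from sums_diff[OF A(2)[OF this] B(2)[OF this]]
    show "(%n. (A n - B n) * s ^ n) sums fd h (k # l) (%u. g u s) u0" by (simp add: left_diff_distrib)
  qed
qed

text \<open>The curves b u s = c (T s) + T s ^ q u with T s = tau (sin s)^2 fill the horn and pass through a
at s = 0. By Baire category the Cauchy estimates for f \<circ> b u are uniform for u in some ball, and a k-fold
difference quotient in u turns the coefficient of s ^ (2 q k) into a k-th partial derivative at a.\<close>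
lemma derivative_bounds:
  fixes X :: "(real^'n) set" and c :: "real => real^'n"
  assumes F: "smooth_on_open U F" "a : U" "\<And>y. y : U ==> y : X ==> F y = f y" and fc: "continuous_on X f"
    and curves: "\<And>c. real_analytic_curve c ==> range c \<subseteq> X ==> real_analytic_fun (f \<circ> c)"
    and c: "c 0 = a" "\<And>t k. t : {0..1} ==> ra1 (%t. c t $ k) t" and epsilon: "epsilon > 0" and tau: "0 < tau" "tau <= 1" and q: "q >= 1"
    and horn: "\<And>t x. 0 <= t ==> t <= tau ==> dist x (c t) <= epsilon * t ^ q ==> x : X"
  obtains C where "C > 0" "\<And>l. \<bar>dl l F a\<bar> <= C ^ Suc (length l) * fact (length l)"
proof -
  define T where "T s = tau * sin s ^ 2" for s :: real
  have T: "0 <= T s" "T s <= tau" for s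
    using tau by (auto simp: T_def mult_left_le abs_square_le_1)
  define b where "b u s = c (T s) + (T s ^ q) *\<^sub>R u" for u s
  have bX: "b u s : X" if "u : cball 0 epsilon" for u s
    by (rule horn[OF T(1)[of s] T(2)[of s]]) (use that T[of s] in \<open>auto simp: b_def dist_norm mult.commute intro: mult_right_mono\<close>)
  have raT: "ra1 T t" for t unfolding T_def by (rule ra1_sin2)
  have "ra1 (%s. b u s $ k) t" for u k t
  proof -
    have "ra1 (%s. c (T s) $ k) t"
      by (rule ra1_compose[where f = "%x. c (x 0) $ k" and \<Gamma> = "%s _. T s" and S = "{0}"]) (use T[of t] tau c(2) raT in auto)
    moreover have "ra1 (%s. T s ^ q * u $ k) t" by (intro ra_mult ra_power ra_const raT) auto
    ultimately show ?thesis unfolding b_def vector_add_component vector_scaleR_component real_scaleR_def by (rule ra_add)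
  qed
  then have anb: "real_analytic_curve (b u)" for u unfolding real_analytic_curve_def real_analytic_fun_iff by blast
  have an: "real_analytic_fun (%s. f (b u s))" if "u : cball 0 epsilon" for u
    using curves[OF anb, of u] bX[OF that] by (auto simp: o_def)
  have cont: "continuous_on (cball 0 epsilon) (%u. f (b u s))" for s
    by (rule continuous_on_compose2[OF fc]) (use bX in \<open>auto simp: b_def intro!: continuous_intros\<close>)
  obtain u0 epsilon' M where e': "epsilon' > 0" "M >= 1" "cball u0 epsilon' \<subseteq> cball 0 epsilon"
    and coef: "\<And>u. u : cball u0 epsilon' ==> EX a:cauchy_box M. ALL s. \<bar>s\<bar> < 1 / (2 * real M) --> (%n. a n * s ^ n) sums f (b u s)"
    by (rule baire_cauchy_box[OF epsilon an cont]) (assumption, (rule that; assumption))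
  \<comment> \<open>Q gathers all that is raised to the power k in the final estimate: the doubling,
    M^(2q) from the coefficient of index 2 q k, and the division by tau^q and epsilon'.\<close>
  define Q where "Q = 2 * real M ^ (2 * q) / (tau ^ q * epsilon')"
  have Q: "Q > 0" using tau e' by (simp add: Q_def)
  have cT: "((%s. c (T s)) \<longlongrightarrow> a) (at 0)"
  proof (rule vec_tendstoI)
    fix k
    have "isCont (%s. c (T s) $ k) 0"
      by (rule isCont_o2[where f = T and g = "%t. c t $ k"]) (use ra1_isCont[OF raT] ra1_isCont[OF c(2)] T[of 0] tau in auto)
    then show "((%s. c (T s) $ k) \<longlongrightarrow> a $ k) (at 0)" using c(1) by (simp add: isCont_def T_def)
  qed
  have T0: "((%s. T s ^ q) \<longlongrightarrow> 0) (at 0)" unfolding T_def using q by (auto intro!: tendsto_eq_intros)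
  have bd: "\<bar>dl l F a\<bar> <= (exp 1 * (real M + Q)) ^ Suc (length l) * fact (length l)" for l
  proof -
    define k where "k = length l"
    \<comment> \<open>k steps of this length stay in the ball of radius epsilon'; k + 1 in place of
      k also admits the empty list.\<close>
    define h where "h = epsilon' / real (Suc k)"
    have h: "h > 0" "real k * h <= epsilon'" using e' by (auto simp: h_def field_simps)
    obtain A where A: "\<And>n. \<bar>A n\<bar> <= 2 ^ k * real M ^ Suc n"
      "\<And>s. \<bar>s\<bar> < 1 / (2 * real M) ==> (%n. A n * s ^ n) sums fd h l (%u. f (b u s)) u0"
      using fd_powser[of h u0 l M "1 / (2 * real M)" "%u s. f (b u s)"] coef h unfolding k_def by fastforce
    \<comment> \<open>All points of the curves, and the intermediate point of the mean value
      theorem, lie within beta s of a; as s -> 0 the intermediate point is driven to a.\<close>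
    define beta where "beta s = norm (c (T s) - a) + T s ^ q * (norm u0 + epsilon')" for s
    have "((%s. norm (c (T s) - a) + T s ^ q * (norm u0 + epsilon')) \<longlongrightarrow> norm (a - a) + 0 * (norm u0 + epsilon')) (at 0)"
      by (intro tendsto_intros cT T0)
    then have beta0: "(beta \<longlongrightarrow> 0) (at 0)" by (simp add: beta_def[abs_def])
    have bbeta: "b u s : cball a (beta s)" if "u : cball u0 epsilon'" for u s
    proof -
      have "norm u <= norm u0 + epsilon'" using that norm_triangle_ineq2[of u u0] by (simp add: dist_norm norm_minus_commute)
      then have "norm (T s ^ q *\<^sub>R u) <= T s ^ q * (norm u0 + epsilon')" using T[of s] by (simp add: mult_left_mono)
      then have "norm ((c (T s) - a) + T s ^ q *\<^sub>R u) <= beta s" unfolding beta_def by (intro norm_triangle_le add_left_mono)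
      then show ?thesis by (simp add: b_def dist_norm norm_minus_commute algebra_simps)
    qed
    obtain r where r: "r > 0" "cball a r \<subseteq> U"
      using F(1,2) unfolding smooth_on_open_def by (meson open_contains_cball)
    have small: "\<forall>\<^sub>F s in at 0. beta s < r" using order_tendstoD(2)[OF beta0 r(1)] .
    have ex: "EX xi. xi : cball a (beta s) & fd h l (%u. f (b u s)) u0 = (T s ^ q * h) ^ k * dl l F xi" if s: "beta s < r" for s
    proof -
      have sub: "cball (b u0 s) (real k * (T s ^ q * h)) \<subseteq> cball a (beta s)"
      proof
        fix y assume y: "y : cball (b u0 s) (real k * (T s ^ q * h))"
        have "norm (y - b u0 s) <= T s ^ q * (real k * h)" using y by (simp add: dist_norm norm_minus_commute mult_ac)
        also have "\<dots> <= T s ^ q * epsilon'" using h T[of s] by (intro mult_left_mono) auto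
        finally have 1: "norm (y - b u0 s) <= T s ^ q * epsilon'" .
        have "norm (T s ^ q *\<^sub>R u0) = T s ^ q * norm u0" using T[of s] by simp
        then have "norm (y - b u0 s + ((c (T s) - a) + T s ^ q *\<^sub>R u0)) <= T s ^ q * epsilon' + (norm (c (T s) - a) + T s ^ q * norm u0)"
          by (intro norm_triangle_mono 1) auto
        then show "y : cball a (beta s)" by (simp add: b_def beta_def dist_norm norm_minus_commute algebra_simps)
      qed
      have "fd h l (%u. f (b u s)) u0 = fd h l (%u. F (b u s)) u0"
      proof (rule fd_cong)
        fix u assume "u : cball u0 (real (length l) * h)"
        then have u: "u : cball u0 epsilon'" using h(2) by (simp add: k_def)
        then have "b u s : U" using bbeta[of u s] s r(2) by force
        then show "f (b u s) = F (b u s)" using F(3) bX u e'(3) by auto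
      qed (use h in auto)
      also have "\<dots> = fd (T s ^ q * h) l F (b u0 s)" unfolding b_def by (rule fd_affine)
      finally show ?thesis
        using fd_mvt[OF F(1), of "T s ^ q * h" "b u0 s" l] sub s r h T[of s] unfolding k_def by fastforce
    qed
    define xi where "xi s = (SOME xi. xi : cball a (beta s) & fd h l (%u. f (b u s)) u0 = (T s ^ q * h) ^ k * dl l F xi)" for s
    have xi: "xi s : cball a (beta s)" "fd h l (%u. f (b u s)) u0 = (T s ^ q * h) ^ k * dl l F (xi s)" if "beta s < r" for s
      using someI_ex[OF ex[OF that]] unfolding xi_def by blast+
    have "((%s. dist (xi s) a) \<longlongrightarrow> 0) (at 0)"
      by (rule Lim_null_comparison[OF eventually_mono[OF small] beta0]) (use xi(1) in \<open>auto simp: dist_commute\<close>)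
    then have "(xi \<longlongrightarrow> a) (at 0)" by (rule tendsto_dist_iff[THEN iffD2])
    with smooth_continuous[OF smooth_dl[OF F(1)] F(2)] have dlxi: "((%s. dl l F (xi s)) \<longlongrightarrow> dl l F a) (at 0)"
      by (rule isCont_tendsto_compose)
    have "((%s::real. sin s / s) \<longlongrightarrow> 1) (at 0)"
      using DERIV_sin[of "0::real"] unfolding has_field_derivative_iff by simp
    then have "((%s. (tau ^ q * h) ^ k * ((sin s / s) ^ (2 * q * k) * dl l F (xi s))) \<longlongrightarrow> (tau ^ q * h) ^ k * (1 ^ (2 * q * k) * dl l F a)) (at 0)"
      by (intro tendsto_intros dlxi)
    then have "((%s. fd h l (%u. f (b u s)) u0 / s ^ (2 * q * k)) \<longlongrightarrow> (tau ^ q * h) ^ k * dl l F a) (at 0)"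
      unfolding power_one mult_1
    proof (rule Lim_transform_eventually)
      show "\<forall>\<^sub>F s in at 0. (tau ^ q * h) ^ k * ((sin s / s) ^ (2 * q * k) * dl l F (xi s)) = fd h l (%u. f (b u s)) u0 / s ^ (2 * q * k)"
        using small
      proof eventually_elim
        case (elim s)
        have "(T s ^ q * h) ^ k = (tau ^ q * h) ^ k * sin s ^ (2 * q * k)"
          by (simp add: T_def power_mult_distrib mult_ac flip: power_mult)
        then show ?case unfolding xi(2)[OF elim] by (simp add: power_divide)
      qed
    qed
    then have "A (2 * q * k) = (tau ^ q * h) ^ k * dl l F a"
      using e' by (intro powser_coeff_limit[where r = "1 / (2 * real M)", OF _ A(2)]) auto
    with A(1)[of "2 * q * k"] have "(tau ^ q * h) ^ k * \<bar>dl l F a\<bar> <= 2 ^ k * real M ^ Suc (2 * q * k)"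
      using tau h by (simp add: abs_mult)
    then have "\<bar>dl l F a\<bar> <= 2 ^ k * real M ^ Suc (2 * q * k) / (tau ^ q * h) ^ k"
      using tau h by (simp add: pos_le_divide_eq mult.commute)
    also have "\<dots> = real M * Q ^ k * real (Suc k) ^ k"
    proof -
      have "real M ^ Suc (2 * q * k) = real M * (real M ^ (2 * q)) ^ k" by (simp add: power_mult)
      then show ?thesis by (simp add: Q_def h_def power_divide power_mult_distrib mult_ac del: of_nat_Suc)
    qed
    also have "\<dots> <= (real M + Q) * (real M + Q) ^ k * (exp 1 ^ Suc k * fact k)"
    proof (intro mult_mono power_mono)
      \<comment> \<open>The step length costs (k+1)^k, which must be bounded by a multiple of k!:
        the quotient is one term of the exponential series at k + 1.\<close>
      have "real (Suc k) ^ k / fact k <= (\<Sum>n. real (Suc k) ^ n / fact n)"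
        using sum_le_suminf[of "%n. real (Suc k) ^ n / fact n" "{k}"] summable_exp[of "real (Suc k)"]
        by (simp add: divide_inverse mult.commute del: of_nat_Suc)
      also have "\<dots> = exp (real (Suc k))" by (simp add: exp_def divide_inverse mult.commute del: of_nat_Suc)
      also have "\<dots> = exp 1 ^ Suc k" by (simp add: exp_of_nat_mult[symmetric] del: of_nat_Suc power_Suc)
      finally show "real (Suc k) ^ k <= exp 1 ^ Suc k * fact k" by (simp add: pos_divide_le_eq)
    qed (use Q in auto)
    also have "\<dots> = (exp 1 * (real M + Q)) ^ Suc k * fact k" by (simp add: power_mult_distrib)
    finally show ?thesis by (simp add: k_def)
  qed
  show thesis by (rule that[OF _ bd]) (use Q in \<open>simp add: add_nonneg_pos\<close>)
qed


section \<open>Convergence of the Taylor series\<close>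

text \<open>The n-fold directional derivative of F along h, at x. \<open>ctp\<close> is the same
  form of degree n at a fixed point a with a complex direction w, and \<open>ctpd\<close> is the
  derivative of \<open>ctp\<close> at w in the direction h.\<close>

primrec tp :: "nat => (real^'n => real) => real^'n => real^'n => real" where
  "tp 0 F h x = F x"
| "tp (Suc n) F h x = (\<Sum>k\<in>UNIV. h $ k * tp n (pdv k F) h x)"

primrec ctp :: "nat => (real^'n => real) => real^'n => complex^'n => complex" where
  "ctp 0 F a w = of_real (F a)"
| "ctp (Suc n) F a w = (\<Sum>k\<in>UNIV. w $ k * ctp n (pdv k F) a w)"

primrec ctpd :: "nat => (real^'n => real) => real^'n => complex^'n => complex^'n => complex" where
  "ctpd 0 F a w h = 0"
| "ctpd (Suc n) F a w h = (\<Sum>k\<in>UNIV. w $ k * ctpd n (pdv k F) a w h + h $ k * ctp n (pdv k F) a w)"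

lemma ctp_cemb: "ctp n F a (cemb h) = of_real (tp n F h a)"
  by (induction n arbitrary: F) (auto simp: cemb_def)

lemma norm_cemb: "norm (cemb x) = norm x"
  by (simp add: norm_vec_def cemb_def)

lemma cemb_diff: "cemb x - cemb y = cemb (x - y)"
  by (simp add: cemb_def vec_eq_iff)

lemma tp_deriv:
  assumes "smooth_on_open U F" "x + t *\<^sub>R h : U"
  shows "((%t. tp n F h (x + t *\<^sub>R h)) has_real_derivative tp (Suc n) F h (x + t *\<^sub>R h)) (at t)"
  using assms(1)
proof (induction n arbitrary: F)
  case 0
  then show ?case using smooth_line_derivative[OF 0 assms(2)] by simp
next
  case (Suc n)
  have "((%t. \<Sum>k\<in>UNIV. h $ k * tp n (pdv k F) h (x + t *\<^sub>R h)) has_real_derivative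
      (\<Sum>k\<in>UNIV. h $ k * tp (Suc n) (pdv k F) h (x + t *\<^sub>R h))) (at t)"
    by (intro DERIV_sum DERIV_cmult Suc.IH smooth_pdv[OF Suc.prems])
  then show ?case by simp
qed

lemma ctp_deriv: "(ctp n F a has_derivative ctpd n F a w) (at w)"
proof (induction n arbitrary: F)
  case 0 then show ?case by simp
next
  case (Suc n)
  have "((%w. \<Sum>k\<in>UNIV. w $ k * ctp n (pdv k F) a w) has_derivative
      (%h. \<Sum>k\<in>UNIV. w $ k * ctpd n (pdv k F) a w h + h $ k * ctp n (pdv k F) a w)) (at w)"
    by (intro has_derivative_sum has_derivative_mult Suc.IH bounded_linear_imp_has_derivative bounded_linear_vec_nth)
  then show ?case by simp
qed

lemma ctpd_complex_linear: "ctpd n F a w (c *s h) = c * ctpd n F a w h"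
  by (induction n arbitrary: F) (auto simp: sum_distrib_left algebra_simps)

lemma ctp_bound:
  fixes F :: "real^'n => real"
  assumes "\<And>l. length l = n ==> \<bar>dl l F a\<bar> <= B" "norm w <= r"
  shows "cmod (ctp n F a w) <= B * (real CARD('n) * r) ^ n"
  using assms(1)
proof (induction n arbitrary: F)
  case 0 then show ?case using 0[of "[]"] by simp
next
  case (Suc n)
  have "cmod (w $ k * ctp n (pdv k F) a w) <= r * (B * (real CARD('n) * r) ^ n)" for k
    unfolding norm_mult
    by (intro mult_mono Suc.IH order_trans[OF Finite_Cartesian_Product.norm_nth_le assms(2)] order_trans[OF norm_ge_zero assms(2)])
      (use Suc.prems[of "k # _"] in auto)
  then have "cmod (\<Sum>k\<in>UNIV. w $ k * ctp n (pdv k F) a w) <= (\<Sum>k\<in>(UNIV::'n set). r * (B * (real CARD('n) * r) ^ n))"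
    by (intro sum_norm_le)
  then show ?case by (simp add: mult_ac)
qed

text \<open>The factor r on the left stands for a division on the right; it avoids the exponent n -
  1 and the case n = 0.\<close>

lemma ctpd_bound:
  fixes F :: "real^'n => real"
  assumes "\<And>l. length l = n ==> \<bar>dl l F a\<bar> <= B" "norm w <= r"
  shows "r * cmod (ctpd n F a w h) <= real n * B * (real CARD('n) * r) ^ n * norm h"
  using assms(1)
proof (induction n arbitrary: F)
  case (Suc n)
  let ?b = "B * (real CARD('n) * r) ^ n"
  have r: "r >= 0" using order_trans[OF norm_ge_zero assms(2)] .
  have "cmod (r * (w $ k * ctpd n (pdv k F) a w h + h $ k * ctp n (pdv k F) a w)) <= r * (real n * ?b * norm h) + r * (norm h * ?b)" for k
  proof -
    have dk: "\<bar>dl l (pdv k F) a\<bar> <= B" if "length l = n" for l using Suc.prems[of "k # l"] that by simp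
    have 1: "cmod (w $ k) * (r * cmod (ctpd n (pdv k F) a w h)) <= r * (real n * ?b * norm h)"
    proof (rule mult_mono[OF order_trans[OF Finite_Cartesian_Product.norm_nth_le assms(2)] _ r])
      show "r * cmod (ctpd n (pdv k F) a w h) <= real n * ?b * norm h" using Suc.IH[OF dk] by (simp add: mult.assoc)
    qed (use r in simp)
    have 2: "r * (cmod (h $ k) * cmod (ctp n (pdv k F) a w)) <= r * (norm h * ?b)"
      by (intro mult_left_mono[OF _ r] mult_mono Finite_Cartesian_Product.norm_nth_le ctp_bound[OF dk assms(2)]) auto
    have "cmod (r * (w $ k * ctpd n (pdv k F) a w h + h $ k * ctp n (pdv k F) a w))
        <= r * (cmod (w $ k * ctpd n (pdv k F) a w h) + cmod (h $ k * ctp n (pdv k F) a w))"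
      unfolding norm_mult[of "of_real r"] using r by (simp add: mult_left_mono norm_triangle_ineq del: norm_mult)
    also have "\<dots> = cmod (w $ k) * (r * cmod (ctpd n (pdv k F) a w h)) + r * (cmod (h $ k) * cmod (ctp n (pdv k F) a w))"
      by (simp add: norm_mult algebra_simps)
    finally show ?thesis using 1 2 by linarith
  qed
  then have "cmod (\<Sum>k\<in>UNIV. r * (w $ k * ctpd n (pdv k F) a w h + h $ k * ctp n (pdv k F) a w))
      <= (\<Sum>k\<in>(UNIV::'n set). r * (real n * ?b * norm h) + r * (norm h * ?b))"
    by (intro sum_norm_le)
  then have "cmod (r * ctpd (Suc n) F a w h) <= real CARD('n) * (r * (real n * ?b * norm h) + r * (norm h * ?b))"
    by (simp add: sum_distrib_left)
  also have "\<dots> = real (Suc n) * B * (real CARD('n) * r) ^ Suc n * norm h" by (simp add: algebra_simps)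
  finally show ?case using r by (simp add: norm_mult)
qed auto

text \<open>For this r the n-th term is at most C / 4^n on the ball, and its derivative at most n /
  4^n <= 1 / 2^n times C / r. So the series may be differentiated term by term, and complex
  linearity passes to the sum. The last conclusion is kept for the comparison with F.\<close>

lemma taylor_series_holomorphic:
  fixes F :: "real^'n => real"
  assumes C: "C > 0" "\<And>l. \<bar>dl l F a\<bar> <= C ^ Suc (length l) * fact (length l)"
    and r: "r = 1 / (4 * C * real CARD('n))"
  obtains G where "holomorphic_multi_on (ball (cemb a) r) G"
    "\<And>x. x : ball a r ==> G (cemb x) = of_real (\<Sum>n. tp n F (x - a) a / fact n)"
    "\<And>h n. norm h < r ==> \<bar>tp n F h a / fact n\<bar> <= C * (C * real CARD('n) * norm h) ^ n"
proof -
  have r0: "r > 0" using C by (simp add: r)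
  have CNr: "C * (real CARD('n) * r) = 1/4" using C by (simp add: r)
  have dl: "\<bar>dl l F a\<bar> <= C ^ Suc n * fact n" if "length l = n" for l n using C(2)[of l] that by simp
  define f where "f n w = ctp n F a w / fact n" for n w
  define f' where "f' n w h = ctpd n F a w h / fact n" for n w h
  have fb: "cmod (f n w) <= C * (C * real CARD('n) * s) ^ n" if "norm w <= s" for n w s
  proof -
    have "cmod (ctp n F a w) <= C ^ Suc n * fact n * (real CARD('n) * s) ^ n" by (rule ctp_bound[OF dl that])
    then have "cmod (ctp n F a w) <= C * (C * real CARD('n) * s) ^ n * fact n" by (simp add: power_mult_distrib mult_ac)
    then show ?thesis by (simp add: f_def norm_divide pos_divide_le_eq)
  qed
  have sf: "summable (%n. f n w)" if "norm w <= r" for w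
    by (rule summable_comparison_test'[of "%n. C * (1/4) ^ n" 0])
      (use fb[OF that] CNr in \<open>auto simp: mult.assoc intro!: summable_mult summable_geometric\<close>)
  have f'b: "cmod (f' n w h) <= C / r * (1/2) ^ n * norm h" if w: "norm w <= r" for n w h
  proof -
    have "r * cmod (ctpd n F a w h) <= real n * (C ^ Suc n * fact n) * (real CARD('n) * r) ^ n * norm h"
      by (rule ctpd_bound[OF dl w])
    also have "\<dots> = fact n * C * (real n * (C * (real CARD('n) * r)) ^ n) * norm h" by (simp add: power_mult_distrib mult_ac)
    also have "\<dots> <= fact n * C * (1/2) ^ n * norm h"
    proof -
      have "real n * (1/4) ^ n <= 2 ^ n * (1/4) ^ n" by (intro mult_right_mono) (auto simp: of_nat_less_two_power less_imp_le)
      also have "\<dots> = (1/2) ^ n" by (simp flip: power_mult_distrib)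
      finally show ?thesis unfolding CNr using C by (intro mult_right_mono mult_left_mono) auto
    qed
    finally show ?thesis using r0 by (simp add: f'_def norm_divide field_simps)
  qed
  have sf': "summable (%n. f' n w h)" if "norm w <= r" for w h
    by (rule summable_comparison_test'[of "%n. C / r * (1/2) ^ n * norm h" 0])
      (use f'b[OF that] in \<open>auto intro!: summable_mult summable_mult2 summable_geometric\<close>)
  have "EX g. ALL w:ball 0 r. (%n. f n w) sums g w & (g has_derivative (%h. \<Sum>n. f' n w h)) (at w within ball 0 r)"
  proof (rule has_derivative_series[where x = 0])
    show "(f n has_derivative f' n w) (at w within ball 0 r)" for n w
      unfolding f_def f'_def
      by (intro bounded_linear.has_derivative[OF bounded_linear_divide] has_derivative_at_withinI[OF ctp_deriv])
    show "\<forall>\<^sub>F n in sequentially. ALL w:ball 0 r. ALL h. norm ((\<Sum>i<n. f' i w h) - (\<Sum>n. f' n w h)) <= e * norm h" if e: "e > 0" for e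
    proof -
      have "((%n. 2 * C / r * (1/2) ^ n) \<longlonglongrightarrow> 2 * C / r * 0)" by (intro tendsto_intros LIMSEQ_power_zero) simp
      then have "\<forall>\<^sub>F n in sequentially. 2 * C / r * (1/2) ^ n < e" using order_tendstoD(2)[of _ 0 _ e] e by simp
      then show ?thesis
      proof eventually_elim
        case (elim n)
        show ?case
        proof (intro ballI allI)
          fix w h :: "complex^'n" assume "w : ball 0 r"
          then have w: "norm w <= r" by simp
          have "norm ((\<Sum>i<n. f' i w h) - (\<Sum>n. f' n w h)) = norm (\<Sum>i. f' (i + n) w h)"
            using suminf_minus_initial_segment[OF sf'[OF w, of h], of n] by (simp add: norm_minus_commute)
          also have "\<dots> <= (\<Sum>i. C / r * (1/2) ^ n * norm h * (1/2) ^ i)"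
          proof (rule norm_suminf_le)
            show "cmod (f' (i + n) w h) <= C / r * (1/2) ^ n * norm h * (1/2) ^ i" for i
              using f'b[OF w, of "i + n" h] by (simp add: power_add mult_ac)
          qed (intro summable_mult summable_geometric, simp)
          also have "\<dots> = 2 * C / r * (1/2) ^ n * norm h" by (subst suminf_mult) (auto simp: suminf_geometric)
          also have "\<dots> <= e * norm h" using elim by (intro mult_right_mono) auto
          finally show "norm ((\<Sum>i<n. f' i w h) - (\<Sum>n. f' n w h)) <= e * norm h" .
        qed
      qed
    qed
    show "(%n. f n 0) sums (\<Sum>n. f n 0)" by (rule summable_sums[OF sf]) (use r0 in auto)
  qed (use r0 in auto)
  then obtain g where g: "\<And>w. w : ball 0 r ==> (%n. f n w) sums g w"
    "\<And>w. w : ball 0 r ==> (g has_derivative (%h. \<Sum>n. f' n w h)) (at w)"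
    by (metis at_within_open[OF _ open_ball])
  show thesis
  proof (rule that[of "%z. g (z - cemb a)"])
    show "holomorphic_multi_on (ball (cemb a) r) (%z. g (z - cemb a))" unfolding holomorphic_multi_on_def
    proof (intro ballI exI conjI allI)
      fix z assume "z : ball (cemb a) r"
      then have w: "z - cemb a : ball 0 r" by (simp add: dist_norm norm_minus_commute)
      have "((%z. z - cemb a) has_derivative (%h. h)) (at z)" by (auto intro!: derivative_eq_intros)
      from has_derivative_compose[OF this g(2)[OF w]]
      show "((%z. g (z - cemb a)) has_derivative (%h. \<Sum>n. f' n (z - cemb a) h)) (at z)" .
      fix c and v :: "complex^'n"
      show "(\<Sum>n. f' n (z - cemb a) (c *s v)) = c * (\<Sum>n. f' n (z - cemb a) v)"
        using sf'[of "z - cemb a" v] w by (subst suminf_mult[symmetric]) (auto simp: f'_def ctpd_complex_linear)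
    qed
    have sr: "(\<Sum>n. f n (cemb h)) = of_real (\<Sum>n. tp n F h a / fact n)" if "norm h < r" for h
    proof -
      have "summable (%n. complex_of_real (tp n F h a / fact n))"
        using sf[of "cemb h"] that by (simp add: f_def ctp_cemb norm_cemb)
      from summable_Re[OF this] have "summable (%n. tp n F h a / fact n)" by (simp only: Re_complex_of_real)
      from suminf_of_real[OF this, where 'a = complex] show ?thesis by (simp add: f_def ctp_cemb)
    qed
    show "g (cemb x - cemb a) = of_real (\<Sum>n. tp n F (x - a) a / fact n)" if "x : ball a r" for x
      using sr[of "x - a"] g(1)[of "cemb (x - a)"] that by (simp add: sums_iff cemb_diff dist_norm norm_minus_commute norm_cemb)
    show "\<bar>tp n F h a / fact n\<bar> <= C * (C * real CARD('n) * norm h) ^ n" for h n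
      using fb[of "cemb h" "norm h" n] by (simp add: f_def ctp_cemb norm_cemb norm_divide)
  qed
qed

text \<open>F need not equal the sum of its Taylor series. But the Maclaurin remainder of F and the
  geometric tail of the convergent series are both of order j + 1, so the difference is flat at
  a.\<close>

lemma taylor_flat:
  fixes F :: "real^'n => real"
  assumes F: "smooth_on_open U F" "a : U" and C: "C > 0" and r: "r = 1 / (4 * C * real CARD('n))"
    and b: "\<And>h n. norm h < r ==> \<bar>tp n F h a / fact n\<bar> <= C * (C * real CARD('n) * norm h) ^ n"
  shows "EX A. \<forall>\<^sub>F x in nhds a. \<bar>F x - (\<Sum>n. tp n F (x - a) a / fact n)\<bar> <= A * norm (x - a) ^ Suc j"
proof -
  let ?n = "Suc j"
  obtain rho where rho: "rho > 0" "cball a rho \<subseteq> U" using F unfolding smooth_on_open_def by (meson open_contains_cball)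
  have fin: "finite {l :: 'n list. length l = ?n}" using finite_lists_length_eq[of "UNIV :: 'n set" ?n] by simp
  have cdl: "continuous_on (cball a rho) (dl l F)" for l
    using smooth_continuous[OF smooth_dl[OF F(1)]] rho(2) by (intro continuous_at_imp_continuous_on) auto
  have "EX B. ALL l:{l :: 'n list. length l = ?n}. ALL x:cball a rho. \<bar>dl l F x\<bar> <= B"
  proof (rule compact_common_bound[OF compact_cball[of a rho] fin, of "%l. dl l F"])
    show "continuous_on (cball a rho) (dl l F)" for l by (rule cdl)
    fix B assume "\<And>l x. l : {l :: 'n list. length l = ?n} ==> x : cball a rho ==> \<bar>dl l F x\<bar> <= B"
    then show ?thesis by (intro exI[of _ B] ballI)
  qed
  then obtain B where B: "ALL l:{l :: 'n list. length l = ?n}. ALL x:cball a rho. \<bar>dl l F x\<bar> <= B" ..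
  define N where "N = real CARD('n)"
  have r0: "r > 0" using C by (simp add: r)
  have main: "\<bar>F (a + h) - (\<Sum>n. tp n F h a / fact n)\<bar> <= (B * N ^ ?n + 2 * C * (C * N) ^ ?n) * norm h ^ ?n"
    if h: "norm h < r" "norm h < rho" for h
  proof -
    have inU: "a + t *\<^sub>R h : cball a rho" if "0 <= t" "t <= 1" for t
      using that h(2) mult_left_le_one_le[of "norm h" t] by (simp add: dist_norm)
    have "EX t. 0 < t & t < 1 & F (a + 1 *\<^sub>R h) = (\<Sum>m<?n. tp m F h (a + 0 *\<^sub>R h) / fact m * 1 ^ m) + tp ?n F h (a + t *\<^sub>R h) / fact ?n * 1 ^ ?n"
    proof (rule Maclaurin)
      show "ALL m t. m < ?n & 0 <= t & t <= 1 --> ((%t. tp m F h (a + t *\<^sub>R h)) has_real_derivative tp (Suc m) F h (a + t *\<^sub>R h)) (at t)"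
        by (intro allI impI tp_deriv[OF F(1)] subsetD[OF rho(2)] inU) auto
    qed (auto simp: fun_eq_iff)
    then obtain t where t: "0 < t" "t < 1" "F (a + 1 *\<^sub>R h) = (\<Sum>m<?n. tp m F h (a + 0 *\<^sub>R h) / fact m * 1 ^ m) + tp ?n F h (a + t *\<^sub>R h) / fact ?n * 1 ^ ?n"
      by (elim exE conjE)
    have "cmod (ctp ?n F (a + t *\<^sub>R h) (cemb h)) <= B * (N * norm h) ^ ?n"
      unfolding N_def by (rule ctp_bound) (use B inU[of t] t in \<open>auto simp: norm_cemb\<close>)
    then have "\<bar>tp ?n F h (a + t *\<^sub>R h)\<bar> <= B * (N * norm h) ^ ?n" by (simp add: ctp_cemb del: tp.simps)
    moreover have "\<bar>tp ?n F h (a + t *\<^sub>R h) / fact ?n\<bar> <= \<bar>tp ?n F h (a + t *\<^sub>R h)\<bar> / 1"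
      unfolding abs_divide by (rule divide_left_mono) (auto simp del: fact_Suc simp: fact_ge_1)
    ultimately have 1: "\<bar>tp ?n F h (a + t *\<^sub>R h) / fact ?n\<bar> <= B * (N * norm h) ^ ?n" by simp
    define x where "x = C * N * norm h"
    have x: "0 <= x" "x <= 1/2"
    proof -
      have "C * N * norm h <= C * N * r" using h(1) C by (intro mult_left_mono) (auto simp: N_def)
      also have "\<dots> = 1/4" using C by (simp add: r N_def)
      finally show "x <= 1/2" by (simp add: x_def)
    qed (use C in \<open>simp add: x_def N_def\<close>)
    have bx: "\<bar>tp m F h a / fact m\<bar> <= C * x ^ m" for m using b[OF h(1)] by (simp add: x_def N_def)
    have gx: "summable (%m. C * x ^ m)" using x by (intro summable_mult summable_geometric) auto
    have s: "summable (%m. tp m F h a / fact m)"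
      by (rule summable_comparison_test'[OF gx, of 0]) (use bx in auto)
    have "norm (\<Sum>i. tp (i + ?n) F h a / fact (i + ?n)) <= (\<Sum>i. C * x ^ ?n * (1/2) ^ i)"
    proof (rule norm_suminf_le)
      fix i
      have "C * x ^ (i + ?n) <= C * x ^ ?n * (1/2) ^ i"
        using x C mult_left_mono[OF power_mono[of x "1/2" i], of "C * x ^ ?n"] by (simp add: power_add mult_ac)
      then show "norm (tp (i + ?n) F h a / fact (i + ?n)) <= C * x ^ ?n * (1/2) ^ i" using bx[of "i + ?n"] by simp
    qed (auto intro!: summable_mult summable_geometric)
    also have "\<dots> = 2 * C * x ^ ?n" by (subst suminf_mult) (auto simp: suminf_geometric)
    finally have 2: "\<bar>\<Sum>i. tp (i + ?n) F h a / fact (i + ?n)\<bar> <= 2 * C * x ^ ?n" by simp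
    have "F (a + h) - (\<Sum>n. tp n F h a / fact n) = tp ?n F h (a + t *\<^sub>R h) / fact ?n - (\<Sum>i. tp (i + ?n) F h a / fact (i + ?n))"
      using t(3) suminf_split_initial_segment[OF s, of ?n] by (simp del: tp.simps fact_Suc sum.lessThan_Suc)
    then have "\<bar>F (a + h) - (\<Sum>n. tp n F h a / fact n)\<bar> <= B * (N * norm h) ^ ?n + 2 * C * x ^ ?n" using 1 2 by linarith
    then show ?thesis by (simp add: x_def power_mult_distrib algebra_simps)
  qed
  have "\<forall>\<^sub>F x in nhds a. dist x a < min r rho" using r0 rho(1) by (intro eventually_nhds_metric[THEN iffD2] exI[of _ "min r rho"]) auto
  then show ?thesis
    by (intro exI[of _ "B * N ^ ?n + 2 * C * (C * N) ^ ?n"], elim eventually_mono)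
      (use main[of "_ - a"] in \<open>auto simp: dist_norm\<close>)
qed


section \<open>Agreement of f with its Taylor series on X\<close>

lemma holomorphic_multi_compose:
  fixes h :: "'n::finite => complex => complex"
  assumes G: "holomorphic_multi_on W G" and D: "open D" and h: "\<And>k. h k holomorphic_on D" and W: "\<And>z. z : D ==> (\<chi> k. h k z) : W"
  shows "(%z. G (\<chi> k. h k z)) holomorphic_on D"
  unfolding holomorphic_on_open[OF D]
proof (intro ballI allI impI)
  fix z assume z: "z : D"
  obtain L where L: "(G has_derivative L) (at (\<chi> k. h k z))" "\<And>c v. L (c *s v) = c * L v"
    using G W[OF z] unfolding holomorphic_multi_on_def by blast
  have "(h k has_field_derivative deriv (h k) z) (at z)" for k
    using h D z holomorphic_derivI by blast
  then have hd: "(h k has_derivative (%t. deriv (h k) z * t)) (at z)" for k unfolding has_field_derivative_def .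
  have "((%z. \<chi> k. h k z) has_derivative (%t. \<chi> k. deriv (h k) z * t)) (at z)"
    by (subst has_derivative_componentwise_within) (auto simp: Basis_vec_def inner_axis intro!: derivative_eq_intros hd)
  from has_derivative_compose[OF this L(1)]
  have "((%z. G (\<chi> k. h k z)) has_derivative (%t. L (\<chi> k. deriv (h k) z * t))) (at z)" .
  moreover have "L (\<chi> k. deriv (h k) z * t) = L (\<chi> k. deriv (h k) z) * t" for t
  proof -
    have "(\<chi> k. deriv (h k) z * t) = t *s (\<chi> k. deriv (h k) z)" by (simp add: vec_eq_iff mult.commute)
    then show ?thesis by (simp add: L(2) mult.commute)
  qed
  ultimately show "EX f'. ((%z. G (\<chi> k. h k z)) has_field_derivative f') (at z)"
    unfolding has_field_derivative_def by auto
qed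

text \<open>The components of gamma extend holomorphically to a common disc about t, and G composed
  with these extensions continues g.\<close>

lemma ra1_holomorphic_multi:
  fixes gamma :: "real => real^'n"
  assumes G: "holomorphic_multi_on W G" "open W" and gamma: "\<And>k. ra1 (%s. gamma s $ k) t" and W: "cemb (gamma t) : W"
    and g: "\<forall>\<^sub>F s in nhds t. G (cemb (gamma s)) = of_real (g s)"
  shows "ra1 g t"
proof -
  have "ALL k. EX r h. r > 0 & h holomorphic_on ball (of_real t) r & (ALL s. \<bar>s - t\<bar> < r --> h (of_real s) = of_real (gamma s $ k))"
    using ra1_holomorphic[OF gamma] by metis
  then obtain r h where r: "\<And>k. r k > 0" "\<And>k. h k holomorphic_on ball (of_real t) (r k)"
    "\<And>k s. \<bar>s - t\<bar> < r k ==> h k (of_real s) = of_real (gamma s $ k)" by metis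
  define rho where "rho = Min (range r)"
  have rho: "rho > 0" "\<And>k. rho <= r k" using r(1) by (auto simp: rho_def)
  have hrho: "h k holomorphic_on ball (of_real t) rho" for k
    by (rule holomorphic_on_subset[OF r(2)]) (use rho(2)[of k] in auto)
  have "continuous_on (ball (of_real t) rho) (%z. \<chi> k. h k z)"
    using hrho holomorphic_on_imp_continuous_on by (intro continuous_on_vec_lambda) blast
  then have "isCont (%z. \<chi> k. h k z) (of_real t)" using rho by (simp add: continuous_on_eq_continuous_at)
  moreover have "(\<chi> k. h k (of_real t)) = cemb (gamma t)" using r(1,3) by (simp add: cemb_def)
  ultimately have "filterlim (%z. \<chi> k. h k z) (nhds (cemb (gamma t))) (nhds (of_real t))"
    using isCont_nhds by fastforce
  then have "\<forall>\<^sub>F z in nhds (of_real t). (\<chi> k. h k z) : W"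
    using eventually_nhds_in_open[OF G(2) W] unfolding filterlim_iff by blast
  then obtain delta where delta: "delta > 0" "\<And>z. dist z (of_real t) < delta ==> (\<chi> k. h k z) : W"
    unfolding eventually_nhds_metric by blast
  obtain delta' where delta': "delta' > 0" "\<And>s. dist s t < delta' ==> G (cemb (gamma s)) = of_real (g s)"
    using g unfolding eventually_nhds_metric by blast
  define R where "R = min rho (min delta delta')"
  show ?thesis
  proof (rule ra1I[where r = R and h = "%z. G (\<chi> k. h k z)"])
    show "(%z. G (\<chi> k. h k z)) holomorphic_on ball (of_real t) R"
    proof (rule holomorphic_multi_compose[OF G(1)])
      show "h k holomorphic_on ball (of_real t) R" for k
        by (rule holomorphic_on_subset[OF hrho]) (auto simp: R_def)
      show "(\<chi> k. h k z) : W" if "z : ball (of_real t) R" for z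
        by (rule delta(2)) (use that in \<open>auto simp: R_def dist_commute\<close>)
    qed simp
    fix s assume s: "\<bar>s - t\<bar> < R"
    have "(\<chi> k. h k (of_real s)) = cemb (gamma s)"
    proof -
      have "h k (of_real s) = of_real (gamma s $ k)" for k by (rule r(3)) (use s rho(2)[of k] in \<open>simp add: R_def\<close>)
      then show ?thesis by (simp add: cemb_def)
    qed
    then show "G (\<chi> k. h k (of_real s)) = of_real (g s)" using delta'(2)[of s] s by (simp add: R_def dist_real_def)
  qed (use rho delta delta' in \<open>auto simp: R_def\<close>)
qed

lemma analytic_curve_lipschitz:
  fixes gamma :: "real => real^'n"
  assumes "\<And>k. ra1 (%s. gamma s $ k) 0"
  obtains Lambda where "\<forall>\<^sub>F s in at 0. norm (gamma s - gamma 0) <= Lambda * \<bar>s\<bar>"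
proof -
  have "ALL k. EX D. ((%s. gamma s $ k) has_real_derivative D) (at 0)" using ra1_deriv[OF assms] by metis
  then obtain D where D: "\<And>k. ((%s. gamma s $ k) has_real_derivative D k) (at 0)" by metis
  have "\<forall>\<^sub>F s in at 0. \<bar>(gamma s - gamma 0) $ k\<bar> <= (\<bar>D k\<bar> + 1) * \<bar>s\<bar>" for k
  proof -
    have "((%s. \<bar>(gamma s $ k - gamma 0 $ k) / (s - 0)\<bar>) \<longlongrightarrow> \<bar>D k\<bar>) (at 0)"
      using D[of k] unfolding has_field_derivative_iff by (intro tendsto_intros)
    then have "\<forall>\<^sub>F s in at 0. \<bar>(gamma s $ k - gamma 0 $ k) / (s - 0)\<bar> < \<bar>D k\<bar> + 1" by (rule order_tendstoD) simp
    moreover have "\<forall>\<^sub>F s in at (0::real). s ~= 0" by (simp add: eventually_at_filter)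
    ultimately show ?thesis by eventually_elim (simp add: abs_divide pos_divide_less_eq less_imp_le)
  qed
  then have "\<forall>\<^sub>F s in at 0. ALL k:UNIV. \<bar>(gamma s - gamma 0) $ k\<bar> <= (\<bar>D k\<bar> + 1) * \<bar>s\<bar>" by (intro eventually_ball_finite) auto
  then have "\<forall>\<^sub>F s in at 0. norm (gamma s - gamma 0) <= (\<Sum>k\<in>UNIV. \<bar>D k\<bar> + 1) * \<bar>s\<bar>"
  proof eventually_elim
    case (elim s)
    then have "(\<Sum>k\<in>UNIV. \<bar>(gamma s - gamma 0) $ k\<bar>) <= (\<Sum>k\<in>UNIV. (\<bar>D k\<bar> + 1) * \<bar>s\<bar>)" by (intro sum_mono) auto
    then show ?case using norm_le_l1_cart[of "gamma s - gamma 0"] by (simp add: sum_distrib_right)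
  qed
  then show thesis by (rule that)
qed

text \<open>The difference of f and its Taylor series along the analytic curve s \<mapsto> phi (v0 + (sin s)^2 (v - v0))
is analytic on the whole line and flat at s = 0, hence zero; s = pi / 2 gives the point phi v.\<close>
lemma chart_agreement:
  fixes phi :: "(nat => real) => real^'n"
  assumes phi: "\<And>t k. t : ucube M ==> ra {..<M} (%x. phi x $ k) t" "\<And>t. t : ucube M ==> phi t : X"
    and curves: "\<And>c. real_analytic_curve c ==> range c \<subseteq> X ==> real_analytic_fun (f \<circ> c)"
    and v: "v0 : ucube M" "v : ucube M" "\<And>t. 0 <= t ==> t <= 1 ==> phi (%i. v0 i + t * (v i - v0 i)) : ball (phi v0) r"
    and G: "holomorphic_multi_on (ball (cemb (phi v0)) r) G" "\<And>x. x : ball (phi v0) r ==> G (cemb x) = of_real (g x)"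
    and flat: "\<And>j. EX A. \<forall>\<^sub>F x in nhds (phi v0). x : X --> \<bar>f x - g x\<bar> <= A * norm (x - phi v0) ^ Suc j"
  shows "f (phi v) = g (phi v)"
proof -
  \<comment> \<open>The factor 1 brings the parameter into the form c (sin s)^2 of
    \<open>ra1_sin2\<close>.\<close>
  define gamma where "gamma s = phi (%i. v0 i + (1 * sin s ^ 2) * (v i - v0 i))" for s
  have sin01: "0 <= 1 * sin s ^ 2" "1 * sin s ^ 2 <= (1::real)" for s :: real by (auto simp: abs_square_le_1)
  have in_u: "(%i. v0 i + (1 * sin s ^ 2) * (v i - v0 i)) : ucube M" for s by (rule ucube_segment[OF v(1,2) sin01])
  have gammaX: "gamma s : X" for s unfolding gamma_def by (rule phi(2)[OF in_u])
  have ragamma: "ra1 (%s. gamma s $ k) t" for k t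
    unfolding gamma_def
    by (rule ra1_compose[where f = "%x. phi x $ k" and \<Gamma> = "%s i. v0 i + (1 * sin s ^ 2) * (v i - v0 i)", OF phi(1)[OF in_u]])
      (intro ra_add ra_mult ra_const ra1_sin2; simp)
  have gammar: "gamma s : ball (phi v0) r" for s unfolding gamma_def by (rule v(3)[OF sin01])
  have gamma0: "gamma 0 = phi v0" by (simp add: gamma_def)
  have "real_analytic_fun (f \<circ> gamma)"
    by (rule curves) (use gammaX ragamma in \<open>auto simp: real_analytic_curve_def real_analytic_fun_iff\<close>)
  then have 1: "ra1 (%s. f (gamma s)) t" for t unfolding real_analytic_fun_iff by simp
  have 2: "ra1 (%s. g (gamma s)) t" for t
    by (rule ra1_holomorphic_multi[OF G(1) open_ball ragamma])
      (use gammar[of t] G(2)[OF gammar] in \<open>auto simp: dist_norm cemb_diff norm_cemb\<close>)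
  have "f (gamma (pi/2)) - g (gamma (pi/2)) = 0"
  proof (rule real_analytic_flat_zero[of "%s. f (gamma s) - g (gamma s)"])
    show "ra1 (%s. f (gamma s) - g (gamma s)) t" for t by (rule ra_diff[OF 1 2])
    fix j
    obtain A where A: "\<forall>\<^sub>F x in nhds (phi v0). x : X --> \<bar>f x - g x\<bar> <= A * norm (x - phi v0) ^ Suc j" using flat by blast
    obtain Lambda where Lambda: "\<forall>\<^sub>F s in at 0. norm (gamma s - gamma 0) <= Lambda * \<bar>s\<bar>" by (rule analytic_curve_lipschitz[OF ragamma])
    have "(gamma \<longlongrightarrow> gamma 0) (at 0)" using ra1_isCont[OF ragamma] unfolding isCont_def by (intro vec_tendstoI)
    then have "\<forall>\<^sub>F s in at 0. gamma s : X --> \<bar>f (gamma s) - g (gamma s)\<bar> <= A * norm (gamma s - phi v0) ^ Suc j"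
      using A unfolding gamma0 filterlim_iff by blast
    then have "\<forall>\<^sub>F s in at 0. \<bar>f (gamma s) - g (gamma s)\<bar> <= (\<bar>A\<bar> * Lambda ^ Suc j) * \<bar>s\<bar> ^ Suc j"
      using Lambda
    proof eventually_elim
      case (elim s)
      have "\<bar>f (gamma s) - g (gamma s)\<bar> <= A * norm (gamma s - phi v0) ^ Suc j" using elim gammaX by simp
      also have "\<dots> <= \<bar>A\<bar> * (Lambda * \<bar>s\<bar>) ^ Suc j" using elim(2) unfolding gamma0 by (intro mult_mono power_mono) auto
      finally show ?case by (simp add: power_mult_distrib mult_ac)
    qed
    then show "EX C. \<forall>\<^sub>F s in at 0. \<bar>f (gamma s) - g (gamma s)\<bar> <= C * \<bar>s\<bar> ^ Suc j" by blast
  qed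
  moreover have "gamma (pi/2) = phi v" by (simp add: gamma_def)
  ultimately show ?thesis by simp
qed

text \<open>The horn bounds the derivatives at a of a smooth local extension F, so its Taylor series
  defines G. F and G agree at a only to infinite order; it is the charts that turn this into
  equality of f and G on X near a.\<close>

lemma local_extension:
  fixes X :: "(real^'n) set" and f :: "real^'n => real"
  assumes sub: "subanalytic_set X" and fat: "fat X" and smooth: "Cinf_on X f"
    and curves: "\<And>c. real_analytic_curve c ==> range c \<subseteq> X ==> real_analytic_fun (f \<circ> c)" and a: "a : X"
  shows "EX r>0. EX G. holomorphic_multi_on (ball (cemb a) r) G & (ALL x:X \<inter> ball a r. G (cemb x) = of_real (f x))"
proof -
  have ex: "EX U F. open U & x : U & smooth_on_open U F & (ALL y:U \<inter> X. F y = f y)" if "x : X" for x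
    using smooth that unfolding Cinf_on_def by (rule bspec)
  obtain U F where F: "a : U" "smooth_on_open U F" "ALL y:U \<inter> X. F y = f y"
    using ex[OF a] by (elim exE conjE)
  have F3: "F y = f y" if "y : U" "y : X" for y using F(3) that by simp
  have fc: "continuous_on X f"
    unfolding continuous_on_eq_continuous_within
  proof
    fix x assume x: "x : X"
    obtain V H where H: "open V" "x : V" "smooth_on_open V H" "ALL y:V \<inter> X. H y = f y"
      using ex[OF x] by (elim exE conjE)
    have "(H \<longlongrightarrow> H x) (at x within X)"
      using smooth_continuous[OF H(3,2)] continuous_at_imp_continuous_at_within continuous_within by blast
    moreover have "\<forall>\<^sub>F y in at x within X. H y = f y" unfolding eventually_at_topological using H by blast
    ultimately have "(f \<longlongrightarrow> H x) (at x within X)" by (rule Lim_transform_eventually)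
    then show "continuous (at x within X) f" using H x by (simp add: continuous_within)
  qed
  obtain M and Phi :: "((nat => real) => real^'n) set" where Phi: "finite Phi" "\<And>phi t. phi : Phi ==> t : ucube M ==> phi t : X"
    "\<And>phi t k. phi : Phi ==> t : ucube M ==> ra {..<M} (%x. phi x $ k) t"
    "\<forall>\<^sub>F x in nhds a. x : X --> (EX phi:Phi. x : phi ` ucube M)"
    by (rule uniformization[OF sub _ a]) (use fat in \<open>simp add: fat_def\<close>, (rule that; assumption))
  obtain c :: "real => real^'n" and q epsilon tau where c: "c 0 = a" "epsilon > 0" "0 < tau" "tau <= 1" "q >= 1"
    "\<And>t k. t : {0..1} ==> ra1 (%t. c t $ k) t" "\<And>t x. 0 <= t ==> t <= tau ==> dist x (c t) <= epsilon * t ^ q ==> x : X"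
  proof (rule horn_in_fat[where M = M, OF fat a Phi(1)])
    show "phi t : X" if "phi : Phi" "t : ucube M" for phi t by (rule Phi(2)[OF that])
    show "ra {..<M} (%x. phi x $ k) t" if "phi : Phi" "t : ucube M" for phi :: "(nat => real) => real^'n" and t k by (rule Phi(3)[OF that])
  qed (rule Phi(4), (rule that; assumption))
  obtain C where C: "C > 0" "\<And>l. \<bar>dl l F a\<bar> <= C ^ Suc (length l) * fact (length l)"
    by (rule derivative_bounds[OF F(2,1) F3 fc curves c(1,6,2-5,7)]) ((assumption | (rule that; assumption))+)
  define r where "r = 1 / (4 * C * real CARD('n))"
  have r0: "r > 0" using C by (simp add: r_def)
  obtain G where G: "holomorphic_multi_on (ball (cemb a) r) G"
    "\<And>x. x : ball a r ==> G (cemb x) = of_real (\<Sum>n. tp n F (x - a) a / fact n)"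
    "\<And>h n. norm h < r ==> \<bar>tp n F h a / fact n\<bar> <= C * (C * real CARD('n) * norm h) ^ n"
    by (rule taylor_series_holomorphic[OF C r_def]) (rule that; assumption)
  define g where "g x = (\<Sum>n. tp n F (x - a) a / fact n)" for x
  note G2 = G(2)[folded g_def]
  have flat: "EX A. \<forall>\<^sub>F x in nhds a. x : X --> \<bar>f x - g x\<bar> <= A * norm (x - a) ^ Suc j" for j
  proof -
    obtain A where A: "\<forall>\<^sub>F x in nhds a. \<bar>F x - g x\<bar> <= A * norm (x - a) ^ Suc j"
      using taylor_flat[OF F(2,1) C(1) r_def G(3)] unfolding g_def by blast
    have "\<forall>\<^sub>F x in nhds a. x : U" using F(1,2) by (intro eventually_nhds_in_open) (auto simp: smooth_on_open_def)
    with A have "\<forall>\<^sub>F x in nhds a. x : X --> \<bar>f x - g x\<bar> <= A * norm (x - a) ^ Suc j"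
      by eventually_elim (use F3 in auto)
    then show ?thesis by blast
  qed
  have one: "\<forall>\<^sub>F x in nhds a. x : phi ` ucube M --> f x = g x" if phi: "phi : Phi" for phi
  proof -
    note raphi = Phi(3)[OF phi] and phiX = Phi(2)[OF phi]
    have "EX N. open N & v0 : N & (ALL v:N \<inter> ucube M. f (phi v) = g (phi v))" if v0: "v0 : ucube M" "phi v0 = a" for v0
    proof -
      have "isCont phi v0" by (rule continuous_chart(1)[OF raphi v0(1)])
      then have fl: "filterlim phi (nhds a) (nhds v0)" using isCont_nhds v0(2) by blast
      have "\<forall>\<^sub>F y in nhds a. y : ball a r" using r0 by (intro eventually_nhds_in_open) auto
      from filterlim_iff[THEN iffD1, rule_format, OF fl this]
      obtain V where V: "open V" "v0 : V" "\<And>x. x : V ==> phi x : ball a r"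
        unfolding eventually_nhds by blast
      obtain delta where delta: "delta > 0" "\<And>x. (ALL i:{..<M}. dist (x i) (v0 i) < delta) ==> (ALL i. i \<notin> {..<M} --> x i = v0 i) ==> x : V"
        using open_fun_box[OF V(1,2), of "{..<M}"] by blast
      let ?N = "{x. ALL i:{..<M}. dist (x i) (v0 i) < delta}"
      have "f (phi v) = g (phi v)" if v: "v : ?N" "v : ucube M" for v
      proof (rule chart_agreement[OF raphi phiX curves v0(1) v(2), where r = r and G = G])
        fix t :: real assume t: "0 <= t" "t <= 1"
        have "(%i. v0 i + t * (v i - v0 i)) : V"
        proof (rule delta(2))
          have "dist (v0 i + t * (v i - v0 i)) (v0 i) < delta" if "i < M" for i
          proof -
            have "dist (v i) (v0 i) < delta" using v(1) that by simp
            moreover have "t * \<bar>v i - v0 i\<bar> <= \<bar>v i - v0 i\<bar>" using t by (simp add: mult_left_le_one_le)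
            ultimately show ?thesis using t by (simp add: dist_real_def abs_mult)
          qed
          then show "ALL i:{..<M}. dist (v0 i + t * (v i - v0 i)) (v0 i) < delta" by simp
          show "ALL i. i \<notin> {..<M} --> v0 i + t * (v i - v0 i) = v0 i" using v(2) v0(1) by (auto simp: ucube_def)
        qed
        then show "phi (%i. v0 i + t * (v i - v0 i)) : ball (phi v0) r" using V(3) v0(2) by simp
      qed (use v0(2) G(1) G2 flat in simp_all)
      moreover have "open ?N" by (rule open_polybox) simp
      moreover have "v0 : ?N" using delta(1) by simp
      ultimately show ?thesis by (intro exI[of _ ?N]) blast
    qed
    then have "ALL v0:{v : ucube M. phi v = a}. EX N. open N & v0 : N & (ALL v:N \<inter> ucube M. f (phi v) = g (phi v))" by blast
    from bchoice[OF this] obtain N where N: "\<And>v0. v0 : ucube M ==> phi v0 = a ==> open (N v0) & v0 : N v0 & (ALL v:N v0 \<inter> ucube M. f (phi v) = g (phi v))"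
      by auto
    \<comment> \<open>A point of the image close to a may come from near any preimage of a. V is a
      neighbourhood of the whole fibre on which agreement is known, and by compactness the image of
      the rest of the cube keeps away from a.\<close>
    define V where "V = (\<Union>v0\<in>{v : ucube M. phi v = a}. N v0)"
    have "open V" unfolding V_def using N by blast
    then have "compact (ucube M - V)" by (rule compact_diff[OF compact_ucube])
    then have "compact (phi ` (ucube M - V))"
      by (intro compact_continuous_image continuous_on_subset[OF continuous_chart(2)[OF raphi]]) auto
    then have "open (- phi ` (ucube M - V))" by (intro open_Compl compact_imp_closed)
    moreover have "a : - phi ` (ucube M - V)" unfolding V_def using N by blast
    ultimately have "\<forall>\<^sub>F x in nhds a. x : - phi ` (ucube M - V)" by (rule eventually_nhds_in_open)
    then show ?thesis
    proof eventually_elim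
      case (elim x)
      show ?case
      proof
        assume "x : phi ` ucube M"
        then obtain v where v: "v : ucube M" "x = phi v" by blast
        then have "v : V" using elim by blast
        then obtain v0 where "v0 : ucube M" "phi v0 = a" "v : N v0" unfolding V_def by blast
        then show "f x = g x" using N v by blast
      qed
    qed
  qed
  have "\<forall>\<^sub>F x in nhds a. ALL phi:Phi. x : phi ` ucube M --> f x = g x" using one Phi(1) by (intro eventually_ball_finite) auto
  with Phi(4) have "\<forall>\<^sub>F x in nhds a. x : X --> f x = g x" by eventually_elim blast
  then obtain delta where delta: "delta > 0" "\<And>x. dist x a < delta ==> x : X ==> f x = g x" unfolding eventually_nhds_metric by blast
  show ?thesis
  proof (intro exI[of _ "min r delta"] exI[of _ G] conjI ballI)
    show "holomorphic_multi_on (ball (cemb a) (min r delta)) G"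
      using G(1) unfolding holomorphic_multi_on_def by simp
    show "G (cemb x) = of_real (f x)" if "x : X \<inter> ball a (min r delta)" for x
      using G2[of x] delta(2)[of x] that by (simp add: dist_commute)
  qed (use r0 delta in auto)
qed


section \<open>Gluing\<close>

lemma holomorphic_line:
  fixes p d :: "complex^'n"
  assumes "holomorphic_multi_on W G" "open D" "\<And>t. t : D ==> p + t *s d : W"
  shows "(%t. G (p + t *s d)) holomorphic_on D"
proof -
  have e: "p + t *s d = (\<chi> k. p $ k + t * d $ k)" for t by (simp add: vec_eq_iff)
  show ?thesis unfolding e
    by (rule holomorphic_multi_compose[OF assms(1,2)]) (use assms(3) in \<open>auto simp: e intro!: holomorphic_intros\<close>)
qed

lemma norm_complex_smult: "norm (t *s (d :: complex^'n)) = cmod t * norm d"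
  by (simp add: norm_vec_def norm_mult L2_set_right_distrib)

text \<open>Near x0 write w = u + i v with u and v real. On the complex line x0 + u + t v the
  difference vanishes for real t in [-1,1], hence at t = i. From this neighbourhood equality spreads
  to z along the complex line through x0 and z, whose parameters in the convex set W form a
  connected set.\<close>

lemma holomorphic_multi_identity:
  fixes G1 G2 :: "complex^'n => complex"
  assumes W: "open W" "convex W" and G: "holomorphic_multi_on W G1" "holomorphic_multi_on W G2"
    and x: "cemb ` ball x0 delta \<subseteq> W" "delta > 0" and eq: "\<And>x. x : ball x0 delta ==> G1 (cemb x) = G2 (cemb x)" and z: "z : W"
  shows "G1 z = G2 z"
proof -
  have x0W: "cemb x0 : W" using x by auto
  obtain e where e: "e > 0" "ball (cemb x0) e \<subseteq> W" using W(1) x0W open_contains_ball by blast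
  \<comment> \<open>The disc of radius 2 contains [-1,1] and i; for t in it the vector u + t v has
    norm below 4 rho, which must not exceed delta or e.\<close>
  define rho where "rho = min delta e / 4"
  have rho: "rho > 0" "4 * rho <= delta" "4 * rho <= e" using e x by (auto simp: rho_def)
  have near: "G1 (cemb x0 + w) = G2 (cemb x0 + w)" if w: "norm w < rho" for w
  proof -
    define u v :: "real^'n" where "u = (\<chi> k. Re (w $ k))" and "v = (\<chi> k. Im (w $ k))"
    have nu: "norm u <= norm w" "norm v <= norm w" unfolding norm_vec_def u_def v_def
      by (auto intro!: L2_set_mono simp: abs_Re_le_cmod abs_Im_le_cmod)
    have wuv: "cemb x0 + w = cemb (x0 + u) + \<i> *s cemb v"
      by (auto simp: vec_eq_iff cemb_def u_def v_def complex_eq_iff)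
    have small: "norm (cemb u + t *s cemb v) < 4 * rho" if "t : ball 0 2" for t
    proof -
      have "norm (cemb u + t *s cemb v) <= norm u + cmod t * norm v"
        using norm_triangle_ineq[of "cemb u" "t *s cemb v"] by (simp add: norm_complex_smult norm_cemb)
      moreover have "cmod t * norm v <= 2 * rho" using that nu(2) w by (intro mult_mono) auto
      ultimately show ?thesis using nu(1) w rho(1) by linarith
    qed
    have inW: "cemb (x0 + u) + t *s cemb v : W" if "t : ball 0 2" for t
    proof -
      have eq': "cemb (x0 + u) + t *s cemb v - cemb x0 = cemb u + t *s cemb v" by (simp add: vec_eq_iff cemb_def)
      have "norm (cemb (x0 + u) + t *s cemb v - cemb x0) < e" using small[OF that] rho(3) unfolding eq' by simp
      then have "cemb (x0 + u) + t *s cemb v : ball (cemb x0) e" by (metis dist_norm dist_commute mem_ball)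
      then show ?thesis using e(2) by auto
    qed
    define D where "D t = G1 (cemb (x0 + u) + t *s cemb v) - G2 (cemb (x0 + u) + t *s cemb v)" for t
    have "D \<i> = 0"
    proof (rule analytic_continuation[of D "ball 0 2" "of_real ` {-1..1}" 0])
      show "D holomorphic_on ball 0 2" unfolding D_def
        by (intro holomorphic_on_diff holomorphic_line[OF G(1)] holomorphic_line[OF G(2)] inW) auto
      show "complex_of_real ` {-1..1} \<subseteq> ball 0 2" by auto
      show "(0::complex) islimpt of_real ` {-1..1}" unfolding islimpt_approachable
      proof (intro allI impI)
        fix eta :: real assume "eta > 0"
        then show "EX y:complex_of_real ` {-1..1}. y ~= 0 & dist y 0 < eta"
          by (intro bexI[of _ "of_real (min 1 (eta / 2))"]) (auto simp: min_def)
      qed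
      show "D t = 0" if t: "t : complex_of_real ` {-1..1}" for t
      proof -
        obtain s where s: "t = of_real s" "\<bar>s\<bar> <= 1" using t by (auto simp: abs_le_iff)
        have c: "cemb (x0 + u) + t *s cemb v = cemb (x0 + u + s *\<^sub>R v)" by (simp add: vec_eq_iff cemb_def s(1))
        have "norm (cemb u + t *s cemb v) < delta" using small[of t] s rho(2) by simp
        moreover have "cemb u + t *s cemb v = cemb (u + s *\<^sub>R v)" by (simp add: vec_eq_iff cemb_def s(1))
        ultimately have "norm (x0 + u + s *\<^sub>R v - x0) < delta" by (simp add: norm_cemb add.assoc)
        then have "x0 + u + s *\<^sub>R v : ball x0 delta" by (metis dist_norm dist_commute mem_ball)
        then show ?thesis unfolding D_def c by (simp add: eq)
      qed
    qed auto
    then show ?thesis by (simp add: D_def wuv)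
  qed
  define d where "d = z - cemb x0"
  define T where "T = {t. cemb x0 + t *s d : W}"
  have ct: "continuous_on UNIV (%t. cemb x0 + t *s d)"
    by (intro continuous_intros) (simp add: vector_scalar_mult_def continuous_on_vec_lambda continuous_on_mult continuous_on_id)
  have oT: "open T" using open_vimage[OF W(1) ct] by (simp add: T_def vimage_def)
  have "convex T" unfolding convex_alt T_def
  proof (intro ballI allI impI)
    fix s t :: complex and u :: real assume st: "s : {t. cemb x0 + t *s d : W}" "t : {t. cemb x0 + t *s d : W}" "0 <= u & u <= 1"
    have "(1 - u) *\<^sub>R (cemb x0 + s *s d) + u *\<^sub>R (cemb x0 + t *s d) = cemb x0 + ((1 - u) *\<^sub>R s + u *\<^sub>R t) *s d"
      by (simp only: vec_eq_iff vector_add_component vector_scaleR_component vector_smult_component)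
        (simp add: algebra_simps scaleR_conv_of_real)
    moreover have "(1 - u) *\<^sub>R (cemb x0 + s *s d) + u *\<^sub>R (cemb x0 + t *s d) : W" using W(2) st by (auto simp: convex_alt)
    ultimately show "(1 - u) *\<^sub>R s + u *\<^sub>R t : {t. cemb x0 + t *s d : W}" by simp
  qed
  then have conn: "connected T" by (rule convex_connected)
  have T01: "0 : T" "1 : T" using x0W z by (auto simp: T_def d_def)
  define E where "E t = G1 (cemb x0 + t *s d) - G2 (cemb x0 + t *s d)" for t
  have "E 1 = 0"
  proof (rule analytic_continuation[of E T "T \<inter> ball 0 (rho / (norm d + 1))" 0])
    show "E holomorphic_on T" unfolding E_def
      by (intro holomorphic_on_diff holomorphic_line[OF G(1) oT] holomorphic_line[OF G(2) oT]) (auto simp: T_def)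
    have dp: "norm d + 1 > 0" using norm_ge_zero[of d] by linarith
    show "0 islimpt (T \<inter> ball 0 (rho / (norm d + 1)))"
      using oT T01 rho dp by (intro interior_limit_point) (auto simp: interior_open open_Int)
    show "E t = 0" if "t : T \<inter> ball 0 (rho / (norm d + 1))" for t
    proof -
      have "cmod t * (norm d + 1) < rho" using that dp by (simp add: pos_less_divide_eq)
      moreover have "cmod t * norm d <= cmod t * (norm d + 1)" by (intro mult_left_mono) auto
      ultimately have "norm (t *s d) < rho" by (simp add: norm_complex_smult)
      then show ?thesis by (simp add: E_def near)
    qed
  qed (use oT conn T01 in auto)
  then show ?thesis by (simp add: E_def d_def)
qed

theorem theorem1p16:
  fixes X :: "(real^'n) set" and f :: "real^'n \<Rightarrow> real"
  assumes "subanalytic_set X"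
    and "fat X"
    and "Cinf_on X f"
    and "\<forall>c. real_analytic_curve c \<and> range c \<subseteq> X \<longrightarrow> real_analytic_fun (f \<circ> c)"
  shows "\<exists>W F. open W \<and> cemb ` X \<subseteq> W \<and> holomorphic_multi_on W F \<and>
           (\<forall>x\<in>X. F (cemb x) = complex_of_real (f x))"
proof -
  have "ALL a:X. EX r G. r > 0 & holomorphic_multi_on (ball (cemb a) r) G & (ALL x:X \<inter> ball a r. G (cemb x) = of_real (f x))"
    using local_extension[OF assms(1-3)] assms(4) by blast
  from bchoice2[OF this] obtain r G where rG: "ALL a:X. r a > 0 & holomorphic_multi_on (ball (cemb a) (r a)) (G a) &
      (ALL x:X \<inter> ball a (r a). G a (cemb x) = of_real (f x))" by (elim exE)
  have r: "r a > 0" and G: "holomorphic_multi_on (ball (cemb a) (r a)) (G a)"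
    and Gf: "\<And>x. x : X ==> x : ball a (r a) ==> G a (cemb x) = of_real (f x)" if "a : X" for a
    using rG that by auto
  \<comment> \<open>Radii are halved: if two half balls meet, the centre of the one with the smaller
    radius lies in the full ball of the other.\<close>
  let ?B = "%a. ball (cemb a) (r a / 2)"
  define W where "W = (\<Union>a\<in>X. ?B a)"
  have cb: "cemb x : ball (cemb a) s \<longleftrightarrow> x : ball a s" for x a s by (simp add: dist_norm cemb_diff norm_cemb)
  have agree1: "G a z = G b z" if a: "a : X" and b: "b : X" and z: "z : ?B a" "z : ?B b" and le: "r b <= r a" for a b z
  proof -
    let ?W = "ball (cemb a) (r a) \<inter> ball (cemb b) (r b)"
    have "dist (cemb a) (cemb b) < r a / 2 + r b / 2"
      using dist_triangle2[of "cemb a" "cemb b" z] z by (simp add: dist_commute)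
    then have "cemb b : ball (cemb a) (r a)" using le by simp
    then have bN: "b : ball a (r a) \<inter> ball b (r b)" unfolding cb using r[OF b] by simp
    \<comment> \<open>The intersection of the full balls contains the point b of X. By fatness it
      then contains a real ball inside X, where both local extensions equal f, and the identity
      theorem applies on the convex intersection.\<close>
    have "b : closure (interior X)" using assms(2) b unfolding fat_def by blast
    then have "(ball a (r a) \<inter> ball b (r b)) \<inter> interior X ~= {}"
      using open_Int_closure_eq_empty[of "ball a (r a) \<inter> ball b (r b)" "interior X"] bN by blast
    then obtain x0 where "x0 : (ball a (r a) \<inter> ball b (r b)) \<inter> interior X" by blast
    moreover have "open ((ball a (r a) \<inter> ball b (r b)) \<inter> interior X)" by (intro open_Int) auto
    ultimately obtain delta where delta: "delta > 0" "ball x0 delta \<subseteq> (ball a (r a) \<inter> ball b (r b)) \<inter> interior X"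
      using open_contains_ball by blast
    have inX: "x : X" "x : ball a (r a)" "x : ball b (r b)" if "x : ball x0 delta" for x
      using delta(2) that interior_subset[of X] by blast+
    show ?thesis
    proof (rule holomorphic_multi_identity[of ?W _ _ x0 delta])
      show "holomorphic_multi_on ?W (G a)" "holomorphic_multi_on ?W (G b)"
        using G[OF a] G[OF b] unfolding holomorphic_multi_on_def by blast+
      show "cemb ` ball x0 delta \<subseteq> ?W" using inX cb by blast
      show "G a (cemb x) = G b (cemb x)" if "x : ball x0 delta" for x
        using Gf[OF a] Gf[OF b] inX[OF that] by simp
      show "z : ?W" using z r[OF a] r[OF b] by auto
    qed (use delta in \<open>auto intro: convex_Int\<close>)
  qed
  have agree: "G a z = G b z" if "a : X" "b : X" "z : ?B a" "z : ?B b" for a b z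
    using agree1[of a b z] agree1[of b a z] that by (cases "r b <= r a") auto
  define F where "F z = G (SOME a. a : X & z : ?B a) z" for z
  have FG: "F z = G a z" if "a : X" "z : ?B a" for a z
    unfolding F_def using someI[of "%a. a : X & z : ?B a" a] that agree by blast
  show ?thesis
  proof (intro exI[of _ W] exI[of _ F] conjI ballI)
    show "open W" unfolding W_def by auto
    show "cemb ` X \<subseteq> W" unfolding W_def using r by fastforce
    show "holomorphic_multi_on W F" unfolding holomorphic_multi_on_def
    proof
      fix z assume "z : W"
      then obtain a where a: "a : X" "z : ?B a" unfolding W_def by blast
      then have "z : ball (cemb a) (r a)" using r[OF a(1)] by simp
      then obtain L where L: "(G a has_derivative L) (at z)" "ALL c v. L (c *s v) = c * L v"
        using G[OF a(1)] unfolding holomorphic_multi_on_def by blast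
      have "(F has_derivative L) (at z)"
        by (rule has_derivative_transform_within_open[OF L(1) open_ball a(2)]) (use FG a(1) in auto)
      then show "EX L. (F has_derivative L) (at z) & (ALL c v. L (c *s v) = c * L v)" using L(2) by blast
    qed
    show "F (cemb x) = complex_of_real (f x)" if "x : X" for x
      using FG[OF that, of "cemb x"] Gf[OF that that] r[OF that] by simp
  qed
qed

end
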